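(* Let $\varepsilon>0$ and $\delta>0$ be fixed. Suppose that $\varepsilon\le\zeta\le\frac\pi2-\varepsilon$ ($<\frac{\pi}{2}$) and let $\alpha,\beta\in\mathbb C$ be bounded. For non-negative integers $n,\ell$ define $$\zeta^{(1)}_{\nu,n,\ell}=(2\nu+\alpha+\beta-n+1)\zeta-\left(\alpha-\ell+\tfrac12\right)\tfrac\pi2,\qquad \zeta^{(2)}_{\nu,n,\ell}=(2\nu+\alpha+\beta-n+1)\zeta+\left(\alpha+\ell+\tfrac12\right)\tfrac\pi2 .$$ Then, as $\nu\to\infty$ in the sector $|\arg\nu|\le\pi-\delta$ ($<\pi$), $$2^{2\nu+\alpha+\beta}B(\nu+1,\nu+\alpha+\beta+1)P_\nu^{(\alpha,\beta)}(\cos(2\zeta))\sim\frac{1}{\sin^{\alpha+1/2}\zeta\cos^{\beta+1/2}\zeta}\sum_{n=0}^\infty\left(\sum_{\ell=0}^n\frac{a_\ell(\alpha)a_{n-\ell}(\beta)}{\sin^\ell\zeta\cos^{n-\ell}\zeta}\cos\left(\zeta^{(1)}_{\nu,n,\ell}\right)\right)\frac{\Gamma(2\nu+\alpha+\beta-n+1)}{\Gamma(2\nu+\alpha+\beta+2)},$$ $$\frac{2^{2\nu+\alpha+\beta+1}}{\pi}B(\nu+1,\nu+\alpha+\beta+1)\mathrm Q_\nu^{(\alpha,\beta)}(\cos(2\zeta))\sim\frac{1}{\sin^{\alpha+1/2}\zeta\cos^{\beta+1/2}\zeta}\sum_{n=0}^\infty\left(\sum_{\ell=0}^n\frac{a_\ell(\alpha)a_{n-\ell}(\beta)}{\sin^\ell\zeta\cos^{n-\ell}\zeta}\cos\left(\zeta^{(2)}_{\nu,n,\ell}\right)\right)\frac{\Gamma(2\nu+\alpha+\beta-n+1)}{\Gamma(2\nu+\alpha+\beta+2)},$$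 $$\frac{2^{2\nu+\alpha+\beta+1}}{\pi}B(\nu+1,\nu+\alpha+\beta+1)\mathsf Q_\nu^{(\alpha,\beta)}(\cos(2\zeta))\sim\frac{-1}{\sin^{\alpha+1/2}\zeta\cos^{\beta+1/2}\zeta}\sum_{n=0}^\infty\left(\sum_{\ell=0}^n\frac{a_\ell(\alpha)a_{n-\ell}(\beta)}{\sin^\ell\zeta\cos^{n-\ell}\zeta}\sin\left(\zeta^{(1)}_{\nu,n,\ell}\right)\right)\frac{\Gamma(2\nu+\alpha+\beta-n+1)}{\Gamma(2\nu+\alpha+\beta+2)}.$$
   Context: $\mathbf F\left({a,b\atop c};x\right)$ is the regularised hypergeometric function, $\sum_{n\ge0}\frac{(a)_n(b)_n}{\Gamma(c+n)\,n!}x^n$ for $|x|<1$, continued analytically to $x\in\mathbb C\setminus[1,\infty)$; $(w)_n=w(w+1)\cdots(w+n-1)$, $(w)_0=1$; $B$ is the beta function; $\mathbb Z^-=\{-1,-2,\dots\}$. The Jacobi functions are $$P_\nu^{(\alpha,\beta)}(z)=\frac{\Gamma(\nu+\alpha+1)}{\Gamma(\nu+1)}\mathbf F\left({-\nu,\nu+\alpha+\beta+1\atop \alpha+1};\frac{1-z}{2}\right),\quad z\in\mathbb C\setminus(-\infty,-1],\ \nu+\alpha\notin\mathbb Z^-,$$ $$Q_\nu^{(\alpha,\beta)}(z)=\frac{2^{\nu+\alpha+\beta}\Gamma(\nu+\alpha+1)\Gamma(\nu+\beta+1)}{(z-1)^{\nu+\alpha+1}(z+1)^\beta}\mathbf F\left({\nu+1,\nu+\alpha+1\atop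 2\nu+\alpha+\beta+2};\frac{2}{1-z}\right),\quad z\in\mathbb C\setminus(-\infty,1],\ \nu+\alpha,\nu+\beta\notin\mathbb Z^-,$$ with principal powers. For $-1<x<1$ and $\nu+\alpha,\nu+\beta\notin\mathbb Z^-$ the associated functions are $$\mathrm Q_\nu^{(\alpha,\beta)}(x)=\lim_{\eta\to0^+}\tfrac12\left(Q_\nu^{(\alpha,\beta)}(x+i\eta)+Q_\nu^{(\alpha,\beta)}(x-i\eta)\right),$$ $$\mathsf Q_\nu^{(\alpha,\beta)}(x)=\lim_{\eta\to0^+}\tfrac12\left(e^{\pi\alpha i}Q_\nu^{(\alpha,\beta)}(x+i\eta)+e^{-\pi\alpha i}Q_\nu^{(\alpha,\beta)}(x-i\eta)\right).$$ Also $a_n(\mu)=\frac{(\frac12+\mu)_n(\frac12-\mu)_n}{(-2)^n n!}$. Meaning of $\sim$: for every non-negative integer $N$, the left-hand side equals the prefactor $\pm\sin^{-\alpha-1/2}\zeta\,\cos^{-\beta-1/2}\zeta$ times the sum of the first $N$ terms of the series plus an error term which is $O\left(|\nu|^{-N-1}e^{2\zeta|\Im\nu|}\right)$ as $\nu\to\infty$ in the stated sector, uniformly for $\zeta,\alpha,\beta$ in the stated ranges. *)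

theory Defs
  imports "HOL-Complex_Analysis.Complex_Analysis"
begin

text \<open>
  The regularised hypergeometric function: the power series, and its analytic continuation to the
  complex plane cut along \<open>[1, \<infinity>)\<close>. The cut plane is connected, so the continuation is
  determined there by its values on the unit disc; values on the cut are unspecified.
\<close>

definition hyp_reg_series :: "complex \<Rightarrow> complex \<Rightarrow> complex \<Rightarrow> complex \<Rightarrow> complex" where
  "hyp_reg_series a b c x =
     (\<Sum>n. pochhammer a n * pochhammer b n * rGamma (c + of_nat n) / fact n * x ^ n)"

definition hyp_reg :: "complex \<Rightarrow> complex \<Rightarrow> complex \<Rightarrow> complex \<Rightarrow> complex" where
  "hyp_reg a b c =
     (SOME f. f holomorphic_on - (complex_of_real ` {1..}) \<and>
              (\<forall>x. norm x < 1 \<longrightarrow> f x = hyp_reg_series a b c x))"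

text \<open>
  The Jacobi functions, as functions of \<open>\<nu>\<close>, \<open>\<alpha>\<close>, \<open>\<beta>\<close>, \<open>z\<close>. They have their intended meaning for
  \<open>z\<close> outside \<open>(-\<infinity>, -1]\<close> and \<open>\<nu> + \<alpha>\<close> not a negative integer (for P), respectively \<open>z\<close> outside
  \<open>(-\<infinity>, 1]\<close> and neither \<open>\<nu> + \<alpha>\<close> nor \<open>\<nu> + \<beta>\<close> a negative integer (for Q).
  In P, the factor \<open>1 / \<Gamma>(\<nu> + 1)\<close> is entire in \<open>\<nu>\<close>, hence \<open>rGamma\<close>.
\<close>

definition jacobi_P :: "complex \<Rightarrow> complex \<Rightarrow> complex \<Rightarrow> complex \<Rightarrow> complex" where
  "jacobi_P \<nu> \<alpha> \<beta> z =
     Gamma (\<nu> + \<alpha> + 1) * rGamma (\<nu> + 1) *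
     hyp_reg (- \<nu>) (\<nu> + \<alpha> + \<beta> + 1) (\<alpha> + 1) ((1 - z) / 2)"

definition jacobi_Q :: "complex \<Rightarrow> complex \<Rightarrow> complex \<Rightarrow> complex \<Rightarrow> complex" where
  "jacobi_Q \<nu> \<alpha> \<beta> z =
     2 powr (\<nu> + \<alpha> + \<beta>) * Gamma (\<nu> + \<alpha> + 1) * Gamma (\<nu> + \<beta> + 1) /
     ((z - 1) powr (\<nu> + \<alpha> + 1) * (z + 1) powr \<beta>) *
     hyp_reg (\<nu> + 1) (\<nu> + \<alpha> + 1) (2 * \<nu> + \<alpha> + \<beta> + 2) (2 / (1 - z))"

text \<open>
  The two associated functions on the cut \<open>-1 < x < 1\<close>: \<open>jacobi_Qcut\<close> is the plain average of the
  boundary values (upright serif Q), \<open>jacobi_Qsf\<close> the one with phase factors (sans-serif Q).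
\<close>

definition jacobi_Qcut :: "complex \<Rightarrow> complex \<Rightarrow> complex \<Rightarrow> real \<Rightarrow> complex" where
  "jacobi_Qcut \<nu> \<alpha> \<beta> x =
     Lim (at_right 0) (\<lambda>\<eta>::real.
       1 / 2 * (jacobi_Q \<nu> \<alpha> \<beta> (of_real x + \<i> * of_real \<eta>) +
                jacobi_Q \<nu> \<alpha> \<beta> (of_real x - \<i> * of_real \<eta>)))"

definition jacobi_Qsf :: "complex \<Rightarrow> complex \<Rightarrow> complex \<Rightarrow> real \<Rightarrow> complex" where
  "jacobi_Qsf \<nu> \<alpha> \<beta> x =
     Lim (at_right 0) (\<lambda>\<eta>::real.
       1 / 2 * (exp (of_real pi * \<alpha> * \<i>) * jacobi_Q \<nu> \<alpha> \<beta> (of_real x + \<i> * of_real \<eta>) +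
                exp (- (of_real pi * \<alpha> * \<i>)) * jacobi_Q \<nu> \<alpha> \<beta> (of_real x - \<i> * of_real \<eta>)))"

definition a_coeff :: "nat \<Rightarrow> complex \<Rightarrow> complex" where
  "a_coeff n \<mu> = pochhammer (1 / 2 + \<mu>) n * pochhammer (1 / 2 - \<mu>) n / ((- 2) ^ n * fact n)"

definition zeta1 :: "complex \<Rightarrow> complex \<Rightarrow> complex \<Rightarrow> real \<Rightarrow> nat \<Rightarrow> nat \<Rightarrow> complex" where
  "zeta1 \<nu> \<alpha> \<beta> \<zeta> n l =
     (2 * \<nu> + \<alpha> + \<beta> - of_nat n + 1) * of_real \<zeta> - (\<alpha> - of_nat l + 1 / 2) * of_real (pi / 2)"

definition zeta2 :: "complex \<Rightarrow> complex \<Rightarrow> complex \<Rightarrow> real \<Rightarrow> nat \<Rightarrow> nat \<Rightarrow> complex" where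
  "zeta2 \<nu> \<alpha> \<beta> \<zeta> n l =
     (2 * \<nu> + \<alpha> + \<beta> - of_nat n + 1) * of_real \<zeta> + (\<alpha> + of_nat l + 1 / 2) * of_real (pi / 2)"

definition prefactor :: "complex \<Rightarrow> complex \<Rightarrow> real \<Rightarrow> complex" where
  "prefactor \<alpha> \<beta> \<zeta> =
     1 / (of_real (sin \<zeta>) powr (\<alpha> + 1 / 2) * of_real (cos \<zeta>) powr (\<beta> + 1 / 2))"

text \<open>
  The \<open>n\<close>-th term of the expansions, with \<open>trig\<close> either \<open>cos\<close> or \<open>sin\<close> and \<open>ph\<close> either
  \<open>zeta1\<close> or \<open>zeta2\<close>.
\<close>

definition expansion_term ::
  "(complex \<Rightarrow> complex) \<Rightarrow> (complex \<Rightarrow> complex \<Rightarrow> complex \<Rightarrow> real \<Rightarrow> nat \<Rightarrow> nat \<Rightarrow> complex) \<Rightarrow>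
   nat \<Rightarrow> complex \<Rightarrow> complex \<Rightarrow> complex \<Rightarrow> real \<Rightarrow> complex" where
  "expansion_term trig ph n \<nu> \<alpha> \<beta> \<zeta> =
     (\<Sum>l\<le>n. a_coeff l \<alpha> * a_coeff (n - l) \<beta> /
             (of_real (sin \<zeta>) ^ l * of_real (cos \<zeta>) ^ (n - l)) * trig (ph \<nu> \<alpha> \<beta> \<zeta> n l)) *
     (Gamma (2 * \<nu> + \<alpha> + \<beta> - of_nat n + 1) / Gamma (2 * \<nu> + \<alpha> + \<beta> + 2))"

text \<open>
  \<open>f \<sim> pre * (\<Sum>n. t n)\<close> as \<open>\<nu> \<rightarrow> \<infinity>\<close> in the sector \<open>\<bar>Arg \<nu>\<bar> \<le> \<pi> - \<delta>\<close>, uniformly for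
  \<open>\<epsilon> \<le> \<zeta> \<le> \<pi>/2 - \<epsilon>\<close> and \<open>\<bar>\<alpha>\<bar>, \<bar>\<beta>\<bar> \<le> M\<close>: the constants \<open>C\<close>, \<open>R\<close> may depend on
  \<open>N\<close>, \<open>\<epsilon>\<close>, \<open>\<delta>\<close>, \<open>M\<close> only.
\<close>

definition uniform_expansion ::
  "real \<Rightarrow> real \<Rightarrow> real \<Rightarrow> (complex \<Rightarrow> complex \<Rightarrow> complex \<Rightarrow> real \<Rightarrow> complex) \<Rightarrow>
   (complex \<Rightarrow> complex \<Rightarrow> real \<Rightarrow> complex) \<Rightarrow>
   (nat \<Rightarrow> complex \<Rightarrow> complex \<Rightarrow> complex \<Rightarrow> real \<Rightarrow> complex) \<Rightarrow> bool" where
  "uniform_expansion \<epsilon> \<delta> M f pre t \<longleftrightarrow>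
     (\<forall>N::nat. \<exists>C R. R > 0 \<and>
       (\<forall>\<nu> \<alpha> \<beta> \<zeta>. norm \<nu> \<ge> R \<longrightarrow> \<bar>Arg \<nu>\<bar> \<le> pi - \<delta> \<longrightarrow> norm \<alpha> \<le> M \<longrightarrow> norm \<beta> \<le> M \<longrightarrow>
          \<epsilon> \<le> \<zeta> \<longrightarrow> \<zeta> \<le> pi / 2 - \<epsilon> \<longrightarrow>
          norm (f \<nu> \<alpha> \<beta> \<zeta> - pre \<alpha> \<beta> \<zeta> * (\<Sum>n<N. t n \<nu> \<alpha> \<beta> \<zeta>))
            \<le> C * (exp (2 * \<zeta> * \<bar>Im \<nu>\<bar>) / norm \<nu> ^ (N + 1))))"

end

theory Submission
  imports Defs
begin

text \<open>With \<open>z = cosh (2 \<xi>)\<close> and \<open>u = 2 \<nu> + \<alpha> + \<beta> + 1\<close>, the Jacobi functions times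
  \<open>sinh \<xi> powr (\<alpha> + 1/2) * cosh \<xi> powr (\<beta> + 1/2)\<close> solve
  \<open>w'' = (u\<^sup>2 + (\<alpha>\<^sup>2 - 1/4) / sinh\<^sup>2 \<xi> - (\<beta>\<^sup>2 - 1/4) / cosh\<^sup>2 \<xi>) w\<close>. For \<open>Re \<xi> > 0\<close> this has the recessive
  solution \<open>w \<xi> = exp (- u \<xi>) g (exp (- 2 \<xi>))\<close> with a power series \<open>g\<close>, \<open>g 0 = 1\<close>, which is the function
  of the second kind up to a factor. The functions on the cut at \<open>cos (2 \<zeta>)\<close> are combinations of the
  boundary values of \<open>w\<close> at \<open>\<plusminus> \<i> \<zeta>\<close>: for the second kind directly, for the first kind because both of
  its Wronskians with \<open>w\<close>, taken from the two sides, have the same explicit value.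

  The inverse factorial series in the theorem solves the differential equation formally. Its partial
  sum \<open>F\<close> solves it with a small right-hand side, so \<open>k w - exp (- u \<xi>) F\<close>, where \<open>k\<close> is the value of \<open>F\<close>
  at infinity, is estimated along a ray from \<open>\<plusminus> \<i> \<zeta>\<close> to infinity on which \<open>exp (u \<xi>)\<close> grows; the ray is
  tilted according to the argument of \<open>u\<close>, and this is how the whole sector \<open>\<bar>arg \<nu>\<bar> \<le> \<pi> - \<delta>\<close> is covered.
  The constant \<open>k\<close> and the gamma factors are never expanded by Stirling's formula: the Wronskian of \<open>w \<xi>\<close> and
  \<open>w (- \<xi>)\<close> on the imaginary axis, computed once from \<open>F\<close> and once in closed form, relates them.
  The closed form is obtained for \<open>\<alpha>\<close> not an integer; the estimate extends to integers by continuity.\<close>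

text \<open>The power of 2 and the Beta function in the theorem are the factors for which each
  left-hand side equals \<open>inverse (pfac \<alpha> \<beta> \<zeta>)\<close> times a number
  \<open>X\<close> with \<open>- X * V = p * a + q * b\<close>. Here \<open>a\<close>,
  \<open>b\<close> are the boundary values of \<open>w\<close> at \<open>\<i> * \<zeta>\<close> and
  \<open>- \<i> * \<zeta>\<close>, \<open>p\<close> and \<open>q\<close> are phases, and
  \<open>V = a' * b + b' * a\<close> is the Wronskian up to sign. The estimates control
  \<open>k * a\<close>, \<open>k * b\<close> and \<open>k\<^sup>2 * V + 2 * u * k\<close>, so that
  \<open>k\<close> cancels in \<open>X\<close>. For the first kind \<open>V\<close> arises by
  eliminating a derivative and is left as it is. For the second kind it must be known as a product
  of gamma functions. That product comes from another function of the first kind, with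
  \<open>\<nu> + \<alpha>\<close>, \<open>- \<alpha>\<close> in place of \<open>\<nu>\<close>,
  \<open>\<alpha>\<close>, which solves the same equation. The Wronskian of these two is a multiple
  of \<open>sin (pi * \<alpha>)\<close>, and this is what excludes integers. The series
  \<open>g\<close> is controlled only in the open unit disc, so on the imaginary axis
  \<open>w\<close> is available only as a limit. The limits exist because the differential equation
  bounds the derivatives of the error near the axis.\<close>

definition conv1 :: "complex fps \<Rightarrow> bool" where
  "conv1 f \<longleftrightarrow> fps_conv_radius f \<ge> 1"

lemma conv1_norm_less: "conv1 f \<Longrightarrow> norm z < 1 \<Longrightarrow> ereal (norm z) < fps_conv_radius f"
  unfolding conv1_def by (metis ereal_less(3) less_le_trans)

lemma conv1_intros:
  "conv1 f \<Longrightarrow> conv1 g \<Longrightarrow> conv1 (f + g)"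
  "conv1 f \<Longrightarrow> conv1 g \<Longrightarrow> conv1 (f - g)"
  "conv1 f \<Longrightarrow> conv1 g \<Longrightarrow> conv1 (f * g)"
  "conv1 f \<Longrightarrow> conv1 (fps_deriv f)"
  "conv1 (fps_const c)" "conv1 fps_X" "conv1 1"
  unfolding conv1_def
  using fps_conv_radius_add[of f g] fps_conv_radius_diff[of f g] fps_conv_radius_mult[of f g]
    fps_conv_radius_deriv[of f]
  by (auto simp: min_def intro: order.trans split: if_splits)

lemma conv1_eval:
  assumes "norm z < 1"
  shows "conv1 f \<Longrightarrow> conv1 g \<Longrightarrow> eval_fps (f + g) z = eval_fps f z + eval_fps g z"
    "conv1 f \<Longrightarrow> conv1 g \<Longrightarrow> eval_fps (f - g) z = eval_fps f z - eval_fps g z"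
    "conv1 f \<Longrightarrow> conv1 g \<Longrightarrow> eval_fps (f * g) z = eval_fps f z * eval_fps g z"
  using assms by (auto intro!: eval_fps_add eval_fps_diff eval_fps_mult conv1_norm_less)

lemma conv1_has_field_derivative [derivative_intros]:
  assumes "conv1 f" "norm (h z) < 1" "(h has_field_derivative h') (at z within S)"
  shows "((\<lambda>w. eval_fps f (h w)) has_field_derivative eval_fps (fps_deriv f) (h z) * h') (at z within S)"
  using DERIV_chain2[OF has_field_derivative_eval_fps[OF conv1_norm_less[OF assms(1,2)]] assms(3)] .

lemma conv1I:
  assumes "\<And>r. 0 < r \<Longrightarrow> r < 1 \<Longrightarrow> summable (\<lambda>n. fps_nth f n * of_real r ^ n)"
  shows "conv1 f"
  unfolding conv1_def fps_conv_radius_def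
  by (rule conv_radius_geI_ex') (use assms in \<open>auto simp: one_ereal_def\<close>)

lemma ratio_tendsto_1:
  fixes a c :: complex
  shows "(\<lambda>n. (a + of_nat n) / (c + of_nat n)) \<longlonglongrightarrow> 1"
proof -
  have inf: "filterlim (\<lambda>n. c + of_nat n :: complex) at_infinity sequentially"
    by (rule tendsto_add_filterlim_at_infinity[OF tendsto_const tendsto_of_nat])
  have "(\<lambda>n. 1 + (a - c) / (c + of_nat n)) \<longlonglongrightarrow> 1 + 0"
    by (intro tendsto_add tendsto_const tendsto_divide_0[OF tendsto_const inf])
  moreover have "eventually (\<lambda>n. c + of_nat n \<noteq> 0) sequentially"
    using filterlim_at_infinity_imp_eventually_ne[OF inf, of 0] .
  hence "eventually (\<lambda>n. 1 + (a - c) / (c + of_nat n) = (a + of_nat n) / (c + of_nat n)) sequentially"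
    by eventually_elim (auto simp: field_simps)
  ultimately show ?thesis by (simp add: Lim_transform_eventually)
qed

section \<open>The hypergeometric series\<close>

definition hyp_fps :: "complex \<Rightarrow> complex \<Rightarrow> complex \<Rightarrow> complex fps" where
  "hyp_fps a b c = Abs_fps (\<lambda>n. pochhammer a n * pochhammer b n * rGamma (c + of_nat n) / fact n)"

lemma hyp_reg_series_eq_eval_fps: "hyp_reg_series a b c x = eval_fps (hyp_fps a b c) x"
  by (simp add: hyp_reg_series_def eval_fps_def hyp_fps_def)

text \<open>The recursion is kept in product form because \<open>rGamma_plus1\<close> then gives it
  for every \<open>c\<close>, including the nonpositive integers, where a quotient of coefficients
  would not make sense.\<close>

lemma hyp_fps_Suc:
  "of_nat (Suc n) * (c + of_nat n) * fps_nth (hyp_fps a b c) (Suc n) =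
     (a + of_nat n) * (b + of_nat n) * fps_nth (hyp_fps a b c) n"
proof -
  have f: "of_nat (Suc n) / fact (Suc n) = (1 / fact n :: complex)"
    by (simp add: fact_Suc del: of_nat_Suc)
  have "of_nat (Suc n) * (c + of_nat n) * fps_nth (hyp_fps a b c) (Suc n) =
     pochhammer a (Suc n) * pochhammer b (Suc n) * ((c + of_nat n) * rGamma (c + of_nat n + 1)) *
       (of_nat (Suc n) / fact (Suc n))"
    by (simp add: hyp_fps_def add_ac)
  also have "\<dots> = (a + of_nat n) * (b + of_nat n) * fps_nth (hyp_fps a b c) n"
    unfolding rGamma_plus1 f by (simp add: hyp_fps_def pochhammer_Suc)
  finally show ?thesis .
qed

text \<open>Effects of differentiation, of raising \<open>c\<close> and of raising \<open>b\<close>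
  on a single coefficient. The contiguous relations below are assembled from these three.\<close>

lemma hyp_fps_nth_shift:
  "of_nat (Suc n) * fps_nth (hyp_fps a b c) (Suc n) =
     (a + of_nat n) * (b + of_nat n) * fps_nth (hyp_fps a b (c + 1)) n"
  "fps_nth (hyp_fps a b c) n = (c + of_nat n) * fps_nth (hyp_fps a b (c + 1)) n"
  "b * fps_nth (hyp_fps a (b + 1) c) n = (b + of_nat n) * fps_nth (hyp_fps a b c) n"
proof -
  have f: "of_nat (Suc n) / fact (Suc n) = (1 / fact n :: complex)"
    by (simp add: fact_Suc del: of_nat_Suc)
  have "of_nat (Suc n) * fps_nth (hyp_fps a b c) (Suc n) =
     pochhammer a (Suc n) * pochhammer b (Suc n) * rGamma (c + of_nat n + 1) * (of_nat (Suc n) / fact (Suc n))"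
    by (simp add: hyp_fps_def add_ac)
  also have "\<dots> = (a + of_nat n) * (b + of_nat n) * fps_nth (hyp_fps a b (c + 1)) n"
    unfolding f by (simp add: hyp_fps_def pochhammer_Suc add_ac)
  finally show "of_nat (Suc n) * fps_nth (hyp_fps a b c) (Suc n) =
     (a + of_nat n) * (b + of_nat n) * fps_nth (hyp_fps a b (c + 1)) n" .
  show "fps_nth (hyp_fps a b c) n = (c + of_nat n) * fps_nth (hyp_fps a b (c + 1)) n"
    using rGamma_plus1[of "c + of_nat n"] by (simp add: hyp_fps_def add_ac)
  show "b * fps_nth (hyp_fps a (b + 1) c) n = (b + of_nat n) * fps_nth (hyp_fps a b c) n"
    using pochhammer_rec[of b n] pochhammer_rec'[of b n] by (simp add: hyp_fps_def)
qed

lemma conv1_hyp_fps: "conv1 (hyp_fps a b c)"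
proof (rule conv1I)
  fix r :: real assume r: "0 < r" "r < 1"
  let ?f = "fps_nth (hyp_fps a b c)"
  have "(\<lambda>n. norm ((a + of_nat n) / (1 + of_nat n) * ((b + of_nat n) / (c + of_nat n)))) \<longlonglongrightarrow> norm (1 * 1 :: complex)"
    by (intro tendsto_intros ratio_tendsto_1)
  hence ev: "eventually (\<lambda>n. norm ((a + of_nat n) / (1 + of_nat n) * ((b + of_nat n) / (c + of_nat n))) < 1 / r) sequentially"
    by (rule order_tendstoD) (use r in auto)
  have inf: "filterlim (\<lambda>n. c + of_nat n :: complex) at_infinity sequentially"
    by (rule tendsto_add_filterlim_at_infinity[OF tendsto_const tendsto_of_nat])
  \<comment> \<open>Since \<open>r < q < 1\<close>, the coefficient quotients, which tend to 1, are
    eventually below \<open>q / r\<close>. Consecutive terms at radius \<open>r\<close> then shrink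
    at least by the factor \<open>q\<close>.\<close>
  define q where "q = (1 + r) / 2"
  have "(\<lambda>n. norm ((a + of_nat n) / (1 + of_nat n) * ((b + of_nat n) / (c + of_nat n)))) \<longlonglongrightarrow> 1"
    using \<open>_ \<longlonglongrightarrow> norm (1 * 1 :: complex)\<close> by simp
  hence "eventually (\<lambda>n. norm ((a + of_nat n) / (1 + of_nat n) * ((b + of_nat n) / (c + of_nat n))) < q / r) sequentially"
    by (rule order_tendstoD) (use r in \<open>auto simp: q_def field_simps\<close>)
  moreover have "eventually (\<lambda>n. c + of_nat n \<noteq> 0) sequentially"
    using filterlim_at_infinity_imp_eventually_ne[OF inf, of 0] .
  ultimately have "eventually (\<lambda>n. norm (?f (Suc n) * of_real r ^ Suc n) \<le> q * norm (?f n * of_real r ^ n)) sequentially"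
  proof eventually_elim
    case (elim n)
    have n1: "(1 + of_nat n :: complex) \<noteq> 0"
      by (metis of_nat_Suc of_nat_eq_0_iff nat.distinct(1))
    have "?f (Suc n) = (a + of_nat n) / (1 + of_nat n) * ((b + of_nat n) / (c + of_nat n)) * ?f n"
      using hyp_fps_Suc[of n c a b] elim(2) n1 by (simp add: nonzero_eq_divide_eq mult_ac add_ac)
    hence "norm (?f (Suc n)) \<le> q / r * norm (?f n)"
      using elim(1) by (simp only: norm_mult) (intro mult_right_mono, auto simp: norm_mult norm_divide)
    hence "r * norm (?f (Suc n)) \<le> q * norm (?f n)" using r by (simp add: field_simps)
    hence "r * norm (?f (Suc n)) * r ^ n \<le> q * norm (?f n) * r ^ n"
      using r by (intro mult_right_mono) auto
    thus ?case using r by (simp add: norm_mult norm_power mult_ac)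
  qed
  then obtain n0 where "\<And>n. n \<ge> n0 \<Longrightarrow> norm (?f (Suc n) * of_real r ^ Suc n) \<le> q * norm (?f n * of_real r ^ n)"
    unfolding eventually_sequentially by blast
  thus "summable (\<lambda>n. ?f n * of_real r ^ n)"
    by (intro summable_ratio_test[of q n0]) (use r in \<open>auto simp: q_def\<close>)
qed

lemma hyp_fps_ode:
  "fps_X * (1 - fps_X) * fps_deriv (fps_deriv (hyp_fps a b c)) +
     (fps_const c - fps_const (a + b + 1) * fps_X) * fps_deriv (hyp_fps a b c)
     - fps_const (a * b) * hyp_fps a b c = 0" (is "?L = 0")
proof (rule fps_ext)
  fix n
  let ?f = "fps_nth (hyp_fps a b c)"
  have eq: "?L = fps_X * fps_deriv (fps_deriv (hyp_fps a b c)) - fps_X * (fps_X * fps_deriv (fps_deriv (hyp_fps a b c)))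
      + fps_const c * fps_deriv (hyp_fps a b c) - fps_const (a + b + 1) * (fps_X * fps_deriv (hyp_fps a b c))
      - fps_const (a * b) * hyp_fps a b c"
    by (simp add: algebra_simps)
  have "fps_nth ?L n = of_nat (Suc n) * (c + of_nat n) * ?f (Suc n) - (a + of_nat n) * (b + of_nat n) * ?f n"
  proof (cases n)
    case 0
    thus ?thesis unfolding eq by simp
  next
    case (Suc m)
    show ?thesis
    proof (cases m)
      case 0
      show ?thesis unfolding eq Suc 0 by (simp add: algebra_simps)
    next
      case (Suc k)
      show ?thesis unfolding eq \<open>n = Suc m\<close> Suc by (simp add: algebra_simps)
    qed
  qed
  thus "fps_nth ?L n = fps_nth 0 n" using hyp_fps_Suc[of n c a b] by simp
qed

text \<open>With \<open>a = - \<nu>\<close>, \<open>b = \<nu> + \<alpha> + \<beta> + 1\<close>,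
  \<open>c = \<alpha> + 1\<close>, raising \<open>b\<close> and \<open>c\<close> together means
  raising \<alpha>. This becomes the ladder operator for the functions of the first kind.\<close>

lemma hyp_fps_raise_bc:
  "fps_const b * hyp_fps a b c - (1 - fps_X) * fps_deriv (hyp_fps a b c) =
     fps_const (b * (c - a)) * hyp_fps a (b + 1) (c + 1)" (is "?L = ?R")
proof (rule fps_ext)
  fix n
  let ?f = "fps_nth (hyp_fps a b c)"
  let ?g = "fps_nth (hyp_fps a b (c + 1))"
  have "fps_nth ?L n = (b + of_nat n) * ?f n - of_nat (Suc n) * ?f (Suc n)"
    by (cases n) (simp_all add: algebra_simps)
  also have "\<dots> = (c - a) * ((b + of_nat n) * ?g n)"
    unfolding hyp_fps_nth_shift(1) hyp_fps_nth_shift(2)[of a b c n] by algebra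
  also have "\<dots> = fps_nth ?R n"
    unfolding hyp_fps_nth_shift(3)[symmetric] by simp
  finally show "fps_nth ?L n = fps_nth ?R n" .
qed

text \<open>The counterpart for the second kind: in \<open>Uf\<close> the parameter \<alpha> occurs
  only in \<open>c\<close>.\<close>

lemma hyp_fps_raise_c:
  "fps_const (c - a - b) * hyp_fps a b c + (1 - fps_X) * fps_deriv (hyp_fps a b c) =
     fps_const ((c - a) * (c - b)) * hyp_fps a b (c + 1)" (is "?L = ?R")
proof (rule fps_ext)
  fix n
  let ?f = "fps_nth (hyp_fps a b c)"
  have "fps_nth ?L n = (c - a - b - of_nat n) * ?f n + of_nat (Suc n) * ?f (Suc n)"
    by (cases n) (simp_all add: algebra_simps)
  also have "\<dots> = (c - a) * (c - b) * fps_nth (hyp_fps a b (c + 1)) n"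
    unfolding hyp_fps_nth_shift(1) hyp_fps_nth_shift(2)[of a b c n] by algebra
  also have "\<dots> = fps_nth ?R n" by simp
  finally show "fps_nth ?L n = fps_nth ?R n" .
qed

text \<open>The opposite direction, from \<open>c + 1\<close> to \<open>c\<close>. It carries the
  analytic continuation to values of \<open>c\<close> to which the transformation to the disc does
  not apply.\<close>

lemma hyp_fps_lower_c:
  "hyp_fps a b c = fps_X * fps_deriv (hyp_fps a b (c + 1)) + fps_const c * hyp_fps a b (c + 1)"
  (is "_ = ?R")
proof (rule fps_ext)
  fix n
  have "fps_nth ?R n = (c + of_nat n) * fps_nth (hyp_fps a b (c + 1)) n"
    by (cases n) (simp_all add: algebra_simps)
  thus "fps_nth (hyp_fps a b c) n = fps_nth ?R n"
    using hyp_fps_nth_shift(2)[of a b c n] by simp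
qed

section \<open>The recessive power series solution\<close>

text \<open>Taylor coefficients of \<open>A / (1 - z)\<^sup>2 - B / (1 + z)\<^sup>2\<close>. In the
  variable \<open>z = exp (- 2 * \<xi>)\<close> this is the potential \<open>qpot A B \<xi>\<close>
  divided by \<open>4 * z\<close>.\<close>

definition rcoef :: "complex \<Rightarrow> complex \<Rightarrow> nat \<Rightarrow> complex" where
  "rcoef A B j = (A - (-1) ^ j * B) * of_nat (Suc j)"

text \<open>Frobenius recursion at exponent 0 for \<open>z * g'' + (1 + u) * g' = r * g\<close>,
  where \<open>r\<close> has the coefficients \<open>rcoef A B\<close>. If
  \<open>of_nat (Suc n) + u\<close> vanishes, the division returns 0 and the series does not solve
  the equation in general.\<close>

fun gcoef :: "complex \<Rightarrow> complex \<Rightarrow> complex \<Rightarrow> nat \<Rightarrow> complex" where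
  "gcoef u A B 0 = 1"
| "gcoef u A B (Suc n) = (\<Sum>k\<le>n. rcoef A B (n - k) * gcoef u A B k) / (of_nat (Suc n) * (of_nat (Suc n) + u))"

definition gfps :: "complex \<Rightarrow> complex \<Rightarrow> complex \<Rightarrow> complex fps" where
  "gfps u A B = Abs_fps (gcoef u A B)"

text \<open>The substitution \<open>z \<mapsto> - z\<close> changes the sign of the left-hand side
  of the equation and exchanges the two double poles of \<open>r\<close>. The flip is needed because
  the Pfaff form of the second-kind function lives at \<open>- exp (- 2 * \<xi>)\<close>.\<close>

lemma gcoef_flip: "gcoef u B A n = (-1) ^ n * gcoef u A B n"
proof (induction n rule: less_induct)
  case (less n)
  show ?case
  proof (cases n)
    case (Suc m)
    have "(\<Sum>k\<le>m. rcoef B A (m - k) * gcoef u B A k) = (\<Sum>k\<le>m. (-1) ^ Suc m * (rcoef A B (m - k) * gcoef u A B k))"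
    proof (intro sum.cong refl)
      fix k assume "k \<in> {..m}"
      hence k: "k < n" and m: "(-1::complex) ^ m = (-1) ^ (m - k) * (-1) ^ k" by (auto simp: Suc simp flip: power_add)
      have sq: "(-1::complex) ^ (m - k) * (-1) ^ (m - k) = 1" by (simp flip: power_mult_distrib)
      have "B - e * A = - (e * (A - e * B))" if "e * e = 1" for e :: complex
        using that by algebra
      from this[OF sq] have flip: "B - (-1) ^ (m - k) * A = - ((-1) ^ (m - k) * (A - (-1) ^ (m - k) * B))" .
      show "rcoef B A (m - k) * gcoef u B A k = (-1) ^ Suc m * (rcoef A B (m - k) * gcoef u A B k)"
        unfolding less[OF k] rcoef_def power_Suc m using flip by (simp add: mult_ac)
    qed
    thus ?thesis by (simp add: Suc sum_distrib_left[symmetric] del: power_Suc)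
  qed auto
qed

text \<open>Majorant argument: \<open>norm (gcoef u A B n) * \<rho> ^ n\<close> stays below the sum
  \<open>C\<close> of its values up to \<open>n0\<close>. Beyond \<open>n0\<close> the Frobenius
  denominator outweighs the whole convolution with \<open>rcoef\<close>.\<close>

lemma conv1_gfps: "conv1 (gfps u A B)"
proof (rule conv1I)
  fix r :: real assume r: "0 < r" "r < 1"
  define \<rho> where "\<rho> = (1 + r) / 2"
  have \<rho>: "0 < \<rho>" "\<rho> < 1" "r < \<rho>" using r by (auto simp: \<rho>_def)
  \<comment> \<open>\<open>T\<close> bounds the series of
    \<open>norm (rcoef A B j) * \<rho> ^ j\<close>; the factor
    \<open>1 / (1 - \<rho>)\<^sup>2\<close> is the sum of
    \<open>(j + 1) * \<rho> ^ j\<close>.\<close>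
  define T where "T = (norm A + norm B) * (1 / (1 - \<rho>)\<^sup>2)"
  have T0: "T \<ge> 0" by (simp add: T_def)
  have geo: "(\<Sum>k\<le>n. real (Suc (n - k)) * \<rho> ^ (n - k)) \<le> 1 / (1 - \<rho>)\<^sup>2" for n
  proof -
    have "(\<Sum>k\<le>n. real (Suc (n - k)) * \<rho> ^ (n - k)) = (\<Sum>k\<le>n. real (Suc k) * \<rho> ^ k)"
      by (rule sum.reindex_bij_witness[of _ "\<lambda>k. n - k" "\<lambda>k. n - k"]) auto
    also have "\<dots> \<le> 1 / (1 - \<rho>)\<^sup>2"
      using geometric_deriv_sums[of \<rho>] \<rho> by (intro sum_le_suminf[THEN order.trans]) (auto simp: sums_iff)
    finally show ?thesis .
  qed
  obtain n0 :: nat where n0: "real n0 \<ge> norm u + T + 1" using real_arch_simple by blast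
  define C where "C = (\<Sum>k\<le>n0. norm (gcoef u A B k) * \<rho> ^ k)"
  have C0: "C \<ge> 0" using \<rho> by (auto simp: C_def intro!: sum_nonneg)
  have bd: "norm (gcoef u A B n) * \<rho> ^ n \<le> C" for n
  proof (induction n rule: less_induct)
    case (less n)
    show ?case
    proof (cases "n \<le> n0")
      case True
      thus ?thesis unfolding C_def
        using \<rho> by (intro member_le_sum[of n "{..n0}" "\<lambda>k. norm (gcoef u A B k) * \<rho> ^ k"]) auto
    next
      case False
      then obtain m where m: "n = Suc m" by (cases n) auto
      have den: "norm (of_nat (Suc m) * (of_nat (Suc m) + u)) \<ge> T"
      proof -
        have "norm (of_nat (Suc m) + u) \<ge> real (Suc m) - norm u"
          using norm_diff_ineq[of "of_nat (Suc m)" u] unfolding norm_of_nat .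
        hence "norm (of_nat (Suc m) + u) \<ge> T" using n0 False m by linarith
        moreover have "norm (of_nat (Suc m) :: complex) \<ge> 1" by (simp only: norm_of_nat)
        ultimately show ?thesis unfolding norm_mult using T0
          by (metis mult_mono mult_1 norm_ge_zero zero_le_one)
      qed
      have den0: "norm (of_nat (Suc m) * (of_nat (Suc m) + u)) > 0"
      proof -
        have "norm (of_nat (Suc m) + u) \<ge> real (Suc m) - norm u"
          using norm_diff_ineq[of "of_nat (Suc m)" u] unfolding norm_of_nat .
        hence "norm (of_nat (Suc m) + u) > 0" using n0 False m T0 by linarith
        thus ?thesis by (simp only: norm_mult norm_of_nat) simp
      qed
      have "norm (\<Sum>k\<le>m. rcoef A B (m - k) * gcoef u A B k) * \<rho> ^ m \<le>
          (\<Sum>k\<le>m. norm (rcoef A B (m - k) * gcoef u A B k) * \<rho> ^ m)"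
        using \<rho> by (simp add: norm_sum sum_distrib_right[symmetric] mult_right_mono)
      also have "\<dots> \<le> (\<Sum>k\<le>m. (norm A + norm B) * C * (real (Suc (m - k)) * \<rho> ^ (m - k)))"
      proof (rule sum_mono)
        fix k assume k: "k \<in> {..m}"
        have rc: "norm (rcoef A B j) \<le> (norm A + norm B) * real (Suc j)" for j
        proof -
          have "norm (A - (-1) ^ j * B) \<le> norm A + norm B"
            using norm_triangle_ineq4[of A "(-1) ^ j * B"] by (simp add: norm_mult norm_power)
          thus ?thesis unfolding rcoef_def norm_mult norm_of_nat by (intro mult_right_mono) auto
        qed
        have pw: "\<rho> ^ m = \<rho> ^ (m - k) * \<rho> ^ k" using k by (simp flip: power_add)
        have "norm (rcoef A B (m - k) * gcoef u A B k) * \<rho> ^ m =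
            norm (rcoef A B (m - k)) * \<rho> ^ (m - k) * (norm (gcoef u A B k) * \<rho> ^ k)"
          unfolding pw norm_mult by (simp only: mult_ac)
        also have "\<dots> \<le> ((norm A + norm B) * real (Suc (m - k))) * \<rho> ^ (m - k) * C"
          by (intro mult_mono mult_right_mono rc less) (use k m \<rho> in auto)
        finally show "norm (rcoef A B (m - k) * gcoef u A B k) * \<rho> ^ m \<le> 
           (norm A + norm B) * C * (real (Suc (m - k)) * \<rho> ^ (m - k))" by (simp only: mult_ac)
      qed
      also have "\<dots> = (norm A + norm B) * C * (\<Sum>k\<le>m. real (Suc (m - k)) * \<rho> ^ (m - k))"
        by (simp only: sum_distrib_left)
      also have "\<dots> \<le> (norm A + norm B) * C * (1 / (1 - \<rho>)\<^sup>2)"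
        by (intro mult_left_mono geo) (use C0 in auto)
      also have "\<dots> = C * T" by (simp add: T_def)
      also have "\<dots> \<le> C * norm (of_nat (Suc m) * (of_nat (Suc m) + u))"
        by (intro mult_left_mono den C0)
      finally have "norm (gcoef u A B n) * \<rho> ^ m \<le> C"
        using den0 by (simp add: m norm_divide divide_le_eq mult_ac del: of_nat_Suc)
      moreover have "\<rho> ^ n \<le> \<rho> ^ m" using \<rho> m by (intro power_decreasing) auto
      hence "norm (gcoef u A B n) * \<rho> ^ n \<le> norm (gcoef u A B n) * \<rho> ^ m" by (intro mult_left_mono) auto
      ultimately show ?thesis by linarith
    qed
  qed
  show "summable (\<lambda>n. fps_nth (gfps u A B) n * of_real r ^ n)"
  proof (rule summable_comparison_test')
    show "summable (\<lambda>n. C * (r / \<rho>) ^ n)" using r \<rho> by (intro summable_mult summable_geometric) auto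
    fix n
    have "norm (gcoef u A B n) * r ^ n = norm (gcoef u A B n) * \<rho> ^ n * (r / \<rho>) ^ n"
      using \<rho> by (simp add: power_divide)
    also have "\<dots> \<le> C * (r / \<rho>) ^ n" using bd r \<rho> by (intro mult_right_mono) auto
    finally show "norm (fps_nth (gfps u A B) n * of_real r ^ n) \<le> C * (r / \<rho>) ^ n"
      using r by (simp add: gfps_def norm_mult norm_power)
  qed
qed

lemma conv1_rcoef: "conv1 (Abs_fps (rcoef A B))"
  and eval_rcoef: "norm z < 1 \<Longrightarrow> eval_fps (Abs_fps (rcoef A B)) z = A / (1 - z)\<^sup>2 - B / (1 + z)\<^sup>2"
proof -
  have s: "(\<lambda>n. rcoef A B n * z ^ n) sums (A / (1 - z)\<^sup>2 - B / (1 + z)\<^sup>2)" if "norm z < 1" for z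
  proof -
    have "(\<lambda>n. A * (of_nat (Suc n) * z ^ n) - B * (of_nat (Suc n) * (-z) ^ n)) sums
        (A * (1 / (1 - z)\<^sup>2) - B * (1 / (1 - (-z))\<^sup>2))"
      by (intro sums_diff sums_mult geometric_deriv_sums) (use that in auto)
    moreover have "(\<lambda>n. A * (of_nat (Suc n) * z ^ n) - B * (of_nat (Suc n) * (-z) ^ n)) = (\<lambda>n. rcoef A B n * z ^ n)"
      by (rule ext) (simp add: rcoef_def power_minus[of z] algebra_simps del: of_nat_Suc)
    ultimately show ?thesis by simp
  qed
  show "conv1 (Abs_fps (rcoef A B))"
    by (rule conv1I) (use s in \<open>auto simp: sums_iff\<close>)
  show "norm z < 1 \<Longrightarrow> eval_fps (Abs_fps (rcoef A B)) z = A / (1 - z)\<^sup>2 - B / (1 + z)\<^sup>2"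
    using s by (simp add: eval_fps_def sums_iff)
qed

text \<open>Exactly for these \<open>u\<close> the recursion for the coefficients of \<open>g\<close> can be solved.\<close>

definition nonres :: "complex \<Rightarrow> bool" where
  "nonres u \<longleftrightarrow> (\<forall>n::nat. of_nat (Suc n) + u \<noteq> 0)"

lemma ode_fps_nth:
  fixes f :: "complex fps"
  shows "fps_nth (fps_X * fps_deriv (fps_deriv f) + fps_const (1 + u) * fps_deriv f) n =
     of_nat (Suc n) * (of_nat (Suc n) + u) * fps_nth f (Suc n)"
  by (cases n) (simp_all add: algebra_simps)

lemma gfps_ode:
  assumes "nonres u"
  shows "fps_X * fps_deriv (fps_deriv (gfps u A B)) + fps_const (1 + u) * fps_deriv (gfps u A B) =
     Abs_fps (rcoef A B) * gfps u A B"
proof (rule fps_ext, subst ode_fps_nth)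
  fix n
  have ne: "(of_nat (Suc n) :: complex) \<noteq> 0" "of_nat (Suc n) + u \<noteq> 0"
    using assms unfolding nonres_def by (simp only: of_nat_eq_0_iff, blast)+
  have "fps_nth (Abs_fps (rcoef A B) * gfps u A B) n = (\<Sum>k\<le>n. rcoef A B (n - k) * gcoef u A B k)"
    unfolding fps_mult_nth atLeast0AtMost
    by (rule sum.reindex_bij_witness[of _ "\<lambda>k. n - k" "\<lambda>k. n - k"]) (auto simp: gfps_def)
  thus "of_nat (Suc n) * (of_nat (Suc n) + u) * fps_nth (gfps u A B) (Suc n) = fps_nth (Abs_fps (rcoef A B) * gfps u A B) n"
    using ne by (simp add: gfps_def del: of_nat_Suc)
qed

text \<open>The factor in front of each new coefficient is nonzero, so the constant term determines
  everything. This is how a transformed hypergeometric function is recognised as a multiple of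
  \<open>g\<close>.\<close>

lemma ode_fps_unique:
  assumes "nonres u"
    and f: "fps_X * fps_deriv (fps_deriv f) + fps_const (1 + u) * fps_deriv f = Abs_fps (rcoef A B) * f"
  shows "f = fps_const (fps_nth f 0) * gfps u A B"
proof (rule fps_ext)
  fix n
  show "fps_nth f n = fps_nth (fps_const (fps_nth f 0) * gfps u A B) n"
  proof (induction n rule: less_induct)
    case (less n)
    show ?case
    proof (cases n)
      case 0 thus ?thesis by (simp add: gfps_def)
    next
      case (Suc m)
      have ne: "(of_nat (Suc m) :: complex) \<noteq> 0" "of_nat (Suc m) + u \<noteq> 0"
        using assms unfolding nonres_def by (simp only: of_nat_eq_0_iff, blast)+
      have "of_nat (Suc m) * (of_nat (Suc m) + u) * fps_nth f (Suc m) = fps_nth (Abs_fps (rcoef A B) * f) m"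
        unfolding f[symmetric] ode_fps_nth ..
      also have "\<dots> = (\<Sum>k\<le>m. rcoef A B k * fps_nth f (m - k))"
        unfolding fps_mult_nth atLeast0AtMost by simp
      also have "\<dots> = fps_nth f 0 * (\<Sum>k\<le>m. rcoef A B k * gcoef u A B (m - k))"
        unfolding sum_distrib_left
      proof (intro sum.cong refl)
        fix k show "rcoef A B k * fps_nth f (m - k) = fps_nth f 0 * (rcoef A B k * gcoef u A B (m - k))"
          using less.IH[of "m - k"] Suc by (simp add: gfps_def)
      qed
      also have "(\<Sum>k\<le>m. rcoef A B k * gcoef u A B (m - k)) = (\<Sum>k\<le>m. rcoef A B (m - k) * gcoef u A B k)"
        by (rule sum.reindex_bij_witness[of _ "\<lambda>k. m - k" "\<lambda>k. m - k"]) auto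
      finally have "fps_nth f (Suc m) = (fps_nth f 0 * (\<Sum>k\<le>m. rcoef A B (m - k) * gcoef u A B k)) /
          (of_nat (Suc m) * (of_nat (Suc m) + u))"
        using ne by (metis mult_eq_0_iff nonzero_mult_div_cancel_left)
      thus ?thesis by (simp add: Suc gfps_def del: of_nat_Suc)
    qed
  qed
qed


lemma Re_pos_not_nonpos: "Re z > 0 \<Longrightarrow> z \<notin> \<real>\<^sub>\<le>\<^sub>0"
  by (auto simp: complex_nonpos_Reals_iff)

lemma norm_less_1_Re: "norm \<tau> < 1 \<Longrightarrow> Re (1 - \<tau>) > 0" "norm \<tau> < 1 \<Longrightarrow> Re (1 + \<tau>) > 0"
  using abs_Re_le_cmod[of \<tau>] by auto

lemma norm_less_1_ne: "norm \<tau> < 1 \<Longrightarrow> 1 - \<tau> \<noteq> 0" "norm \<tau> < 1 \<Longrightarrow> 1 + \<tau> \<noteq> 0" for \<tau> :: complex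
  using norm_less_1_Re[of \<tau>] by force+

section \<open>Analytic continuation of the hypergeometric series\<close>

text \<open>Under \<open>x = xmap \<tau>\<close> the hypergeometric function becomes \<open>lfac p q * g\<close>, and the unit disc of \<open>\<tau>\<close> is
  mapped bijectively onto the plane cut along \<open>[1, \<infinity>)\<close>; the inverse map is \<open>taumap\<close>.\<close>

definition lfac :: "complex \<Rightarrow> complex \<Rightarrow> complex \<Rightarrow> complex" where
  "lfac p q \<tau> = exp (p * Ln (1 - \<tau>) + q * Ln (1 + \<tau>))"

lemma lfac_nz [simp]: "lfac p q \<tau> \<noteq> 0"
  and lfac_0 [simp]: "lfac p q 0 = 1"
  and lfac_flip: "lfac p q (- \<tau>) = lfac q p \<tau>"
  by (simp_all add: lfac_def add.commute)

lemma lfac_inv: "lfac p q \<tau> * lfac (- p) (- q) \<tau> = 1"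
  unfolding lfac_def exp_add[symmetric] by simp

lemma lfac_deriv:
  assumes "Re (1 - \<tau>) > 0" "Re (1 + \<tau>) > 0"
  shows "(lfac p q has_field_derivative lfac p q \<tau> * (q / (1 + \<tau>) - p / (1 - \<tau>))) (at \<tau>)"
  unfolding lfac_def
  by (rule derivative_eq_intros refl Re_pos_not_nonpos assms)+ (simp add: field_simps)

definition gf :: "complex \<Rightarrow> complex \<Rightarrow> complex \<Rightarrow> complex \<Rightarrow> complex" where
  "gf u A B = eval_fps (gfps u A B)"

definition gf' :: "complex \<Rightarrow> complex \<Rightarrow> complex \<Rightarrow> complex \<Rightarrow> complex" where
  "gf' u A B = eval_fps (fps_deriv (gfps u A B))"

definition gf'' :: "complex \<Rightarrow> complex \<Rightarrow> complex \<Rightarrow> complex \<Rightarrow> complex" where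
  "gf'' u A B = eval_fps (fps_deriv (fps_deriv (gfps u A B)))"

lemma gf_deriv:
  assumes "norm z < 1"
  shows "(gf u A B has_field_derivative gf' u A B z) (at z)"
    "(gf' u A B has_field_derivative gf'' u A B z) (at z)"
  unfolding gf_def gf'_def gf''_def
  using assms by (auto intro!: has_field_derivative_eval_fps conv1_norm_less conv1_intros conv1_gfps)

lemma gf_holomorphic: "gf u A B holomorphic_on ball 0 1" "gf' u A B holomorphic_on ball 0 1"
  unfolding holomorphic_on_open[OF open_ball] using gf_deriv[of _ u A B] by (force simp: dist_norm)+

lemma gf_0 [simp]: "gf u A B 0 = 1"
  by (simp add: gf_def eval_fps_at_0 gfps_def)

lemma gf_ode:
  assumes "nonres u" "norm z < 1"
  shows "z * gf'' u A B z + (1 + u) * gf' u A B z = (A / (1 - z)\<^sup>2 - B / (1 + z)\<^sup>2) * gf u A B z"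
  using arg_cong[OF gfps_ode[OF assms(1), of A B], of "\<lambda>f. eval_fps f z"]
  by (simp add: conv1_eval assms conv1_intros conv1_gfps conv1_rcoef eval_rcoef gf_def gf'_def gf''_def)

lemma gf_flip:
  assumes "norm z < 1"
  shows "gf u B A z = gf u A B (- z)"
  unfolding gf_def eval_fps_def
  by (simp add: gfps_def gcoef_flip[of u B A] power_minus[of z] mult_ac)


text \<open>\<open>1 - xmap \<tau>\<close> is the square of
  \<open>(1 + \<tau>) / (1 - \<tau>)\<close>, and that quotient maps the unit disc onto the right
  half-plane. At \<open>\<tau> = exp (- 2 * \<xi>)\<close> the value is
  \<open>2 / (1 - cosh (2 * \<xi>))\<close>, the argument occurring in
  \<open>jacobi_Q\<close>.\<close>

definition xmap :: "complex \<Rightarrow> complex" where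
  "xmap \<tau> = - 4 * \<tau> / (1 - \<tau>)\<^sup>2"

lemma xmap_deriv:
  assumes "\<tau> \<noteq> 1"
  shows "(xmap has_field_derivative - 4 * (1 + \<tau>) / (1 - \<tau>) ^ 3) (at \<tau>)"
proof -
  have n: "(1 - \<tau>)\<^sup>2 \<noteq> 0" "1 - \<tau> \<noteq> 0" using assms by auto
  have d: "((\<lambda>\<tau>. - 4 * \<tau> / (1 - \<tau>)\<^sup>2) has_field_derivative
     (- 4 * (1 - \<tau>)\<^sup>2 - (- 4 * \<tau>) * (- 2 * (1 - \<tau>))) / ((1 - \<tau>)\<^sup>2 * (1 - \<tau>)\<^sup>2)) (at \<tau>)"
    by (rule derivative_eq_intros refl n)+ (simp add: algebra_simps)
  have "(- 4 * s\<^sup>2 - (- 4 * t) * (- 2 * s)) / (s\<^sup>2 * s\<^sup>2) = - 4 * (s + 2 * t) / s ^ 3" if "s \<noteq> 0" for s t :: complex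
    using that by (simp add: divide_simps power_numeral_reduce) (simp add: algebra_simps)
  from this[OF n(2), of \<tau>] d show ?thesis unfolding xmap_def by (simp only:) (simp add: algebra_simps)
qed

lemma deriv_xmap_deriv:
  fixes \<tau> :: complex
  assumes "\<tau> \<noteq> 1"
  shows "((\<lambda>\<tau>. - 4 * (1 + \<tau>) / (1 - \<tau>) ^ 3) has_field_derivative
     (- 4 / (1 - \<tau>) ^ 3 - 12 * (1 + \<tau>) / (1 - \<tau>) ^ 4)) (at \<tau>)"
proof -
  have n: "(1 - \<tau>) ^ 3 \<noteq> 0" "1 - \<tau> \<noteq> 0" using assms by auto
  have d: "((\<lambda>\<tau>. - 4 * (1 + \<tau>) / (1 - \<tau>) ^ 3) has_field_derivative
     (- 4 * (1 - \<tau>) ^ 3 - (- 4 * (1 + \<tau>)) * (- 3 * (1 - \<tau>)\<^sup>2)) / ((1 - \<tau>) ^ 3 * (1 - \<tau>) ^ 3)) (at \<tau>)"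
    by (rule derivative_eq_intros refl n)+ (simp add: algebra_simps)
  have eq: "(- 4 * s ^ 3 - (- 4 * t) * (- 3 * s\<^sup>2)) / (s ^ 3 * s ^ 3) = - 4 / s ^ 3 - 12 * t / s ^ 4"
    if "s \<noteq> 0" for s t :: complex
    using that by (simp add: divide_simps power_numeral_reduce) (simp add: algebra_simps)
  show ?thesis using d unfolding eq[OF n(2)] .
qed

lemma log_deriv_deriv:
  fixes \<tau> p q :: complex
  assumes "1 - \<tau> \<noteq> 0" "1 + \<tau> \<noteq> 0"
  shows "((\<lambda>\<tau>. p / (1 - \<tau>) - q / (1 + \<tau>)) has_field_derivative (p / (1 - \<tau>)\<^sup>2 + q / (1 + \<tau>)\<^sup>2)) (at \<tau>)"
  by (rule derivative_eq_intros refl assms)+ (simp add: power2_eq_square)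

text \<open>These are the coefficients of the function and of its first derivative after the change
  of variable, with \<open>p\<close>, \<open>q\<close> the exponents of \<open>lfac\<close> and
  \<open>e\<close> for \<open>a * b\<close>. The exponents are the ones that make the
  first-derivative term vanish; what remains of the zeroth-order term is the right-hand side of the
  equation for \<open>g\<close>.\<close>

lemma pullback_coeffs:
  fixes \<tau> p q e :: complex
  assumes "1 - \<tau> \<noteq> 0" "1 + \<tau> \<noteq> 0"
  shows "\<tau> * ((p / (1 - \<tau>) - q / (1 + \<tau>)) ^ 2 + (p / (1 - \<tau>)\<^sup>2 + q / (1 + \<tau>)\<^sup>2)) - 4 / (1 - \<tau>)\<^sup>2 * e
     + (p + q + 1) * (p / (1 - \<tau>) - q / (1 + \<tau>)) = (p\<^sup>2 + p - 4 * e) / (1 - \<tau>)\<^sup>2 - (q\<^sup>2 + q) / (1 + \<tau>)\<^sup>2"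
    "\<tau> * (2 * (p / (1 - \<tau>) - q / (1 + \<tau>)) * (- 4 * (1 + \<tau>) / (1 - \<tau>) ^ 3)
       + (- 4 / (1 - \<tau>) ^ 3 - 12 * (1 + \<tau>) / (1 - \<tau>) ^ 4))
     + 4 / (1 - \<tau>)\<^sup>2 * ((p + q + 1) - (p + 3 / 2) * (- 4 * \<tau> / (1 - \<tau>)\<^sup>2))
     + (p + q + 1) * (- 4 * (1 + \<tau>) / (1 - \<tau>) ^ 3) = 0"
proof -
  show "\<tau> * ((p / (1 - \<tau>) - q / (1 + \<tau>)) ^ 2 + (p / (1 - \<tau>)\<^sup>2 + q / (1 + \<tau>)\<^sup>2)) - 4 / (1 - \<tau>)\<^sup>2 * e
     + (p + q + 1) * (p / (1 - \<tau>) - q / (1 + \<tau>)) = (p\<^sup>2 + p - 4 * e) / (1 - \<tau>)\<^sup>2 - (q\<^sup>2 + q) / (1 + \<tau>)\<^sup>2"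
    using assms by (simp add: divide_simps) algebra
  \<comment> \<open>With \<open>c\<close> and \<open>d\<close> free, the numerator is a quadratic in
    \<tau> without constant term. Both remaining coefficients vanish for
    \<open>c = p + q + 1\<close> and \<open>d = p + 3 / 2\<close>.\<close>
  have "\<tau> * (2 * (p / (1 - \<tau>) - q / (1 + \<tau>)) * (- 4 * (1 + \<tau>) / (1 - \<tau>) ^ 3)
       + (- 4 / (1 - \<tau>) ^ 3 - 12 * (1 + \<tau>) / (1 - \<tau>) ^ 4))
     + 4 / (1 - \<tau>)\<^sup>2 * (c - d * (- 4 * \<tau> / (1 - \<tau>)\<^sup>2)) + c * (- 4 * (1 + \<tau>) / (1 - \<tau>) ^ 3) =
     (\<tau> * (16 * d + 8 * q - 8 * p - 8 * c - 16) + \<tau> * \<tau> * (8 * (c - p - q - 1))) / (1 - \<tau>) ^ 4" for c d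
    using assms by (simp add: divide_simps power_numeral_reduce) (simp add: algebra_simps)
  from this[of "p + q + 1" "p + 3 / 2"]
  show "\<tau> * (2 * (p / (1 - \<tau>) - q / (1 + \<tau>)) * (- 4 * (1 + \<tau>) / (1 - \<tau>) ^ 3)
       + (- 4 / (1 - \<tau>) ^ 3 - 12 * (1 + \<tau>) / (1 - \<tau>) ^ 4))
     + 4 / (1 - \<tau>)\<^sup>2 * ((p + q + 1) - (p + 3 / 2) * (- 4 * \<tau> / (1 - \<tau>)\<^sup>2))
     + (p + q + 1) * (- 4 * (1 + \<tau>) / (1 - \<tau>) ^ 3) = 0"
  proof (rule trans)
    have "16 * (p + 3 / 2) + 8 * q - 8 * p - 8 * (p + q + 1) - 16 = 0" "p + q + 1 - p - q - 1 = 0"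
      by (simp_all add: algebra_simps)
    thus "(\<tau> * (16 * (p + 3 / 2) + 8 * q - 8 * p - 8 * (p + q + 1) - 16)
       + \<tau> * \<tau> * (8 * (p + q + 1 - p - q - 1))) / (1 - \<tau>) ^ 4 = 0" by (simp only: mult_zero_right add_0 div_0)
  qed
qed

section \<open>The hypergeometric equation in the disc variable\<close>

context
  fixes a b c :: complex
  assumes nr: "nonres (c - 1)"
begin

abbreviation (input) "pe \<equiv> a + b - 1 / 2"
abbreviation (input) "qe \<equiv> c - a - b - 1 / 2"
abbreviation (input) "AA \<equiv> (b - a)\<^sup>2 - 1 / 4"
abbreviation (input) "BB \<equiv> (c - a - b)\<^sup>2 - 1 / 4"
abbreviation (input) "ff0 \<equiv> eval_fps (hyp_fps a b c)"
abbreviation (input) "ff1 \<equiv> eval_fps (fps_deriv (hyp_fps a b c))"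
abbreviation (input) "ff2 \<equiv> eval_fps (fps_deriv (fps_deriv (hyp_fps a b c)))"

lemma hyp_eval_ode:
  assumes "norm z < 1"
  shows "z * (1 - z) * ff2 z + (c - (a + b + 1) * z) * ff1 z - a * b * ff0 z = 0"
  using arg_cong[OF hyp_fps_ode[of a b c], of "\<lambda>f. eval_fps f z"]
  by (simp add: conv1_eval assms conv1_intros conv1_hyp_fps)

text \<open>Divided by \<open>lfac\<close>, the composition with \<open>xmap\<close> is analytic
  near 0 and solves the equation for \<open>g\<close> there. Uniqueness of the power series solution
  then fixes it by its value \<open>rGamma c\<close> at 0.\<close>

lemma pullback_near_0:
  "eventually (\<lambda>\<tau>. ff0 (xmap \<tau>) = rGamma c * lfac pe qe \<tau> * gf (c - 1) AA BB \<tau>) (nhds 0)"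
proof -
  define m where "m = (\<lambda>\<tau>. pe / (1 - \<tau>) - qe / (1 + \<tau>))"
  define X1 where "X1 = (\<lambda>\<tau>::complex. - 4 * (1 + \<tau>) / (1 - \<tau>) ^ 3)"
  define X2 where "X2 = (\<lambda>\<tau>::complex. - 4 / (1 - \<tau>) ^ 3 - 12 * (1 + \<tau>) / (1 - \<tau>) ^ 4)"
  define \<mu> where "\<mu> = lfac (- pe) (- qe)"
  define G where "G = (\<lambda>\<tau>. \<mu> \<tau> * ff0 (xmap \<tau>))"
  define G1 where "G1 = (\<lambda>\<tau>. \<mu> \<tau> * (m \<tau> * ff0 (xmap \<tau>) + X1 \<tau> * ff1 (xmap \<tau>)))"
  define m1 where "m1 = (\<lambda>\<tau>. pe / (1 - \<tau>)\<^sup>2 + qe / (1 + \<tau>)\<^sup>2)"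
  define G2 where "G2 = (\<lambda>\<tau>. \<mu> \<tau> * ((m \<tau> ^ 2 + m1 \<tau>) * ff0 (xmap \<tau>) + (2 * m \<tau> * X1 \<tau> + X2 \<tau>) * ff1 (xmap \<tau>)
       + X1 \<tau> ^ 2 * ff2 (xmap \<tau>)))"
  \<comment> \<open>The radius 1/8 keeps \<open>xmap\<close> inside the disc of convergence, since
    \<open>4 / 8 < (7 / 8)\<^sup>2\<close>.\<close>
  have small: "norm \<tau> < 1 \<and> norm (xmap \<tau>) < 1" if "\<tau> \<in> ball 0 (1/8)" for \<tau>
  proof -
    have t: "norm \<tau> < 1 / 8" using that by simp
    have "norm (1 - \<tau>) \<ge> 7 / 8" using norm_triangle_ineq2[of 1 \<tau>] t by simp
    hence "norm (1 - \<tau>) ^ 2 \<ge> (7 / 8) ^ 2" by (intro power_mono) auto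
    hence "4 * norm \<tau> < norm (1 - \<tau>) ^ 2" using t by (simp add: power2_eq_square)
    moreover have "1 - \<tau> \<noteq> 0" using t by auto
    ultimately show ?thesis using t by (simp add: xmap_def norm_divide norm_mult norm_power)
  qed
  have ne: "1 - \<tau> \<noteq> 0" "1 + \<tau> \<noteq> 0" "\<tau> \<noteq> 1" "Re (1 - \<tau>) > 0" "Re (1 + \<tau>) > 0" "norm (xmap \<tau>) < 1"
    if "\<tau> \<in> ball 0 (1/8)" for \<tau>
    using small[OF that] norm_less_1_ne[of \<tau>] norm_less_1_Re[of \<tau>] by auto
  have dmu: "(\<mu> has_field_derivative \<mu> \<tau> * m \<tau>) (at \<tau>)" if "\<tau> \<in> ball 0 (1/8)" for \<tau>
  proof -
    have "(- q) / s - (- p) / t = p / t - q / s" for p q s t :: complex by simp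
    from this[of qe "1 + \<tau>" pe "1 - \<tau>"] show ?thesis
      unfolding \<mu>_def m_def using lfac_deriv[OF ne(4,5)[OF that], of "- pe" "- qe"] by (simp only:)
  qed
  have dX: "(xmap has_field_derivative X1 \<tau>) (at \<tau>)" if "\<tau> \<in> ball 0 (1/8)" for \<tau>
    unfolding X1_def using xmap_deriv[OF ne(3)[OF that]] .
  have dX1: "(X1 has_field_derivative X2 \<tau>) (at \<tau>)" if "\<tau> \<in> ball 0 (1/8)" for \<tau>
    unfolding X1_def X2_def by (rule deriv_xmap_deriv[OF ne(3)[OF that]])
  have dm: "(m has_field_derivative m1 \<tau>) (at \<tau>)" if "\<tau> \<in> ball 0 (1/8)" for \<tau>
    unfolding m_def m1_def by (rule log_deriv_deriv[OF ne(1,2)[OF that]])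
  have dG: "(G has_field_derivative G1 \<tau>) (at \<tau>)" if "\<tau> \<in> ball 0 (1/8)" for \<tau>
    unfolding G_def G1_def
    by (rule derivative_eq_intros dmu dX refl conv1_hyp_fps that ne(6)[OF that])+ (simp add: algebra_simps)
  have dG1: "(G1 has_field_derivative G2 \<tau>) (at \<tau>)" if "\<tau> \<in> ball 0 (1/8)" for \<tau>
    unfolding G1_def G2_def
    by (rule derivative_eq_intros dmu dX dX1 dm refl conv1_hyp_fps conv1_intros that ne(6)[OF that])+
       (simp add: algebra_simps power2_eq_square)
  have ode: "\<tau> * G2 \<tau> + (1 + (c - 1)) * G1 \<tau> = (AA / (1 - \<tau>)\<^sup>2 - BB / (1 + \<tau>)\<^sup>2) * G \<tau>" if "\<tau> \<in> ball 0 (1/8)" for \<tau>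
  proof -
    note n = ne[OF that]
    \<comment> \<open>This makes the leading terms agree: \<tau> times the squared derivative of
      \<open>xmap\<close> reproduces the coefficient \<open>x * (1 - x)\<close> of the
      hypergeometric equation up to the factor \<open>- 4 / (1 - \<tau>)\<^sup>2\<close>.\<close>
    have e: "\<tau> * X1 \<tau> ^ 2 = - (4 / (1 - \<tau>)\<^sup>2) * (xmap \<tau> * (1 - xmap \<tau>))"
    proof -
      have "1 - xmap \<tau> = (1 + \<tau>)\<^sup>2 / (1 - \<tau>)\<^sup>2"
        using n by (simp add: xmap_def divide_simps) (simp add: algebra_simps power2_eq_square)
      thus ?thesis using n(1-3)
        by (simp add: xmap_def X1_def divide_simps power_numeral_reduce) (auto simp: algebra_simps)
    qed
    have h: "xmap \<tau> * (1 - xmap \<tau>) * ff2 (xmap \<tau>) = a * b * ff0 (xmap \<tau>) - (c - (a + b + 1) * xmap \<tau>) * ff1 (xmap \<tau>)"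
      using hyp_eval_ode[OF n(6)] by (simp add: algebra_simps)
    have "\<tau> * X1 \<tau> ^ 2 * ff2 (xmap \<tau>) = - (4 / (1 - \<tau>)\<^sup>2) * (xmap \<tau> * (1 - xmap \<tau>) * ff2 (xmap \<tau>))"
      unfolding e by (simp only: mult_ac)
    hence k: "\<tau> * X1 \<tau> ^ 2 * ff2 (xmap \<tau>) = - (4 / (1 - \<tau>)\<^sup>2) * (a * b * ff0 (xmap \<tau>) - (c - (a + b + 1) * xmap \<tau>) * ff1 (xmap \<tau>))"
      unfolding h .
    have c0: "\<tau> * (m \<tau> ^ 2 + m1 \<tau>) - 4 / (1 - \<tau>)\<^sup>2 * (a * b) + c * m \<tau> = AA / (1 - \<tau>)\<^sup>2 - BB / (1 + \<tau>)\<^sup>2"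
    proof -
      have 1: "pe + qe + 1 = c" by simp
      have 2: "pe\<^sup>2 + pe - 4 * (a * b) = AA" "qe\<^sup>2 + qe = BB"
        by (simp_all add: algebra_simps power2_eq_square)
      show ?thesis
        using pullback_coeffs(1)[OF n(1,2), of pe qe "a * b"] unfolding 1 2 m_def m1_def .
    qed
    have c1: "\<tau> * (2 * m \<tau> * X1 \<tau> + X2 \<tau>) + 4 / (1 - \<tau>)\<^sup>2 * (c - (a + b + 1) * xmap \<tau>) + c * X1 \<tau> = 0"
    proof -
      have 1: "pe + qe + 1 = c" "pe + 3 / 2 = a + b + 1" by simp_all
      show ?thesis
        using pullback_coeffs(2)[OF n(1,2), of pe qe] unfolding 1 m_def X1_def X2_def xmap_def .
    qed
    have "\<tau> * G2 \<tau> + (1 + (c - 1)) * G1 \<tau> = \<mu> \<tau> * ((\<tau> * (m \<tau> ^ 2 + m1 \<tau>) + c * m \<tau>) * ff0 (xmap \<tau>) +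
       (\<tau> * (2 * m \<tau> * X1 \<tau> + X2 \<tau>) + c * X1 \<tau>) * ff1 (xmap \<tau>) + \<tau> * X1 \<tau> ^ 2 * ff2 (xmap \<tau>))"
      unfolding G1_def G2_def by (simp add: algebra_simps)
    also have "\<dots> = \<mu> \<tau> * ((\<tau> * (m \<tau> ^ 2 + m1 \<tau>) - 4 / (1 - \<tau>)\<^sup>2 * (a * b) + c * m \<tau>) * ff0 (xmap \<tau>) +
       (\<tau> * (2 * m \<tau> * X1 \<tau> + X2 \<tau>) + 4 / (1 - \<tau>)\<^sup>2 * (c - (a + b + 1) * xmap \<tau>) + c * X1 \<tau>) * ff1 (xmap \<tau>))"
    proof -
      have "M * ((T1 + cm) * F0 + (T2 + cX) * F1 + (-w) * (ab * F0 - D * F1)) =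
          M * ((T1 - w * ab + cm) * F0 + (T2 + w * D + cX) * F1)" for M T1 cm F0 T2 cX F1 w ab D :: complex
        by (simp add: algebra_simps)
      thus ?thesis unfolding k .
    qed
    also have "\<dots> = (AA / (1 - \<tau>)\<^sup>2 - BB / (1 + \<tau>)\<^sup>2) * G \<tau>"
      unfolding c0 c1 G_def by simp
    finally show ?thesis .
  qed
  have hol: "G holomorphic_on ball 0 (1/8)"
    using dG unfolding holomorphic_on_open[OF open_ball] by blast
  define y where "y = fps_expansion G 0"
  have "G analytic_on ball 0 (1/8)" using hol by (simp add: analytic_on_open)
  hence "G analytic_on {0}" by (rule analytic_on_subset) auto
  hence y: "G has_fps_expansion y" unfolding y_def by (rule analytic_at_imp_has_fps_expansion_0)
  have nh: "eventually (\<lambda>\<tau>::complex. \<tau> \<in> ball 0 (1/8)) (nhds 0)" by (intro eventually_nhds_in_open) auto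
  have dd: "deriv G \<tau> = G1 \<tau>" if "\<tau> \<in> ball 0 (1/8)" for \<tau> using dG[OF that] by (rule DERIV_imp_deriv)
  have dd2: "deriv (deriv G) \<tau> = G2 \<tau>" if "\<tau> \<in> ball 0 (1/8)" for \<tau>
  proof -
    have "eventually (\<lambda>w. w \<in> ball 0 (1/8)) (nhds \<tau>)" using that by (intro eventually_nhds_in_open) auto
    hence "eventually (\<lambda>w. deriv G w = G1 w) (nhds \<tau>)" by eventually_elim (rule dd)
    hence "deriv (deriv G) \<tau> = deriv G1 \<tau>" by (rule deriv_cong_ev) simp
    thus ?thesis using dG1[OF that] by (simp add: DERIV_imp_deriv)
  qed
  have R: "eval_fps (Abs_fps (rcoef AA BB)) has_fps_expansion Abs_fps (rcoef AA BB)"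
    by (rule eval_fps_has_fps_expansion) (use conv1_norm_less[OF conv1_rcoef, of 0] in \<open>simp add: zero_ereal_def\<close>)
  have E1: "(\<lambda>\<tau>. eval_fps (Abs_fps (rcoef AA BB)) \<tau> * G \<tau>) has_fps_expansion Abs_fps (rcoef AA BB) * y"
    by (intro fps_expansion_intros R y)
  have E2: "(\<lambda>\<tau>. \<tau> * deriv (deriv G) \<tau> + (1 + (c - 1)) * deriv G \<tau>) has_fps_expansion
      fps_X * fps_deriv (fps_deriv y) + fps_const (1 + (c - 1)) * fps_deriv y"
    by (intro fps_expansion_intros y has_fps_expansion_deriv)
  have E3: "eventually (\<lambda>\<tau>. \<tau> * deriv (deriv G) \<tau> + (1 + (c - 1)) * deriv G \<tau> = eval_fps (Abs_fps (rcoef AA BB)) \<tau> * G \<tau>) (nhds 0)"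
    using nh
  proof eventually_elim
    case (elim \<tau>)
    have "norm \<tau> < 1" using small[OF elim] by simp
    thus ?case using ode[OF elim] by (simp only: dd[OF elim] dd2[OF elim] eval_rcoef)
  qed
  from E2 have "(\<lambda>\<tau>. eval_fps (Abs_fps (rcoef AA BB)) \<tau> * G \<tau>) has_fps_expansion
      fps_X * fps_deriv (fps_deriv y) + fps_const (1 + (c - 1)) * fps_deriv y"
    by (rule iffD1[OF has_fps_expansion_cong[OF E3 refl]])
  from fps_expansion_unique_complex[OF this E1]
  have "fps_X * fps_deriv (fps_deriv y) + fps_const (1 + (c - 1)) * fps_deriv y = Abs_fps (rcoef AA BB) * y" .
  hence yg: "y = fps_const (fps_nth y 0) * gfps (c - 1) AA BB"
    by (rule ode_fps_unique[OF nr])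
  have "fps_nth y 0 = G 0"
    using y by (metis has_fps_expansion_imp_0_eq_fps_nth_0)
  also have "\<dots> = rGamma c" by (simp add: G_def \<mu>_def xmap_def eval_fps_at_0 hyp_fps_def)
  finally have y0: "fps_nth y 0 = rGamma c" .
  have "eventually (\<lambda>\<tau>. eval_fps y \<tau> = G \<tau>) (nhds 0)" using y by (simp add: has_fps_expansion_def)
  thus ?thesis using nh
  proof eventually_elim
    case (elim \<tau>)
    have n1: "norm \<tau> < 1" using small[OF elim(2)] by simp
    have "eval_fps y \<tau> = rGamma c * gf (c - 1) AA BB \<tau>"
      by (subst yg) (simp add: conv1_eval n1 conv1_intros conv1_gfps gf_def y0)
    hence h: "lfac pe qe \<tau> * (\<mu> \<tau> * ff0 (xmap \<tau>)) = lfac pe qe \<tau> * (rGamma c * gf (c - 1) AA BB \<tau>)"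
      using elim(1) by (simp add: G_def)
    have "X = r * L * g" if "L * m = 1" "L * (m * X) = L * (r * g)" for X r L g m :: complex
      using that by algebra
    from this[OF lfac_inv[of pe qe \<tau>, folded \<mu>_def] h] show ?case .
  qed
qed

end

section \<open>The cut plane and its parametrisation by the disc\<close>

abbreviation cut_plane :: "complex set" where "cut_plane \<equiv> - (complex_of_real ` {1..})"

lemma open_cut_plane: "open cut_plane"
  by (intro open_Compl closed_injective_linear_image closed_atLeast) (auto simp: linear_of_real inj_of_real)

lemma cut_plane_iff: "x \<in> cut_plane \<longleftrightarrow> 1 - x \<notin> \<real>\<^sub>\<le>\<^sub>0"
proof -
  have "x \<in> complex_of_real ` {1..} \<longleftrightarrow> 1 - x \<in> \<real>\<^sub>\<le>\<^sub>0"
    by (auto simp: complex_nonpos_Reals_iff image_iff complex_eq_iff intro!: bexI[of _ "Re x"])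
  thus ?thesis by simp
qed

lemma ball_subset_cut_plane: "ball 0 1 \<subseteq> cut_plane"
  by (auto simp: image_iff)

lemma connected_cut_plane: "connected cut_plane"
proof (rule starlike_imp_connected, unfold starlike_def, intro bexI ballI subsetI)
  show "0 \<in> cut_plane" by (auto simp: image_iff)
  fix x y assume x: "x \<in> cut_plane" and y: "y \<in> closed_segment 0 x"
  then obtain t where t: "0 \<le> t" "t \<le> 1" "y = of_real t * x"
    by (auto simp: closed_segment_def scaleR_conv_of_real)
  show "y \<in> cut_plane"
  proof (rule ccontr)
    assume "\<not> y \<in> cut_plane"
    then obtain s where s: "s \<ge> 1" "of_real t * x = of_real s" using t by auto
    hence "t \<noteq> 0" by auto
    hence "x = of_real (s / t)" using s by (simp add: field_simps)
    moreover have "s / t \<ge> 1" using s t \<open>t \<noteq> 0\<close> by (simp add: le_divide_eq)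
    ultimately show False using x by (metis ComplD atLeast_iff image_eqI)
  qed
qed

definition taumap :: "complex \<Rightarrow> complex" where
  "taumap x = (csqrt (1 - x) - 1) / (csqrt (1 - x) + 1)"

lemma csqrt_cut_plane: "x \<in> cut_plane \<Longrightarrow> Re (csqrt (1 - x)) > 0"
proof (rule ccontr)
  assume x: "x \<in> cut_plane" and "\<not> Re (csqrt (1 - x)) > 0"
  hence "Re (csqrt (1 - x)) = 0" using Re_csqrt[of "1 - x"] by linarith
  hence "Re ((csqrt (1 - x))\<^sup>2) \<le> 0" "Im ((csqrt (1 - x))\<^sup>2) = 0"
    by (simp_all add: power2_eq_square)
  hence "1 - x \<in> \<real>\<^sub>\<le>\<^sub>0" by (simp add: complex_nonpos_Reals_iff)
  thus False using x cut_plane_iff by blast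
qed

text \<open>Off the cut \<open>csqrt (1 - x)\<close> has positive real part, hence is closer to 1
  than to -1, and the quotient has modulus below 1.\<close>

lemma taumap:
  assumes "x \<in> cut_plane"
  shows "norm (taumap x) < 1" "xmap (taumap x) = x"
proof -
  define r where "r = csqrt (1 - x)"
  have r: "Re r > 0" "r\<^sup>2 = 1 - x" using csqrt_cut_plane[OF assms] by (auto simp: r_def)
  have r1: "r + 1 \<noteq> 0" using r by (auto simp: complex_eq_iff)
  have "norm (r - 1) ^ 2 < norm (r + 1) ^ 2" using r unfolding cmod_power2 by (simp add: power2_eq_square algebra_simps)
  hence "norm (r - 1) < norm (r + 1)" by (rule power2_less_imp_less) simp
  thus "norm (taumap x) < 1" using r1 by (simp add: taumap_def r_def norm_divide)
  have e: "1 - taumap x = 2 / (r + 1)" using r1 by (simp add: taumap_def r_def[symmetric] field_simps)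
  have "xmap (taumap x) = - ((r - 1) * (r + 1))"
    unfolding xmap_def e using r1
    by (simp add: taumap_def r_def[symmetric] divide_simps power2_eq_square) (simp add: algebra_simps)
  also have "\<dots> = x" using r(2) by (simp add: algebra_simps power2_eq_square)
  finally show "xmap (taumap x) = x" .
qed

lemma taumap_holomorphic: "taumap holomorphic_on cut_plane"
proof -
  have 1: "1 - z \<notin> \<real>\<^sub>\<le>\<^sub>0" if "z \<in> cut_plane" for z using that cut_plane_iff by blast
  have 0: "Re w > 0 \<Longrightarrow> w + 1 \<noteq> 0" for w by (auto simp: complex_eq_iff)
  have 2: "csqrt (1 - z) + 1 \<noteq> 0" if "z \<in> cut_plane" for z
    by (rule 0) (rule csqrt_cut_plane[OF that])
  show ?thesis unfolding taumap_def by (intro holomorphic_intros 1 2)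
qed

lemma xmap_cut_plane:
  assumes "norm \<tau> < 1" shows "xmap \<tau> \<in> cut_plane"
proof -
  note n = norm_less_1_ne[OF assms]
  have e: "1 - xmap \<tau> = ((1 + \<tau>) / (1 - \<tau>))\<^sup>2"
    using n by (simp add: xmap_def divide_simps) (simp add: algebra_simps power2_eq_square)
  have "Re ((1 + \<tau>) / (1 - \<tau>)) > 0"
  proof -
    have "Re ((1 + \<tau>) * cnj (1 - \<tau>)) = 1 - (norm \<tau>)\<^sup>2"
      unfolding cmod_power2 by (simp add: power2_eq_square algebra_simps)
    also have "\<dots> > 0" using assms by (simp add: power_less_one_iff abs_square_less_1)
    finally show ?thesis using n by (simp add: Re_complex_div_gt_0)
  qed
  moreover have "w\<^sup>2 \<notin> \<real>\<^sub>\<le>\<^sub>0" if "Re w > 0" for w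
    using that by (auto simp: complex_nonpos_Reals_iff power2_eq_square mult_less_0_iff not_le)
  ultimately have "1 - xmap \<tau> \<notin> \<real>\<^sub>\<le>\<^sub>0" unfolding e by blast
  thus ?thesis using cut_plane_iff by blast
qed

lemma xmap_holomorphic: "xmap holomorphic_on ball 0 1"
  unfolding xmap_def by (intro holomorphic_intros) (use norm_less_1_ne in auto)

lemma lfac_holomorphic: "lfac p q holomorphic_on ball 0 1"
  unfolding holomorphic_on_open[OF open_ball] using lfac_deriv[OF norm_less_1_Re] by (force simp: dist_norm)

lemma hyp_series_holomorphic: "eval_fps (hyp_fps a b c) holomorphic_on ball 0 1"
  by (intro holomorphic_on_eval_fps) (use conv1_norm_less[OF conv1_hyp_fps] in \<open>auto simp: in_eball_iff\<close>)

text \<open>The right-hand side of \<open>pullback_near_0\<close> is holomorphic on the whole disc,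
  and \<open>taumap\<close> carries it to the whole cut plane. It agrees with the series near 0,
  hence on the unit disc by the identity theorem.\<close>

lemma hyp_continuation_nonres:
  assumes "nonres (c - 1)"
  shows "\<exists>F. F holomorphic_on cut_plane \<and> (\<forall>x. norm x < 1 \<longrightarrow> F x = eval_fps (hyp_fps a b c) x)"
proof -
  define F0 where "F0 = (\<lambda>\<tau>. rGamma c * lfac (a + b - 1 / 2) (c - a - b - 1 / 2) \<tau> *
     gf (c - 1) ((b - a)\<^sup>2 - 1 / 4) ((c - a - b)\<^sup>2 - 1 / 4) \<tau>)"
  have F0: "F0 holomorphic_on ball 0 1" unfolding F0_def
    by (intro holomorphic_intros lfac_holomorphic gf_holomorphic)
  have hol: "F0 \<circ> taumap holomorphic_on cut_plane"
    by (rule holomorphic_on_compose_gen[OF taumap_holomorphic F0]) (use taumap in auto)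
  have "isCont taumap 0"
    by (meson taumap_holomorphic holomorphic_on_imp_continuous_on continuous_on_eq_continuous_at open_cut_plane
        ball_subset_cut_plane centre_in_ball subsetD zero_less_one)
  hence "filterlim taumap (nhds 0) (nhds 0)"
    by (simp add: isCont_def tendsto_nhds_iff taumap_def)
  from eventually_compose_filterlim[OF pullback_near_0[OF assms, of a b] this]
  have "eventually (\<lambda>x. eval_fps (hyp_fps a b c) (xmap (taumap x)) = F0 (taumap x)) (nhds 0)"
    by (simp add: F0_def)
  then obtain S where S: "open S" "0 \<in> S" "\<And>x. x \<in> S \<Longrightarrow> eval_fps (hyp_fps a b c) (xmap (taumap x)) = F0 (taumap x)"
    unfolding eventually_nhds by blast
  have "(F0 \<circ> taumap) x = eval_fps (hyp_fps a b c) x" if "norm x < 1" for x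
  proof (rule analytic_continuation_open[where s = "S \<inter> ball 0 1" and s' = "ball 0 1"
        and f = "F0 \<circ> taumap" and g = "eval_fps (hyp_fps a b c)"])
    show "F0 \<circ> taumap holomorphic_on ball 0 1" using hol ball_subset_cut_plane by (rule holomorphic_on_subset)
    show "eval_fps (hyp_fps a b c) holomorphic_on ball 0 1" by (rule hyp_series_holomorphic)
    fix z assume "z \<in> S \<inter> ball 0 1"
    thus "(F0 \<circ> taumap) z = eval_fps (hyp_fps a b c) z"
      using S(3)[of z] taumap(2)[of z] ball_subset_cut_plane by auto
  qed (use S that in auto)
  with hol show ?thesis by (intro exI[of _ "F0 \<circ> taumap"] conjI allI impI)
qed

lemma nonres_if_Re: "Re u > -1 \<Longrightarrow> nonres u"
  unfolding nonres_def
proof (intro allI notI)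
  fix n :: nat assume u: "Re u > -1" "of_nat (Suc n) + u = 0"
  hence "Re (of_nat (Suc n) + u) = 0" by (simp only: zero_complex.sel)
  thus False using u(1) by simp
qed

text \<open>For \<open>Re c > 0\<close> the disc representation applies. The remaining
  \<open>c\<close> are reached by induction, lowering \<open>c\<close> by 1 with
  \<open>hyp_fps_lower_c\<close>.\<close>

lemma hyp_continuation:
  "\<exists>F. F holomorphic_on cut_plane \<and> (\<forall>x. norm x < 1 \<longrightarrow> F x = eval_fps (hyp_fps a b c) x)"
proof -
  obtain k :: nat where k: "- Re c < real k" using reals_Archimedean2 by blast
  have step: "Re c + real k > 0 \<Longrightarrow> ?thesis" for k
  proof (induction k arbitrary: c)
    case 0
    thus ?case by (intro hyp_continuation_nonres nonres_if_Re) auto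
  next
    case (Suc k)
    hence "Re (c + 1) + real k > 0" by simp
    from Suc.IH[OF this] obtain F where F: "F holomorphic_on cut_plane"
      "\<And>x. norm x < 1 \<Longrightarrow> F x = eval_fps (hyp_fps a b (c + 1)) x"
      by blast
    have "(\<lambda>x. x * deriv F x + c * F x) holomorphic_on cut_plane"
      by (intro holomorphic_intros F open_cut_plane)
    moreover have "x * deriv F x + c * F x = eval_fps (hyp_fps a b c) x" if "norm x < 1" for x
    proof -
      have "eventually (\<lambda>w. w \<in> ball 0 1) (nhds x)" using that by (intro eventually_nhds_in_open) auto
      hence "eventually (\<lambda>w. F w = eval_fps (hyp_fps a b (c + 1)) w) (nhds x)" by eventually_elim (use F in auto)
      hence "deriv F x = deriv (eval_fps (hyp_fps a b (c + 1))) x" by (rule deriv_cong_ev) simp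
      also have "\<dots> = eval_fps (fps_deriv (hyp_fps a b (c + 1))) x"
        by (intro DERIV_imp_deriv has_field_derivative_eval_fps conv1_norm_less conv1_hyp_fps that)
      finally show ?thesis
        by (subst hyp_fps_lower_c[of a b c]) (simp add: conv1_eval that conv1_intros conv1_hyp_fps F)
    qed
    ultimately show ?case by blast
  qed
  have "Re c + real k > 0" using k by linarith
  thus ?thesis by (rule step)
qed

text \<open>\<open>hyp_reg\<close> is a choice, so its defining properties are available only once
  some continuation is known to exist.\<close>

lemma hyp_reg_spec: "hyp_reg a b c holomorphic_on cut_plane \<and> (\<forall>x. norm x < 1 \<longrightarrow> hyp_reg a b c x = hyp_reg_series a b c x)"
  unfolding hyp_reg_def hyp_reg_series_eq_eval_fps using hyp_continuation[of a b c] by (rule someI_ex)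

lemma hyp_reg_holomorphic: "hyp_reg a b c holomorphic_on cut_plane"
  and hyp_reg_eq_eval_fps: "norm x < 1 \<Longrightarrow> hyp_reg a b c x = eval_fps (hyp_fps a b c) x"
  using hyp_reg_spec[of a b c] by (auto simp: hyp_reg_series_eq_eval_fps)

text \<open>Both sides are holomorphic on the disc, so the identity extends from a neighbourhood of
  0.\<close>

lemma hyp_reg_pullback:
  assumes "nonres (c - 1)" "norm \<tau> < 1"
  shows "hyp_reg a b c (xmap \<tau>) = rGamma c * lfac (a + b - 1 / 2) (c - a - b - 1 / 2) \<tau> *
     gf (c - 1) ((b - a)\<^sup>2 - 1 / 4) ((c - a - b)\<^sup>2 - 1 / 4) \<tau>"
proof -
  define F0 where "F0 = (\<lambda>\<tau>. rGamma c * lfac (a + b - 1 / 2) (c - a - b - 1 / 2) \<tau> *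
     gf (c - 1) ((b - a)\<^sup>2 - 1 / 4) ((c - a - b)\<^sup>2 - 1 / 4) \<tau>)"
  have F0: "F0 holomorphic_on ball 0 1" unfolding F0_def
    by (intro holomorphic_intros lfac_holomorphic gf_holomorphic)
  have "isCont xmap 0" unfolding xmap_def by (intro continuous_intros) auto
  hence "filterlim xmap (nhds 0) (nhds 0)" by (simp add: isCont_def tendsto_nhds_iff xmap_def)
  moreover have "eventually (\<lambda>x::complex. norm x < 1) (nhds 0)"
    using eventually_nhds_in_open[of "ball 0 1" "0::complex"] by simp
  ultimately have "eventually (\<lambda>\<tau>. norm (xmap \<tau>) < 1) (nhds 0)"
    by (rule eventually_compose_filterlim[rotated])
  with pullback_near_0[OF assms(1), of a b]
  have "eventually (\<lambda>\<tau>. hyp_reg a b c (xmap \<tau>) = F0 \<tau>) (nhds 0)"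
    by eventually_elim (simp add: hyp_reg_eq_eval_fps F0_def)
  then obtain S where S: "open S" "0 \<in> S" "\<And>x. x \<in> S \<Longrightarrow> hyp_reg a b c (xmap x) = F0 x"
    unfolding eventually_nhds by blast
  have "(hyp_reg a b c \<circ> xmap) \<tau> = F0 \<tau>"
  proof (rule analytic_continuation_open[where s = "S \<inter> ball 0 1" and s' = "ball 0 1"
        and f = "hyp_reg a b c \<circ> xmap" and g = F0])
    show "hyp_reg a b c \<circ> xmap holomorphic_on ball 0 1"
      by (rule holomorphic_on_compose_gen[OF xmap_holomorphic hyp_reg_holomorphic])
         (metis image_subsetI mem_ball_0 xmap_cut_plane)
    fix z assume "z \<in> S \<inter> ball 0 1"
    thus "(hyp_reg a b c \<circ> xmap) z = F0 z" using S(3) by auto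
  qed (use S(1,2) assms F0 in auto)
  thus ?thesis by (simp add: F0_def)
qed

lemma hyp_reg_deriv:
  assumes "x \<in> cut_plane"
  shows "(hyp_reg a b c has_field_derivative deriv (hyp_reg a b c) x) (at x)"
    "(deriv (hyp_reg a b c) has_field_derivative deriv (deriv (hyp_reg a b c)) x) (at x)"
  using assms by (auto intro!: holomorphic_derivI[OF _ open_cut_plane] hyp_reg_holomorphic holomorphic_deriv open_cut_plane)

lemma deriv_hyp_reg_eq_eval_fps:
  assumes "norm x < 1"
  shows "deriv (hyp_reg a b c) x = eval_fps (fps_deriv (hyp_fps a b c)) x"
proof -
  have "eventually (\<lambda>w. w \<in> ball 0 1) (nhds x)" using assms by (intro eventually_nhds_in_open) auto
  hence "eventually (\<lambda>w. hyp_reg a b c w = eval_fps (hyp_fps a b c) w) (nhds x)"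
    by eventually_elim (use hyp_reg_eq_eval_fps in auto)
  hence "deriv (hyp_reg a b c) x = deriv (eval_fps (hyp_fps a b c)) x" by (rule deriv_cong_ev) simp
  thus ?thesis
    by (simp add: DERIV_imp_deriv[OF has_field_derivative_eval_fps[OF conv1_norm_less[OF conv1_hyp_fps assms]]])
qed

text \<open>Permanence of the differential equation under continuation in the connected cut
  plane.\<close>

lemma hyp_reg_ode:
  assumes "x \<in> cut_plane"
  shows "x * (1 - x) * deriv (deriv (hyp_reg a b c)) x + (c - (a + b + 1) * x) * deriv (hyp_reg a b c) x
     - a * b * hyp_reg a b c x = 0"
proof (rule analytic_continuation_open[where s = "ball 0 1" and s' = cut_plane and g = "\<lambda>_. 0"
      and f = "\<lambda>x. x * (1 - x) * deriv (deriv (hyp_reg a b c)) x + (c - (a + b + 1) * x) * deriv (hyp_reg a b c) x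
     - a * b * hyp_reg a b c x"])
  show "(\<lambda>x. x * (1 - x) * deriv (deriv (hyp_reg a b c)) x + (c - (a + b + 1) * x) * deriv (hyp_reg a b c) x
     - a * b * hyp_reg a b c x) holomorphic_on cut_plane"
    by (intro holomorphic_intros hyp_reg_holomorphic open_cut_plane)
  fix z :: complex assume z: "z \<in> ball 0 1"
  have "eventually (\<lambda>w. w \<in> ball 0 1) (nhds z)" using z by (intro eventually_nhds_in_open) auto
  hence "eventually (\<lambda>w. deriv (hyp_reg a b c) w = eval_fps (fps_deriv (hyp_fps a b c)) w) (nhds z)"
    by eventually_elim (use deriv_hyp_reg_eq_eval_fps in auto)
  hence "deriv (deriv (hyp_reg a b c)) z = deriv (eval_fps (fps_deriv (hyp_fps a b c))) z" by (rule deriv_cong_ev) simp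
  also have "\<dots> = eval_fps (fps_deriv (fps_deriv (hyp_fps a b c))) z"
    by (intro DERIV_imp_deriv has_field_derivative_eval_fps conv1_norm_less conv1_intros conv1_hyp_fps) (use z in auto)
  finally show "z * (1 - z) * deriv (deriv (hyp_reg a b c)) z + (c - (a + b + 1) * z) * deriv (hyp_reg a b c) z
     - a * b * hyp_reg a b c z = 0"
    using arg_cong[OF hyp_fps_ode[of a b c], of "\<lambda>f. eval_fps f z"] z
    by (simp add: conv1_eval conv1_intros conv1_hyp_fps hyp_reg_eq_eval_fps deriv_hyp_reg_eq_eval_fps)
qed (use assms in \<open>simp_all add: ball_subset_cut_plane connected_cut_plane open_cut_plane\<close>)


section \<open>The connection coefficient\<close>

definition qpot :: "complex \<Rightarrow> complex \<Rightarrow> complex \<Rightarrow> complex" where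
  "qpot A B \<xi> = A / (sinh \<xi>)\<^sup>2 - B / (cosh \<xi>)\<^sup>2"

definition wu :: "complex \<Rightarrow> complex \<Rightarrow> complex \<Rightarrow> complex \<Rightarrow> complex" where
  "wu u A B \<xi> = exp (- u * \<xi>) * gf u A B (exp (- 2 * \<xi>))"

definition wu' :: "complex \<Rightarrow> complex \<Rightarrow> complex \<Rightarrow> complex \<Rightarrow> complex" where
  "wu' u A B \<xi> = exp (- u * \<xi>) * (- u * gf u A B (exp (- 2 * \<xi>)) - 2 * exp (- 2 * \<xi>) * gf' u A B (exp (- 2 * \<xi>)))"

lemma norm_exp_less_1: "Re \<xi> > 0 \<Longrightarrow> norm (exp (- 2 * \<xi>)) < 1"
  by simp

lemma gf_deriv_chain [derivative_intros]:
  assumes "(h has_field_derivative h') (at z)" "norm (h z) < 1"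
  shows "((\<lambda>w. gf u A B (h w)) has_field_derivative gf' u A B (h z) * h') (at z)"
    "((\<lambda>w. gf' u A B (h w)) has_field_derivative gf'' u A B (h z) * h') (at z)"
  using DERIV_chain2[OF gf_deriv(1)[OF assms(2)] assms(1)] DERIV_chain2[OF gf_deriv(2)[OF assms(2)] assms(1)]
  by auto

lemma sinh_exp: "sinh \<xi> = (1 - exp (- 2 * \<xi>)) * exp \<xi> / 2"
  and cosh_exp: "cosh \<xi> = (1 + exp (- 2 * \<xi>)) * exp \<xi> / 2" for \<xi> :: complex
proof -
  have "exp (- 2 * \<xi>) * exp \<xi> = exp (- \<xi>)" unfolding exp_add[symmetric] by simp
  thus "sinh \<xi> = (1 - exp (- 2 * \<xi>)) * exp \<xi> / 2" "cosh \<xi> = (1 + exp (- 2 * \<xi>)) * exp \<xi> / 2"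
    by (simp_all only: sinh_field_def cosh_field_def left_diff_distrib distrib_right mult_1_left)
qed

lemma sinh_sq_exp: "(sinh \<xi>)\<^sup>2 = (1 - exp (- 2 * \<xi>))\<^sup>2 / (4 * exp (- 2 * \<xi>))"
  and cosh_sq_exp: "(cosh \<xi>)\<^sup>2 = (1 + exp (- 2 * \<xi>))\<^sup>2 / (4 * exp (- 2 * \<xi>))" for \<xi> :: complex
proof -
  have "exp (- 2 * \<xi>) * (exp \<xi>)\<^sup>2 = exp (- 2 * \<xi> + (\<xi> + \<xi>))" unfolding power2_eq_square exp_add by (rule refl)
  hence e: "(exp \<xi>)\<^sup>2 = 1 / exp (- 2 * \<xi>)" by (simp add: eq_divide_eq mult.commute)
  show "(sinh \<xi>)\<^sup>2 = (1 - exp (- 2 * \<xi>))\<^sup>2 / (4 * exp (- 2 * \<xi>))"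
    "(cosh \<xi>)\<^sup>2 = (1 + exp (- 2 * \<xi>))\<^sup>2 / (4 * exp (- 2 * \<xi>))"
    unfolding sinh_exp cosh_exp power_divide power_mult_distrib e by simp_all
qed

lemma wu_deriv:
  assumes "Re \<xi> > 0"
  shows "(wu u A B has_field_derivative wu' u A B \<xi>) (at \<xi>)"
  unfolding wu_def wu'_def
  by (rule derivative_eq_intros refl norm_exp_less_1[OF assms])+ (simp add: algebra_simps)

text \<open>This is \<open>gf_ode\<close> in the variable \<xi>: the exponential factor accounts for
  \<open>u\<^sup>2\<close>, and the right-hand side of the equation for \<open>g\<close> becomes the
  potential.\<close>

lemma wu_deriv2:
  assumes "Re \<xi> > 0" "nonres u"
  shows "(wu' u A B has_field_derivative (u\<^sup>2 + qpot A B \<xi>) * wu u A B \<xi>) (at \<xi>)"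
proof -
  define t where "t = exp (- 2 * \<xi>)"
  have t: "norm t < 1" "t \<noteq> 0" using norm_exp_less_1[OF assms(1)] by (simp_all add: t_def)
  note n = norm_less_1_ne[OF t(1)]
  have q: "qpot A B \<xi> = 4 * t * (A / (1 - t)\<^sup>2 - B / (1 + t)\<^sup>2)"
    unfolding qpot_def sinh_sq_exp cosh_sq_exp t_def[symmetric] using n t by (simp add: right_diff_distrib mult_ac)
  have "(wu' u A B has_field_derivative exp (- u * \<xi>) * (u\<^sup>2 * gf u A B t + 4 * t * (t * gf'' u A B t + (1 + u) * gf' u A B t))) (at \<xi>)"
    unfolding wu'_def t_def
    by (rule derivative_eq_intros refl norm_exp_less_1[OF assms(1)])+ (simp add: algebra_simps power2_eq_square)
  thus ?thesis unfolding gf_ode[OF assms(2) t(1)]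
    by (rule DERIV_cong) (simp only: wu_def t_def[symmetric] q, simp add: algebra_simps)
qed

text \<open>\<open>wP\<close> is the function of the first kind in the normal form of the equation, \<open>wP'\<close> its derivative.\<close>

definition Mfac :: "complex \<Rightarrow> complex \<Rightarrow> complex \<Rightarrow> complex" where
  "Mfac \<alpha> \<beta> \<xi> = exp ((\<alpha> + 1 / 2) * Ln (sinh \<xi>) + (\<beta> + 1 / 2) * Ln (cosh \<xi>))"

definition Pf :: "complex \<Rightarrow> complex \<Rightarrow> complex \<Rightarrow> complex \<Rightarrow> complex" where
  "Pf \<nu> \<alpha> \<beta> = hyp_reg (- \<nu>) (\<nu> + \<alpha> + \<beta> + 1) (\<alpha> + 1)"

definition mlog :: "complex \<Rightarrow> complex \<Rightarrow> complex \<Rightarrow> complex" where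
  "mlog \<alpha> \<beta> \<xi> = (\<alpha> + 1 / 2) * (cosh \<xi> / sinh \<xi>) + (\<beta> + 1 / 2) * (sinh \<xi> / cosh \<xi>)"

definition wP :: "complex \<Rightarrow> complex \<Rightarrow> complex \<Rightarrow> complex \<Rightarrow> complex" where
  "wP \<nu> \<alpha> \<beta> \<xi> = Mfac \<alpha> \<beta> \<xi> * Pf \<nu> \<alpha> \<beta> (- (sinh \<xi>)\<^sup>2)"

definition wP' :: "complex \<Rightarrow> complex \<Rightarrow> complex \<Rightarrow> complex \<Rightarrow> complex" where
  "wP' \<nu> \<alpha> \<beta> \<xi> = Mfac \<alpha> \<beta> \<xi> * (mlog \<alpha> \<beta> \<xi> * Pf \<nu> \<alpha> \<beta> (- (sinh \<xi>)\<^sup>2)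
     - 2 * sinh \<xi> * cosh \<xi> * deriv (Pf \<nu> \<alpha> \<beta>) (- (sinh \<xi>)\<^sup>2))"

text \<open>The conditions under which both logarithms in \<open>Mfac\<close> are differentiable and
  \<open>- (sinh \<xi>)\<^sup>2\<close> lies off the cut. They hold on the open strip and also at
  the boundary points \<open>\<i> * \<zeta>\<close> and \<open>- \<i> * \<zeta>\<close>, where the
  functions of the first kind are still differentiable.\<close>

definition okP :: "complex \<Rightarrow> bool" where
  "okP \<xi> \<longleftrightarrow> sinh \<xi> \<notin> \<real>\<^sub>\<le>\<^sub>0 \<and> Re (cosh \<xi>) > 0"

lemma okP_D:
  assumes "okP \<xi>"
  shows "sinh \<xi> \<noteq> 0" "cosh \<xi> \<noteq> 0" "cosh \<xi> \<notin> \<real>\<^sub>\<le>\<^sub>0" "- (sinh \<xi>)\<^sup>2 \<in> cut_plane"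
proof -
  show "sinh \<xi> \<noteq> 0" using assms by (auto simp: okP_def)
  show "cosh \<xi> \<noteq> 0" using assms by (auto simp: okP_def)
  show "cosh \<xi> \<notin> \<real>\<^sub>\<le>\<^sub>0" using assms by (auto simp: okP_def complex_nonpos_Reals_iff)
  have "w\<^sup>2 \<notin> \<real>\<^sub>\<le>\<^sub>0" if "Re w > 0" for w
    using that by (auto simp: complex_nonpos_Reals_iff power2_eq_square mult_less_0_iff not_le)
  hence "(cosh \<xi>)\<^sup>2 \<notin> \<real>\<^sub>\<le>\<^sub>0" using assms unfolding okP_def by blast
  moreover have "1 - (- (sinh \<xi>)\<^sup>2) = (cosh \<xi>)\<^sup>2" by (simp add: cosh_square_eq)
  ultimately show "- (sinh \<xi>)\<^sup>2 \<in> cut_plane" using cut_plane_iff by metis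
qed

lemma Mfac_deriv:
  assumes "okP \<xi>"
  shows "(Mfac \<alpha> \<beta> has_field_derivative Mfac \<alpha> \<beta> \<xi> * mlog \<alpha> \<beta> \<xi>) (at \<xi>)"
  unfolding Mfac_def mlog_def using assms okP_D[OF assms] unfolding okP_def
  by (auto intro!: derivative_eq_intros simp: field_simps)

lemma mlog_deriv:
  assumes "okP \<xi>"
  shows "(mlog \<alpha> \<beta> has_field_derivative - (\<alpha> + 1 / 2) / (sinh \<xi>)\<^sup>2 + (\<beta> + 1 / 2) / (cosh \<xi>)\<^sup>2) (at \<xi>)"
proof -
  note n = okP_D(1,2)[OF assms]
  have a: "(sinh \<xi> * sinh \<xi> - cosh \<xi> * cosh \<xi>) / (sinh \<xi> * sinh \<xi>) = - 1 / (sinh \<xi>)\<^sup>2"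
    "(cosh \<xi> * cosh \<xi> - sinh \<xi> * sinh \<xi>) / (cosh \<xi> * cosh \<xi>) = 1 / (cosh \<xi>)\<^sup>2"
    using hyperbolic_pythagoras[of \<xi>] by (simp_all add: power2_eq_square algebra_simps)
  have "((\<lambda>\<xi>. cosh \<xi> / sinh \<xi>) has_field_derivative (sinh \<xi> * sinh \<xi> - cosh \<xi> * cosh \<xi>) / (sinh \<xi> * sinh \<xi>)) (at \<xi>)"
    "((\<lambda>\<xi>. sinh \<xi> / cosh \<xi>) has_field_derivative (cosh \<xi> * cosh \<xi> - sinh \<xi> * sinh \<xi>) / (cosh \<xi> * cosh \<xi>)) (at \<xi>)"
    by (rule derivative_eq_intros refl n | simp)+
  from DERIV_add[OF DERIV_cmult[OF this(1)[unfolded a], of "\<alpha> + 1 / 2"] DERIV_cmult[OF this(2)[unfolded a], of "\<beta> + 1 / 2"]]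
  have D: "(mlog \<alpha> \<beta> has_field_derivative (\<alpha> + 1 / 2) * (- 1 / (sinh \<xi>)\<^sup>2) + (\<beta> + 1 / 2) * (1 / (cosh \<xi>)\<^sup>2)) (at \<xi>)"
    unfolding mlog_def[abs_def] .
  have "p * (- 1 / S) + q * (1 / C) = - p / S + q / C" for p q S C :: complex by simp
  thus ?thesis using D by (simp only:)
qed

lemma Pf_deriv:
  assumes "x \<in> cut_plane"
  shows "(Pf \<nu> \<alpha> \<beta> has_field_derivative deriv (Pf \<nu> \<alpha> \<beta>) x) (at x)"
    "(deriv (Pf \<nu> \<alpha> \<beta>) has_field_derivative deriv (deriv (Pf \<nu> \<alpha> \<beta>)) x) (at x)"
  unfolding Pf_def by (rule hyp_reg_deriv[OF assms])+

lemma msinh_deriv: "((\<lambda>\<xi>. - (sinh \<xi>)\<^sup>2) has_field_derivative (- 2 * sinh \<xi> * cosh \<xi>)) (at \<xi>)" for \<xi> :: complex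
  by (rule derivative_eq_intros refl)+ simp

lemma wP_deriv:
  assumes "okP \<xi>"
  shows "(wP \<nu> \<alpha> \<beta> has_field_derivative wP' \<nu> \<alpha> \<beta> \<xi>) (at \<xi>)"
proof -
  have "((\<lambda>\<xi>. Pf \<nu> \<alpha> \<beta> (- (sinh \<xi>)\<^sup>2)) has_field_derivative deriv (Pf \<nu> \<alpha> \<beta>) (- (sinh \<xi>)\<^sup>2) * (- 2 * sinh \<xi> * cosh \<xi>)) (at \<xi>)"
    by (rule DERIV_chain2[OF Pf_deriv(1)[OF okP_D(4)[OF assms]] msinh_deriv])
  from DERIV_mult[OF Mfac_deriv[OF assms, of \<alpha> \<beta>] this] show ?thesis
    unfolding wP_def[abs_def] wP'_def by (rule DERIV_cong) (simp add: algebra_simps)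
qed

text \<open>Liouville normal form: \<open>mlog\<close> is the logarithmic derivative of
  \<open>Mfac\<close>, and the exponents \<open>\<alpha> + 1 / 2\<close>,
  \<open>\<beta> + 1 / 2\<close> are those that remove the first-order term.\<close>

lemma wP_deriv2:
  assumes "okP \<xi>" "u = 2 * \<nu> + \<alpha> + \<beta> + 1"
  shows "(wP' \<nu> \<alpha> \<beta> has_field_derivative (u\<^sup>2 + qpot (\<alpha>\<^sup>2 - 1 / 4) (\<beta>\<^sup>2 - 1 / 4) \<xi>) * wP \<nu> \<alpha> \<beta> \<xi>) (at \<xi>)"
proof -
  let ?s = "sinh \<xi>" and ?c = "cosh \<xi>"
  define f0 f1 f2 where "f0 = Pf \<nu> \<alpha> \<beta> (- ?s\<^sup>2)" and "f1 = deriv (Pf \<nu> \<alpha> \<beta>) (- ?s\<^sup>2)"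
    and "f2 = deriv (deriv (Pf \<nu> \<alpha> \<beta>)) (- ?s\<^sup>2)"
  define m m1 where "m = mlog \<alpha> \<beta> \<xi>" and "m1 = - (\<alpha> + 1 / 2) / ?s\<^sup>2 + (\<beta> + 1 / 2) / ?c\<^sup>2"
  note n = okP_D(1,2)[OF assms(1)] and cp = okP_D(4)[OF assms(1)]
  have d0: "((\<lambda>\<xi>. Pf \<nu> \<alpha> \<beta> (- (sinh \<xi>)\<^sup>2)) has_field_derivative f1 * (- 2 * ?s * ?c)) (at \<xi>)"
    unfolding f1_def by (rule DERIV_chain2[OF Pf_deriv(1)[OF cp] msinh_deriv])
  have d1: "((\<lambda>\<xi>. deriv (Pf \<nu> \<alpha> \<beta>) (- (sinh \<xi>)\<^sup>2)) has_field_derivative f2 * (- 2 * ?s * ?c)) (at \<xi>)"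
    unfolding f2_def by (rule DERIV_chain2[OF Pf_deriv(2)[OF cp] msinh_deriv])
  have d2: "((\<lambda>\<xi>. 2 * sinh \<xi> * cosh \<xi>) has_field_derivative 2 * (?c\<^sup>2 + ?s\<^sup>2)) (at \<xi>)"
    by (rule derivative_eq_intros refl)+ (simp add: algebra_simps power2_eq_square)
  have D: "(wP' \<nu> \<alpha> \<beta> has_field_derivative Mfac \<alpha> \<beta> \<xi> * ((m\<^sup>2 + m1) * f0 - (4 * m * ?s * ?c + 2 * (?c\<^sup>2 + ?s\<^sup>2)) * f1
       + 4 * ?s\<^sup>2 * ?c\<^sup>2 * f2)) (at \<xi>)"
    unfolding wP'_def[abs_def]
    by (rule DERIV_cong[OF DERIV_mult[OF Mfac_deriv[OF assms(1)] DERIV_diff[OF DERIV_mult[OF mlog_deriv[OF assms(1), of \<alpha> \<beta>, folded m1_def] d0] DERIV_mult[OF d2 d1]]]])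
       (simp add: algebra_simps power2_eq_square f0_def f1_def m_def[symmetric])
  have cs: "?c\<^sup>2 = 1 + ?s\<^sup>2" by (simp add: cosh_square_eq)
  have ode: "- ?s\<^sup>2 * ?c\<^sup>2 * f2 + ((\<alpha> + 1) + (\<alpha> + \<beta> + 2) * ?s\<^sup>2) * f1 + \<nu> * (\<nu> + \<alpha> + \<beta> + 1) * f0 = 0"
    using hyp_reg_ode[OF cp, of "- \<nu>" "\<nu> + \<alpha> + \<beta> + 1" "\<alpha> + 1"]
    unfolding f0_def f1_def f2_def Pf_def cs by (simp add: algebra_simps)
  have X: "?c / ?s * (?s / ?c) = 1" "(?c / ?s)\<^sup>2 = 1 + 1 / ?s\<^sup>2" "(?s / ?c)\<^sup>2 = 1 - 1 / ?c\<^sup>2" "?c / ?s * ?s * ?c = ?c\<^sup>2" "?s / ?c * ?s * ?c = ?s\<^sup>2"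
  proof -
    have s2: "?s\<^sup>2 = ?c\<^sup>2 - 1" using cs by simp
    show "?c / ?s * (?s / ?c) = 1" using n by simp
    show "(?c / ?s)\<^sup>2 = 1 + 1 / ?s\<^sup>2" using n by (simp add: power_divide cs add_divide_distrib)
    show "(?s / ?c)\<^sup>2 = 1 - 1 / ?c\<^sup>2"
      unfolding power_divide s2 using n by (simp add: diff_divide_distrib)
    show "?c / ?s * ?s * ?c = ?c\<^sup>2" "?s / ?c * ?s * ?c = ?s\<^sup>2" using n by (simp_all add: power2_eq_square)
  qed
  \<comment> \<open>The coefficient of the first derivative is four times the one in the
    hypergeometric equation, so it disappears together with the second derivative
    \<open>f2\<close>.\<close>
  have c1: "4 * m * ?s * ?c + 2 * (?c\<^sup>2 + ?s\<^sup>2) = 4 * ((\<alpha> + 1) + (\<alpha> + \<beta> + 2) * ?s\<^sup>2)"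
  proof -
    have "m * ?s * ?c = (\<alpha> + 1 / 2) * ?c\<^sup>2 + (\<beta> + 1 / 2) * ?s\<^sup>2"
    proof -
      have "(p * X + q * Y) * s * c = p * c\<^sup>2 + q * s\<^sup>2" if "X * s * c = c\<^sup>2" "Y * s * c = s\<^sup>2" for p q X Y s c :: complex
        using that by algebra
      from this[OF X(4,5)] show ?thesis unfolding m_def mlog_def .
    qed
    moreover have "4 * m * s * c + 2 * (c\<^sup>2 + s\<^sup>2) = 4 * ((\<alpha> + 1) + (\<alpha> + \<beta> + 2) * s\<^sup>2)"
      if "m * s * c = (\<alpha> + 1 / 2) * c\<^sup>2 + (\<beta> + 1 / 2) * s\<^sup>2" "c\<^sup>2 = 1 + s\<^sup>2" for m s c :: complex
    proof -
      have "4 * m * s * c + 2 * (c\<^sup>2 + s\<^sup>2) = 4 * (m * s * c) + 2 * (c\<^sup>2 + s\<^sup>2)" by simp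
      also have "\<dots> = 4 * ((\<alpha> + 1) + (\<alpha> + \<beta> + 2) * s\<^sup>2)" unfolding that by (simp add: algebra_simps)
      finally show ?thesis .
    qed
    ultimately show ?thesis using cs by blast
  qed
  have c0: "m\<^sup>2 + m1 + 4 * (\<nu> * (\<nu> + \<alpha> + \<beta> + 1)) = u\<^sup>2 + qpot (\<alpha>\<^sup>2 - 1 / 4) (\<beta>\<^sup>2 - 1 / 4) \<xi>"
  proof -
    have g: "(p * X + q * Y)\<^sup>2 + (- p * I + q * J) = (p + q)\<^sup>2 + (p\<^sup>2 - p) * I - (q\<^sup>2 - q) * J"
      if "X * Y = 1" "X\<^sup>2 = 1 + I" "Y\<^sup>2 = 1 - J" for p q X Y I J :: complex
      using that by algebra
    have "m\<^sup>2 + m1 = (\<alpha> + \<beta> + 1)\<^sup>2 + (\<alpha>\<^sup>2 - 1 / 4) * (1 / ?s\<^sup>2) - (\<beta>\<^sup>2 - 1 / 4) * (1 / ?c\<^sup>2)"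
    proof -
      have 1: "(\<alpha> + 1 / 2) + (\<beta> + 1 / 2) = \<alpha> + \<beta> + 1" "(\<alpha> + 1 / 2)\<^sup>2 - (\<alpha> + 1 / 2) = \<alpha>\<^sup>2 - 1 / 4"
        "(\<beta> + 1 / 2)\<^sup>2 - (\<beta> + 1 / 2) = \<beta>\<^sup>2 - 1 / 4"
        by (simp_all add: power2_eq_square algebra_simps)
      have "- p / S + q / C = - p * (1 / S) + q * (1 / C)" for p q S C :: complex by simp
      hence m1: "m1 = - (\<alpha> + 1 / 2) * (1 / ?s\<^sup>2) + (\<beta> + 1 / 2) * (1 / ?c\<^sup>2)" unfolding m1_def .
      show ?thesis using g[OF X(1-3), of "\<alpha> + 1 / 2" "\<beta> + 1 / 2"] unfolding 1 m_def m1 mlog_def .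
    qed
    moreover have "u\<^sup>2 = (\<alpha> + \<beta> + 1)\<^sup>2 + 4 * (\<nu> * (\<nu> + \<alpha> + \<beta> + 1))"
      unfolding assms(2) by (simp add: power2_eq_square algebra_simps)
    ultimately show ?thesis unfolding qpot_def by simp
  qed
  have g: "M * (mm * f0 - 4 * k * f1 + 4 * s * c * f2) = w * (M * f0)"
    if "- s * c * f2 + k * f1 + e * f0 = 0" "mm + 4 * e = w" for M mm f0 f1 f2 k s c e w :: complex
    using that by algebra
  show ?thesis
    by (rule DERIV_cong[OF D], unfold c1 wP_def f0_def[symmetric], rule g[OF ode c0])
qed

lemma sinh_complex: "sinh z = Complex (sinh (Re z) * cos (Im z)) (cosh (Re z) * sin (Im z))"
  and cosh_complex: "cosh z = Complex (cosh (Re z) * cos (Im z)) (sinh (Re z) * sin (Im z))"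
  by (simp_all add: complex_eq_iff sinh_field_def cosh_field_def Re_exp Im_exp algebra_simps diff_divide_distrib add_divide_distrib)

text \<open>A convex domain, so that a vanishing derivative gives a constant Wronskian. Its closure
  contains the points \<open>\<i> * \<zeta>\<close> and \<open>- \<i> * \<zeta>\<close> at which
  boundary values are taken.\<close>

definition strip :: "complex set" where
  "strip = {\<xi>. Re \<xi> > 0 \<and> - (pi / 2) < Im \<xi> \<and> Im \<xi> < pi / 2}"

lemma strip_convex: "convex strip" and strip_open: "open strip"
proof -
  have e: "strip = {\<xi>. Re \<xi> > 0} \<inter> {\<xi>. Im \<xi> > - (pi / 2)} \<inter> {\<xi>. Im \<xi> < pi / 2}" by (auto simp: strip_def)
  show "convex strip" unfolding e by (intro convex_Int convex_halfspace_Re_gt convex_halfspace_Im_gt convex_halfspace_Im_lt)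
  show "open strip" unfolding e by (intro open_Int open_halfspace_Re_gt open_halfspace_Im_gt open_halfspace_Im_lt)
qed

lemma strip_okP: "\<xi> \<in> strip \<Longrightarrow> okP \<xi>"
proof -
  assume x: "\<xi> \<in> strip"
  hence "cos (Im \<xi>) > 0" by (intro cos_gt_zero_pi) (auto simp: strip_def)
  thus "okP \<xi>" using x
    by (auto simp: okP_def strip_def sinh_complex cosh_complex complex_nonpos_Reals_iff mult_le_0_iff)
qed

lemma wronskian_const:
  fixes f g :: "complex \<Rightarrow> complex"
  assumes "\<And>x. x \<in> S \<Longrightarrow> (f has_field_derivative f' x) (at x)" "\<And>x. x \<in> S \<Longrightarrow> (g has_field_derivative g' x) (at x)"
    "\<And>x. x \<in> S \<Longrightarrow> (f' has_field_derivative Q x * f x) (at x)" "\<And>x. x \<in> S \<Longrightarrow> (g' has_field_derivative Q x * g x) (at x)"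
    "convex S" "a \<in> S" "b \<in> S"
  shows "f a * g' a - f' a * g a = f b * g' b - f' b * g b"
proof -
  have "((\<lambda>x. f x * g' x - f' x * g x) has_field_derivative 0) (at x within S)" if "x \<in> S" for x
    by (rule DERIV_cong[OF has_field_derivative_at_within[OF DERIV_diff[OF DERIV_mult[OF assms(1)[OF that] assms(4)[OF that]]
          DERIV_mult[OF assms(3)[OF that] assms(2)[OF that]]]]]) (simp add: algebra_simps)
  from has_field_derivative_zero_constant[OF assms(5) this] show ?thesis using assms(6,7) by metis
qed


subsection \<open>Ladder operators\<close>

text \<open>The Wronskian of \<open>wP\<close> and \<open>wr\<close> is constant, but cannot be read off at \<open>\<xi> = 0\<close> for all \<open>\<alpha>\<close>, nor easily at
  infinity. The ladder operators raise \<open>\<alpha>\<close> by one, and so reduce its computation to the limit \<open>\<alpha> + k\<close>,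
  \<open>k \<rightarrow> \<infinity>\<close>, at a fixed point.\<close>

definition wr :: "complex \<Rightarrow> complex \<Rightarrow> complex \<Rightarrow> complex \<Rightarrow> complex" where
  "wr \<nu> \<alpha> \<beta> \<xi> = rGamma (2 * \<nu> + \<alpha> + \<beta> + 2) * wu (2 * \<nu> + \<alpha> + \<beta> + 1) (\<alpha>\<^sup>2 - 1 / 4) (\<beta>\<^sup>2 - 1 / 4) \<xi>"

definition wr' :: "complex \<Rightarrow> complex \<Rightarrow> complex \<Rightarrow> complex \<Rightarrow> complex" where
  "wr' \<nu> \<alpha> \<beta> \<xi> = rGamma (2 * \<nu> + \<alpha> + \<beta> + 2) * wu' (2 * \<nu> + \<alpha> + \<beta> + 1) (\<alpha>\<^sup>2 - 1 / 4) (\<beta>\<^sup>2 - 1 / 4) \<xi>"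

text \<open>Under \<open>nonres\<close>, \<open>wr\<close> is \<open>Nfac\<close> times a
  hypergeometric function of \<open>1 / (cosh \<xi>)\<^sup>2\<close>. In this form raising \<alpha>
  moves a single hypergeometric parameter and divides \<open>Nfac\<close> by
  \<open>2 * sinh \<xi>\<close>.\<close>

definition Nfac :: "complex \<Rightarrow> complex \<Rightarrow> complex \<Rightarrow> complex \<Rightarrow> complex" where
  "Nfac \<nu> \<alpha> \<beta> \<xi> = exp (- (2 * \<nu> + \<alpha> + \<beta> + 1) * \<xi>) * lfac (1 / 2 - \<alpha>) (- (2 * \<nu> + \<beta> + 3 / 2)) (exp (- 2 * \<xi>))"

definition Uf :: "complex \<Rightarrow> complex \<Rightarrow> complex \<Rightarrow> complex \<Rightarrow> complex" where
  "Uf \<nu> \<alpha> \<beta> = hyp_reg (\<nu> + 1) (\<nu> + \<beta> + 1) (2 * \<nu> + \<alpha> + \<beta> + 2)"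

text \<open>The raising operator is \<open>cosh \<xi>\<close> times differentiation plus
  multiplication by \<open>Lmul\<close>.\<close>

definition Lmul :: "complex \<Rightarrow> complex \<Rightarrow> complex \<Rightarrow> complex \<Rightarrow> complex" where
  "Lmul \<nu> \<alpha> \<beta> \<xi> = (2 * \<nu> + \<alpha> + \<beta> + 1) * sinh \<xi> - (\<alpha> + 1 / 2) / sinh \<xi>"

definition dfac :: "complex \<Rightarrow> complex \<Rightarrow> complex \<Rightarrow> complex" where
  "dfac \<nu> \<alpha> \<beta> = (\<nu> + \<alpha> + 1) * (\<nu> + \<alpha> + \<beta> + 1)"

lemma wr_deriv:
  assumes "Re \<xi> > 0"
  shows "(wr \<nu> \<alpha> \<beta> has_field_derivative wr' \<nu> \<alpha> \<beta> \<xi>) (at \<xi>)"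
  unfolding wr_def[abs_def] wr'_def by (intro DERIV_cmult wu_deriv assms)

lemma wr_deriv2:
  assumes "Re \<xi> > 0" "u = 2 * \<nu> + \<alpha> + \<beta> + 1" "nonres u"
  shows "(wr' \<nu> \<alpha> \<beta> has_field_derivative (u\<^sup>2 + qpot (\<alpha>\<^sup>2 - 1 / 4) (\<beta>\<^sup>2 - 1 / 4) \<xi>) * wr \<nu> \<alpha> \<beta> \<xi>) (at \<xi>)"
proof -
  have "(wr' \<nu> \<alpha> \<beta> has_field_derivative rGamma (2 * \<nu> + \<alpha> + \<beta> + 2) * ((u\<^sup>2 + qpot (\<alpha>\<^sup>2 - 1 / 4) (\<beta>\<^sup>2 - 1 / 4) \<xi>)
     * wu u (\<alpha>\<^sup>2 - 1 / 4) (\<beta>\<^sup>2 - 1 / 4) \<xi>)) (at \<xi>)"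
    unfolding wr'_def[abs_def] assms(2)[symmetric] by (intro DERIV_cmult wu_deriv2 assms)
  thus ?thesis by (rule DERIV_cong) (simp add: wr_def assms(2))
qed

text \<open>The pullback is taken at \<open>- exp (- 2 * \<xi>)\<close>, where \<open>xmap\<close>
  equals \<open>1 / (cosh \<xi>)\<^sup>2\<close>; the flip of \<open>g\<close> restores the order of
  \<alpha> and \<beta>.\<close>

lemma wr_pfaff:
  assumes "Re \<xi> > 0" "nonres (2 * \<nu> + \<alpha> + \<beta> + 1)"
  shows "wr \<nu> \<alpha> \<beta> \<xi> = Nfac \<nu> \<alpha> \<beta> \<xi> * Uf \<nu> \<alpha> \<beta> (1 / (cosh \<xi>)\<^sup>2)"
proof -
  define t where "t = exp (- 2 * \<xi>)"
  have t: "norm t < 1" "t \<noteq> 0" using norm_exp_less_1[OF assms(1)] by (simp_all add: t_def)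
  have x: "xmap (- t) = 1 / (cosh \<xi>)\<^sup>2" unfolding cosh_sq_exp t_def[symmetric] by (simp add: xmap_def)
  have nr: "nonres (2 * \<nu> + \<alpha> + \<beta> + 2 - 1)" using assms(2) by (simp add: algebra_simps)
  have e: "\<nu> + 1 + (\<nu> + \<beta> + 1) - 1 / 2 = 2 * \<nu> + \<beta> + 3 / 2"
     "2 * \<nu> + \<alpha> + \<beta> + 2 - (\<nu> + 1) - (\<nu> + \<beta> + 1) = \<alpha>" "\<nu> + \<beta> + 1 - (\<nu> + 1) = \<beta>"
     "2 * \<nu> + \<alpha> + \<beta> + 2 - 1 = 2 * \<nu> + \<alpha> + \<beta> + 1"
    by simp_all
  have "Uf \<nu> \<alpha> \<beta> (1 / (cosh \<xi>)\<^sup>2) = rGamma (2 * \<nu> + \<alpha> + \<beta> + 2) * lfac (\<alpha> - 1 / 2) (2 * \<nu> + \<beta> + 3 / 2) t *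
     gf (2 * \<nu> + \<alpha> + \<beta> + 1) (\<alpha>\<^sup>2 - 1 / 4) (\<beta>\<^sup>2 - 1 / 4) t"
    using hyp_reg_pullback[OF nr, of "- t" "\<nu> + 1" "\<nu> + \<beta> + 1"] t(1) gf_flip[of "- t"]
    unfolding e x Uf_def lfac_flip by simp
  moreover have "lfac (1 / 2 - \<alpha>) (- (2 * \<nu> + \<beta> + 3 / 2)) t * lfac (\<alpha> - 1 / 2) (2 * \<nu> + \<beta> + 3 / 2) t = 1"
    using lfac_inv[of "1 / 2 - \<alpha>" "- (2 * \<nu> + \<beta> + 3 / 2)" t] unfolding minus_diff_eq minus_minus .
  moreover have "E * (l * (r * l' * g)) = r * (E * g)" if "l * l' = 1" for E l r l' g :: complex
    using that by algebra
  ultimately show ?thesis unfolding wr_def wu_def Nfac_def t_def[symmetric] mult.assoc by simp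
qed

lemma norm_inv_cosh_sq_real: "x > 0 \<Longrightarrow> norm (1 / (cosh (complex_of_real x))\<^sup>2) < 1"
proof -
  assume x: "x > 0"
  have "(cosh (complex_of_real x)) = of_real (cosh x)" by (simp add: cosh_field_def flip: exp_of_real)
  moreover have "cosh x > 1" using x by (metis cosh_0 cosh_real_strict_mono le_less)
  hence "(cosh x)\<^sup>2 > 1" by (simp add: one_less_power)
  ultimately show ?thesis by (simp add: norm_divide norm_power)
qed

lemma Nfac_deriv:
  assumes "Re \<xi> > 0"
  shows "(Nfac \<nu> \<alpha> \<beta> has_field_derivative Nfac \<nu> \<alpha> \<beta> \<xi> * ((1 / 2 - \<alpha>) * (cosh \<xi> / sinh \<xi>)
      - (2 * \<nu> + \<beta> + 3 / 2) * (sinh \<xi> / cosh \<xi>))) (at \<xi>)"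
proof -
  define t where "t = exp (- 2 * \<xi>)"
  have t: "norm t < 1" "t \<noteq> 0" using norm_exp_less_1[OF assms(1)] by (simp_all add: t_def)
  note n = norm_less_1_ne[OF t(1)]
  define p q where "p = 1 / 2 - \<alpha>" and "q = - (2 * \<nu> + \<beta> + 3 / 2)"
  have c: "cosh \<xi> / sinh \<xi> = (1 + t) / (1 - t)" "sinh \<xi> / cosh \<xi> = (1 - t) / (1 + t)"
    unfolding sinh_exp cosh_exp t_def[symmetric] using n by simp_all
  have "((\<lambda>\<xi>. exp (- 2 * \<xi>)) has_field_derivative t * (-2)) (at \<xi>)"
    unfolding t_def by (rule derivative_eq_intros refl)+ simp
  from DERIV_chain2[OF _ this, of "lfac p q"] lfac_deriv[OF norm_less_1_Re[OF t(1)]]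
  have l: "((\<lambda>\<xi>. lfac p q (exp (- 2 * \<xi>))) has_field_derivative lfac p q t * (q / (1 + t) - p / (1 - t)) * (t * (-2))) (at \<xi>)"
    unfolding t_def by blast
  have e: "((\<lambda>\<xi>. exp (- (2 * \<nu> + \<alpha> + \<beta> + 1) * \<xi>)) has_field_derivative
     exp (- (2 * \<nu> + \<alpha> + \<beta> + 1) * \<xi>) * (p + q)) (at \<xi>)"
    by (rule derivative_eq_intros refl)+ (simp add: p_def q_def)
  have k: "p + q + (q / (1 + t) - p / (1 - t)) * (t * (-2)) = p * ((1 + t) / (1 - t)) + q * ((1 - t) / (1 + t))"
  proof -
    have "(1 + t) / (1 - t) = 1 + 2 * t / (1 - t)" "(1 - t) / (1 + t) = 1 - 2 * t / (1 + t)"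
      using n by (simp_all add: field_simps)
    note * = this
    show ?thesis unfolding * by (simp add: algebra_simps)
  qed
  have D: "(Nfac \<nu> \<alpha> \<beta> has_field_derivative Nfac \<nu> \<alpha> \<beta> \<xi> * (p + q + (q / (1 + t) - p / (1 - t)) * (t * (-2)))) (at \<xi>)"
    unfolding Nfac_def[abs_def] p_def[symmetric] q_def[symmetric]
    by (rule DERIV_cong[OF DERIV_mult[OF e l]]) (simp add: t_def algebra_simps)
  have "N * (p * X + (- q) * Y) = N * (p * X - q * Y)" for N p q X Y :: complex by simp
  from this[of "Nfac \<nu> \<alpha> \<beta> \<xi>" p "(1 + t) / (1 - t)" "2 * \<nu> + \<beta> + 3 / 2" "(1 - t) / (1 + t)"]
  show ?thesis using D[unfolded k] unfolding c p_def[symmetric] q_def by (simp only:)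
qed

lemma cosh_sinh_div:
  fixes \<xi> :: complex
  assumes "sinh \<xi> \<noteq> 0" "cosh \<xi> \<noteq> 0"
  shows "cosh \<xi> * (cosh \<xi> / sinh \<xi>) = sinh \<xi> + 1 / sinh \<xi>" "cosh \<xi> * (sinh \<xi> / cosh \<xi>) = sinh \<xi>"
proof -
  have "cosh \<xi> * (cosh \<xi> / sinh \<xi>) = (cosh \<xi>)\<^sup>2 / sinh \<xi>" by (simp add: power2_eq_square)
  also have "\<dots> = sinh \<xi> + 1 / sinh \<xi>"
    unfolding cosh_square_eq using assms by (simp add: add_divide_distrib power2_eq_square)
  finally show "cosh \<xi> * (cosh \<xi> / sinh \<xi>) = sinh \<xi> + 1 / sinh \<xi>" .
  show "cosh \<xi> * (sinh \<xi> / cosh \<xi>) = sinh \<xi>" using assms by simp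
qed

lemma Nfac_Suc: "Re \<xi> > 0 \<Longrightarrow> 2 * sinh \<xi> * Nfac \<nu> (\<alpha> + 1) \<beta> \<xi> = Nfac \<nu> \<alpha> \<beta> \<xi>"
proof -
  assume x: "Re \<xi> > 0"
  define t where "t = exp (- 2 * \<xi>)"
  have n: "1 - t \<noteq> 0" using norm_less_1_ne[OF norm_exp_less_1[OF x]] by (simp add: t_def)
  have "Nfac \<nu> \<alpha> \<beta> \<xi> = exp (\<xi> + Ln (1 - t)) * Nfac \<nu> (\<alpha> + 1) \<beta> \<xi>"
    unfolding Nfac_def lfac_def t_def[symmetric] exp_add[symmetric] by (simp add: algebra_simps)
  also have "exp (\<xi> + Ln (1 - t)) = 2 * sinh \<xi>"
    unfolding exp_add sinh_exp t_def[symmetric] using n by simp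
  finally show ?thesis by simp
qed

lemma Mfac_Suc: "okP \<xi> \<Longrightarrow> Mfac (\<alpha> + 1) \<beta> \<xi> = sinh \<xi> * Mfac \<alpha> \<beta> \<xi>"
proof -
  assume x: "okP \<xi>"
  have "Mfac (\<alpha> + 1) \<beta> \<xi> = exp (Ln (sinh \<xi>)) * Mfac \<alpha> \<beta> \<xi>"
    unfolding Mfac_def exp_add[symmetric] by (simp add: algebra_simps)
  thus ?thesis using okP_D(1)[OF x] by simp
qed

text \<open>\<open>hyp_fps_raise_bc\<close> is a relation between power series, hence the condition
  that the argument lie in the unit disc. The factor \<open>sinh \<xi>\<close> left over by the
  operator is what \<open>Mfac\<close> gains when \<alpha> is raised.\<close>

lemma raise_wP:
  assumes "okP \<xi>" "norm ((sinh \<xi>)\<^sup>2) < 1"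
  shows "cosh \<xi> * wP' \<nu> \<alpha> \<beta> \<xi> + Lmul \<nu> \<alpha> \<beta> \<xi> * wP \<nu> \<alpha> \<beta> \<xi> = 2 * dfac \<nu> \<alpha> \<beta> * wP \<nu> (\<alpha> + 1) \<beta> \<xi>"
proof -
  let ?s = "sinh \<xi>" and ?c = "cosh \<xi>"
  note n = okP_D(1,2)[OF assms(1)]
  have nx: "norm (- ?s\<^sup>2) < 1" using assms(2) by simp
  define b where "b = \<nu> + \<alpha> + \<beta> + 1"
  define f0 f1 where "f0 = Pf \<nu> \<alpha> \<beta> (- ?s\<^sup>2)" and "f1 = deriv (Pf \<nu> \<alpha> \<beta>) (- ?s\<^sup>2)"
  have "b * f0 - (1 - (- ?s\<^sup>2)) * f1 = b * (\<alpha> + 1 - (- \<nu>)) * Pf \<nu> (\<alpha> + 1) \<beta> (- ?s\<^sup>2)"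
    using arg_cong[OF hyp_fps_raise_bc[of b "- \<nu>" "\<alpha> + 1"], of "\<lambda>f. eval_fps f (- ?s\<^sup>2)"] nx
    unfolding f0_def f1_def Pf_def b_def
    by (simp add: conv1_eval conv1_intros conv1_hyp_fps hyp_reg_eq_eval_fps deriv_hyp_reg_eq_eval_fps add_ac)
  hence r: "b * f0 - ?c\<^sup>2 * f1 = dfac \<nu> \<alpha> \<beta> * Pf \<nu> (\<alpha> + 1) \<beta> (- ?s\<^sup>2)"
    unfolding dfac_def b_def cosh_square_eq by (simp add: algebra_simps)
  have m: "?c * mlog \<alpha> \<beta> \<xi> + Lmul \<nu> \<alpha> \<beta> \<xi> = 2 * b * ?s"
  proof -
    note 1 = cosh_sinh_div[OF n]
    have "?c * mlog \<alpha> \<beta> \<xi> = (\<alpha> + 1 / 2) * (?c * (?c / ?s)) + (\<beta> + 1 / 2) * (?c * (?s / ?c))"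
      unfolding mlog_def by (simp only: distrib_left mult_ac)
    also have "\<dots> = (\<alpha> + 1 / 2) * ?s + (\<alpha> + 1 / 2) / ?s + (\<beta> + 1 / 2) * ?s"
      unfolding 1 by (simp add: distrib_left)
    finally show ?thesis unfolding Lmul_def b_def by (simp add: algebra_simps)
  qed
  have g: "c * (M * (ml * f0 - 2 * s * c * f1)) + L * (M * f0) = 2 * d * (s * M * F)"
    if "c * ml + L = 2 * b * s" "b * f0 - c\<^sup>2 * f1 = d * F" for c M ml s L d F b f0 f1 :: complex
  proof -
    have "c * (M * (ml * f0 - 2 * s * c * f1)) + L * (M * f0) = M * ((c * ml + L) * f0 - 2 * s * (c\<^sup>2 * f1))"
      by (simp add: algebra_simps power2_eq_square)
    also have "\<dots> = 2 * s * M * (b * f0 - c\<^sup>2 * f1)" unfolding that(1) by (simp add: algebra_simps)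
    finally show ?thesis unfolding that(2) by simp
  qed
  show ?thesis
    unfolding wP_def wP'_def f0_def[symmetric] f1_def[symmetric] Mfac_Suc[OF assms(1)] by (rule g[OF m r])
qed

text \<open>The same mechanism with \<open>hyp_fps_raise_c\<close> at the argument
  \<open>1 / (cosh \<xi>)\<^sup>2\<close>; the derivative of \<open>wr\<close> is computed from its
  Pfaff form.\<close>

lemma raise_wr:
  assumes "\<xi> \<in> strip" "nonres (2 * \<nu> + \<alpha> + \<beta> + 1)" "nonres (2 * \<nu> + (\<alpha> + 1) + \<beta> + 1)"
    "norm (1 / (cosh \<xi>)\<^sup>2) < 1"
  shows "cosh \<xi> * wr' \<nu> \<alpha> \<beta> \<xi> + Lmul \<nu> \<alpha> \<beta> \<xi> * wr \<nu> \<alpha> \<beta> \<xi> = - 4 * dfac \<nu> \<alpha> \<beta> * wr \<nu> (\<alpha> + 1) \<beta> \<xi>"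
proof -
  let ?s = "sinh \<xi>" and ?c = "cosh \<xi>"
  have re: "Re \<xi> > 0" using assms(1) by (simp add: strip_def)
  have ok: "okP \<xi>" by (rule strip_okP[OF assms(1)])
  note n = okP_D(1,2)[OF ok]
  define y where "y = 1 / ?c\<^sup>2"
  have ny: "norm y < 1" using assms(4) by (simp only: y_def)
  define F0 F1 where "F0 = Uf \<nu> \<alpha> \<beta> y" and "F1 = deriv (Uf \<nu> \<alpha> \<beta>) y"
  have dy: "((\<lambda>\<xi>. 1 / (cosh \<xi>)\<^sup>2) has_field_derivative - 2 * y * (?s / ?c)) (at \<xi>)"
  proof -
    have c2: "?c\<^sup>2 \<noteq> 0" using n by simp
    have "((\<lambda>\<xi>. 1 / (cosh \<xi>)\<^sup>2) has_field_derivative (0 * ?c\<^sup>2 - 1 * (2 * ?c * ?s)) / (?c\<^sup>2 * ?c\<^sup>2)) (at \<xi>)"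
      by (rule derivative_eq_intros refl c2)+ simp
    moreover have "(0 * c\<^sup>2 - 1 * (2 * c * s)) / (c\<^sup>2 * c\<^sup>2) = - 2 * (1 / c\<^sup>2) * (s / c)" if "c \<noteq> 0" for c s :: complex
      using that by (simp add: power2_eq_square)
    from this[OF n(2)] have "(0 * ?c\<^sup>2 - 1 * (2 * ?c * ?s)) / (?c\<^sup>2 * ?c\<^sup>2) = - 2 * (1 / ?c\<^sup>2) * (?s / ?c)" .
    ultimately show ?thesis unfolding y_def by (simp only:)
  qed
  have "y \<in> cut_plane" using ny ball_subset_cut_plane by auto
  hence "(Uf \<nu> \<alpha> \<beta> has_field_derivative F1) (at y)" unfolding Uf_def F1_def by (rule hyp_reg_deriv(1))
  hence dF: "((\<lambda>\<xi>. Uf \<nu> \<alpha> \<beta> (1 / (cosh \<xi>)\<^sup>2)) has_field_derivative F1 * (- 2 * y * (?s / ?c))) (at \<xi>)"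
    unfolding y_def[symmetric] by (intro DERIV_chain2[OF _ dy]) (simp add: y_def)
  have "((\<lambda>\<xi>. Nfac \<nu> \<alpha> \<beta> \<xi> * Uf \<nu> \<alpha> \<beta> (1 / (cosh \<xi>)\<^sup>2)) has_field_derivative wr' \<nu> \<alpha> \<beta> \<xi>) (at \<xi>)"
  proof (rule DERIV_cong_ev[THEN iffD1, OF refl _ refl wr_deriv[OF re]])
    have "eventually (\<lambda>z. z \<in> {z. Re z > 0}) (nhds \<xi>)"
      by (rule eventually_nhds_in_open) (use re open_halfspace_Re_gt in auto)
    thus "eventually (\<lambda>z. wr \<nu> \<alpha> \<beta> z = Nfac \<nu> \<alpha> \<beta> z * Uf \<nu> \<alpha> \<beta> (1 / (cosh z)\<^sup>2)) (nhds \<xi>)"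
      by eventually_elim (use wr_pfaff assms(2) in auto)
  qed
  from DERIV_unique[OF this DERIV_mult[OF Nfac_deriv[OF re] dF]]
  have w': "wr' \<nu> \<alpha> \<beta> \<xi> = Nfac \<nu> \<alpha> \<beta> \<xi> * (((1 / 2 - \<alpha>) * (?c / ?s) - (2 * \<nu> + \<beta> + 3 / 2) * (?s / ?c)) * F0
       + F1 * (- 2 * y * (?s / ?c)))"
    unfolding F0_def y_def by (simp add: algebra_simps)
  have w: "wr \<nu> \<alpha> \<beta> \<xi> = Nfac \<nu> \<alpha> \<beta> \<xi> * F0"
    unfolding F0_def y_def by (rule wr_pfaff[OF re assms(2)])
  have nrS: "nonres (2 * \<nu> + (\<alpha> + 1) + \<beta> + 1)" by fact
  have w1: "wr \<nu> (\<alpha> + 1) \<beta> \<xi> = Nfac \<nu> (\<alpha> + 1) \<beta> \<xi> * Uf \<nu> (\<alpha> + 1) \<beta> y"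
    unfolding y_def by (rule wr_pfaff[OF re nrS])
  have "(2 * \<nu> + \<alpha> + \<beta> + 2 - (\<nu> + 1) - (\<nu> + \<beta> + 1)) * F0 + (1 - y) * F1 =
     (2 * \<nu> + \<alpha> + \<beta> + 2 - (\<nu> + 1)) * (2 * \<nu> + \<alpha> + \<beta> + 2 - (\<nu> + \<beta> + 1)) * eval_fps (hyp_fps (\<nu> + 1) (\<nu> + \<beta> + 1) (2 * \<nu> + \<alpha> + \<beta> + 2 + 1)) y"
    using arg_cong[OF hyp_fps_raise_c[of "2 * \<nu> + \<alpha> + \<beta> + 2" "\<nu> + 1" "\<nu> + \<beta> + 1"], of "\<lambda>f. eval_fps f y"] ny
    unfolding F0_def F1_def Uf_def
    by (simp only: conv1_eval conv1_intros conv1_hyp_fps hyp_reg_eq_eval_fps deriv_hyp_reg_eq_eval_fps) (simp add: eval_fps_const)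
  moreover have "2 * \<nu> + (\<alpha> + 1) + \<beta> + 2 = 2 * \<nu> + \<alpha> + \<beta> + 2 + 1" by simp
  hence "Uf \<nu> (\<alpha> + 1) \<beta> y = eval_fps (hyp_fps (\<nu> + 1) (\<nu> + \<beta> + 1) (2 * \<nu> + \<alpha> + \<beta> + 2 + 1)) y"
    unfolding Uf_def hyp_reg_eq_eval_fps[OF ny] by simp
  moreover have "2 * \<nu> + \<alpha> + \<beta> + 2 - (\<nu> + 1) - (\<nu> + \<beta> + 1) = \<alpha>"
     "2 * \<nu> + \<alpha> + \<beta> + 2 - (\<nu> + 1) = \<nu> + \<alpha> + \<beta> + 1" "2 * \<nu> + \<alpha> + \<beta> + 2 - (\<nu> + \<beta> + 1) = \<nu> + \<alpha> + 1"
    by simp_all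
  ultimately have r: "\<alpha> * F0 + (1 - y) * F1 = dfac \<nu> \<alpha> \<beta> * Uf \<nu> (\<alpha> + 1) \<beta> y"
    unfolding dfac_def by (simp add: mult_ac add_ac)
  have cs: "?c\<^sup>2 = 1 + ?s\<^sup>2" by (simp add: cosh_square_eq)
  have 1: "?c * (?c / ?s) = ?s + 1 / ?s" "?c * (?s / ?c) = ?s" "y * ?s * ?s = 1 - y"
  proof -
    show "?c * (?c / ?s) = ?s + 1 / ?s" "?c * (?s / ?c) = ?s"
      by (rule cosh_sinh_div[OF n])+
    have "?s * ?s = ?c\<^sup>2 - 1" using cs by (simp add: power2_eq_square)
    thus "y * ?s * ?s = 1 - y" unfolding y_def mult.assoc using n by (simp add: right_diff_distrib diff_divide_distrib)
  qed
  have s: "1 / ?s * ?s = 1" using n by simp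
  have g: "c * (N * (((1 / 2 - \<alpha>) * X - (2 * \<nu> + \<beta> + 3 / 2) * Y) * F0 + F1 * (- 2 * y * Y)))
     + ((2 * \<nu> + \<alpha> + \<beta> + 1) * s - (\<alpha> + 1 / 2) * I) * (N * F0) = - 4 * d * (N1 * U)"
    if "c * X = s + I" "c * Y = s" "y * s * s = 1 - y" "I * s = 1" "\<alpha> * F0 + (1 - y) * F1 = d * U" "2 * s * N1 = N"
    for c N X Y F0 F1 y s I d N1 U :: complex
  proof -
    have "c * (N * (((1 / 2 - \<alpha>) * X - (2 * \<nu> + \<beta> + 3 / 2) * Y) * F0 + F1 * (- 2 * y * Y)))
     + ((2 * \<nu> + \<alpha> + \<beta> + 1) * s - (\<alpha> + 1 / 2) * I) * (N * F0) =
      N * (((1 / 2 - \<alpha>) * (c * X) - (2 * \<nu> + \<beta> + 3 / 2) * (c * Y)) * F0 - 2 * y * F1 * (c * Y)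
       + ((2 * \<nu> + \<alpha> + \<beta> + 1) * s - (\<alpha> + 1 / 2) * I) * F0)"
      by (simp add: algebra_simps)
    also have "\<dots> = N * (- 2) * (\<alpha> * I * F0 + y * s * F1)"
      unfolding that(1,2) by (simp add: algebra_simps)
    also have "y * s = (1 - y) * I" using that(3,4) by algebra
    also have "N * (- 2) * (\<alpha> * I * F0 + (1 - y) * I * F1) = N * (- 2) * I * (\<alpha> * F0 + (1 - y) * F1)"
      by (simp add: algebra_simps)
    also have "\<dots> = - 4 * d * ((s * I) * N1 * U)" unfolding that(5) that(6)[symmetric] by (simp add: algebra_simps)
    also have "s * I = 1" using that(4) by (simp add: mult.commute)
    finally show ?thesis by simp
  qed
  show ?thesis
    unfolding w w' w1 Lmul_def using g[OF 1 s r Nfac_Suc[OF re]] by simp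
qed


text \<open>Differentiating the ladder relation and removing the second derivative by the equation
  expresses the derivative of the raised function by the original function and its
  derivative.\<close>

lemma raise_deriv:
  fixes Q g' \<xi> :: "complex" and fF fF' gF :: "complex \<Rightarrow> complex"
  assumes S: "open S" "\<xi> \<in> S" and eq: "\<And>z. z \<in> S \<Longrightarrow> cosh z * fF' z + Lmul \<nu> \<alpha> \<beta> z * fF z = K * gF z"
    and d: "(fF has_field_derivative fF' \<xi>) (at \<xi>)" "(fF' has_field_derivative Q * fF \<xi>) (at \<xi>)"
      "(gF has_field_derivative g') (at \<xi>)" and nz: "sinh \<xi> \<noteq> 0"
  shows "K * g' = (sinh \<xi> + Lmul \<nu> \<alpha> \<beta> \<xi>) * fF' \<xi> +
    (cosh \<xi> * Q + ((2 * \<nu> + \<alpha> + \<beta> + 1) * cosh \<xi> + (\<alpha> + 1 / 2) * cosh \<xi> / (sinh \<xi>)\<^sup>2)) * fF \<xi>"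
proof -
  have q: "((\<lambda>z. (\<alpha> + 1 / 2) / sinh z) has_field_derivative (0 * sinh \<xi> - (\<alpha> + 1 / 2) * cosh \<xi>) / (sinh \<xi> * sinh \<xi>)) (at \<xi>)"
    by (rule derivative_eq_intros refl nz)+ simp
  have ds: "(sinh has_field_derivative cosh \<xi>) (at \<xi>)" and dc: "(cosh has_field_derivative sinh \<xi>) (at \<xi>)"
    by (rule derivative_eq_intros refl | simp)+
  from DERIV_diff[OF DERIV_cmult[OF ds, of "2 * \<nu> + \<alpha> + \<beta> + 1"] q]
  have "(Lmul \<nu> \<alpha> \<beta> has_field_derivative (2 * \<nu> + \<alpha> + \<beta> + 1) * cosh \<xi> - (0 * sinh \<xi> - (\<alpha> + 1 / 2) * cosh \<xi>) / (sinh \<xi> * sinh \<xi>)) (at \<xi>)"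
    unfolding Lmul_def[abs_def] .
  moreover have "a - (0 * s - p * c) / (s * s) = a + p * c / s\<^sup>2" for a p s c :: complex by (simp add: power2_eq_square)
  ultimately have L: "(Lmul \<nu> \<alpha> \<beta> has_field_derivative (2 * \<nu> + \<alpha> + \<beta> + 1) * cosh \<xi> + (\<alpha> + 1 / 2) * cosh \<xi> / (sinh \<xi>)\<^sup>2) (at \<xi>)"
    by (simp only:)
  have "((\<lambda>z. cosh z * fF' z + Lmul \<nu> \<alpha> \<beta> z * fF z) has_field_derivative
     (sinh \<xi> + Lmul \<nu> \<alpha> \<beta> \<xi>) * fF' \<xi> +
    (cosh \<xi> * Q + ((2 * \<nu> + \<alpha> + \<beta> + 1) * cosh \<xi> + (\<alpha> + 1 / 2) * cosh \<xi> / (sinh \<xi>)\<^sup>2)) * fF \<xi>) (at \<xi>)"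
    by (rule DERIV_cong[OF DERIV_add[OF DERIV_mult[OF dc d(2)] DERIV_mult[OF L d(1)]]]) (simp add: algebra_simps)
  moreover have "eventually (\<lambda>z. z \<in> S) (nhds \<xi>)" using S by (rule eventually_nhds_in_open)
  hence "eventually (\<lambda>z. cosh z * fF' z + Lmul \<nu> \<alpha> \<beta> z * fF z = K * gF z) (nhds \<xi>)"
    by eventually_elim (rule eq)
  ultimately have "((\<lambda>z. K * gF z) has_field_derivative
     (sinh \<xi> + Lmul \<nu> \<alpha> \<beta> \<xi>) * fF' \<xi> +
    (cosh \<xi> * Q + ((2 * \<nu> + \<alpha> + \<beta> + 1) * cosh \<xi> + (\<alpha> + 1 / 2) * cosh \<xi> / (sinh \<xi>)\<^sup>2)) * fF \<xi>) (at \<xi>)"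
    by (simp add: DERIV_cong_ev)
  from DERIV_unique[OF DERIV_cmult[OF d(3), of K] this] show ?thesis .
qed

text \<open>The left-hand side is the determinant of the linear map that takes a solution and its
  derivative to the raised pair, up to normalising constants. It gives the ratio of the Wronskians
  for \<alpha> and \<open>\<alpha> + 1\<close>.\<close>

lemma Lmul_wronskian_identity:
  fixes \<nu> \<alpha> \<beta> \<xi> :: complex
  assumes "sinh \<xi> \<noteq> 0" "cosh \<xi> \<noteq> 0"
  defines "u \<equiv> 2 * \<nu> + \<alpha> + \<beta> + 1"
  shows "Lmul \<nu> \<alpha> \<beta> \<xi> * (sinh \<xi> + Lmul \<nu> \<alpha> \<beta> \<xi>)
     - cosh \<xi> * (cosh \<xi> * (u\<^sup>2 + qpot (\<alpha>\<^sup>2 - 1 / 4) (\<beta>\<^sup>2 - 1 / 4) \<xi>)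
     + (u * cosh \<xi> + (\<alpha> + 1 / 2) * cosh \<xi> / (sinh \<xi>)\<^sup>2)) = - 4 * dfac \<nu> \<alpha> \<beta>"
proof -
  define s c I where "s = sinh \<xi>" and "c = cosh \<xi>" and "I = 1 / sinh \<xi>"
  have h: "s * I = 1" "c\<^sup>2 = 1 + s\<^sup>2" using assms by (auto simp: s_def c_def I_def cosh_square_eq)
  have 1: "Lmul \<nu> \<alpha> \<beta> \<xi> = u * s - (\<alpha> + 1 / 2) * I" by (simp add: Lmul_def u_def s_def I_def)
  have 2: "c * (c * (u\<^sup>2 + qpot (\<alpha>\<^sup>2 - 1 / 4) (\<beta>\<^sup>2 - 1 / 4) \<xi>) + (u * c + (\<alpha> + 1 / 2) * c / (sinh \<xi>)\<^sup>2))
     = c\<^sup>2 * (u\<^sup>2 + u) + (\<alpha>\<^sup>2 + \<alpha> + 1 / 4) * (c\<^sup>2 * I\<^sup>2) - (\<beta>\<^sup>2 - 1 / 4)"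
    using assms(2) unfolding qpot_def c_def I_def
    by (simp add: power_divide algebra_simps add_divide_distrib diff_divide_distrib flip: power2_eq_square)
       (simp add: power2_eq_square)
  have i: "s\<^sup>2 * I\<^sup>2 = 1" using h(1) by (simp flip: power_mult_distrib)
  have ci: "c\<^sup>2 * I\<^sup>2 = 1 + I\<^sup>2" unfolding h(2) by (simp add: distrib_right i add.commute)
  have "(u * s - (\<alpha> + 1 / 2) * I) * (s + (u * s - (\<alpha> + 1 / 2) * I)) =
     (u\<^sup>2 + u) * s\<^sup>2 - (2 * u + 1) * (\<alpha> + 1 / 2) * (s * I) + (\<alpha> + 1 / 2)\<^sup>2 * I\<^sup>2"
    by (simp add: power2_eq_square algebra_simps)
  also have "\<dots> = (u\<^sup>2 + u) * s\<^sup>2 - (2 * u + 1) * (\<alpha> + 1 / 2) + (\<alpha> + 1 / 2)\<^sup>2 * I\<^sup>2" unfolding h(1) by simp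
  finally have E1: "Lmul \<nu> \<alpha> \<beta> \<xi> * (sinh \<xi> + Lmul \<nu> \<alpha> \<beta> \<xi>) = (u\<^sup>2 + u) * s\<^sup>2 - (2 * u + 1) * (\<alpha> + 1 / 2) + (\<alpha> + 1 / 2)\<^sup>2 * I\<^sup>2"
    unfolding 1 s_def .
  note E2 = 2[unfolded ci, unfolded h(2), unfolded c_def]
  show ?thesis
    unfolding E1 E2 by (simp add: u_def dfac_def power2_eq_square algebra_simps)
qed

section \<open>Limits of hypergeometric series and gamma quotients for large parameters\<close>

definition ser :: "complex \<Rightarrow> (nat \<Rightarrow> complex) \<Rightarrow> complex \<Rightarrow> complex" where
  "ser a r x = (\<Sum>n. pochhammer a n / fact n * (\<Prod>j<n. r j) * x ^ n)"

text \<open>Tannery's theorem: the ratios are bounded by \<open>1 + \<eta>\<close> uniformly in the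
  index, so the absolute binomial series at radius \<open>(1 + \<eta>) * norm x < 1\<close> is a
  summable majorant. The limit is again a binomial series.\<close>

lemma ser_tendsto:
  fixes a \<rho> x :: complex and r :: "nat \<Rightarrow> nat \<Rightarrow> complex"
  assumes x: "norm x < 1" and lim: "\<And>j. (\<lambda>k. r k j) \<longlonglongrightarrow> \<rho>" and \<rho>: "norm \<rho> \<le> 1"
    and bd: "\<And>\<eta>. \<eta> > 0 \<Longrightarrow> eventually (\<lambda>k. \<forall>j. norm (r k j) \<le> 1 + \<eta>) sequentially"
  shows "(\<lambda>k. ser a (r k) x) \<longlonglongrightarrow> (1 - \<rho> * x) powr (- a)"
proof -
  define \<eta> where "\<eta> = (1 - norm x) / 2"
  have \<eta>: "\<eta> > 0" "(1 + \<eta>) * norm x < 1"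
  proof -
    show "\<eta> > 0" using x by (simp add: \<eta>_def)
    have "(1 + \<eta>) * norm x < 1 \<longleftrightarrow> 0 < (1 - norm x) * (2 - norm x)"
      by (simp add: \<eta>_def field_simps)
    thus "(1 + \<eta>) * norm x < 1" using x by simp
  qed
  define M where "M = (\<lambda>n. norm (pochhammer a n / fact n) * ((1 + \<eta>) * norm x) ^ n)"
  \<comment> \<open>\<open>hyp_fps a 1 1\<close> is the binomial series; its radius of convergence
    gives the summability of \<open>M\<close>.\<close>
  have coef: "fps_nth (hyp_fps a 1 1) n = pochhammer a n / fact n" for n
    using Gamma_fact[of n, where 'a = complex]
    by (simp add: hyp_fps_def rGamma_inverse_Gamma pochhammer_fact[symmetric] divide_inverse)
  have sM: "summable M"
  proof -
    have "summable (\<lambda>n. norm (fps_nth (hyp_fps a 1 1) n * of_real ((1 + \<eta>) * norm x) ^ n))"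
      by (rule norm_summable_fps, rule conv1_norm_less[OF conv1_hyp_fps]) (use \<eta> in \<open>simp add: abs_mult del: of_real_mult of_real_add\<close>)
    moreover have "\<bar>(1 + \<eta>) * norm x\<bar> = (1 + \<eta>) * norm x" using \<eta>(1) by simp
    ultimately show ?thesis unfolding coef M_def norm_mult norm_power norm_of_real by (simp only:)
  qed
  have ev: "eventually (\<lambda>(n, k). norm (pochhammer a n / fact n * (\<Prod>j<n. r k j) * x ^ n) \<le> M n) (at_top \<times>\<^sub>F sequentially)"
  proof -
    have "eventually (\<lambda>k. \<forall>n. norm (pochhammer a n / fact n * (\<Prod>j<n. r k j) * x ^ n) \<le> M n) sequentially"
      using bd[OF \<eta>(1)]
    proof eventually_elim
      case (elim k)
      show ?case
      proof
        fix n
        have "norm (\<Prod>j<n. r k j) \<le> (\<Prod>j<n. 1 + \<eta>)"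
          unfolding prod_norm[symmetric] by (rule prod_mono) (use elim in auto)
        hence "norm (\<Prod>j<n. r k j) * norm x ^ n \<le> (1 + \<eta>) ^ n * norm x ^ n" by (intro mult_right_mono) auto
        hence "norm (pochhammer a n / fact n) * (norm (\<Prod>j<n. r k j) * norm x ^ n) \<le> norm (pochhammer a n / fact n) * ((1 + \<eta>) ^ n * norm x ^ n)"
          by (intro mult_left_mono) auto
        thus "norm (pochhammer a n / fact n * (\<Prod>j<n. r k j) * x ^ n) \<le> M n"
          by (simp only: norm_mult norm_power M_def power_mult_distrib mult.assoc)
      qed
    qed
    thus ?thesis unfolding eventually_prod_filter
      by (intro exI[of _ "\<lambda>_. True"] exI[of _ "\<lambda>k. \<forall>n. norm (pochhammer a n / fact n * (\<Prod>j<n. r k j) * x ^ n) \<le> M n"]) auto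
  qed
  have "(\<lambda>k. ser a (r k) x) \<longlonglongrightarrow> (\<Sum>n. pochhammer a n / fact n * (\<Prod>j<n. \<rho>) * x ^ n)"
    unfolding ser_def
    by (rule tannerys_theorem[OF _ ev sM, THEN conjunct2, THEN conjunct2]) (intro tendsto_mult tendsto_prod tendsto_const lim trivial_limit_sequentially)+
  also have "(\<lambda>n. pochhammer a n / fact n * (\<Prod>j<n. \<rho>) * x ^ n) = (\<lambda>n. ((- a) gchoose n) * (- (\<rho> * x)) ^ n)"
    by (rule ext) (simp add: gbinomial_pochhammer power_minus[of "\<rho> * x"] power_mult_distrib mult_ac)
  also have "(\<Sum>n. ((- a) gchoose n) * (- (\<rho> * x)) ^ n) = (1 + (- (\<rho> * x))) powr (- a)"
  proof -
    have "norm (\<rho> * x) \<le> norm x" using \<rho> by (simp add: norm_mult mult_left_le_one_le)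
    thus ?thesis using gen_binomial_complex[of "- (\<rho> * x)" "- a"] x by (simp add: sums_iff)
  qed
  finally show ?thesis by simp
qed

lemma eval_hyp_fps_ser:
  assumes "\<And>j::nat. c + of_nat j \<noteq> 0" and nx: "norm x < 1"
  shows "eval_fps (hyp_fps a b c) x = rGamma c * ser a (\<lambda>j. (b + of_nat j) / (c + of_nat j)) x"
proof -
  have p: "fps_nth (hyp_fps a b c) n = rGamma c * (pochhammer a n / fact n * (\<Prod>j<n. (b + of_nat j) / (c + of_nat j)))" for n
  proof -
    have "pochhammer c n \<noteq> 0" using assms by (simp add: pochhammer_prod)
    moreover have "(\<Prod>j<n. (b + of_nat j) / (c + of_nat j)) = pochhammer b n / pochhammer c n"
      by (simp add: pochhammer_prod prod_dividef atLeast0LessThan)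
    ultimately show ?thesis
      using pochhammer_rGamma[of c n] by (simp add: hyp_fps_def)
  qed
  have r: "rGamma c \<noteq> 0"
  proof
    assume "rGamma c = 0"
    then obtain n where "c = - of_nat n" by (auto simp: rGamma_eq_zero_iff elim: nonpos_Ints_cases')
    thus False using assms(1)[of n] by simp
  qed
  have "summable (\<lambda>n. fps_nth (hyp_fps a b c) n * x ^ n)"
    by (rule summable_fps, rule conv1_norm_less[OF conv1_hyp_fps nx])
  hence "summable (\<lambda>n. rGamma c * (pochhammer a n / fact n * (\<Prod>j<n. (b + of_nat j) / (c + of_nat j)) * x ^ n))"
    unfolding p mult.assoc .
  from suminf_mult[OF summable_mult_D[OF this r], of "rGamma c"] show ?thesis
    unfolding eval_fps_def p ser_def mult.assoc .
qed

text \<open>For \<open>rGamma z \<noteq> 0\<close> the expression is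
  \<open>rGamma z / rGamma_series z n\<close>, so Euler's limit applies. At a zero of
  \<open>rGamma\<close> the claim is transported from \<open>z + 1\<close>, at the cost of the
  factor \<open>(z + 1 + n) / n\<close>, which tends to 1.\<close>

lemma rGamma_shift_asymp:
  "(\<lambda>n. rGamma (z + of_nat n + 1) * fact n * exp (z * of_real (ln (of_nat n)))) \<longlonglongrightarrow> (1::complex)"
proof -
  have base: "(\<lambda>n. rGamma (z + of_nat n + 1) * fact n * exp (z * of_real (ln (of_nat n)))) \<longlonglongrightarrow> (1::complex)"
    if z: "rGamma z \<noteq> 0" for z
  proof -
    have "(\<lambda>n. rGamma z / rGamma_series z n) \<longlonglongrightarrow> rGamma z / rGamma z"
      by (intro tendsto_intros rGamma_series_LIMSEQ z)
    moreover have "rGamma z / rGamma_series z n = rGamma (z + of_nat n + 1) * fact n * exp (z * of_real (ln (of_nat n)))" for n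
    proof -
      have r: "rGamma z = pochhammer z (n + 1) * rGamma (z + of_nat (n + 1))"
        by (rule pochhammer_rGamma)
      hence "pochhammer z (n + 1) \<noteq> 0" using z by auto
      thus ?thesis by (subst r) (simp add: rGamma_series_def add_ac)
    qed
    ultimately show ?thesis using z by simp
  qed
  obtain m :: nat where m: "- Re z < real m" using reals_Archimedean2 by blast
  have "Re z + real m > 0 \<Longrightarrow> ?thesis" for m
  proof (induction m arbitrary: z)
    case 0
    hence "rGamma z \<noteq> 0" by (auto simp: rGamma_eq_zero_iff elim!: nonpos_Ints_cases')
    thus ?case by (rule base)
  next
    case (Suc m)
    hence "Re (z + 1) + real m > 0" by simp
    from Suc.IH[OF this] have 1: "(\<lambda>n. rGamma (z + 1 + of_nat n + 1) * fact n * exp ((z + 1) * of_real (ln (of_nat n)))) \<longlonglongrightarrow> (1::complex)" .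
    have "(\<lambda>n. (z + 1 + of_nat n) / (0 + of_nat n) * (rGamma (z + 1 + of_nat n + 1) * fact n * exp ((z + 1) * of_real (ln (of_nat n))))) \<longlonglongrightarrow> (1 * 1::complex)"
      by (intro tendsto_mult 1 ratio_tendsto_1)
    moreover have "eventually (\<lambda>n::nat. n > 0) sequentially" by (rule eventually_gt_at_top)
    hence "eventually (\<lambda>n. (z + 1 + of_nat n) / (0 + of_nat n) * (rGamma (z + 1 + of_nat n + 1) * fact n * exp ((z + 1) * of_real (ln (of_nat n)))) =
       rGamma (z + of_nat n + 1) * fact n * exp (z * of_real (ln (of_nat n)))) sequentially"
    proof eventually_elim
      case (elim n)
      have e: "exp ((z + 1) * of_real (ln (of_nat n))) = exp (z * of_real (ln (of_nat n))) * of_nat n"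
        using elim by (simp add: distrib_right exp_add exp_of_real)
      have "rGamma (z + of_nat n + 1) = (z + 1 + of_nat n) * rGamma (z + 1 + of_nat n + 1)"
        using rGamma_plus1[of "z + of_nat n + 1"] by (simp add: add_ac)
      thus ?case unfolding e using elim by simp
    qed
    ultimately show ?case by (simp add: Lim_transform_eventually)
  qed
  moreover have "Re z + real m > 0" using m by linarith
  ultimately show ?thesis by blast
qed

text \<open>The hypothesis \<open>x + y = z + w\<close> balances the powers of the index, so that
  only Euler's limits for \<open>x\<close> and \<open>y\<close> survive.\<close>

lemma pochhammer_rGamma_limit:
  fixes x y z w :: complex
  assumes "x + y = z + w"
  shows "(\<lambda>k. pochhammer x (Suc k) * pochhammer y (Suc k) * (rGamma (z + of_nat k + 1) * rGamma (w + of_nat k + 1))) \<longlonglongrightarrow> rGamma x * rGamma y"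
proof -
  let ?e = "\<lambda>z n. exp (z * of_real (ln (of_nat n))) :: complex"
  have "(\<lambda>k. rGamma_series x k * rGamma_series y k * ((rGamma (z + of_nat k + 1) * fact k * ?e z k) * (rGamma (w + of_nat k + 1) * fact k * ?e w k)))
     \<longlonglongrightarrow> rGamma x * rGamma y * (1 * 1)"
    by (intro tendsto_mult rGamma_series_LIMSEQ rGamma_shift_asymp)
  moreover have "rGamma_series x k * rGamma_series y k * ((rGamma (z + of_nat k + 1) * fact k * ?e z k) * (rGamma (w + of_nat k + 1) * fact k * ?e w k))
      = pochhammer x (Suc k) * pochhammer y (Suc k) * (rGamma (z + of_nat k + 1) * rGamma (w + of_nat k + 1))" for k
  proof -
    have e: "?e x k * ?e y k = ?e z k * ?e w k" unfolding exp_add[symmetric] distrib_right[symmetric] assms ..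
    have g: "px / (f * ex) * (py / (f * ey)) * ((rz * f * ez) * (rw * f * ew)) = px * py * (rz * rw)"
      if "ex * ey = ez * ew" "ex \<noteq> 0" "ey \<noteq> 0" "f \<noteq> 0" for px py f ex ey rz rw ez ew :: complex
    proof -
      have "px / (f * ex) * (py / (f * ey)) * ((rz * f * ez) * (rw * f * ew)) = px * py * (rz * rw) * ((ez * ew) / (ex * ey))"
        using that(4) by (simp add: field_simps)
      also have "(ez * ew) / (ex * ey) = 1" using that(1)[symmetric] that(2,3) by simp
      finally show ?thesis by simp
    qed
    show ?thesis unfolding rGamma_series_def Suc_eq_plus1 using g[OF e, of "fact k"] by simp
  qed
  ultimately show ?thesis by simp
qed

lemma ratio_bound:
  fixes b c :: complex
  assumes "\<eta> > 0"
  shows "eventually (\<lambda>k. \<forall>j. norm ((b + of_nat k + of_nat j) / (c + of_nat k + of_nat j)) \<le> 1 + \<eta>) sequentially"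
    "eventually (\<lambda>k. \<forall>j. norm ((b + of_nat j) / (c + of_nat k + of_nat j)) \<le> 1 + \<eta>) sequentially"
proof -
  \<comment> \<open>Large enough that from \<open>K\<close> on the denominators dominate both
    \<open>norm (b - c) / \<eta>\<close> and \<open>norm b + real j\<close>.\<close>
  obtain K :: nat where K: "real K \<ge> norm c + norm (b - c) / \<eta> + norm b + 1" using real_arch_simple by blast
  have lb: "norm (c + of_nat k + of_nat j) \<ge> real k + real j - norm c" for k j
    using norm_diff_ineq[of "of_nat (k + j)" c] unfolding norm_of_nat by (simp add: add_ac)
  have div0: "norm (b - c) / \<eta> \<ge> 0" using assms by simp
  show "eventually (\<lambda>k. \<forall>j. norm ((b + of_nat k + of_nat j) / (c + of_nat k + of_nat j)) \<le> 1 + \<eta>) sequentially"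
    using eventually_ge_at_top[of K]
  proof eventually_elim
    case (elim k)
    show ?case
    proof
      fix j
      have l: "norm (c + of_nat k + of_nat j) \<ge> norm (b - c) / \<eta>" "norm (c + of_nat k + of_nat j) > 0"
        using lb[of k j] K elim div0 norm_ge_zero[of b] by linarith+
      hence "norm (b - c) \<le> \<eta> * norm (c + of_nat k + of_nat j)" using assms by (simp add: divide_le_eq mult.commute)
      hence "norm ((b - c) / (c + of_nat k + of_nat j)) \<le> \<eta>" using l by (simp add: norm_divide divide_le_eq)
      moreover have "(b + of_nat k + of_nat j) / (c + of_nat k + of_nat j) = 1 + (b - c) / (c + of_nat k + of_nat j)"
        using l(2) by (simp add: field_simps)
      ultimately show "norm ((b + of_nat k + of_nat j) / (c + of_nat k + of_nat j)) \<le> 1 + \<eta>"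
        using norm_triangle_ineq[of 1 "(b - c) / (c + of_nat k + of_nat j)"] by simp
    qed
  qed
  show "eventually (\<lambda>k. \<forall>j. norm ((b + of_nat j) / (c + of_nat k + of_nat j)) \<le> 1 + \<eta>) sequentially"
    using eventually_ge_at_top[of K]
  proof eventually_elim
    case (elim k)
    show ?case
    proof
      fix j :: nat
      have "norm (b + of_nat j) \<le> norm b + real j" using norm_triangle_ineq[of b "of_nat j"] by simp
      also have "\<dots> \<le> norm (c + of_nat k + of_nat j)" using lb[of k j] K elim div0 by linarith
      finally have "norm ((b + of_nat j) / (c + of_nat k + of_nat j)) \<le> 1"
        by (simp add: norm_divide divide_le_eq_1)
      thus "norm ((b + of_nat j) / (c + of_nat k + of_nat j)) \<le> 1 + \<eta>" using assms by linarith
    qed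
  qed
qed

lemma nonres_shift: "nonres u \<Longrightarrow> nonres (u + of_nat k)"
  unfolding nonres_def by (metis add.assoc add.commute add_Suc of_nat_add)

text \<open>Moving from \<alpha> to \<open>\<alpha> + of_nat k\<close> produces pochhammer factors,
  and the series at the shifted parameter contribute reciprocal gamma functions.
  \<open>pochhammer_rGamma_limit\<close> applies to exactly this product, while the remaining series
  become elementary in the limit.\<close>

lemma wronskian_value:
  assumes "\<xi> \<in> strip" and nr: "nonres (2 * \<nu> + \<alpha> + \<beta> + 1)" "nonres (\<nu> + \<alpha>)" "nonres (\<nu> + \<alpha> + \<beta>)"
  shows "wP \<nu> \<alpha> \<beta> \<xi> * wr' \<nu> \<alpha> \<beta> \<xi> - wP' \<nu> \<alpha> \<beta> \<xi> * wr \<nu> \<alpha> \<beta> \<xi> =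
     - 2 * exp (- (2 * \<nu> + \<alpha> + \<beta> + 1) * of_real (ln 2)) * rGamma (\<nu> + \<alpha> + 1) * rGamma (\<nu> + \<alpha> + \<beta> + 1)"
proof -
  define W where "W = (\<lambda>a x. wP \<nu> a \<beta> x * wr' \<nu> a \<beta> x - wP' \<nu> a \<beta> x * wr \<nu> a \<beta> x)"
  have Re_pos: "Re z > 0" if "z \<in> strip" for z using that by (simp add: strip_def)
  \<comment> \<open>At \<open>sinh x0 = 1 / 2\<close> both series converge, with arguments
    \<open>- 1 / 4\<close> and \<open>4 / 5\<close>. Moreover \<open>2 * sinh x0 = 1\<close>, so
    \<open>Nfac\<close> does not change when \<alpha> is raised.\<close>
  define x0 :: real where "x0 = arsinh (1 / 2)"
  have x0: "x0 > 0" "sinh x0 = 1 / 2" by (simp_all add: x0_def)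
  define \<xi>0 where "\<xi>0 = complex_of_real x0"
  have \<xi>0: "\<xi>0 \<in> strip" using x0(1) by (simp add: strip_def \<xi>0_def)
  define c0 where "c0 = cosh x0"
  have c0: "c0 > 0" "c0\<^sup>2 = 5 / 4"
    using cosh_square_eq[of x0] x0 by (simp_all add: c0_def power2_eq_square)
  have sc: "sinh \<xi>0 = of_real (1 / 2)" "cosh \<xi>0 = of_real c0"
    unfolding x0(2)[symmetric] c0_def \<xi>0_def by (simp_all add: sinh_field_def cosh_field_def flip: exp_of_real)
  define S where "S = {z. z \<in> strip \<and> norm ((sinh z)\<^sup>2) < 1 \<and> norm (1 / (cosh z)\<^sup>2) < 1}"
  have S: "open S" "\<xi>0 \<in> S"
  proof -
    have c: "continuous_on strip (\<lambda>z. norm ((sinh z)\<^sup>2))" "continuous_on strip (\<lambda>z. norm (1 / (cosh z)\<^sup>2))"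
      by (intro continuous_intros; use okP_D(2)[OF strip_okP] in auto)+
    have "open (strip \<inter> (\<lambda>z. norm ((sinh z)\<^sup>2)) -` {..<1} \<inter> (strip \<inter> (\<lambda>z. norm (1 / (cosh z)\<^sup>2)) -` {..<1}))"
      by (intro open_Int continuous_open_preimage c strip_open open_lessThan)
    also have "(strip \<inter> (\<lambda>z. norm ((sinh z)\<^sup>2)) -` {..<1} \<inter> (strip \<inter> (\<lambda>z. norm (1 / (cosh z)\<^sup>2)) -` {..<1})) = S"
      by (auto simp: S_def)
    finally show "open S" .
    have "norm (1 / (cosh \<xi>0)\<^sup>2) < 1" unfolding \<xi>0_def by (rule norm_inv_cosh_sq_real[OF x0(1)])
    thus "\<xi>0 \<in> S" using \<xi>0 by (simp add: S_def sc power2_eq_square norm_mult)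
  qed
  note n0 = okP_D(1,2)[OF strip_okP[OF \<xi>0]]
  have rP: "cosh z * wP' \<nu> a \<beta> z + Lmul \<nu> a \<beta> z * wP \<nu> a \<beta> z = (2 * dfac \<nu> a \<beta>) * wP \<nu> (a + 1) \<beta> z" if "z \<in> S" for a z
    using that raise_wP[of z \<nu> a \<beta>] strip_okP[of z] unfolding S_def by simp
  have rU: "cosh z * wr' \<nu> a \<beta> z + Lmul \<nu> a \<beta> z * wr \<nu> a \<beta> z = (- 4 * dfac \<nu> a \<beta>) * wr \<nu> (a + 1) \<beta> z"
    if "z \<in> S" "nonres (2 * \<nu> + a + \<beta> + 1)" for a z
  proof -
    have "nonres (2 * \<nu> + (a + 1) + \<beta> + 1)" using nonres_shift[OF that(2), of 1] by (simp add: algebra_simps)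
    thus ?thesis using that raise_wr[of z \<nu> a \<beta>] unfolding S_def by simp
  qed
  \<comment> \<open>Using the ladder relations for both derivatives expresses the Wronskian by
    function values at \<open>a\<close> and \<open>a + 1\<close> alone, so that no derivative has to
    be followed in the limit.\<close>
  have casorati: "cosh \<xi>0 * W a \<xi>0 = - dfac \<nu> a \<beta> * (4 * wP \<nu> a \<beta> \<xi>0 * wr \<nu> (a + 1) \<beta> \<xi>0 + 2 * wr \<nu> a \<beta> \<xi>0 * wP \<nu> (a + 1) \<beta> \<xi>0)"
    if "nonres (2 * \<nu> + a + \<beta> + 1)" for a
  proof -
    have "c * (p * r' - p' * r) = - d * (4 * p * r1 + 2 * r * p1)"
      if "c * p' + m * p = (2 * d) * p1" "c * r' + m * r = (- 4 * d) * r1" for c p p' r r' m d p1 r1 :: complex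
      using that by algebra
    from this[OF rP[OF S(2), of a] rU[OF S(2) that]] show ?thesis unfolding W_def .
  qed
  \<comment> \<open>The raised pair is a linear image of the original one, so its Wronskian picks up
    the determinant \<open>- 4 * dfac \<nu> a \<beta>\<close>; the constants 2 and -4 of the two
    ladder relations account for the rest.\<close>
  have step: "W a \<xi>0 = 2 * dfac \<nu> a \<beta> * W (a + 1) \<xi>0" if na: "nonres (2 * \<nu> + a + \<beta> + 1)" and d: "dfac \<nu> a \<beta> \<noteq> 0" for a
  proof -
    have na1: "nonres (2 * \<nu> + (a + 1) + \<beta> + 1)" using nonres_shift[OF na, of 1] by (simp add: algebra_simps)
    let ?u = "2 * \<nu> + a + \<beta> + 1"
    let ?Q = "?u\<^sup>2 + qpot (a\<^sup>2 - 1 / 4) (\<beta>\<^sup>2 - 1 / 4) \<xi>0"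
    note re = Re_pos[OF \<xi>0] and ok = strip_okP[OF \<xi>0]
    have dP: "(2 * dfac \<nu> a \<beta>) * wP' \<nu> (a + 1) \<beta> \<xi>0 = (sinh \<xi>0 + Lmul \<nu> a \<beta> \<xi>0) * wP' \<nu> a \<beta> \<xi>0 +
       (cosh \<xi>0 * ?Q + (?u * cosh \<xi>0 + (a + 1 / 2) * cosh \<xi>0 / (sinh \<xi>0)\<^sup>2)) * wP \<nu> a \<beta> \<xi>0"
      by (rule raise_deriv[OF S rP _ _ _ n0(1)]) (use wP_deriv[OF ok] wP_deriv2[OF ok refl] in auto)
    have dU: "(- 4 * dfac \<nu> a \<beta>) * wr' \<nu> (a + 1) \<beta> \<xi>0 = (sinh \<xi>0 + Lmul \<nu> a \<beta> \<xi>0) * wr' \<nu> a \<beta> \<xi>0 +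
       (cosh \<xi>0 * ?Q + (?u * cosh \<xi>0 + (a + 1 / 2) * cosh \<xi>0 / (sinh \<xi>0)\<^sup>2)) * wr \<nu> a \<beta> \<xi>0"
      by (rule raise_deriv[OF S rU[OF _ na] _ _ _ n0(1)]) (use wr_deriv[OF re] wr_deriv2[OF re refl na] in auto)
    have gen: "(2 * d) * (- 4 * d) * (p1 * r1' - p1' * r1) = - 4 * d * (p * r' - p' * r)"
      if "c * p' + m * p = (2 * d) * p1" "c * r' + m * r = (- 4 * d) * r1"
        "(2 * d) * p1' = k * p' + e * p" "(- 4 * d) * r1' = k * r' + e * r" "m * k - c * e = - 4 * d"
      for c m d p p' p1 p1' r r' r1 r1' k e :: complex
    proof -
      have "(2 * d) * (- 4 * d) * (p1 * r1' - p1' * r1) = ((2 * d) * p1) * ((- 4 * d) * r1') - ((2 * d) * p1') * ((- 4 * d) * r1)"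
        by (simp add: algebra_simps)
      also have "\<dots> = (m * k - c * e) * (p * r' - p' * r)"
        unfolding that(1,2)[symmetric] that(3,4) by (simp add: algebra_simps)
      finally show ?thesis unfolding that(5) .
    qed
    have "(2 * dfac \<nu> a \<beta>) * (- 4 * dfac \<nu> a \<beta>) * W (a + 1) \<xi>0 = - 4 * dfac \<nu> a \<beta> * W a \<xi>0"
      unfolding W_def by (rule gen[OF rP[OF S(2)] rU[OF S(2) na] dP dU Lmul_wronskian_identity[OF n0]])
    hence "2 * (dfac \<nu> a \<beta> * W (a + 1) \<xi>0) = W a \<xi>0" using d by simp
    thus ?thesis by (simp add: mult.assoc)
  qed
  define X Y where "X = \<nu> + \<alpha> + 1" and "Y = \<nu> + \<alpha> + \<beta> + 1"
  have nrk: "nonres (2 * \<nu> + (\<alpha> + of_nat k) + \<beta> + 1)" for k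
    using nonres_shift[OF nr(1), of k] by (simp add: algebra_simps)
  have dk: "dfac \<nu> (\<alpha> + of_nat k) \<beta> = (X + of_nat k) * (Y + of_nat k)" for k
    by (simp add: dfac_def X_def Y_def algebra_simps)
  have dk0: "dfac \<nu> (\<alpha> + of_nat k) \<beta> \<noteq> 0" for k
    using nr(2,3) unfolding dk nonres_def X_def Y_def by (simp add: add_ac)
  have iter: "W \<alpha> \<xi>0 = 2 ^ k * (pochhammer X k * pochhammer Y k) * W (\<alpha> + of_nat k) \<xi>0" for k
  proof (induction k)
    case (Suc k)
    have "W (\<alpha> + of_nat k) \<xi>0 = 2 * ((X + of_nat k) * (Y + of_nat k)) * W (\<alpha> + of_nat (Suc k)) \<xi>0"
      using step[OF nrk dk0, of k] unfolding dk by (simp add: add_ac)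
    thus ?case unfolding Suc by (simp add: pochhammer_Suc mult_ac)
  qed simp
  define HP HU where "HP = (\<lambda>k. eval_fps (hyp_fps (- \<nu>) (Y + of_nat k) (\<alpha> + 1 + of_nat k)) (- (1 / 4)))"
    and "HU = (\<lambda>k. eval_fps (hyp_fps (\<nu> + 1) (\<nu> + \<beta> + 1) (2 * \<nu> + \<alpha> + \<beta> + 2 + of_nat k)) (4 / 5))"
  define M N where "M = Mfac \<alpha> \<beta> \<xi>0" and "N = Nfac \<nu> \<alpha> \<beta> \<xi>0"
  have Mk: "Mfac (\<alpha> + of_nat k) \<beta> \<xi>0 = M / 2 ^ k" for k
  proof (induction k)
    case (Suc k)
    show ?case using Mfac_Suc[OF strip_okP[OF \<xi>0], of "\<alpha> + of_nat k" \<beta>] unfolding Suc by (simp add: sc add_ac)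
  qed (simp add: M_def)
  have Nk: "Nfac \<nu> (\<alpha> + of_nat k) \<beta> \<xi>0 = N" for k
  proof (induction k)
    case (Suc k)
    show ?case using Nfac_Suc[OF Re_pos[OF \<xi>0], of \<nu> "\<alpha> + of_nat k" \<beta>] unfolding Suc by (simp add: sc add_ac)
  qed (simp add: N_def)
  have Pk: "wP \<nu> (\<alpha> + of_nat k) \<beta> \<xi>0 = M / 2 ^ k * HP k" for k
  proof -
    have "- (sinh \<xi>0)\<^sup>2 = - (1 / 4)" by (simp add: sc power2_eq_square)
    note e = this
    have "norm (- (1 / 4) :: complex) < 1" by simp
    thus ?thesis unfolding wP_def Mk HP_def Pf_def Y_def e by (simp only: hyp_reg_eq_eval_fps) (simp add: add_ac)
  qed
  have Uk: "wr \<nu> (\<alpha> + of_nat k) \<beta> \<xi>0 = N * HU k" for k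
  proof -
    have "(cosh \<xi>0)\<^sup>2 = of_real (c0\<^sup>2)" by (simp add: sc)
    hence c: "(cosh \<xi>0)\<^sup>2 = 5 / 4" unfolding c0 by simp
    have e: "1 / (cosh \<xi>0)\<^sup>2 = 4 / 5" unfolding c by simp
    show ?thesis unfolding wr_pfaff[OF Re_pos[OF \<xi>0] nrk] Nk Uf_def e HU_def
      by (simp add: hyp_reg_eq_eval_fps add_ac)
  qed
  \<comment> \<open>The left-hand side does not depend on \<open>k\<close>, so it equals the limit
    of the right-hand side.\<close>
  have WW: "of_real c0 * W \<alpha> \<xi>0 = - (M * N) * (pochhammer X (Suc k) * pochhammer Y (Suc k) * (4 * (HP k * HU (Suc k)) + HU k * HP (Suc k)))" for k
  proof -
    have "of_real c0 * W \<alpha> \<xi>0 = 2 ^ k * (pochhammer X k * pochhammer Y k) * (cosh \<xi>0 * W (\<alpha> + of_nat k) \<xi>0)"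
      unfolding iter[of k] sc by (simp only: mult_ac)
    also have "cosh \<xi>0 * W (\<alpha> + of_nat k) \<xi>0 = - ((X + of_nat k) * (Y + of_nat k)) * (4 * (M / 2 ^ k * HP k) * (N * HU (Suc k)) + 2 * (N * HU k) * (M / 2 ^ Suc k * HP (Suc k)))"
    proof -
      have e: "\<alpha> + of_nat k + 1 = \<alpha> + of_nat (Suc k)" by simp
      show ?thesis unfolding casorati[OF nrk] dk e Pk Uk ..
    qed
    also have "2 ^ k * (pochhammer X k * pochhammer Y k) * (- ((X + of_nat k) * (Y + of_nat k)) * (4 * (M / 2 ^ k * HP k) * (N * HU (Suc k)) + 2 * (N * HU k) * (M / 2 ^ Suc k * HP (Suc k))))
      = - (M * N) * (pochhammer X (Suc k) * pochhammer Y (Suc k) * (4 * (HP k * HU (Suc k)) + HU k * HP (Suc k)))"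
    proof -
      have "T * (px * py) * (- (x * y) * (4 * (M / T * h) * (N * u1) + 2 * (N * u) * (M / (2 * T) * h1)))
         = - (M * N) * ((px * x) * (py * y) * (4 * (h * u1) + u * h1))" if "T \<noteq> 0" for T px py x y h u1 u h1 :: complex
        using that by (simp add: field_simps)
      from this[of "2 ^ k"] show ?thesis unfolding pochhammer_Suc power_Suc by simp
    qed
    finally show ?thesis .
  qed
  define sP sU where "sP = (\<lambda>k. ser (- \<nu>) (\<lambda>j. (Y + of_nat k + of_nat j) / (\<alpha> + 1 + of_nat k + of_nat j)) (- (1 / 4)))"
    and "sU = (\<lambda>k. ser (\<nu> + 1) (\<lambda>j. (\<nu> + \<beta> + 1 + of_nat j) / (2 * \<nu> + \<alpha> + \<beta> + 2 + of_nat k + of_nat j)) (4 / 5))"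
  \<comment> \<open>In the first-kind series the parameter quotients tend to 1, which leaves
    \<open>(5 / 4) powr \<nu>\<close>. In the second-kind series below they tend to 0, which leaves
    1.\<close>
  have "sP \<longlonglongrightarrow> (1 - 1 * (- (1 / 4))) powr (- (- \<nu>))"
    unfolding sP_def
  proof (rule ser_tendsto)
    fix j
    show "(\<lambda>k. (Y + of_nat k + of_nat j) / (\<alpha> + 1 + of_nat k + of_nat j)) \<longlonglongrightarrow> 1"
      using ratio_tendsto_1[of "Y + of_nat j" "\<alpha> + 1 + of_nat j"] by (simp add: add_ac)
  qed (use ratio_bound(1) in auto)
  hence limP: "sP \<longlonglongrightarrow> exp (\<nu> * of_real (ln (5 / 4)))"
    by (simp add: powr_def Ln_of_real[of "5 / 4", simplified])
  have "sU \<longlonglongrightarrow> (1 - 0 * (4 / 5)) powr (- (\<nu> + 1))"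
    unfolding sU_def
  proof (rule ser_tendsto)
    fix j
    have "filterlim (\<lambda>k. (2 * \<nu> + \<alpha> + \<beta> + 2 + of_nat j) + of_nat k :: complex) at_infinity sequentially"
      by (rule tendsto_add_filterlim_at_infinity[OF tendsto_const tendsto_of_nat])
    hence "filterlim (\<lambda>k. 2 * \<nu> + \<alpha> + \<beta> + 2 + of_nat k + of_nat j :: complex) at_infinity sequentially"
      by (simp add: add_ac)
    thus "(\<lambda>k. (\<nu> + \<beta> + 1 + of_nat j) / (2 * \<nu> + \<alpha> + \<beta> + 2 + of_nat k + of_nat j)) \<longlonglongrightarrow> 0"
      by (rule tendsto_divide_0[OF tendsto_const])
  qed (use ratio_bound(2) in auto)
  hence limU: "sU \<longlonglongrightarrow> 1" by simp
  have "eventually (\<lambda>k. \<forall>j. c + of_nat k + of_nat j \<noteq> 0) sequentially" for c :: complex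
  proof -
    obtain K :: nat where K: "- Re c < real K" using reals_Archimedean2 by blast
    show ?thesis using eventually_ge_at_top[of K]
    proof eventually_elim
      case (elim k)
      show ?case
      proof (intro allI notI)
        fix j :: nat assume "c + of_nat k + of_nat j = 0"
        hence "Re (c + of_nat k + of_nat j) = 0" by (simp only: zero_complex.sel)
        thus False using K elim by simp
      qed
    qed
  qed note nz = this
  have HPe: "eventually (\<lambda>k. HP k = rGamma (\<alpha> + 1 + of_nat k) * sP k) sequentially"
    using nz[of "\<alpha> + 1"] unfolding HP_def sP_def by eventually_elim (rule eval_hyp_fps_ser, auto)
  have HUe: "eventually (\<lambda>k. HU k = rGamma (2 * \<nu> + \<alpha> + \<beta> + 2 + of_nat k) * sU k) sequentially"
    using nz[of "2 * \<nu> + \<alpha> + \<beta> + 2"] unfolding HU_def sU_def by eventually_elim (rule eval_hyp_fps_ser, auto)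
  let ?p = "\<lambda>k. pochhammer X (Suc k) * pochhammer Y (Suc k)"
  define v where "v = 2 * \<nu> + \<alpha> + \<beta> + 1"
  have "(\<lambda>k. 4 * (?p k * (rGamma (\<alpha> + of_nat k + 1) * rGamma (v + 1 + of_nat k + 1)) * (sP k * sU (Suc k)))
      + ?p k * (rGamma (v + of_nat k + 1) * rGamma (\<alpha> + 1 + of_nat k + 1)) * (sU k * sP (Suc k)))
     \<longlonglongrightarrow> 4 * (rGamma X * rGamma Y * (exp (\<nu> * of_real (ln (5 / 4))) * 1)) + rGamma X * rGamma Y * (1 * exp (\<nu> * of_real (ln (5 / 4))))"
    by (intro tendsto_add tendsto_mult[OF tendsto_const] tendsto_mult[OF pochhammer_rGamma_limit tendsto_mult] limP limU
         filterlim_sequentially_Suc[THEN iffD2]) (simp_all add: X_def Y_def v_def)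
  moreover have "eventually (\<lambda>k. 4 * (?p k * (rGamma (\<alpha> + of_nat k + 1) * rGamma (v + 1 + of_nat k + 1)) * (sP k * sU (Suc k)))
      + ?p k * (rGamma (v + of_nat k + 1) * rGamma (\<alpha> + 1 + of_nat k + 1)) * (sU k * sP (Suc k))
      = ?p k * (4 * (HP k * HU (Suc k)) + HU k * HP (Suc k))) sequentially"
    using HPe HUe HPe[unfolded eventually_sequentially_Suc[symmetric, of "\<lambda>k. HP k = _ k * sP k"]] HUe[unfolded eventually_sequentially_Suc[symmetric, of "\<lambda>k. HU k = _ k * sU k"]]
  proof eventually_elim
    case (elim k)
    show ?case unfolding elim v_def by (simp add: algebra_simps)
  qed
  ultimately have lim: "(\<lambda>k. - (M * N) * (?p k * (4 * (HP k * HU (Suc k)) + HU k * HP (Suc k)))) \<longlonglongrightarrow>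
     - (M * N) * (4 * (rGamma X * rGamma Y * (exp (\<nu> * of_real (ln (5 / 4))) * 1)) + rGamma X * rGamma Y * (1 * exp (\<nu> * of_real (ln (5 / 4)))))"
    by (intro tendsto_mult[OF tendsto_const]) (rule Lim_transform_eventually)
  have "(\<lambda>k::nat. of_real c0 * W \<alpha> \<xi>0) \<longlonglongrightarrow> - (M * N) * (4 * (rGamma X * rGamma Y * (exp (\<nu> * of_real (ln (5 / 4))) * 1)) + rGamma X * rGamma Y * (1 * exp (\<nu> * of_real (ln (5 / 4)))))"
    using lim unfolding WW[symmetric] .
  hence val: "of_real c0 * W \<alpha> \<xi>0 = - 5 * (M * N * exp (\<nu> * of_real (ln (5 / 4)))) * (rGamma X * rGamma Y)"
    by (simp add: tendsto_const_iff algebra_simps)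
  \<comment> \<open>\<open>(5 / 4) powr \<nu>\<close> is \<open>cosh x0\<close> to the power
    \<open>2 * \<nu>\<close>. Together with the powers in \<open>Mfac\<close> and
    \<open>Nfac\<close> a single \<open>1 / cosh x0\<close> remains, and all powers of
    \<open>exp x0\<close> cancel.\<close>
  have MN: "M * N * exp (\<nu> * of_real (ln (5 / 4))) = exp (- v * of_real (ln 2)) / (2 * of_real c0)"
  proof -
    define l where "l = complex_of_real (ln c0)"
    have "ln (5 / 4) = 2 * ln c0" unfolding c0(2)[symmetric] using c0(1) by (simp add: ln_realpow)
    hence l2: "complex_of_real (ln (5 / 4)) = 2 * l" by (simp add: l_def)
    define t where "t = exp (- 2 * x0)"
    have et: "exp (- 2 * \<xi>0) = of_real t" unfolding t_def \<xi>0_def by (simp flip: exp_of_real)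
    have t1: "1 - t = exp (- x0)" "1 + t = 2 * c0 * exp (- x0)"
    proof -
      have "sinh x0 = (1 - t) * exp x0 / 2" "c0 = (1 + t) * exp x0 / 2"
        unfolding c0_def t_def sinh_field_def cosh_field_def by (simp_all add: algebra_simps flip: exp_add)
      thus "1 - t = exp (- x0)" "1 + t = 2 * c0 * exp (- x0)" unfolding x0(2) by (simp_all add: exp_minus field_simps)
    qed
    have "1 - complex_of_real t = of_real (exp (- x0))" unfolding t1(1)[symmetric] by simp
    hence "Ln (1 - of_real t) = of_real (ln (exp (- x0)))" by (simp only: Ln_of_real exp_gt_zero)
    hence L1: "Ln (1 - of_real t) = - \<xi>0" unfolding \<xi>0_def by simp
    have tp: "1 + t > 0" unfolding t1 using c0 by simp
    have "1 + complex_of_real t = of_real (1 + t)" by simp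
    hence "Ln (1 + of_real t) = of_real (ln (1 + t))" by (simp only: Ln_of_real tp)
    also have "ln (1 + t) = ln 2 + ln c0 - x0" unfolding t1 using c0 by (simp add: ln_mult)
    finally have L2: "Ln (1 + of_real t) = of_real (ln 2) + l - \<xi>0" by (simp add: l_def \<xi>0_def)
    have L3: "Ln (sinh \<xi>0) = - of_real (ln 2)" unfolding sc using Ln_of_real[of "1 / 2"] by (simp add: ln_div)
    have L4: "Ln (cosh \<xi>0) = l" unfolding sc l_def using c0 by (simp add: Ln_of_real)
    have "M * N * exp (\<nu> * of_real (ln (5 / 4))) = exp (- v * of_real (ln 2) - of_real (ln 2) - l)"
      unfolding M_def N_def Mfac_def Nfac_def lfac_def et L1 L2 L3 L4 l2 exp_add[symmetric] v_def
      by (rule arg_cong[where f = exp]) (simp add: field_simps)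
    also have "\<dots> = exp (- v * of_real (ln 2)) / (2 * of_real c0)"
      using c0 by (simp add: exp_diff l_def exp_of_real)
    finally show ?thesis .
  qed
  have "W \<alpha> \<xi>0 = - 2 * exp (- v * of_real (ln 2)) * rGamma X * rGamma Y"
  proof -
    have "complex_of_real c0 * of_real c0 = of_real (c0\<^sup>2)" by (simp add: power2_eq_square)
    hence cc: "complex_of_real c0 * of_real c0 = 5 / 4" unfolding c0 by simp
    have "W' = - 2 * e * g" if "c * W' = - 5 * (e / (2 * c)) * g" "c * c = 5 / 4" "c \<noteq> 0" for c W' e g :: complex
    proof -
      have "c * c * W' = - 5 / 2 * e * g" using that(1,3) by (simp add: field_simps)
      thus ?thesis unfolding that(2) by simp
    qed
    from this[OF val[unfolded MN] cc] c0 show ?thesis by (simp add: mult.assoc)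
  qed
  moreover have "W \<alpha> \<xi> = W \<alpha> \<xi>0"
    unfolding W_def
    by (rule wronskian_const[where Q = "\<lambda>\<xi>. (2 * \<nu> + \<alpha> + \<beta> + 1)\<^sup>2 + qpot (\<alpha>\<^sup>2 - 1 / 4) (\<beta>\<^sup>2 - 1 / 4) \<xi>", OF _ _ _ _ strip_convex assms(1) \<xi>0])
       (use wP_deriv wP_deriv2 wr_deriv wr_deriv2 strip_okP Re_pos nr in auto)
  ultimately show ?thesis unfolding W_def X_def Y_def v_def by simp
qed


text \<open>Both functions solve the same equation, since
  \<open>2 * \<nu> + \<alpha> + \<beta> + 1\<close> and \<open>\<alpha>\<^sup>2\<close> are
  unchanged. Here the point \<open>\<xi> = 0\<close> can be used: the factor
  \<open>sinh \<xi>\<close> of the product of the two \<open>Mfac\<close> cancels the pole of the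
  logarithmic derivatives, and the limit is evaluated by the reflection formula for
  \<open>rGamma\<close>.\<close>

lemma wronskian_PP:
  assumes "\<xi> \<in> strip"
  shows "wP \<nu> \<alpha> \<beta> \<xi> * wP' (\<nu> + \<alpha>) (- \<alpha>) \<beta> \<xi> - wP' \<nu> \<alpha> \<beta> \<xi> * wP (\<nu> + \<alpha>) (- \<alpha>) \<beta> \<xi> =
     - 2 * sin (of_real pi * \<alpha>) / of_real pi"
proof -
  define \<nu>1 where "\<nu>1 = \<nu> + \<alpha>"
  define W where "W = (\<lambda>x. wP \<nu> \<alpha> \<beta> x * wP' \<nu>1 (- \<alpha>) \<beta> x - wP' \<nu> \<alpha> \<beta> x * wP \<nu>1 (- \<alpha>) \<beta> x)"
  define f where "f = (\<lambda>x. Pf \<nu> \<alpha> \<beta> (- (sinh x)\<^sup>2))"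
  define f1 where "f1 = (\<lambda>x. deriv (Pf \<nu> \<alpha> \<beta>) (- (sinh x)\<^sup>2))"
  define g where "g = (\<lambda>x. Pf \<nu>1 (- \<alpha>) \<beta> (- (sinh x)\<^sup>2))"
  define g1 where "g1 = (\<lambda>x. deriv (Pf \<nu>1 (- \<alpha>) \<beta>) (- (sinh x)\<^sup>2))"
  \<comment> \<open>The Wronskian after cancelling the pole of \<open>mlog\<close> against
    \<open>sinh\<close>; this form has a limit at 0.\<close>
  define \<Phi> where "\<Phi> = (\<lambda>x. exp ((2 * \<beta> + 1) * Ln (cosh x)) *
     (- 2 * \<alpha> * cosh x * f x * g x - 2 * (sinh x)\<^sup>2 * cosh x * (f x * g1 x - f1 x * g x)))"
  have W\<Phi>: "W x = \<Phi> x" if "x \<in> strip" for x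
  proof -
    note n = okP_D(1,2)[OF strip_okP[OF that]]
    define m k where "m = mlog \<alpha> \<beta> x" and "k = mlog (- \<alpha>) \<beta> x"
    have id: "(a + 1 / 2) * X + K - ((b + 1 / 2) * X + K) = (a - b) * X" for a b X K :: complex
      by (simp add: algebra_simps)
    have mk: "k - m = - 2 * \<alpha> * (cosh x / sinh x)"       using id[of "- \<alpha>" "cosh x / sinh x" "(\<beta> + 1 / 2) * (sinh x / cosh x)" \<alpha>] unfolding m_def k_def mlog_def by simp
    have MM: "Mfac \<alpha> \<beta> x * Mfac (- \<alpha>) \<beta> x = sinh x * exp ((2 * \<beta> + 1) * Ln (cosh x))"
    proof -
      have "Mfac \<alpha> \<beta> x * Mfac (- \<alpha>) \<beta> x = exp (Ln (sinh x) + (2 * \<beta> + 1) * Ln (cosh x))"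
        unfolding Mfac_def exp_add[symmetric] by (rule arg_cong[where f = exp]) (simp add: algebra_simps)
      thus ?thesis using n by (simp add: exp_add)
    qed
    have "W x = (Mfac \<alpha> \<beta> x * Mfac (- \<alpha>) \<beta> x) * ((k - m) * f x * g x - 2 * sinh x * cosh x * (f x * g1 x - f1 x * g x))"
      unfolding W_def wP_def wP'_def f_def f1_def g_def g1_def m_def k_def by (simp add: algebra_simps)
    also have "\<dots> = \<Phi> x" unfolding MM mk \<Phi>_def using n(1) by (simp add: field_simps power2_eq_square)
    finally show ?thesis .
  qed
  have const: "W a = W b" if "a \<in> strip" "b \<in> strip" for a b
    unfolding W_def
  proof (rule wronskian_const[OF _ _ _ _ strip_convex that])
    fix x assume x: "x \<in> strip"
    note ok = strip_okP[OF x]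
    show "(wP \<nu> \<alpha> \<beta> has_field_derivative wP' \<nu> \<alpha> \<beta> x) (at x)"
      "(wP \<nu>1 (- \<alpha>) \<beta> has_field_derivative wP' \<nu>1 (- \<alpha>) \<beta> x) (at x)" by (rule wP_deriv[OF ok])+
    show "(wP' \<nu> \<alpha> \<beta> has_field_derivative ((2 * \<nu> + \<alpha> + \<beta> + 1)\<^sup>2 + qpot (\<alpha>\<^sup>2 - 1 / 4) (\<beta>\<^sup>2 - 1 / 4) x) * wP \<nu> \<alpha> \<beta> x) (at x)"
      by (rule wP_deriv2[OF ok refl])
    have u: "2 * \<nu> + \<alpha> + \<beta> + 1 = 2 * \<nu>1 + (- \<alpha>) + \<beta> + 1" by (simp add: \<nu>1_def)
    show "(wP' \<nu>1 (- \<alpha>) \<beta> has_field_derivative ((2 * \<nu> + \<alpha> + \<beta> + 1)\<^sup>2 + qpot (\<alpha>\<^sup>2 - 1 / 4) (\<beta>\<^sup>2 - 1 / 4) x) * wP \<nu>1 (- \<alpha>) \<beta> x) (at x)"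
      using wP_deriv2[OF ok u, of ] by simp
  qed
  have c0: "(0::complex) \<in> cut_plane" using ball_subset_cut_plane by auto
  have co: "isCont (Pf a b \<beta>) 0" "isCont (deriv (Pf a b \<beta>)) 0" for a b
    using DERIV_isCont[OF Pf_deriv(1)[OF c0]] DERIV_isCont[OF Pf_deriv(2)[OF c0]] by auto
  have tn: "((\<lambda>x. - (sinh x)\<^sup>2) \<longlongrightarrow> 0) (at (0::complex))"
  proof -
    have "((\<lambda>x. - (sinh x)\<^sup>2) \<longlongrightarrow> - (sinh (0::complex))\<^sup>2) (at 0)" by (intro tendsto_intros)
    thus ?thesis by simp
  qed
  have cf: "((\<lambda>x. Pf a b \<beta> (- (sinh x)\<^sup>2)) \<longlongrightarrow> Pf a b \<beta> 0) (at 0)"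
    "((\<lambda>x. deriv (Pf a b \<beta>) (- (sinh x)\<^sup>2)) \<longlongrightarrow> deriv (Pf a b \<beta>) 0) (at 0)" for a b
    by (rule isCont_tendsto_compose[OF co(1) tn], rule isCont_tendsto_compose[OF co(2) tn])
  have L: "((\<lambda>x. Ln (cosh x)) \<longlongrightarrow> Ln 1) (at (0::complex))"
    by (rule tendsto_Ln) (use tendsto_cosh[OF tendsto_ident_at, of "0::complex" UNIV] in auto)
  have "(\<Phi> \<longlongrightarrow> exp ((2 * \<beta> + 1) * Ln 1) * (- 2 * \<alpha> * cosh 0 * Pf \<nu> \<alpha> \<beta> 0 * Pf \<nu>1 (- \<alpha>) \<beta> 0
     - 2 * (sinh 0)\<^sup>2 * cosh 0 * (Pf \<nu> \<alpha> \<beta> 0 * deriv (Pf \<nu>1 (- \<alpha>) \<beta>) 0 - deriv (Pf \<nu> \<alpha> \<beta>) 0 * Pf \<nu>1 (- \<alpha>) \<beta> 0))) (at 0)"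
    unfolding \<Phi>_def f_def g_def f1_def g1_def by (intro tendsto_intros cf L)
  hence lim: "(\<Phi> \<longlongrightarrow> - 2 * \<alpha> * Pf \<nu> \<alpha> \<beta> 0 * Pf \<nu>1 (- \<alpha>) \<beta> 0) (at 0)" by simp
  have fl: "filterlim (\<lambda>x. complex_of_real x) (at 0) (at_right 0)"
    unfolding filterlim_at
  proof (intro conjI)
    show "\<forall>\<^sub>F x in at_right (0::real). complex_of_real x \<in> UNIV \<and> complex_of_real x \<noteq> 0"
      by (rule eventually_mono[OF eventually_at_right_less]) auto
    have "((\<lambda>x. complex_of_real x) \<longlongrightarrow> complex_of_real 0) (at_right 0)" by (intro tendsto_intros)
    thus "((\<lambda>x. complex_of_real x) \<longlongrightarrow> 0) (at_right 0)" by simp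
  qed
  have "((\<lambda>x. \<Phi> (complex_of_real x)) \<longlongrightarrow> - 2 * \<alpha> * Pf \<nu> \<alpha> \<beta> 0 * Pf \<nu>1 (- \<alpha>) \<beta> 0) (at_right 0)"
    by (rule filterlim_compose[OF lim fl])
  moreover have "eventually (\<lambda>x. \<Phi> (complex_of_real x) = W \<xi>) (at_right 0)"
  proof (rule eventually_mono[OF eventually_at_right_less])
    fix x :: real assume "0 < x"
    hence "complex_of_real x \<in> strip" by (simp add: strip_def)
    thus "\<Phi> (complex_of_real x) = W \<xi>" using W\<Phi> const assms by metis
  qed
  ultimately have "((\<lambda>_::real. W \<xi>) \<longlongrightarrow> - 2 * \<alpha> * Pf \<nu> \<alpha> \<beta> 0 * Pf \<nu>1 (- \<alpha>) \<beta> 0) (at_right 0)"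
    by (rule Lim_transform_eventually)
  hence "W \<xi> = - 2 * \<alpha> * Pf \<nu> \<alpha> \<beta> 0 * Pf \<nu>1 (- \<alpha>) \<beta> 0" by (simp add: tendsto_const_iff)
  also have "Pf a b \<beta> 0 = rGamma (b + 1)" for a b
    unfolding Pf_def by (simp add: hyp_reg_eq_eval_fps eval_fps_at_0 hyp_fps_def)
  hence "- 2 * \<alpha> * Pf \<nu> \<alpha> \<beta> 0 * Pf \<nu>1 (- \<alpha>) \<beta> 0 = - 2 * (\<alpha> * rGamma (\<alpha> + 1) * rGamma (1 - \<alpha>))" by simp
  also have "\<dots> = - 2 * sin (of_real pi * \<alpha>) / of_real pi"
    unfolding rGamma_plus1 by (simp add: rGamma_reflection_complex)
  finally show ?thesis unfolding W_def \<nu>1_def .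
qed

subsection \<open>Boundary values on the cut\<close>

text \<open>\<open>sphase \<alpha>\<close> is the phase of \<open>sinh \<xi> powr (\<alpha> + 1/2)\<close> at \<open>\<xi> = \<i> \<zeta>\<close>, \<open>pfac \<alpha> \<beta> \<zeta>\<close> the modulus factor (the
  reciprocal of \<open>prefactor\<close>), and \<open>omv\<close> the value of the Wronskian of \<open>wP\<close> and \<open>wu\<close>.\<close>

definition pfac :: "complex \<Rightarrow> complex \<Rightarrow> real \<Rightarrow> complex" where
  "pfac \<alpha> \<beta> \<zeta> = exp ((\<alpha> + 1 / 2) * of_real (ln (sin \<zeta>)) + (\<beta> + 1 / 2) * of_real (ln (cos \<zeta>)))"

definition sphase :: "complex \<Rightarrow> complex" where
  "sphase \<alpha> = exp (\<i> * of_real (pi / 2) * (\<alpha> + 1 / 2))"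

definition pcut :: "complex \<Rightarrow> complex \<Rightarrow> complex \<Rightarrow> real \<Rightarrow> complex" where
  "pcut \<nu> \<alpha> \<beta> \<zeta> = pfac \<alpha> \<beta> \<zeta> * Pf \<nu> \<alpha> \<beta> (of_real ((sin \<zeta>)\<^sup>2))"

text \<open>The derivative of \<open>pcut\<close> with respect to \<zeta>. Because of
  \<open>\<xi> = \<i> * \<zeta>\<close> it differs from \<open>wP'\<close> by a factor
  \<open>\<i>\<close> or \<open>- \<i>\<close> besides the phase.\<close>

definition pcut' :: "complex \<Rightarrow> complex \<Rightarrow> complex \<Rightarrow> real \<Rightarrow> complex" where
  "pcut' \<nu> \<alpha> \<beta> \<zeta> = pfac \<alpha> \<beta> \<zeta> * (((\<alpha> + 1 / 2) * of_real (cos \<zeta> / sin \<zeta>) - (\<beta> + 1 / 2) * of_real (sin \<zeta> / cos \<zeta>)) *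
     Pf \<nu> \<alpha> \<beta> (of_real ((sin \<zeta>)\<^sup>2)) + 2 * of_real (sin \<zeta> * cos \<zeta>) * deriv (Pf \<nu> \<alpha> \<beta>) (of_real ((sin \<zeta>)\<^sup>2)))"

definition omv :: "complex \<Rightarrow> complex \<Rightarrow> complex \<Rightarrow> complex" where
  "omv \<nu> \<alpha> \<beta> = - 2 * exp (- (2 * \<nu> + \<alpha> + \<beta> + 1) * of_real (ln 2)) * Gamma (2 * \<nu> + \<alpha> + \<beta> + 2) *
     rGamma (\<nu> + \<alpha> + 1) * rGamma (\<nu> + \<alpha> + \<beta> + 1)"

lemma sinh_ii: "sinh (\<i> * of_real y) = \<i> * of_real (sin y)" and cosh_ii: "cosh (\<i> * of_real y) = of_real (cos y)"
  by (simp_all add: sinh_complex cosh_complex complex_eq_iff)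

lemma wP_boundary:
  assumes "0 < \<zeta>" "\<zeta> < pi / 2"
  shows "okP (\<i> * of_real \<zeta>)" "okP (- (\<i> * of_real \<zeta>))"
    "wP \<nu> \<alpha> \<beta> (\<i> * of_real \<zeta>) = sphase \<alpha> * pcut \<nu> \<alpha> \<beta> \<zeta>"
    "wP \<nu> \<alpha> \<beta> (- (\<i> * of_real \<zeta>)) = inverse (sphase \<alpha>) * pcut \<nu> \<alpha> \<beta> \<zeta>"
    "wP' \<nu> \<alpha> \<beta> (\<i> * of_real \<zeta>) = - \<i> * sphase \<alpha> * pcut' \<nu> \<alpha> \<beta> \<zeta>"
    "wP' \<nu> \<alpha> \<beta> (- (\<i> * of_real \<zeta>)) = \<i> * inverse (sphase \<alpha>) * pcut' \<nu> \<alpha> \<beta> \<zeta>"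
proof -
  have s: "sin \<zeta> > 0" using assms by (intro sin_gt_zero) auto
  have c: "cos \<zeta> > 0" using assms by (intro cos_gt_zero_pi) auto
  show "okP (\<i> * of_real \<zeta>)" "okP (- (\<i> * of_real \<zeta>))"
    using s c by (simp_all add: okP_def sinh_ii cosh_ii complex_nonpos_Reals_iff)
  have L: "Ln (\<i> * of_real (sin \<zeta>)) = of_real (ln (sin \<zeta>)) + \<i> * of_real (pi / 2)"
    "Ln (- (\<i> * of_real (sin \<zeta>))) = of_real (ln (sin \<zeta>)) - \<i> * of_real (pi / 2)"
  proof -
    have e: "exp (\<i> * of_real (pi / 2)) = \<i>" using exp_Euler[of "of_real (pi / 2)"] by (simp add: exp_eq_polar cis.ctr complex_eq_iff Re_exp Im_exp)
    show "Ln (\<i> * of_real (sin \<zeta>)) = of_real (ln (sin \<zeta>)) + \<i> * of_real (pi / 2)"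
    proof (rule Ln_unique)
      show "exp (of_real (ln (sin \<zeta>)) + \<i> * of_real (pi / 2)) = \<i> * of_real (sin \<zeta>)"
        unfolding exp_add e using s by (simp add: exp_of_real)
    qed auto
    show "Ln (- (\<i> * of_real (sin \<zeta>))) = of_real (ln (sin \<zeta>)) - \<i> * of_real (pi / 2)"
    proof (rule Ln_unique)
      show "exp (of_real (ln (sin \<zeta>)) - \<i> * of_real (pi / 2)) = - (\<i> * of_real (sin \<zeta>))"
        unfolding exp_diff e using s by (simp add: exp_of_real)
    qed (use pi_gt_zero in \<open>auto simp: field_simps\<close>)
  qed
  have Lc: "Ln (of_real (cos \<zeta>)) = of_real (ln (cos \<zeta>))" by (rule Ln_of_real[OF c])
  have M: "Mfac \<alpha> \<beta> (\<i> * of_real \<zeta>) = sphase \<alpha> * pfac \<alpha> \<beta> \<zeta>"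
    "Mfac \<alpha> \<beta> (- (\<i> * of_real \<zeta>)) = inverse (sphase \<alpha>) * pfac \<alpha> \<beta> \<zeta>"
    unfolding Mfac_def sphase_def pfac_def sinh_minus cosh_minus sinh_ii cosh_ii L Lc exp_minus[symmetric] exp_add[symmetric]
    by (rule arg_cong[where f = exp], simp add: algebra_simps)+
  have x: "- (sinh (\<i> * of_real \<zeta>))\<^sup>2 = of_real ((sin \<zeta>)\<^sup>2)" "- (sinh (- (\<i> * of_real \<zeta>)))\<^sup>2 = of_real ((sin \<zeta>)\<^sup>2)"
    unfolding sinh_minus sinh_ii by (simp_all add: power_mult_distrib)
  show "wP \<nu> \<alpha> \<beta> (\<i> * of_real \<zeta>) = sphase \<alpha> * pcut \<nu> \<alpha> \<beta> \<zeta>"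
    "wP \<nu> \<alpha> \<beta> (- (\<i> * of_real \<zeta>)) = inverse (sphase \<alpha>) * pcut \<nu> \<alpha> \<beta> \<zeta>"
    unfolding wP_def M x pcut_def by simp_all
  define D where "D = (\<alpha> + 1 / 2) * of_real (cos \<zeta> / sin \<zeta>) - (\<beta> + 1 / 2) * of_real (sin \<zeta> / cos \<zeta>)"
  have m: "mlog \<alpha> \<beta> (\<i> * of_real \<zeta>) = - \<i> * D"
  proof -
    have i: "z / (\<i> * w) = - \<i> * (z / w)" "\<i> * w / z = \<i> * (w / z)" for z w :: complex
      by (simp_all add: divide_inverse mult_ac)
    have "a * (- \<i> * X) + b * (\<i> * Y) = - \<i> * (a * X - b * Y)" for a b X Y :: complex by (simp add: algebra_simps)
    thus ?thesis unfolding mlog_def sinh_ii cosh_ii i D_def of_real_divide .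
  qed
  have m': "mlog \<alpha> \<beta> (- (\<i> * of_real \<zeta>)) = \<i> * D"
  proof -
    have "mlog \<alpha> \<beta> (- \<xi>) = - mlog \<alpha> \<beta> \<xi>" for \<xi> unfolding mlog_def by simp
    from this[of "\<i> * of_real \<zeta>"] show ?thesis unfolding m by simp
  qed
  define F F1 where "F = Pf \<nu> \<alpha> \<beta> (of_real ((sin \<zeta>)\<^sup>2))" and "F1 = deriv (Pf \<nu> \<alpha> \<beta>) (of_real ((sin \<zeta>)\<^sup>2))"
  have p': "pcut' \<nu> \<alpha> \<beta> \<zeta> = pfac \<alpha> \<beta> \<zeta> * (D * F + 2 * of_real (sin \<zeta> * cos \<zeta>) * F1)"
    unfolding pcut'_def D_def F_def F1_def ..
  show "wP' \<nu> \<alpha> \<beta> (\<i> * of_real \<zeta>) = - \<i> * sphase \<alpha> * pcut' \<nu> \<alpha> \<beta> \<zeta>"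
    unfolding wP'_def M x m p' F_def[symmetric] F1_def[symmetric]
    unfolding sinh_ii cosh_ii by (simp add: algebra_simps)
  show "wP' \<nu> \<alpha> \<beta> (- (\<i> * of_real \<zeta>)) = \<i> * inverse (sphase \<alpha>) * pcut' \<nu> \<alpha> \<beta> \<zeta>"
    unfolding wP'_def M x m' p' F_def[symmetric] F1_def[symmetric]
    unfolding sinh_minus cosh_minus sinh_ii cosh_ii
    by (simp add: algebra_simps)
qed

lemma sphase_nz [simp]: "sphase \<alpha> \<noteq> 0" by (simp add: sphase_def)

lemma wP_isCont:
  assumes "okP \<xi>"
  shows "isCont (wP \<nu> \<alpha> \<beta>) \<xi>" "isCont (wP' \<nu> \<alpha> \<beta>) \<xi>"
  using DERIV_isCont[OF wP_deriv[OF assms]] DERIV_isCont[OF wP_deriv2[OF assms refl]] by auto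

lemma rGamma_nonres: "nonres u \<Longrightarrow> rGamma (u + 1) \<noteq> 0"
proof
  assume n: "nonres u" and "rGamma (u + 1) = 0"
  then obtain n where "u + 1 = - of_nat n" by (auto simp: rGamma_eq_zero_iff elim: nonpos_Ints_cases')
  hence "of_nat (Suc n) + u = 0" by (simp add: algebra_simps eq_neg_iff_add_eq_0)
  thus False using n unfolding nonres_def by blast
qed

lemma wronskian_Pu:
  assumes "\<xi> \<in> strip" "nonres (2 * \<nu> + \<alpha> + \<beta> + 1)" "nonres (\<nu> + \<alpha>)" "nonres (\<nu> + \<alpha> + \<beta>)"
    "u = 2 * \<nu> + \<alpha> + \<beta> + 1" "A = \<alpha>\<^sup>2 - 1 / 4" "B = \<beta>\<^sup>2 - 1 / 4"
  shows "wP \<nu> \<alpha> \<beta> \<xi> * wu' u A B \<xi> - wP' \<nu> \<alpha> \<beta> \<xi> * wu u A B \<xi> = omv \<nu> \<alpha> \<beta>"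
proof -
  define r where "r = rGamma (2 * \<nu> + \<alpha> + \<beta> + 2)"
  have "r \<noteq> 0" using rGamma_nonres[OF assms(2)] by (simp add: r_def add_ac)
  hence r: "Gamma (2 * \<nu> + \<alpha> + \<beta> + 2) * r = 1" "r \<noteq> 0" by (simp_all add: Gamma_def r_def)
  have "r * (wP \<nu> \<alpha> \<beta> \<xi> * wu' u A B \<xi> - wP' \<nu> \<alpha> \<beta> \<xi> * wu u A B \<xi>) = r * omv \<nu> \<alpha> \<beta>"
  proof -
    have "r * (p * w' - p' * w) = r * (- 2 * e * G * g * h)"
      if "p * (r * w') - p' * (r * w) = - 2 * e * g * h" "G * r = 1" for p w p' w' e G g h :: complex
    proof -
      have "r * (p * w' - p' * w) = (G * r) * (p * (r * w') - p' * (r * w))" unfolding that(2) by (simp add: algebra_simps)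
      thus ?thesis unfolding that(1) by (simp add: algebra_simps)
    qed
    from this[OF wronskian_value[OF assms(1-4), unfolded wr_def wr'_def, folded r_def] r(1)]
    show ?thesis unfolding omv_def assms(5-7) .
  qed
  thus ?thesis using r(2) by simp
qed

section \<open>Connection formulas from the Wronskians at the boundary\<close>

locale cut_limits =
  fixes \<nu> \<alpha> \<beta> u A B :: complex and \<zeta> :: real and Fp Fm :: "complex filter" and a a' b b' :: complex
  assumes z: "0 < \<zeta>" "\<zeta> < pi / 2"
    and u: "u = 2 * \<nu> + \<alpha> + \<beta> + 1" "A = \<alpha>\<^sup>2 - 1 / 4" "B = \<beta>\<^sup>2 - 1 / 4"
    and nr: "nonres (2 * \<nu> + \<alpha> + \<beta> + 1)" "nonres (\<nu> + \<alpha>)" "nonres (\<nu> + \<alpha> + \<beta>)" "nonres \<nu>" "nonres (\<nu> + \<beta>)"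
    and Fp: "Fp \<noteq> bot" "Fp \<le> nhds (\<i> * of_real \<zeta>)" "eventually (\<lambda>\<xi>. \<xi> \<in> strip) Fp"
    and Fm: "Fm \<noteq> bot" "Fm \<le> nhds (- (\<i> * of_real \<zeta>))" "eventually (\<lambda>\<xi>. \<xi> \<in> strip) Fm"
    and lp: "(wu u A B \<longlongrightarrow> a) Fp" "(wu' u A B \<longlongrightarrow> a') Fp"
    and lm: "(wu u A B \<longlongrightarrow> b) Fm" "(wu' u A B \<longlongrightarrow> b') Fm"
begin

lemma tendsto_le_nhds: "isCont f x \<Longrightarrow> F \<le> nhds x \<Longrightarrow> (f \<longlongrightarrow> f x) F" for f :: "complex \<Rightarrow> complex"
  by (rule filterlim_mono[OF _ order_refl]) (simp_all add: isCont_def tendsto_at_iff_tendsto_nhds)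

lemma limit_value: "\<lbrakk>F \<noteq> bot; (f \<longlongrightarrow> l) F; eventually (\<lambda>x. f x = c) F\<rbrakk> \<Longrightarrow> l = c" for f :: "complex \<Rightarrow> complex"
  using Lim_transform_eventually[of f l F "\<lambda>_. c"] by (simp add: tendsto_const_iff)

text \<open>The Wronskians are constant on the strip, so they pass to the limit along the filters at
  \<open>\<i> * \<zeta>\<close> and \<open>- \<i> * \<zeta>\<close>. There \<open>wP\<close> is
  continuous, while for \<open>wu\<close> only limits are assumed. The same \<open>wu\<close> serves
  both functions of the first kind, because it depends only on \<open>u\<close>, \<open>A\<close>
  and \<open>B\<close>.\<close>

lemma boundary_wronskians:
  "sphase \<alpha> * (pcut \<nu> \<alpha> \<beta> \<zeta> * a' + \<i> * pcut' \<nu> \<alpha> \<beta> \<zeta> * a) = omv \<nu> \<alpha> \<beta>"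
  "inverse (sphase \<alpha>) * (pcut \<nu> \<alpha> \<beta> \<zeta> * b' - \<i> * pcut' \<nu> \<alpha> \<beta> \<zeta> * b) = omv \<nu> \<alpha> \<beta>"
  "sphase (- \<alpha>) * (pcut (\<nu> + \<alpha>) (- \<alpha>) \<beta> \<zeta> * a' + \<i> * pcut' (\<nu> + \<alpha>) (- \<alpha>) \<beta> \<zeta> * a) = omv (\<nu> + \<alpha>) (- \<alpha>) \<beta>"
  "inverse (sphase (- \<alpha>)) * (pcut (\<nu> + \<alpha>) (- \<alpha>) \<beta> \<zeta> * b' - \<i> * pcut' (\<nu> + \<alpha>) (- \<alpha>) \<beta> \<zeta> * b) = omv (\<nu> + \<alpha>) (- \<alpha>) \<beta>"
  "pcut \<nu> \<alpha> \<beta> \<zeta> * pcut' (\<nu> + \<alpha>) (- \<alpha>) \<beta> \<zeta> - pcut' \<nu> \<alpha> \<beta> \<zeta> * pcut (\<nu> + \<alpha>) (- \<alpha>) \<beta> \<zeta> = - 2 * sin (of_real pi * \<alpha>) / of_real pi"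
proof -
  note bd = wP_boundary[OF z]
  have cp: "(wP n c \<beta> \<longlongrightarrow> wP n c \<beta> (\<i> * of_real \<zeta>)) Fp" "(wP' n c \<beta> \<longlongrightarrow> wP' n c \<beta> (\<i> * of_real \<zeta>)) Fp"
    "(wP n c \<beta> \<longlongrightarrow> wP n c \<beta> (- (\<i> * of_real \<zeta>))) Fm" "(wP' n c \<beta> \<longlongrightarrow> wP' n c \<beta> (- (\<i> * of_real \<zeta>))) Fm" for n c
    by (rule tendsto_le_nhds[OF wP_isCont(1)[OF bd(1)] Fp(2)], rule tendsto_le_nhds[OF wP_isCont(2)[OF bd(1)] Fp(2)],
        rule tendsto_le_nhds[OF wP_isCont(1)[OF bd(2)] Fm(2)], rule tendsto_le_nhds[OF wP_isCont(2)[OF bd(2)] Fm(2)])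
  have e: "eventually (\<lambda>\<xi>. wP n c \<beta> \<xi> * wu' u A B \<xi> - wP' n c \<beta> \<xi> * wu u A B \<xi> = omv n c \<beta>) F"
    if "eventually (\<lambda>\<xi>. \<xi> \<in> strip) F" "n = \<nu> \<and> c = \<alpha> \<or> n = \<nu> + \<alpha> \<and> c = - \<alpha>" for n c F
    using that(1)
  proof eventually_elim
    case (elim \<xi>)
    have h: "2 * (\<nu> + \<alpha>) + (- \<alpha>) + \<beta> + 1 = 2 * \<nu> + \<alpha> + \<beta> + 1" "\<nu> + \<alpha> + (- \<alpha>) = \<nu>" "(- \<alpha>)\<^sup>2 = \<alpha>\<^sup>2"
      by simp_all
    show ?case using that(2) wronskian_Pu[OF elim nr(1-3) u]
      wronskian_Pu[OF elim, of "\<nu> + \<alpha>" "- \<alpha>" \<beta> u A B, unfolded h, OF nr(1,4,5) u] by blast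
  qed
  have P: "wP n c \<beta> (\<i> * of_real \<zeta>) * a' - wP' n c \<beta> (\<i> * of_real \<zeta>) * a = omv n c \<beta>"
    if "n = \<nu> \<and> c = \<alpha> \<or> n = \<nu> + \<alpha> \<and> c = - \<alpha>" for n c
    by (rule limit_value[OF Fp(1) tendsto_diff[OF tendsto_mult[OF cp(1) lp(2)] tendsto_mult[OF cp(2) lp(1)]] e[OF Fp(3) that]])
  have Q: "wP n c \<beta> (- (\<i> * of_real \<zeta>)) * b' - wP' n c \<beta> (- (\<i> * of_real \<zeta>)) * b = omv n c \<beta>"
    if "n = \<nu> \<and> c = \<alpha> \<or> n = \<nu> + \<alpha> \<and> c = - \<alpha>" for n c
    by (rule limit_value[OF Fm(1) tendsto_diff[OF tendsto_mult[OF cp(3) lm(2)] tendsto_mult[OF cp(4) lm(1)]] e[OF Fm(3) that]])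
  have g: "s * p * x' - - \<i> * s * p' * x = w \<Longrightarrow> s * (p * x' + \<i> * p' * x) = w"
    "s * p * x' - \<i> * s * p' * x = w \<Longrightarrow> s * (p * x' - \<i> * p' * x) = w" for s p p' x x' w :: complex
    by (simp_all add: algebra_simps)
  show "sphase \<alpha> * (pcut \<nu> \<alpha> \<beta> \<zeta> * a' + \<i> * pcut' \<nu> \<alpha> \<beta> \<zeta> * a) = omv \<nu> \<alpha> \<beta>"
    using P[of \<nu> \<alpha>] unfolding bd by (intro g(1)) simp
  show "inverse (sphase \<alpha>) * (pcut \<nu> \<alpha> \<beta> \<zeta> * b' - \<i> * pcut' \<nu> \<alpha> \<beta> \<zeta> * b) = omv \<nu> \<alpha> \<beta>"
    using Q[of \<nu> \<alpha>] unfolding bd by (intro g(2)) simp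
  show "sphase (- \<alpha>) * (pcut (\<nu> + \<alpha>) (- \<alpha>) \<beta> \<zeta> * a' + \<i> * pcut' (\<nu> + \<alpha>) (- \<alpha>) \<beta> \<zeta> * a) = omv (\<nu> + \<alpha>) (- \<alpha>) \<beta>"
    using P[of "\<nu> + \<alpha>" "- \<alpha>"] unfolding bd by (intro g(1)) simp
  show "inverse (sphase (- \<alpha>)) * (pcut (\<nu> + \<alpha>) (- \<alpha>) \<beta> \<zeta> * b' - \<i> * pcut' (\<nu> + \<alpha>) (- \<alpha>) \<beta> \<zeta> * b) = omv (\<nu> + \<alpha>) (- \<alpha>) \<beta>"
    using Q[of "\<nu> + \<alpha>" "- \<alpha>"] unfolding bd by (intro g(2)) simp
  have ss: "sphase \<alpha> * sphase (- \<alpha>) = \<i>"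
  proof -
    have "sphase \<alpha> * sphase (- \<alpha>) = exp (\<i> * of_real (pi / 2))"
      unfolding sphase_def exp_add[symmetric] by (rule arg_cong[where f = exp]) (simp add: field_simps)
    thus ?thesis by (simp add: complex_eq_iff Re_exp Im_exp)
  qed
  have PP: "wP \<nu> \<alpha> \<beta> (\<i> * of_real \<zeta>) * wP' (\<nu> + \<alpha>) (- \<alpha>) \<beta> (\<i> * of_real \<zeta>) - wP' \<nu> \<alpha> \<beta> (\<i> * of_real \<zeta>) * wP (\<nu> + \<alpha>) (- \<alpha>) \<beta> (\<i> * of_real \<zeta>)
     = - 2 * sin (of_real pi * \<alpha>) / of_real pi"
    by (rule limit_value[OF Fp(1) tendsto_diff[OF tendsto_mult[OF cp(1) cp(2)] tendsto_mult[OF cp(2) cp(1)]]])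
       (use Fp(3) wronskian_PP in \<open>auto elim!: eventually_mono\<close>)
  have g5: "s * p * (- \<i> * t * q') - - \<i> * s * p' * (t * q) = p * q' - p' * q" if "s * t = \<i>" for s t p p' q q' :: complex
  proof -
    have "s * p * (- \<i> * t * q') - - \<i> * s * p' * (t * q) = - \<i> * (s * t) * (p * q' - p' * q)" by (simp add: algebra_simps)
    thus ?thesis unfolding that by simp
  qed
  show "pcut \<nu> \<alpha> \<beta> \<zeta> * pcut' (\<nu> + \<alpha>) (- \<alpha>) \<beta> \<zeta> - pcut' \<nu> \<alpha> \<beta> \<zeta> * pcut (\<nu> + \<alpha>) (- \<alpha>) \<beta> \<zeta> = - 2 * sin (of_real pi * \<alpha>) / of_real pi"
    using PP unfolding bd g5[OF ss] .
qed

text \<open>Eliminates \<open>pcut'\<close> from the two boundary Wronskians with \<open>wu\<close>,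
  which have the same value \<open>omv \<nu> \<alpha> \<beta>\<close>. Nothing is divided by a sine,
  so the formula holds for integer \<alpha> as well.\<close>

lemma pcut_formula:
  "pcut \<nu> \<alpha> \<beta> \<zeta> * (a' * b + b' * a) = omv \<nu> \<alpha> \<beta> * (inverse (sphase \<alpha>) * b + sphase \<alpha> * a)"
proof -
  have g: "p * (a' * b + b' * a) = w * (t * b + s * a)"
    if "s * (p * a' + \<i> * p' * a) = w" "t * (p * b' - \<i> * p' * b) = w" "s * t = 1" for p p' s t w :: complex
  proof -
    have "p * (a' * b + b' * a) = (s * t) * (p * (a' * b + b' * a))" unfolding that by simp
    also have "\<dots> = s * (p * a' + \<i> * p' * a) * (t * b) + t * (p * b' - \<i> * p' * b) * (s * a)"
      by (simp add: algebra_simps)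
    finally show ?thesis unfolding that(1,2) by (simp add: algebra_simps)
  qed
  show ?thesis by (rule g[OF boundary_wronskians(1,2)]) simp
qed

text \<open>At each of the two boundary points the two functions of the first kind give a linear
  system for the limits of \<open>wu\<close> and its derivative. Its determinant is their Wronskian,
  a multiple of \<open>sin (of_real pi * \<alpha>)\<close>. Solving the systems needs that sine to
  be nonzero, although the result no longer contains it.\<close>

lemma wronskian_ab:
  assumes "sin (of_real pi * \<alpha>) \<noteq> 0"
  shows "a' * b + b' * a = - of_real pi * omv \<nu> \<alpha> \<beta> * omv (\<nu> + \<alpha>) (- \<alpha>) \<beta>"
proof -
  define S where "S = sin (of_real pi * \<alpha>)"
  \<comment> \<open>The phases produce the same sine as the determinant, which is why it cancels in
    the final formula.\<close>
  have sq: "(sphase \<alpha>)\<^sup>2 - (sphase (- \<alpha>))\<^sup>2 = - 2 * S"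
  proof -
    have e: "(sphase c)\<^sup>2 = \<i> * exp (\<i> * (of_real pi * c))" for c
    proof -
      have "(sphase c)\<^sup>2 = exp (\<i> * of_real (pi / 2)) * exp (\<i> * (of_real pi * c))"
        unfolding sphase_def power2_eq_square exp_add[symmetric] by (rule arg_cong[where f = exp]) (simp add: algebra_simps)
      also have "exp (\<i> * of_real (pi / 2)) = \<i>" by (simp add: complex_eq_iff Re_exp Im_exp)
      finally show ?thesis .
    qed
    have "S = (exp (\<i> * (of_real pi * \<alpha>)) - exp (\<i> * (of_real pi * - \<alpha>))) / (2 * \<i>)"
      unfolding S_def sin_exp_eq by simp
    hence d: "exp (\<i> * (of_real pi * \<alpha>)) - exp (\<i> * (of_real pi * - \<alpha>)) = 2 * \<i> * S" by simp
    show ?thesis unfolding e right_diff_distrib[symmetric] d by simp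
  qed
  have g: "x' * y + y' * x = - Pi * w * v"
    if e: "s * (p * x' + \<i> * p' * x) = w" "inverse s * (p * y' - \<i> * p' * y) = w"
      "t * (q * x' + \<i> * q' * x) = v" "inverse t * (q * y' - \<i> * q' * y) = v"
      and wr: "p * q' - p' * q = - 2 * S / Pi" and st: "s\<^sup>2 - t\<^sup>2 = - 2 * S" "s * t = \<i>" and nz: "S \<noteq> 0" "Pi \<noteq> 0"
    for x x' y y' w v s t p p' q q' Pi :: complex
  proof -
    have nzst: "s \<noteq> 0" "t \<noteq> 0" using st(2) by auto
    define D where "D = p * q' - p' * q"
    have "D = - 2 * S / Pi" unfolding D_def by (rule wr)
    hence D: "D \<noteq> 0" "D * Pi = - 2 * S" using nz by simp_all
    have r1: "s \<noteq> 0 \<Longrightarrow> s * X = w \<Longrightarrow> X = w / s" and r2: "s \<noteq> 0 \<Longrightarrow> inverse s * X = w \<Longrightarrow> X = w * s" for s X w :: complex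
      by auto
    have e': "p * x' + \<i> * p' * x = w / s" "q * x' + \<i> * q' * x = v / t" "p * y' - \<i> * p' * y = w * s" "q * y' - \<i> * q' * y = v * t"
      by (rule r1[OF nzst(1) e(1)], rule r1[OF nzst(2) e(3)], rule r2[OF nzst(1) e(2)], rule r2[OF nzst(2) e(4)])
    have x: "\<i> * D * x = p * (v / t) - q * (w / s)" "D * x' = q' * (w / s) - p' * (v / t)"
      and y: "- \<i> * D * y = p * (v * t) - q * (w * s)" "D * y' = q' * (w * s) - p' * (v * t)"
      unfolding e'[symmetric] D_def by (simp_all add: algebra_simps)
    have 1: "t / s - s / t = \<i> * (s\<^sup>2 - t\<^sup>2)"
    proof -
      have "t / s = t\<^sup>2 / (s * t)" "s / t = s\<^sup>2 / (s * t)" using nzst by (simp_all add: power2_eq_square)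
      hence "t / s - s / t = - (s\<^sup>2 - t\<^sup>2) / (s * t)" by (simp add: diff_divide_distrib)
      also have "\<dots> = \<i> * (s\<^sup>2 - t\<^sup>2)" unfolding st(2) by (simp add: algebra_simps)
      finally show ?thesis .
    qed
    have 2: "- \<i> * (p * v1 - q * w1) * (q' * w2 - p' * v2) + \<i> * (q' * w1 - p' * v1) * (p * v2 - q * w2) = \<i> * D * (w1 * v2 - v1 * w2)"
      for v1 w1 v2 w2 unfolding D_def by (simp add: algebra_simps)
    have "D * D * (x' * y + y' * x) = - \<i> * (\<i> * D * x) * (D * y') + \<i> * (D * x') * (- \<i> * D * y)"
      by (simp add: algebra_simps)
    also have "\<dots> = \<i> * D * (w / s * (v * t) - v / t * (w * s))" unfolding x y by (rule 2)
    also have "w / s * (v * t) - v / t * (w * s) = w * v * (t / s - s / t)" by (simp add: algebra_simps)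
    also have "t / s - s / t = \<i> * (- 2 * S)" unfolding 1 st(1) ..
    also have "\<i> * D * (w * v * (\<i> * (- 2 * S))) = D * (2 * S * w * v)" by (simp add: algebra_simps)
    finally have "D * (D * (x' * y + y' * x)) = D * (2 * S * w * v)" by (simp only: mult.assoc)
    hence "D * (x' * y + y' * x) = 2 * S * w * v" using D(1) by simp
    also have "2 * S = - (D * Pi)" using D(2) by simp
    also have "- (D * Pi) * w * v = D * (- Pi * w * v)" by (simp add: algebra_simps)
    finally show ?thesis by (rule mult_left_cancel[OF D(1), THEN iffD1])
  qed
  have ss: "sphase \<alpha> * sphase (- \<alpha>) = \<i>"
  proof -
    have "sphase \<alpha> * sphase (- \<alpha>) = exp (\<i> * of_real (pi / 2))"
      unfolding sphase_def exp_add[symmetric] by (rule arg_cong[where f = exp]) (simp add: field_simps)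
    thus ?thesis by (simp add: complex_eq_iff Re_exp Im_exp)
  qed
  show ?thesis
  proof (rule g)
    show "S \<noteq> 0" using assms by (simp only: S_def not_False_eq_True)
    show "complex_of_real pi \<noteq> 0" by simp
  qed (rule boundary_wronskians[folded S_def] sq ss)+
qed

end


section \<open>The formal solution\<close>

text \<open>In the variables \<open>s = 2 / (1 - \<tau>)\<close>, \<open>c = 2 / (1 + \<tau>)\<close> with \<open>\<tau> = exp (- 2 \<xi>)\<close>, differentiation with
  respect to \<open>\<xi>\<close> is \<open>s' = 2 s - s\<^sup>2\<close>, \<open>c' = 2 c - c\<^sup>2\<close>, and \<open>\<xi> \<mapsto> - \<xi>\<close> is \<open>s \<mapsto> 2 - s\<close>, \<open>c \<mapsto> 2 - c\<close>.\<close>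

definition bco :: "complex \<Rightarrow> complex \<Rightarrow> nat \<Rightarrow> nat \<Rightarrow> complex" where
  "bco \<alpha> \<beta> n l = a_coeff l \<alpha> * a_coeff (n - l) \<beta>"

definition bp :: "complex \<Rightarrow> complex \<Rightarrow> nat \<Rightarrow> complex \<Rightarrow> complex \<Rightarrow> complex" where
  "bp \<alpha> \<beta> n s c = (\<Sum>l\<le>n. bco \<alpha> \<beta> n l * (s ^ l * c ^ (n - l)))"

definition bp' :: "complex \<Rightarrow> complex \<Rightarrow> nat \<Rightarrow> complex \<Rightarrow> complex \<Rightarrow> complex" where
  "bp' \<alpha> \<beta> n s c = (\<Sum>l\<le>n. bco \<alpha> \<beta> n l * (s ^ l * c ^ (n - l) * (of_nat l * (2 - s) + of_nat (n - l) * (2 - c))))"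

definition bp'' :: "complex \<Rightarrow> complex \<Rightarrow> nat \<Rightarrow> complex \<Rightarrow> complex \<Rightarrow> complex" where
  "bp'' \<alpha> \<beta> n s c = (\<Sum>l\<le>n. bco \<alpha> \<beta> n l * (s ^ l * c ^ (n - l) * ((of_nat l * (2 - s) + of_nat (n - l) * (2 - c))\<^sup>2
     - of_nat l * (2 * s - s\<^sup>2) - of_nat (n - l) * (2 * c - c\<^sup>2))))"

text \<open>The potential \<open>qpot A B \<xi>\<close> in the new variables. It is invariant under
  \<open>s \<mapsto> 2 - s\<close>, \<open>c \<mapsto> 2 - c\<close>.\<close>

definition Qp :: "complex \<Rightarrow> complex \<Rightarrow> complex \<Rightarrow> complex \<Rightarrow> complex" where
  "Qp A B s c = A * (s\<^sup>2 - 2 * s) + B * (c\<^sup>2 - 2 * c)"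

text \<open>The \<open>a_coeff\<close> are the coefficients of Hankel's expansions of Bessel
  functions. Their two-term recursion is what the formal solution requires separately in each of its
  two variables.\<close>

lemma a_coeff_Suc: "((of_nat l + 1 / 2)\<^sup>2 - \<mu>\<^sup>2) * a_coeff l \<mu> = - 2 * of_nat (Suc l) * a_coeff (Suc l) \<mu>"
proof -
  have "- 2 * of_nat (Suc l) * a_coeff (Suc l) \<mu> = (1 / 2 + \<mu> + of_nat l) * (1 / 2 - \<mu> + of_nat l) * a_coeff l \<mu>"
  proof -
    have "- 2 * n * (p * x * (q * y) / ((- 2) * P * (n * f))) = x * y * (p * q / (P * f))"
      if "n \<noteq> 0" for n p x q y P f :: complex using that by simp
    from this[OF of_nat_neq_0] show ?thesis unfolding a_coeff_def pochhammer_Suc power_Suc fact_Suc .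
  qed
  also have "(1 / 2 + \<mu> + of_nat l) * (1 / 2 - \<mu> + of_nat l) = (of_nat l + 1 / 2)\<^sup>2 - \<mu>\<^sup>2"
    by (simp add: power2_eq_square algebra_simps)
  finally show ?thesis by simp
qed

lemma a_coeff_0 [simp]: "a_coeff 0 \<mu> = 1" by (simp add: a_coeff_def)

text \<open>The relation between \<open>s\<close> and \<open>c\<close> removes the mixed terms with
  \<open>l * (n - l)\<close>. What remains separates into one part for \<open>s\<close> and one for
  \<open>c\<close>, and each is the recursion for \<open>a_coeff\<close>.\<close>

lemma bp_recurrence:
  assumes "s + c = s * c"
  shows "2 * bp' \<alpha> \<beta> (Suc n) s c = bp'' \<alpha> \<beta> n s c - 2 * of_nat n * bp' \<alpha> \<beta> n s c - Qp (\<alpha>\<^sup>2 - 1 / 4) (\<beta>\<^sup>2 - 1 / 4) s c * bp \<alpha> \<beta> n s c"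
proof -
  let ?L = "\<lambda>l. of_nat (Suc l) * a_coeff (Suc l) \<alpha> * a_coeff (n - l) \<beta> * (s ^ Suc l * c ^ (n - l)) * (2 - s)"
  let ?R = "\<lambda>l. a_coeff l \<alpha> * (of_nat (Suc (n - l)) * a_coeff (Suc (n - l)) \<beta>) * (s ^ l * c ^ Suc (n - l)) * (2 - c)"
  have trm: "bco \<alpha> \<beta> n l * (s ^ l * c ^ (n - l) * ((of_nat l * (2 - s) + of_nat (n - l) * (2 - c))\<^sup>2
     - of_nat l * (2 * s - s\<^sup>2) - of_nat (n - l) * (2 * c - c\<^sup>2)))
     - 2 * of_nat n * (bco \<alpha> \<beta> n l * (s ^ l * c ^ (n - l) * (of_nat l * (2 - s) + of_nat (n - l) * (2 - c))))
     - Qp (\<alpha>\<^sup>2 - 1 / 4) (\<beta>\<^sup>2 - 1 / 4) s c * (bco \<alpha> \<beta> n l * (s ^ l * c ^ (n - l))) = 2 * ?L l + 2 * ?R l"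
    if "l \<le> n" for l
  proof -
    define m where "m = n - l"
    have n: "(of_nat n :: complex) = of_nat l + of_nat m" using that by (simp add: m_def flip: of_nat_add)
    define X Y where "X = (of_nat l :: complex)" and "Y = (of_nat m :: complex)"
    have k: "(X * (2 - s) + Y * (2 - c))\<^sup>2 - X * (2 * s - s\<^sup>2) - Y * (2 * c - c\<^sup>2) - 2 * (X + Y) * (X * (2 - s) + Y * (2 - c))
       - ((\<alpha>\<^sup>2 - 1 / 4) * (s\<^sup>2 - 2 * s) + (\<beta>\<^sup>2 - 1 / 4) * (c\<^sup>2 - 2 * c)) =
       ((X + 1 / 2)\<^sup>2 - \<alpha>\<^sup>2) * (s\<^sup>2 - 2 * s) + ((Y + 1 / 2)\<^sup>2 - \<beta>\<^sup>2) * (c\<^sup>2 - 2 * c)"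
    proof -
      have "(X * (2 - s) + Y * (2 - c))\<^sup>2 - X * (2 * s - s\<^sup>2) - Y * (2 * c - c\<^sup>2) - 2 * (X + Y) * (X * (2 - s) + Y * (2 - c))
       - ((\<alpha>\<^sup>2 - 1 / 4) * (s\<^sup>2 - 2 * s) + (\<beta>\<^sup>2 - 1 / 4) * (c\<^sup>2 - 2 * c)) -
       (((X + 1 / 2)\<^sup>2 - \<alpha>\<^sup>2) * (s\<^sup>2 - 2 * s) + ((Y + 1 / 2)\<^sup>2 - \<beta>\<^sup>2) * (c\<^sup>2 - 2 * c)) = 2 * X * Y * (s * c - (s + c))"
        by (simp add: power2_eq_square algebra_simps)
      thus ?thesis unfolding assms by simp
    qed
    have g: "(a * b) * (S * C * W) - 2 * (X + Y) * ((a * b) * (S * C * V)) - Z * ((a * b) * (S * C))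
        = 2 * (p1 * a1 * b * (s * S * C) * (2 - s)) + 2 * (a * (q1 * b1) * (S * (c * C)) * (2 - c))"
      if "W - 2 * (X + Y) * V - Z = P * (s\<^sup>2 - 2 * s) + Q * (c\<^sup>2 - 2 * c)" "P * a = - 2 * p1 * a1" "Q * b = - 2 * q1 * b1"
      for a b S C W V Z P Q p1 a1 q1 b1 :: complex
    proof -
      have "(a * b) * (S * C * W) - 2 * (X + Y) * ((a * b) * (S * C * V)) - Z * ((a * b) * (S * C)) = a * b * (S * C) * (W - 2 * (X + Y) * V - Z)"
        by (simp add: algebra_simps)
      also have "\<dots> = S * C * ((P * a) * b * (s\<^sup>2 - 2 * s) + (Q * b) * a * (c\<^sup>2 - 2 * c))"
        unfolding that(1) by (simp add: algebra_simps)
      finally show ?thesis unfolding that(2,3) by (simp add: power2_eq_square algebra_simps)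
    qed
    show ?thesis
      unfolding bco_def n m_def[symmetric] X_def[symmetric] Y_def[symmetric] Qp_def power_Suc
      by (rule g[OF k a_coeff_Suc[of l \<alpha>, folded X_def] a_coeff_Suc[of m \<beta>, folded Y_def]])
  qed
  have "bp' \<alpha> \<beta> (Suc n) s c = (\<Sum>l\<le>Suc n. of_nat l * bco \<alpha> \<beta> (Suc n) l * (s ^ l * c ^ (Suc n - l)) * (2 - s))
     + (\<Sum>l\<le>Suc n. bco \<alpha> \<beta> (Suc n) l * of_nat (Suc n - l) * (s ^ l * c ^ (Suc n - l)) * (2 - c))"
    unfolding bp'_def sum.distrib[symmetric] by (intro sum.cong refl) (simp add: algebra_simps)
  also have "(\<Sum>l\<le>Suc n. of_nat l * bco \<alpha> \<beta> (Suc n) l * (s ^ l * c ^ (Suc n - l)) * (2 - s)) = (\<Sum>l\<le>n. ?L l)"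
    unfolding sum.atMost_Suc_shift by (simp add: bco_def mult_ac)
  also have "(\<Sum>l\<le>Suc n. bco \<alpha> \<beta> (Suc n) l * of_nat (Suc n - l) * (s ^ l * c ^ (Suc n - l)) * (2 - c)) = (\<Sum>l\<le>n. ?R l)"
    unfolding sum.atMost_Suc by (simp, intro sum.cong refl) (simp add: bco_def Suc_diff_le mult_ac)
  finally have "2 * bp' \<alpha> \<beta> (Suc n) s c = (\<Sum>l\<le>n. 2 * ?L l + 2 * ?R l)"
    by (simp add: sum.distrib sum_distrib_left)
  also have "\<dots> = bp'' \<alpha> \<beta> n s c - 2 * of_nat n * bp' \<alpha> \<beta> n s c - Qp (\<alpha>\<^sup>2 - 1 / 4) (\<beta>\<^sup>2 - 1 / 4) s c * bp \<alpha> \<beta> n s c"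
    unfolding bp''_def bp'_def bp_def sum_distrib_left sum_subtractf[symmetric]
    by (intro sum.cong refl) (rule trm[symmetric], simp)
  finally show ?thesis .
qed

text \<open>\<open>u * ff u n\<close> is \<open>\<Gamma>(u + 1) / \<Gamma>(u - n)\<close>, so \<open>Fs\<close> is a partial sum of the inverse factorial series, and \<open>rem\<close> is
  the residual it leaves in the differential equation.\<close>

definition ff :: "complex \<Rightarrow> nat \<Rightarrow> complex" where
  "ff u n = (\<Prod>j<n. u - 1 - of_nat j)"

definition Fs :: "complex \<Rightarrow> complex \<Rightarrow> complex \<Rightarrow> nat \<Rightarrow> complex \<Rightarrow> complex \<Rightarrow> complex" where
  "Fs \<alpha> \<beta> u N s c = (\<Sum>n<N. bp \<alpha> \<beta> n s c / ff u n)"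

definition Fs' :: "complex \<Rightarrow> complex \<Rightarrow> complex \<Rightarrow> nat \<Rightarrow> complex \<Rightarrow> complex \<Rightarrow> complex" where
  "Fs' \<alpha> \<beta> u N s c = (\<Sum>n<N. bp' \<alpha> \<beta> n s c / ff u n)"

definition Fs'' :: "complex \<Rightarrow> complex \<Rightarrow> complex \<Rightarrow> nat \<Rightarrow> complex \<Rightarrow> complex \<Rightarrow> complex" where
  "Fs'' \<alpha> \<beta> u N s c = (\<Sum>n<N. bp'' \<alpha> \<beta> n s c / ff u n)"

definition rem :: "complex \<Rightarrow> complex \<Rightarrow> complex \<Rightarrow> nat \<Rightarrow> complex \<Rightarrow> complex \<Rightarrow> complex" where
  "rem \<alpha> \<beta> u N s c = 2 * bp' \<alpha> \<beta> N s c / ff u (N - 1)"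

text \<open>The residuals telescope. By the recurrence the term of index \<open>N\<close>
  contributes \<open>2 * bp'\<close> at \<open>N + 1\<close> minus \<open>2 * (u - N)\<close> times
  \<open>bp'\<close> at \<open>N\<close>, and division by \<open>ff u N\<close> turns the second
  part into the previous residual. The shift in \<open>u - N\<close> is the reason for a factorial
  series instead of powers of \<open>u\<close>.\<close>

lemma Fs_ode:
  assumes sc: "s + c = s * c" and N: "N \<ge> 1" and u: "\<And>j. j < N \<Longrightarrow> u - 1 - of_nat j \<noteq> 0"
  shows "Fs'' \<alpha> \<beta> u N s c - 2 * u * Fs' \<alpha> \<beta> u N s c - Qp (\<alpha>\<^sup>2 - 1 / 4) (\<beta>\<^sup>2 - 1 / 4) s c * Fs \<alpha> \<beta> u N s c = rem \<alpha> \<beta> u N s c"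
  using N u
proof (induction N rule: nat_induct_at_least)
  case base
  have "bp' \<alpha> \<beta> 0 s c = 0" "bp'' \<alpha> \<beta> 0 s c = 0" "bp \<alpha> \<beta> 0 s c = 1" by (simp_all add: bp'_def bp''_def bp_def bco_def)
  thus ?case using bp_recurrence[OF sc, of \<alpha> \<beta> 0] by (simp add: Fs_def Fs'_def Fs''_def rem_def ff_def)
next
  case (Suc N)
  have u': "u - of_nat N \<noteq> 0" using Suc.prems[of "N - 1"] Suc.hyps by (cases N) auto
  have f: "ff u N = ff u (N - 1) * (u - of_nat N)" using Suc.hyps by (cases N) (simp_all add: ff_def)
  have fN: "ff u N \<noteq> 0" using Suc.prems by (auto simp: ff_def)
  hence fN1: "ff u (N - 1) \<noteq> 0" using f by auto
  let ?Q = "Qp (\<alpha>\<^sup>2 - 1 / 4) (\<beta>\<^sup>2 - 1 / 4) s c"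
  have IH: "Fs'' \<alpha> \<beta> u N s c - 2 * u * Fs' \<alpha> \<beta> u N s c - ?Q * Fs \<alpha> \<beta> u N s c = rem \<alpha> \<beta> u N s c"
    using Suc by simp
  have "Fs'' \<alpha> \<beta> u (Suc N) s c - 2 * u * Fs' \<alpha> \<beta> u (Suc N) s c - ?Q * Fs \<alpha> \<beta> u (Suc N) s c
     = rem \<alpha> \<beta> u N s c + (bp'' \<alpha> \<beta> N s c - 2 * u * bp' \<alpha> \<beta> N s c - ?Q * bp \<alpha> \<beta> N s c) / ff u N"
    unfolding IH[symmetric] Fs_def Fs'_def Fs''_def sum.lessThan_Suc by (simp add: algebra_simps diff_divide_distrib add_divide_distrib)
  also have "bp'' \<alpha> \<beta> N s c - 2 * u * bp' \<alpha> \<beta> N s c - ?Q * bp \<alpha> \<beta> N s c = 2 * bp' \<alpha> \<beta> (Suc N) s c - 2 * (u - of_nat N) * bp' \<alpha> \<beta> N s c"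
    unfolding bp_recurrence[OF sc] by (simp add: algebra_simps)
  also have "rem \<alpha> \<beta> u N s c + \<dots> / ff u N = rem \<alpha> \<beta> u (Suc N) s c"
  proof -
    have "2 * b / f + (2 * B - 2 * v * b) / (f * v) = 2 * B / (f * v)" if "f \<noteq> 0" "v \<noteq> 0" for b f B v :: complex
      using that by (simp add: diff_divide_distrib)
    from this[OF fN1 u'] show ?thesis unfolding rem_def diff_Suc_1 f .
  qed
  finally show ?case .
qed

text \<open>\<open>\<kappa> = 1\<close> serves for \<open>s\<close>, \<open>c\<close> themselves and
  \<open>\<kappa> = - 1\<close> for \<open>2 - s\<close>, \<open>2 - c\<close>, which satisfy the
  same equation with the opposite sign.\<close>

lemma bp_deriv:
  fixes s c :: "complex \<Rightarrow> complex"
  assumes "(s has_field_derivative \<kappa> * (2 * s x - (s x)\<^sup>2)) (at x)" "(c has_field_derivative \<kappa> * (2 * c x - (c x)\<^sup>2)) (at x)"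
  shows "((\<lambda>x. bp \<alpha> \<beta> n (s x) (c x)) has_field_derivative \<kappa> * bp' \<alpha> \<beta> n (s x) (c x)) (at x)"
    "((\<lambda>x. bp' \<alpha> \<beta> n (s x) (c x)) has_field_derivative \<kappa> * bp'' \<alpha> \<beta> n (s x) (c x)) (at x)"
proof -
  have pw: "((\<lambda>x. f x ^ l) has_field_derivative \<kappa> * (of_nat l * (f x ^ l * (2 - f x)))) (at x)"
    if "(f has_field_derivative \<kappa> * (2 * f x - (f x)\<^sup>2)) (at x)" for f :: "complex \<Rightarrow> complex" and l
  proof (cases l)
    case (Suc m)
    show ?thesis by (rule DERIV_cong[OF DERIV_power[OF that, of l]]) (simp add: Suc power2_eq_square algebra_simps)
  qed simp
  have p: "((\<lambda>x. s x ^ l * c x ^ m) has_field_derivative \<kappa> * (s x ^ l * c x ^ m * (of_nat l * (2 - s x) + of_nat m * (2 - c x)))) (at x)" for l m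
    by (rule DERIV_cong[OF DERIV_mult[OF pw[OF assms(1), of l] pw[OF assms(2), of m]]]) (simp add: algebra_simps)
  have q: "((\<lambda>x. of_nat l * (2 - s x) + of_nat m * (2 - c x)) has_field_derivative
      - \<kappa> * (of_nat l * (2 * s x - (s x)\<^sup>2) + of_nat m * (2 * c x - (c x)\<^sup>2))) (at x)" for l m :: nat
    by (rule DERIV_cong[OF DERIV_add[OF DERIV_cmult[OF DERIV_diff[OF DERIV_const assms(1)]] DERIV_cmult[OF DERIV_diff[OF DERIV_const assms(2)]]]])
       (simp add: algebra_simps)
  show "((\<lambda>x. bp \<alpha> \<beta> n (s x) (c x)) has_field_derivative \<kappa> * bp' \<alpha> \<beta> n (s x) (c x)) (at x)"
    unfolding bp_def bp'_def sum_distrib_left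
    by (intro DERIV_sum DERIV_cong[OF DERIV_cmult[OF p]]) (simp add: mult_ac)
  show "((\<lambda>x. bp' \<alpha> \<beta> n (s x) (c x)) has_field_derivative \<kappa> * bp'' \<alpha> \<beta> n (s x) (c x)) (at x)"
    unfolding bp'_def bp''_def sum_distrib_left
    by (intro DERIV_sum DERIV_cong[OF DERIV_cmult[OF DERIV_mult[OF p q]]]) (simp add: power2_eq_square algebra_simps)
qed

lemma Fs_deriv:
  fixes s c :: "complex \<Rightarrow> complex"
  assumes "(s has_field_derivative \<kappa> * (2 * s x - (s x)\<^sup>2)) (at x)" "(c has_field_derivative \<kappa> * (2 * c x - (c x)\<^sup>2)) (at x)"
  shows "((\<lambda>x. Fs \<alpha> \<beta> u N (s x) (c x)) has_field_derivative \<kappa> * Fs' \<alpha> \<beta> u N (s x) (c x)) (at x)"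
    "((\<lambda>x. Fs' \<alpha> \<beta> u N (s x) (c x)) has_field_derivative \<kappa> * Fs'' \<alpha> \<beta> u N (s x) (c x)) (at x)"
  unfolding Fs_def Fs'_def Fs''_def sum_distrib_left times_divide_eq_right
  by (intro DERIV_sum DERIV_cdivide bp_deriv assms)+

definition sv :: "complex \<Rightarrow> complex" where "sv \<xi> = 2 / (1 - exp (- 2 * \<xi>))"
definition cv :: "complex \<Rightarrow> complex" where "cv \<xi> = 2 / (1 + exp (- 2 * \<xi>))"

lemma sv_cv:
  assumes "1 - exp (- 2 * \<xi>) \<noteq> 0" "1 + exp (- 2 * \<xi>) \<noteq> 0"
  shows "sv \<xi> + cv \<xi> = sv \<xi> * cv \<xi>" "2 - sv \<xi> = - exp (- 2 * \<xi>) * sv \<xi>" "2 - cv \<xi> = exp (- 2 * \<xi>) * cv \<xi>"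
    "(sv has_field_derivative (2 * sv \<xi> - (sv \<xi>)\<^sup>2)) (at \<xi>)" "(cv has_field_derivative (2 * cv \<xi> - (cv \<xi>)\<^sup>2)) (at \<xi>)"
proof -
  define t where "t = exp (- 2 * \<xi>)"
  note n = assms[folded t_def]
  show "2 - sv \<xi> = - exp (- 2 * \<xi>) * sv \<xi>" "2 - cv \<xi> = exp (- 2 * \<xi>) * cv \<xi>"
    unfolding sv_def cv_def t_def[symmetric] using n by (simp_all add: field_simps)
  show "sv \<xi> + cv \<xi> = sv \<xi> * cv \<xi>"
    unfolding sv_def cv_def t_def[symmetric] using n by (simp add: add_frac_eq)
  have s1: "2 * sv \<xi> - (sv \<xi>)\<^sup>2 = - 4 * t / (1 - t)\<^sup>2" and c1: "2 * cv \<xi> - (cv \<xi>)\<^sup>2 = 4 * t / (1 + t)\<^sup>2"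
    unfolding sv_def cv_def t_def[symmetric] using n by (simp_all add: divide_simps power2_eq_square)
  have dt: "((\<lambda>\<xi>. exp (- 2 * \<xi>)) has_field_derivative - 2 * t) (at \<xi>)"
    unfolding t_def by (rule derivative_eq_intros refl)+ simp
  have "((\<lambda>\<xi>. 2 / (1 - exp (- 2 * \<xi>))) has_field_derivative (0 * (1 - t) - 2 * (0 - (- 2 * t))) / ((1 - t) * (1 - t))) (at \<xi>)"
    unfolding t_def by (intro DERIV_divide[OF DERIV_const DERIV_diff[OF DERIV_const dt[unfolded t_def]]] assms)
  thus "(sv has_field_derivative (2 * sv \<xi> - (sv \<xi>)\<^sup>2)) (at \<xi>)"
    unfolding s1 unfolding sv_def[abs_def] by (rule DERIV_cong) (simp add: power2_eq_square)
  have "((\<lambda>\<xi>. 2 / (1 + exp (- 2 * \<xi>))) has_field_derivative (0 * (1 + t) - 2 * (0 + (- 2 * t))) / ((1 + t) * (1 + t))) (at \<xi>)"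
    unfolding t_def by (intro DERIV_divide[OF DERIV_const DERIV_add[OF DERIV_const dt[unfolded t_def]]] assms)
  thus "(cv has_field_derivative (2 * cv \<xi> - (cv \<xi>)\<^sup>2)) (at \<xi>)"
    unfolding c1 unfolding cv_def[abs_def] by (rule DERIV_cong) (simp add: power2_eq_square)
qed

subsection \<open>Bounds\<close>

definition acB :: "real \<Rightarrow> nat \<Rightarrow> real" where
  "acB M l = (\<Prod>i<l. 1 / 2 + M + real i) * (\<Prod>i<l. 1 / 2 + M + real i)"

lemma norm_a_coeff:
  assumes "norm \<mu> \<le> M" shows "norm (a_coeff l \<mu>) \<le> acB M l"
proof -
  have p: "norm (pochhammer (1 / 2 + z) l) \<le> (\<Prod>i<l. 1 / 2 + M + real i)" if "norm z \<le> M" for z :: complex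
  proof -
    have "norm (1 / 2 + z + of_nat i) \<le> 1 / 2 + M + real i" for i
      using norm_triangle_ineq[of "1 / 2 + z" "of_nat i"] norm_triangle_ineq[of "1 / 2" z] that by simp
    thus ?thesis unfolding pochhammer_prod atLeast0LessThan prod_norm[symmetric] by (intro prod_mono) auto
  qed
  have "M \<ge> 0" using assms norm_ge_zero order_trans by blast
  hence pos: "(\<Prod>i<l. 1 / 2 + M + real i) \<ge> 0" by (intro prod_nonneg) auto
  have "norm (a_coeff l \<mu>) = norm (pochhammer (1 / 2 + \<mu>) l) * norm (pochhammer (1 / 2 + (- \<mu>)) l) / (2 ^ l * fact l)"
    by (simp add: a_coeff_def norm_mult norm_divide norm_power)
  also have "\<dots> \<le> acB M l / (2 ^ l * fact l)"
    unfolding acB_def by (intro divide_right_mono mult_mono p pos) (use assms in auto)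
  also have "\<dots> \<le> acB M l / 1"
  proof (intro divide_left_mono)
    have "(1::real) * 1 \<le> 2 ^ l * fact l" by (intro mult_mono) (auto simp: fact_ge_1)
    thus "(1::real) \<le> 2 ^ l * fact l" by simp
  qed (use pos in \<open>auto simp: acB_def\<close>)
  finally show ?thesis by simp
qed

lemma acB_nonneg: "M \<ge> 0 \<Longrightarrow> acB M l \<ge> 0"
  by (auto simp: acB_def intro!: mult_nonneg_nonneg prod_nonneg)

text \<open>A common majorant for \<open>bp\<close> and \<open>bp'\<close>: the factor
  \<open>real (Suc n) * R\<close> beyond \<open>R ^ n\<close> pays for the differentiation.\<close>

definition bB :: "real \<Rightarrow> real \<Rightarrow> nat \<Rightarrow> real" where
  "bB M R n = real (Suc n) * R ^ Suc n * (\<Sum>l\<le>n. acB M l * acB M (n - l))"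

lemma bB_nonneg: "M \<ge> 0 \<Longrightarrow> R \<ge> 0 \<Longrightarrow> bB M R n \<ge> 0"
  by (auto simp: bB_def intro!: mult_nonneg_nonneg sum_nonneg acB_nonneg)

lemma bco_bound: "norm \<alpha> \<le> M \<Longrightarrow> norm \<beta> \<le> M \<Longrightarrow> norm (bco \<alpha> \<beta> n l) \<le> acB M l * acB M (n - l)"
  unfolding bco_def norm_mult by (intro mult_mono norm_a_coeff acB_nonneg) (auto intro: order_trans[OF norm_ge_zero])

lemma sum_bco_bound:
  assumes "norm \<alpha> \<le> M" "norm \<beta> \<le> M" "\<And>l. l \<le> n \<Longrightarrow> norm (f l) \<le> X * (real (Suc n) * R ^ Suc n)"
  shows "norm (\<Sum>l\<le>n. bco \<alpha> \<beta> n l * f l) \<le> X * bB M R n"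
proof -
  have M: "M \<ge> 0" using assms(1) norm_ge_zero order_trans by blast
  have "norm (\<Sum>l\<le>n. bco \<alpha> \<beta> n l * f l) \<le> (\<Sum>l\<le>n. (acB M l * acB M (n - l)) * (X * (real (Suc n) * R ^ Suc n)))"
    by (intro sum_norm_le, unfold norm_mult, intro mult_mono bco_bound assms mult_nonneg_nonneg acB_nonneg M) auto
  thus ?thesis by (simp add: bB_def sum_distrib_right sum_distrib_left mult_ac)
qed

lemma monom_bound:
  fixes s c :: complex
  assumes "norm s \<le> R" "norm c \<le> R" "l \<le> n"
  shows "norm (s ^ l * c ^ (n - l)) \<le> R ^ n"
proof -
  have "norm (s ^ l * c ^ (n - l)) \<le> R ^ l * R ^ (n - l)"
    unfolding norm_mult norm_power
    by (intro mult_mono power_mono assms) (use order_trans[OF norm_ge_zero assms(1)] in auto)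
  thus ?thesis using assms(3) by (simp flip: power_add)
qed

lemma bp_bound:
  assumes "norm \<alpha> \<le> M" "norm \<beta> \<le> M" "norm s \<le> R" "norm c \<le> R" "R \<ge> 1"
  shows "norm (bp \<alpha> \<beta> n s c) \<le> bB M R n"
proof -
  have "norm (s ^ l * c ^ (n - l)) \<le> 1 * (real (Suc n) * R ^ Suc n)" if "l \<le> n" for l
  proof -
    have "R ^ n \<le> R ^ Suc n" by (rule power_increasing) (use assms in auto)
    also have "\<dots> \<le> real (Suc n) * R ^ Suc n" using mult_right_mono[of 1 "real (Suc n)" "R ^ Suc n"] assms(5) by simp
    finally show ?thesis using monom_bound[OF assms(3,4) that] by simp
  qed
  from sum_bco_bound[OF assms(1,2) this] show ?thesis unfolding bp_def by simp
qed

text \<open>Differentiation brings out \<open>2 - s = - t * s\<close> or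
  \<open>2 - c = t * c\<close>, hence a factor \<open>t\<close>, which is
  \<open>exp (- 2 * \<xi>)\<close> in the application. In the reflected variables the small factor
  comes instead from the monomial itself, which is why \<open>n \<ge> 1\<close> is required there.
  This decay makes the residual integrable along rays.\<close>

lemma bp'_bound:
  assumes "norm \<alpha> \<le> M" "norm \<beta> \<le> M" "norm s \<le> R" "norm c \<le> R" "R \<ge> 1" "2 - s = - t * s" "2 - c = t * c"
  shows "norm (bp' \<alpha> \<beta> n s c) \<le> norm t * bB M R n"
    "norm t \<le> 1 \<Longrightarrow> n \<ge> 1 \<Longrightarrow> norm (bp' \<alpha> \<beta> n (2 - s) (2 - c)) \<le> norm t * bB M R n"
    "norm t \<le> 1 \<Longrightarrow> norm (bp \<alpha> \<beta> n (2 - s) (2 - c)) \<le> bB M R n"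
proof -
  have lin: "norm (of_nat l * x + of_nat (n - l) * y) \<le> real (Suc n) * R" if "norm x \<le> R" "norm y \<le> R" "l \<le> n" for x y :: complex and l
  proof -
    have "norm (of_nat l * x + of_nat (n - l) * y) \<le> real l * R + real (n - l) * R"
      by (rule order_trans[OF norm_triangle_ineq], unfold norm_mult norm_of_nat, intro add_mono mult_left_mono that) auto
    also have "\<dots> = real n * R" using that(3) by (simp add: of_nat_diff algebra_simps)
    also have "\<dots> \<le> real (Suc n) * R" using assms(5) by (intro mult_right_mono) auto
    finally show ?thesis .
  qed
  have R0: "R \<ge> 0" using assms(5) by simp
  have "norm (s ^ l * c ^ (n - l) * (of_nat l * (2 - s) + of_nat (n - l) * (2 - c))) \<le> norm t * (real (Suc n) * R ^ Suc n)" if "l \<le> n" for l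
  proof -
    have "of_nat l * (2 - s) + of_nat (n - l) * (2 - c) = t * (of_nat l * (- s) + of_nat (n - l) * c)"
      unfolding assms(6,7) by (simp add: algebra_simps)
    hence "norm (s ^ l * c ^ (n - l) * (of_nat l * (2 - s) + of_nat (n - l) * (2 - c))) =
       norm t * (norm (s ^ l * c ^ (n - l)) * norm (of_nat l * (- s) + of_nat (n - l) * c))"
      by (simp only: norm_mult mult_ac)
    also have "\<dots> \<le> norm t * (R ^ n * (real (Suc n) * R))"
      by (intro mult_left_mono mult_mono monom_bound lin assms that) (use assms R0 in auto)
    finally show ?thesis by (simp add: mult_ac)
  qed
  from sum_bco_bound[OF assms(1,2) this] show "norm (bp' \<alpha> \<beta> n s c) \<le> norm t * bB M R n" unfolding bp'_def by simp
  {
    assume t: "norm t \<le> 1"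
    have ns: "norm (2 - s) \<le> R" "norm (2 - c) \<le> R" "norm (2 - s) \<le> norm t * R" "norm (2 - c) \<le> norm t * R"
    proof -
      show a: "norm (2 - s) \<le> norm t * R" "norm (2 - c) \<le> norm t * R" unfolding assms(6,7) norm_mult norm_minus_cancel
        by (intro mult_left_mono assms norm_ge_zero)+
      have "norm t * R \<le> R" using t R0 by (simp add: mult_left_le_one_le)
      thus "norm (2 - s) \<le> R" "norm (2 - c) \<le> R" using a by linarith+
    qed
    show "norm (bp \<alpha> \<beta> n (2 - s) (2 - c)) \<le> bB M R n" by (rule bp_bound[OF assms(1,2) ns(1,2) assms(5)])
    assume n: "n \<ge> 1"
    have "norm ((2 - s) ^ l * (2 - c) ^ (n - l) * (of_nat l * (2 - (2 - s)) + of_nat (n - l) * (2 - (2 - c)))) \<le> norm t * (real (Suc n) * R ^ Suc n)" if "l \<le> n" for l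
    proof -
      have "norm ((2 - s) ^ l * (2 - c) ^ (n - l)) \<le> (norm t * R) ^ n" by (rule monom_bound[OF ns(3,4) that])
      also have "\<dots> \<le> norm t * R ^ n"
      proof -
        have "norm t ^ n \<le> norm t ^ 1" by (rule power_decreasing) (use n t in auto)
        thus ?thesis unfolding power_mult_distrib using R0 by (intro mult_right_mono) auto
      qed
      finally have "norm ((2 - s) ^ l * (2 - c) ^ (n - l)) * norm (of_nat l * (2 - (2 - s)) + of_nat (n - l) * (2 - (2 - c))) \<le> (norm t * R ^ n) * (real (Suc n) * R)"
        by (intro mult_mono lin that) (use assms(3,4) R0 in simp_all)
      thus ?thesis unfolding norm_mult by (simp add: mult_ac)
    qed
    from sum_bco_bound[OF assms(1,2) this] show "norm (bp' \<alpha> \<beta> n (2 - s) (2 - c)) \<le> norm t * bB M R n" unfolding bp'_def by simp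
  }
qed

lemma ff_bound:
  assumes "norm u \<ge> 2 * real n"
  shows "norm (ff u n) \<ge> (norm u / 2) ^ n"
proof -
  have "(\<Prod>j<n. norm u / 2) \<le> (\<Prod>j<n. norm (u - 1 - of_nat j))"
  proof (intro prod_mono conjI)
    fix j assume "j \<in> {..<n}"
    hence j: "1 + real j \<le> real n" by auto
    have "norm u - norm (1 + of_nat j :: complex) \<le> norm (u - (1 + of_nat j))" by (rule norm_triangle_ineq2)
    moreover have "norm (1 + of_nat j :: complex) = 1 + real j" by (metis norm_of_nat of_nat_Suc of_nat_1 of_nat_add plus_1_eq_Suc)
    ultimately show "norm u / 2 \<le> norm (u - 1 - of_nat j)" using j assms by (simp add: algebra_simps)
  qed auto
  thus ?thesis by (simp add: ff_def prod_norm)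
qed


subsection \<open>Estimates along rays\<close>

text \<open>Since \<open>Re \<mu> \<ge> 0\<close>, the homogeneous solutions do not decay, so that the condition at infinity picks the
  small solution.\<close>

lemma decay:
  fixes z r :: "real \<Rightarrow> complex"
  assumes d: "\<And>t. t \<ge> 0 \<Longrightarrow> (z has_vector_derivative (\<mu> * z t + r t)) (at t)"
    and r: "\<And>t. t \<ge> 0 \<Longrightarrow> norm (r t) \<le> R * exp (- m * t)"
    and m: "m > 0" "Re \<mu> \<ge> 0" and z: "(z \<longlongrightarrow> 0) at_top" and t: "t \<ge> 0"
  shows "norm (z t) \<le> R / (m + Re \<mu>) * exp (- m * t)"
proof -
  \<comment> \<open>Integrating factor: the derivative of \<open>y\<close> is
    \<open>exp (- \<mu> * t) * r t\<close>. It is compared with that of \<phi> and integrated from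
    \<open>t\<close> to infinity, where \<open>y\<close> vanishes.\<close>
  define y where "y = (\<lambda>t. exp (- \<mu> * of_real t) * z t)"
  define a where "a = m + Re \<mu>"
  have a: "a > 0" using m by (simp add: a_def)
  have dy: "(y has_vector_derivative (exp (- \<mu> * of_real t) * r t)) (at t)" if "t \<ge> 0" for t
  proof -
    have "((\<lambda>t. exp (- \<mu> * of_real t)) has_vector_derivative (exp (- \<mu> * of_real t) * (- \<mu>))) (at t)"
    proof (rule has_vector_derivative_real_field)
      show "((\<lambda>x. exp (- \<mu> * x)) has_field_derivative (exp (- \<mu> * of_real t) * (- \<mu>))) (at (of_real t))"
        by (rule derivative_eq_intros refl)+ simp
    qed
    from has_vector_derivative_mult[OF this d[OF that]] show ?thesis
      unfolding y_def by (rule has_vector_derivative_eq_rhs) (simp add: algebra_simps)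
  qed
  have ne: "norm (exp (- \<mu> * of_real t)) = exp (- Re \<mu> * t)" for t by simp
  define \<phi> where "\<phi> = (\<lambda>t. - (R / a) * exp (- a * t))"
  have dphi: "(\<phi> has_vector_derivative (R * exp (- a * t))) (at t)" for t
    unfolding \<phi>_def has_real_derivative_iff_has_vector_derivative[symmetric]
    by (rule derivative_eq_intros refl)+ (use a in simp)
  have bound: "norm (y s - y t) \<le> R / a * exp (- a * t)" if "s > t" for s
  proof -
    have "norm (y s - y t) \<le> \<phi> s - \<phi> t"
    proof (rule differentiable_bound_general[OF that])
      have "x \<ge> 0" if "x \<in> {t..s}" for x using t that by auto
      thus "continuous_on {t..s} y"
        by (auto intro!: continuous_at_imp_continuous_on has_vector_derivative_continuous[OF dy])
      show "continuous_on {t..s} \<phi>"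
        by (auto intro!: continuous_at_imp_continuous_on has_vector_derivative_continuous[OF dphi])
      fix x assume x: "t < x" "x < s"
      show "(y has_vector_derivative (exp (- \<mu> * of_real x) * r x)) (at x)" using dy[of x] t x by simp
      show "(\<phi> has_vector_derivative (R * exp (- a * x))) (at x)" by (rule dphi)
      have "norm (exp (- \<mu> * of_real x) * r x) \<le> exp (- Re \<mu> * x) * (R * exp (- m * x))"
        unfolding norm_mult ne by (intro mult_left_mono r) (use t x in auto)
      also have "\<dots> = R * exp (- a * x)" by (simp add: a_def algebra_simps flip: exp_add)
      finally show "norm (exp (- \<mu> * of_real x) * r x) \<le> R * exp (- a * x)" .
    qed
    also have "\<dots> \<le> R / a * exp (- a * t)"
    proof -
      have "R \<ge> 0" using order_trans[OF norm_ge_zero r[of 0]] by simp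
      hence "R / a * exp (- a * s) \<ge> 0" using a by simp
      thus ?thesis by (simp add: \<phi>_def)
    qed
    finally show ?thesis .
  qed
  have "(y \<longlongrightarrow> 0) at_top"
  proof (rule Lim_null_comparison[OF _ tendsto_norm_zero[OF z]])
    show "\<forall>\<^sub>F x in at_top. norm (y x) \<le> norm (z x)"
      using eventually_ge_at_top[of 0]
    proof eventually_elim
      case (elim x)
      have "exp (- Re \<mu> * x) \<le> 1" using m elim by simp
      thus ?case unfolding y_def norm_mult ne by (intro mult_left_le_one_le) auto
    qed
  qed
  hence "((\<lambda>s. norm (y s - y t)) \<longlongrightarrow> norm (0 - y t)) at_top" by (intro tendsto_intros)
  hence "norm (0 - y t) \<le> R / a * exp (- a * t)"
    by (rule tendsto_upperbound) (use bound in \<open>auto intro: eventually_mono[OF eventually_gt_at_top[of t]]\<close>)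
  hence "norm (y t) \<le> R / a * exp (- a * t)" by simp
  hence "exp (Re \<mu> * t) * norm (y t) \<le> exp (Re \<mu> * t) * (R / a * exp (- a * t))" by (intro mult_left_mono) auto
  moreover have "exp (Re \<mu> * t) * norm (y t) = norm (z t)"
    unfolding y_def norm_mult ne mult.assoc[symmetric] exp_add[symmetric] by simp
  moreover have "exp (Re \<mu> * t) * (R / a * exp (- a * t)) = R / a * (exp (Re \<mu> * t) * exp (- a * t))" by simp
  moreover have "exp (Re \<mu> * t) * exp (- a * t) = exp (- m * t)"
    unfolding exp_add[symmetric] by (simp add: a_def algebra_simps)
  ultimately have "norm (z t) \<le> R / a * exp (- m * t)" by (simp only:)
  thus ?thesis by (simp only: a_def)
qed

text \<open>\<open>y\<close> and \<open>z\<close> stand for the error and its derivative along a ray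
  with direction \<open>e\<close>. With \<open>X\<close> the supremum of \<open>norm (y t)\<close>,
  \<open>decay\<close> bounds \<open>z\<close> by a multiple of \<open>Q * X + P\<close>;
  integrating once more bounds \<open>y\<close>, and so \<open>X\<close>, in the same way. The
  condition \<open>2 * Q \<le> \<kappa>\<^sup>2 * norm u\<close> makes the factor in front of
  \<open>X\<close> at most 1/2, and \<open>X\<close> is absorbed.\<close>

lemma ray_estimate:
  fixes y z q r :: "real \<Rightarrow> complex" and u e :: complex
  assumes dy: "\<And>t. t \<ge> 0 \<Longrightarrow> (y has_vector_derivative (e * z t)) (at t)"
    and dz: "\<And>t. t \<ge> 0 \<Longrightarrow> (z has_vector_derivative (e * (2 * u * z t + q t * y t - r t))) (at t)"
    and q: "\<And>t. t \<ge> 0 \<Longrightarrow> norm (q t) \<le> Q * exp (- (2 * \<kappa>) * t)" and r: "\<And>t. t \<ge> 0 \<Longrightarrow> norm (r t) \<le> P * exp (- (2 * \<kappa>) * t)"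
    and lim: "(y \<longlongrightarrow> 0) at_top" "(z \<longlongrightarrow> 0) at_top"
    and e: "norm e \<le> 2" "Re (u * e) \<ge> \<kappa> * norm u" and \<kappa>: "\<kappa> > 0" and u: "norm u > 0" "2 * Q \<le> \<kappa>\<^sup>2 * norm u"
  shows "norm (y 0) \<le> 2 * P / (\<kappa>\<^sup>2 * norm u)" "norm (z 0) \<le> 2 * P / (\<kappa> * norm u)"
proof -
  let ?m = "2 * \<kappa>"
  have Q0: "Q \<ge> 0" using order_trans[OF norm_ge_zero q[of 0]] by simp
  have P0: "P \<ge> 0" using order_trans[OF norm_ge_zero r[of 0]] by simp
  have "eventually (\<lambda>t. norm (y t) < 1) at_top" using order_tendstoD(2)[OF tendsto_norm_zero[OF lim(1)], of 1] by simp
  then obtain T where T: "\<And>t. t \<ge> T \<Longrightarrow> norm (y t) < 1" unfolding eventually_at_top_linorder by blast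
  have "continuous_on {0..max T 0} (\<lambda>t. norm (y t))"
    by (intro continuous_on_norm continuous_at_imp_continuous_on ballI has_vector_derivative_continuous[OF dy]) auto
  hence "bounded ((\<lambda>t. norm (y t)) ` {0..max T 0})" by (intro compact_imp_bounded compact_continuous_image) auto
  then obtain B where B: "\<And>t. t \<in> {0..max T 0} \<Longrightarrow> norm (y t) \<le> B" unfolding bounded_iff by (metis image_eqI abs_norm_cancel real_norm_def)
  have bd: "norm (y t) \<le> max B 1" if "t \<ge> 0" for t
    using B[of t] T[of t] that by (cases "t \<le> max T 0") (auto simp: le_max_iff_disj not_le less_imp_le)
  \<comment> \<open>Finite, because \<open>y\<close> is continuous and tends to 0.\<close>
  define X where "X = (SUP t\<in>{0..}. norm (y t))"
  have bdd: "bdd_above ((\<lambda>t. norm (y t)) ` {0..})" using bd by (intro bdd_aboveI2) auto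
  have yX: "norm (y t) \<le> X" if "t \<ge> 0" for t unfolding X_def using that by (intro cSUP_upper bdd) auto
  have X0: "X \<ge> 0" using yX[of 0] norm_ge_zero[of "y 0"] by linarith
  define K where "K = Q * X + P"
  have K0: "K \<ge> 0" using Q0 X0 P0 by (simp add: K_def)
  have zb: "norm (z t) \<le> K / (\<kappa> * norm u) * exp (- ?m * t)" if "t \<ge> 0" for t
  proof -
    have "norm (z t) \<le> 2 * K / (?m + Re (2 * u * e)) * exp (- ?m * t)"
    proof (rule decay[where \<mu> = "2 * u * e" and r = "\<lambda>t. e * (q t * y t - r t)"])
      fix t :: real assume t: "t \<ge> 0"
      show "(z has_vector_derivative 2 * u * e * z t + e * (q t * y t - r t)) (at t)"
        by (rule has_vector_derivative_eq_rhs[OF dz[OF t]]) (simp add: algebra_simps)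
      have "norm (q t * y t - r t) \<le> (Q * exp (- ?m * t)) * X + P * exp (- ?m * t)"
        by (rule order_trans[OF norm_triangle_ineq4], unfold norm_mult, intro add_mono mult_mono q r t yX)
           (use Q0 in auto)
      hence "norm e * norm (q t * y t - r t) \<le> 2 * ((Q * exp (- ?m * t)) * X + P * exp (- ?m * t))"
        using e(1) by (intro mult_mono) auto
      also have "\<dots> = 2 * K * exp (- ?m * t)" by (simp add: K_def algebra_simps)
      finally show "norm (e * (q t * y t - r t)) \<le> 2 * K * exp (- ?m * t)" by (simp only: norm_mult)
    next
      have "\<kappa> * norm u \<ge> 0" using \<kappa> by simp
      thus "Re (2 * u * e) \<ge> 0" using e(2) by (simp add: mult.assoc)
    qed (use \<kappa> lim that in auto)
    also have "\<dots> \<le> K / (\<kappa> * norm u) * exp (- ?m * t)"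
    proof (intro mult_right_mono)
      have "2 * (\<kappa> * norm u) \<le> ?m + Re (2 * u * e)" using e(2) \<kappa> by (simp add: mult.assoc)
      hence "2 * K / (?m + Re (2 * u * e)) \<le> 2 * K / (2 * (\<kappa> * norm u))"
        by (rule frac_le[rotated 3]) (use K0 \<kappa> u(1) in auto)
      thus "2 * K / (?m + Re (2 * u * e)) \<le> K / (\<kappa> * norm u)" by simp
    qed auto
    finally show ?thesis .
  qed
  have yb: "norm (y t) \<le> K / (\<kappa>\<^sup>2 * norm u)" if "t \<ge> 0" for t
  proof -
    have "norm (y t) \<le> 2 * (K / (\<kappa> * norm u)) / (?m + Re 0) * exp (- ?m * t)"
    proof (rule decay[where \<mu> = 0 and r = "\<lambda>t. e * z t"])
      fix t :: real assume t: "t \<ge> 0"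
      show "(y has_vector_derivative 0 * y t + e * z t) (at t)" using dy[OF t] by simp
      have "norm e * norm (z t) \<le> 2 * (K / (\<kappa> * norm u) * exp (- ?m * t))"
        using e(1) zb[OF t] by (intro mult_mono) auto
      thus "norm (e * z t) \<le> 2 * (K / (\<kappa> * norm u)) * exp (- ?m * t)" by (simp add: norm_mult)
    qed (use \<kappa> lim that in auto)
    also have "\<dots> \<le> 2 * (K / (\<kappa> * norm u)) / (?m + Re 0) * 1"
      by (intro mult_left_mono) (use \<kappa> that K0 in auto)
    also have "\<dots> = K / (\<kappa>\<^sup>2 * norm u)" using \<kappa> by (simp add: power2_eq_square)
    finally show ?thesis .
  qed
  have pos: "\<kappa>\<^sup>2 * norm u > 0" using \<kappa> u by simp
  have XK: "X \<le> K / (\<kappa>\<^sup>2 * norm u)" unfolding X_def by (rule cSUP_least) (use yb in auto)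
  hence "X * (\<kappa>\<^sup>2 * norm u) \<le> Q * X + P" using pos by (simp add: le_divide_eq K_def)
  moreover have "2 * Q * X \<le> \<kappa>\<^sup>2 * norm u * X" using u(2) X0 by (intro mult_right_mono)
  ultimately have QX: "Q * X \<le> P" by (simp add: algebra_simps)
  hence K2: "K \<le> 2 * P" by (simp add: K_def)
  show "norm (y 0) \<le> 2 * P / (\<kappa>\<^sup>2 * norm u)"
    by (rule order_trans[OF yb[of 0]]) (use K2 pos in \<open>auto intro!: divide_right_mono\<close>)
  show "norm (z 0) \<le> 2 * P / (\<kappa> * norm u)"
    by (rule order_trans[OF zb[of 0]]) (use K2 \<kappa> u in \<open>auto intro!: divide_right_mono\<close>)
qed

lemma dist_one_ge_sin: "norm (1 - of_real \<rho> * cis \<theta>) \<ge> \<bar>sin \<theta>\<bar>" "norm (1 + of_real \<rho> * cis \<theta>) \<ge> \<bar>sin \<theta>\<bar>"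
proof -
  have "norm (1 - of_real \<rho> * cis \<theta>) \<ge> \<bar>sin \<theta>\<bar>" for \<rho>
  proof -
    have "(1 - of_real \<rho> * cis \<theta>) * cis (- \<theta>) = cis (- \<theta>) - of_real \<rho>"
      by (simp add: left_diff_distrib mult.assoc cis_mult)
    hence "\<bar>Im ((1 - of_real \<rho> * cis \<theta>) * cis (- \<theta>))\<bar> = \<bar>sin \<theta>\<bar>" by simp
    thus ?thesis using abs_Im_le_cmod[of "(1 - of_real \<rho> * cis \<theta>) * cis (- \<theta>)"] by (simp add: norm_mult)
  qed
  from this[of \<rho>] this[of "- \<rho>"] show "norm (1 - of_real \<rho> * cis \<theta>) \<ge> \<bar>sin \<theta>\<bar>" "norm (1 + of_real \<rho> * cis \<theta>) \<ge> \<bar>sin \<theta>\<bar>" by simp_all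
qed

lemma sin_ge_sin:
  assumes "0 < \<epsilon>" "\<epsilon> \<le> x" "x \<le> pi - \<epsilon>" shows "sin \<epsilon> \<le> sin x"
proof (cases "x \<le> pi / 2")
  case True
  thus ?thesis using assms by (intro sin_monotone_2pi_le) auto
next
  case False
  have "sin \<epsilon> \<le> sin (pi - x)" using False assms by (intro sin_monotone_2pi_le) auto
  thus ?thesis by simp
qed

definition dmin :: "real \<Rightarrow> real \<Rightarrow> real" where
  "dmin \<epsilon> \<kappa> = min (1 - exp (- (\<kappa> * \<epsilon>))) (sin \<epsilon>)"

text \<open>Far along the ray, for \<open>t \<ge> \<epsilon> / 2\<close>, the modulus of \<tau> is
  bounded away from 1. Before that the imaginary part has moved by at most
  \<open>\<epsilon> / 2\<close>, so the argument of \<tau> stays away from the multiples of pi. The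
  two cases give the two entries of \<open>dmin\<close>.\<close>

lemma ray_distance:
  assumes "\<epsilon> > 0" "\<kappa> > 0" "\<epsilon> \<le> \<bar>Im \<xi>\<bar>" "\<bar>Im \<xi>\<bar> \<le> pi / 2 - \<epsilon>" "Re \<xi> \<ge> 0" "Re e \<ge> \<kappa>" "\<bar>Im e\<bar> \<le> 1" "t \<ge> 0"
  defines "\<tau> \<equiv> exp (- 2 * (\<xi> + of_real t * e))"
  shows "dmin \<epsilon> \<kappa> > 0" "norm (1 - \<tau>) \<ge> dmin \<epsilon> \<kappa>" "norm (1 + \<tau>) \<ge> dmin \<epsilon> \<kappa>" "norm \<tau> \<le> exp (- (2 * \<kappa>) * t)"
proof -
  have ep: "\<epsilon> \<le> pi / 4" using assms(3,4) by linarith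
  hence "sin \<epsilon> > 0" using assms(1) pi_gt_zero by (intro sin_gt_zero) linarith+
  thus "dmin \<epsilon> \<kappa> > 0" using assms(1,2) by (simp add: dmin_def)
  have nt: "norm \<tau> = exp (- 2 * (Re \<xi> + t * Re e))" by (simp add: \<tau>_def)
  have "\<kappa> * t \<le> Re e * t" using assms by (intro mult_right_mono) auto
  hence "- 2 * (Re \<xi> + t * Re e) \<le> - (2 * \<kappa>) * t" using assms(5) by (simp add: algebra_simps)
  thus nt2: "norm \<tau> \<le> exp (- (2 * \<kappa>) * t)" unfolding nt by simp
  have "norm (1 - \<tau>) \<ge> dmin \<epsilon> \<kappa> \<and> norm (1 + \<tau>) \<ge> dmin \<epsilon> \<kappa>"
  proof (cases "t \<ge> \<epsilon> / 2")
    case True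
    have "\<kappa> * (\<epsilon> / 2) \<le> \<kappa> * t" using True assms(2) by (intro mult_left_mono) auto
    hence "exp (- (2 * \<kappa>) * t) \<le> exp (- (\<kappa> * \<epsilon>))" by simp
    hence "norm \<tau> \<le> exp (- (\<kappa> * \<epsilon>))" using nt2 by linarith
    moreover have "norm (1 - \<tau>) \<ge> 1 - norm \<tau>" "norm (1 + \<tau>) \<ge> 1 - norm \<tau>"
      using norm_triangle_ineq2[of 1 \<tau>] norm_triangle_ineq2[of 1 "- \<tau>"] by simp_all
    ultimately show ?thesis by (auto simp: dmin_def min_def)
  next
    case False
    define y where "y = Im \<xi> + t * Im e"
    have "t * \<bar>Im e\<bar> \<le> t * 1" by (intro mult_left_mono) (use assms in auto)
    hence a: "\<bar>t * Im e\<bar> \<le> \<epsilon> / 2" using False assms(8) by (simp add: abs_mult)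
    hence y: "\<epsilon> / 2 \<le> \<bar>y\<bar>" "\<bar>y\<bar> \<le> pi / 2 - \<epsilon> / 2" using assms(3,4) unfolding y_def by linarith+
    have "sin \<epsilon> \<le> sin (2 * \<bar>y\<bar>)" using y assms(1) by (intro sin_ge_sin) auto
    also have "\<dots> \<le> \<bar>sin (- 2 * y)\<bar>" by (cases "y \<ge> 0") auto
    finally have s: "sin \<epsilon> \<le> \<bar>sin (- 2 * y)\<bar>" .
    have "\<tau> = of_real (norm \<tau>) * cis (- 2 * y)"
    proof -
      have "\<tau> = exp (of_real (- 2 * (Re \<xi> + t * Re e))) * cis (- 2 * y)"
        unfolding \<tau>_def cis_conv_exp exp_add[symmetric] y_def
        by (rule arg_cong[where f = exp]) (simp add: complex_eq_iff algebra_simps)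
      thus ?thesis unfolding nt by (simp only: exp_of_real)
    qed
    thus ?thesis using dist_one_ge_sin[of "- 2 * y" "norm \<tau>"] s by (auto simp: dmin_def min_def)
  qed
  thus "norm (1 - \<tau>) \<ge> dmin \<epsilon> \<kappa>" "norm (1 + \<tau>) \<ge> dmin \<epsilon> \<kappa>" by auto
qed

text \<open>A negative real \<open>u\<close> would satisfy \<open>norm u + Re u = 0\<close>.\<close>

lemma nonres_sector:
  assumes "norm u + Re u > 0" shows "nonres u"
  unfolding nonres_def
proof (intro allI notI)
  fix n :: nat assume "of_nat (Suc n) + u = 0"
  hence u: "u = - of_nat (Suc n)" by (simp add: eq_neg_iff_add_eq_0 add.commute del: of_nat_Suc)
  show False using assms unfolding u by (simp del: of_nat_Suc)
qed

text \<open>The value of the partial sum at \<open>\<xi> = \<infinity>\<close> is \<open>Fs \<alpha> \<beta> u N 2 2\<close>, while \<open>gf\<close> is \<open>1\<close> there; hence \<open>hdiff\<close> vanishes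
  at infinity.\<close>

definition hdiff :: "complex \<Rightarrow> complex \<Rightarrow> complex \<Rightarrow> nat \<Rightarrow> complex \<Rightarrow> complex" where
  "hdiff \<alpha> \<beta> u N \<xi> = Fs \<alpha> \<beta> u N 2 2 * gf u (\<alpha>\<^sup>2 - 1 / 4) (\<beta>\<^sup>2 - 1 / 4) (exp (- 2 * \<xi>)) - Fs \<alpha> \<beta> u N (sv \<xi>) (cv \<xi>)"

definition hdiff' :: "complex \<Rightarrow> complex \<Rightarrow> complex \<Rightarrow> nat \<Rightarrow> complex \<Rightarrow> complex" where
  "hdiff' \<alpha> \<beta> u N \<xi> = Fs \<alpha> \<beta> u N 2 2 * (- 2 * exp (- 2 * \<xi>) * gf' u (\<alpha>\<^sup>2 - 1 / 4) (\<beta>\<^sup>2 - 1 / 4) (exp (- 2 * \<xi>))) - Fs' \<alpha> \<beta> u N (sv \<xi>) (cv \<xi>)"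

lemma exp_ne: "Re \<xi> > 0 \<Longrightarrow> 1 - exp (- 2 * \<xi>) \<noteq> 0" "Re \<xi> > 0 \<Longrightarrow> 1 + exp (- 2 * \<xi>) \<noteq> 0"
  using norm_less_1_ne[OF norm_exp_less_1] by auto

text \<open>The multiple of \<open>g\<close> solves the homogeneous equation and the partial sum
  solves it up to \<open>rem\<close>, so \<open>rem\<close> is the only source term for the
  difference.\<close>

lemma hdiff_deriv:
  fixes \<alpha> \<beta> :: complex
  assumes "Re \<xi> > 0" "nonres u" "N \<ge> 1" "\<And>j. j < N \<Longrightarrow> u - 1 - of_nat j \<noteq> 0"
  defines "A \<equiv> \<alpha>\<^sup>2 - 1 / 4" and "B \<equiv> \<beta>\<^sup>2 - 1 / 4"
  shows "(hdiff \<alpha> \<beta> u N has_field_derivative hdiff' \<alpha> \<beta> u N \<xi>) (at \<xi>)"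
    "(hdiff' \<alpha> \<beta> u N has_field_derivative (2 * u * hdiff' \<alpha> \<beta> u N \<xi> + Qp A B (sv \<xi>) (cv \<xi>) * hdiff \<alpha> \<beta> u N \<xi>
       - rem \<alpha> \<beta> u N (sv \<xi>) (cv \<xi>))) (at \<xi>)"
proof -
  define t where "t = exp (- 2 * \<xi>)"
  note ne = exp_ne[OF assms(1)]
  note sc = sv_cv[OF ne]
  have t: "norm t < 1" using norm_exp_less_1[OF assms(1)] by (simp add: t_def)
  have dF: "((\<lambda>\<xi>. Fs \<alpha> \<beta> u N (sv \<xi>) (cv \<xi>)) has_field_derivative Fs' \<alpha> \<beta> u N (sv \<xi>) (cv \<xi>)) (at \<xi>)"
    "((\<lambda>\<xi>. Fs' \<alpha> \<beta> u N (sv \<xi>) (cv \<xi>)) has_field_derivative Fs'' \<alpha> \<beta> u N (sv \<xi>) (cv \<xi>)) (at \<xi>)"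
    using Fs_deriv[of sv 1 \<xi> cv \<alpha> \<beta> u N] sc(4,5) by simp_all
  have dg: "((\<lambda>\<xi>. gf u A B (exp (- 2 * \<xi>))) has_field_derivative - 2 * t * gf' u A B t) (at \<xi>)"
    unfolding t_def by (rule derivative_eq_intros refl norm_exp_less_1[OF assms(1)])+ simp
  have dg': "((\<lambda>\<xi>. - 2 * exp (- 2 * \<xi>) * gf' u A B (exp (- 2 * \<xi>))) has_field_derivative
      4 * t * (t * gf'' u A B t + (1 + u) * gf' u A B t) + 2 * u * (- 2 * t * gf' u A B t)) (at \<xi>)"
    unfolding t_def by (rule derivative_eq_intros refl norm_exp_less_1[OF assms(1)])+ (simp add: algebra_simps)
  have q: "Qp A B (sv \<xi>) (cv \<xi>) = 4 * t * (A / (1 - t)\<^sup>2 - B / (1 + t)\<^sup>2)"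
  proof -
    have "sv \<xi> * sv \<xi> - 2 * sv \<xi> = - (2 - sv \<xi>) * sv \<xi>" "cv \<xi> * cv \<xi> - 2 * cv \<xi> = - (2 - cv \<xi>) * cv \<xi>" by (simp_all add: algebra_simps)
    hence "(sv \<xi>)\<^sup>2 - 2 * sv \<xi> = t * (sv \<xi>)\<^sup>2" "(cv \<xi>)\<^sup>2 - 2 * cv \<xi> = - t * (cv \<xi>)\<^sup>2"
      unfolding sc(2,3) by (simp_all add: t_def power2_eq_square)
    hence "Qp A B (sv \<xi>) (cv \<xi>) = A * (t * (sv \<xi>)\<^sup>2) + B * (- t * (cv \<xi>)\<^sup>2)" unfolding Qp_def by (simp only:)
    also have "(sv \<xi>)\<^sup>2 = 4 / (1 - t)\<^sup>2" unfolding sv_def t_def[symmetric] by (simp add: power_divide)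
    also have "(cv \<xi>)\<^sup>2 = 4 / (1 + t)\<^sup>2" unfolding cv_def t_def[symmetric] by (simp add: power_divide)
    finally show ?thesis by (simp add: algebra_simps)
  qed
  have "hdiff \<alpha> \<beta> u N = (\<lambda>\<xi>. Fs \<alpha> \<beta> u N 2 2 * gf u A B (exp (- 2 * \<xi>)) - Fs \<alpha> \<beta> u N (sv \<xi>) (cv \<xi>))"
    unfolding hdiff_def[abs_def] A_def B_def ..
  thus "(hdiff \<alpha> \<beta> u N has_field_derivative hdiff' \<alpha> \<beta> u N \<xi>) (at \<xi>)"
    unfolding hdiff'_def A_def[symmetric] B_def[symmetric] t_def[symmetric] using DERIV_diff[OF DERIV_cmult[OF dg] dF(1)] by simp
  have "hdiff' \<alpha> \<beta> u N = (\<lambda>\<xi>. Fs \<alpha> \<beta> u N 2 2 * (- 2 * exp (- 2 * \<xi>) * gf' u A B (exp (- 2 * \<xi>))) - Fs' \<alpha> \<beta> u N (sv \<xi>) (cv \<xi>))"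
    unfolding hdiff'_def[abs_def] A_def B_def ..
  moreover have "Fs'' \<alpha> \<beta> u N (sv \<xi>) (cv \<xi>) = rem \<alpha> \<beta> u N (sv \<xi>) (cv \<xi>) + 2 * u * Fs' \<alpha> \<beta> u N (sv \<xi>) (cv \<xi>)
      + Qp A B (sv \<xi>) (cv \<xi>) * Fs \<alpha> \<beta> u N (sv \<xi>) (cv \<xi>)"
    using Fs_ode[OF sc(1) assms(3,4), of \<alpha> \<beta>] unfolding A_def B_def by (simp add: algebra_simps)
  moreover have "4 * t * (t * gf'' u A B t + (1 + u) * gf' u A B t) = Qp A B (sv \<xi>) (cv \<xi>) * gf u A B t"
    unfolding gf_ode[OF assms(2) t] q by (simp only: mult.assoc)
  ultimately show "(hdiff' \<alpha> \<beta> u N has_field_derivative (2 * u * hdiff' \<alpha> \<beta> u N \<xi> + Qp A B (sv \<xi>) (cv \<xi>) * hdiff \<alpha> \<beta> u N \<xi>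
       - rem \<alpha> \<beta> u N (sv \<xi>) (cv \<xi>))) (at \<xi>)"
    using DERIV_diff[OF DERIV_cmult[OF dg', of "Fs \<alpha> \<beta> u N 2 2"] dF(2)]
    unfolding hdiff'_def hdiff_def A_def[symmetric] B_def[symmetric] t_def[symmetric]
    by (simp only:) (erule DERIV_cong, simp only: algebra_simps)
qed


lemma coef_bounds:
  assumes "norm \<alpha> \<le> M" "norm \<beta> \<le> M" "norm s \<le> R" "norm c \<le> R" "R \<ge> 1" "2 - s = - t * s" "2 - c = t * c" "norm u \<ge> 2 * real N" "N \<ge> 1"
  shows "norm (Qp (\<alpha>\<^sup>2 - 1 / 4) (\<beta>\<^sup>2 - 1 / 4) s c) \<le> 2 * (M\<^sup>2 + 1) * R\<^sup>2 * norm t"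
    "norm (rem \<alpha> \<beta> u N s c) \<le> 2 * bB M R N / (norm u / 2) ^ (N - 1) * norm t"
    "norm t \<le> 1 \<Longrightarrow> norm (rem \<alpha> \<beta> u N (2 - s) (2 - c)) \<le> 2 * bB M R N / (norm u / 2) ^ (N - 1) * norm t"
proof -
  have "s * s - 2 * s = - (2 - s) * s" "c * c - 2 * c = - (2 - c) * c" by (simp_all add: algebra_simps)
  hence e: "s\<^sup>2 - 2 * s = t * s\<^sup>2" "c\<^sup>2 - 2 * c = - t * c\<^sup>2" unfolding assms(6,7) by (simp_all add: power2_eq_square)
  have w: "norm (w\<^sup>2 - 1 / 4) \<le> M\<^sup>2 + 1" if "norm w \<le> M" for w :: complex
  proof -
    have "norm (w\<^sup>2 - 1 / 4) \<le> norm w ^ 2 + 1 / 4" using norm_triangle_ineq4[of "w\<^sup>2" "1 / 4"] by (simp add: norm_power)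
    moreover have "norm w ^ 2 \<le> M\<^sup>2" using that by (intro power_mono) auto
    ultimately show ?thesis by linarith
  qed
  have sq: "norm (s\<^sup>2) \<le> R\<^sup>2" "norm (c\<^sup>2) \<le> R\<^sup>2" unfolding norm_power by (intro power_mono assms norm_ge_zero)+
  have tm: "norm (A * (t * x)) \<le> (M\<^sup>2 + 1) * (norm t * R\<^sup>2)" if "norm A \<le> M\<^sup>2 + 1" "norm x \<le> R\<^sup>2" for A x
    unfolding norm_mult by (intro mult_mono that order_refl) (auto intro: add_nonneg_nonneg)
  have "norm (Qp (\<alpha>\<^sup>2 - 1 / 4) (\<beta>\<^sup>2 - 1 / 4) s c) \<le> (M\<^sup>2 + 1) * (norm t * R\<^sup>2) + (M\<^sup>2 + 1) * (norm t * R\<^sup>2)"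
    unfolding Qp_def e minus_mult_left[symmetric] mult_minus_right
    by (rule order_trans[OF norm_triangle_ineq], unfold norm_minus_cancel, intro add_mono tm w sq assms)
  thus "norm (Qp (\<alpha>\<^sup>2 - 1 / 4) (\<beta>\<^sup>2 - 1 / 4) s c) \<le> 2 * (M\<^sup>2 + 1) * R\<^sup>2 * norm t" by (simp add: algebra_simps)
  have M: "M \<ge> 0" using assms(1) norm_ge_zero order_trans by blast
  have u: "norm u > 0" using assms(8,9) by linarith
  have ffb: "(norm u / 2) ^ (N - 1) \<le> norm (ff u (N - 1))" by (rule ff_bound) (use assms(8) in linarith)
  have ffp: "(norm u / 2) ^ (N - 1) > 0" using u by simp
  have r: "norm (2 * x / ff u (N - 1)) \<le> 2 * bB M R N / (norm u / 2) ^ (N - 1) * norm t" if "norm x \<le> norm t * bB M R N" for x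
  proof -
    have "norm (2 * x / ff u (N - 1)) \<le> 2 * (norm t * bB M R N) / (norm u / 2) ^ (N - 1)"
      unfolding norm_divide norm_mult by (rule frac_le) (use that ffb ffp order_trans[OF norm_ge_zero that] in auto)
    thus ?thesis by (simp add: mult_ac)
  qed
  show "norm (rem \<alpha> \<beta> u N s c) \<le> 2 * bB M R N / (norm u / 2) ^ (N - 1) * norm t"
    unfolding rem_def by (rule r[OF bp'_bound(1)[OF assms(1-7)]])
  show "norm (rem \<alpha> \<beta> u N (2 - s) (2 - c)) \<le> 2 * bB M R N / (norm u / 2) ^ (N - 1) * norm t" if "norm t \<le> 1"
    unfolding rem_def by (rule r[OF bp'_bound(2)[OF assms(1-7) that assms(9)]])
qed

lemma ff_nonzero:
  assumes "norm u \<ge> 2 * real N" "N \<ge> 1" "n \<le> N"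
  shows "ff u n \<noteq> 0" "j < N \<Longrightarrow> u - 1 - of_nat j \<noteq> 0"
proof -
  have u: "norm u > 0" using assms by linarith
  have "(norm u / 2) ^ k \<le> norm (ff u k)" if "k \<le> N" for k by (rule ff_bound) (use assms that in simp)
  moreover have "(norm u / 2) ^ k > 0" for k using u by simp
  ultimately have nz: "ff u k \<noteq> 0" if "k \<le> N" for k using that by (metis norm_zero not_less)
  show "ff u n \<noteq> 0" by (rule nz[OF assms(3)])
  show "u - 1 - of_nat j \<noteq> 0" if "j < N" using nz[of N] that by (auto simp: ff_def)
qed

lemma Fs_bound:
  assumes "norm \<alpha> \<le> M" "norm \<beta> \<le> M" "norm s \<le> R" "norm c \<le> R" "R \<ge> 1" "norm u \<ge> 2 * real N" "norm u \<ge> 2"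
  shows "norm (Fs \<alpha> \<beta> u N s c) \<le> (\<Sum>n<N. bB M R n)"
  unfolding Fs_def
proof (rule sum_norm_le)
  fix n assume n: "n \<in> {..<N}"
  have M: "M \<ge> 0" using assms(1) norm_ge_zero order_trans by blast
  have "(norm u / 2) ^ n \<le> norm (ff u n)" by (rule ff_bound) (use assms n in simp)
  moreover have "(1::real) \<le> (norm u / 2) ^ n" using assms by simp
  ultimately have "1 \<le> norm (ff u n)" by linarith
  hence "norm (bp \<alpha> \<beta> n s c / ff u n) \<le> bB M R n / 1"
    unfolding norm_divide by (intro frac_le bp_bound assms) (auto intro!: bB_nonneg M simp: assms order_trans[OF zero_le_one assms(5)])
  thus "norm (bp \<alpha> \<beta> n s c / ff u n) \<le> bB M R n" by simp
qed

lemma Fs_tendsto: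
  assumes "(f \<longlongrightarrow> s) F" "(g \<longlongrightarrow> c) F"
  shows "((\<lambda>x. Fs \<alpha> \<beta> u N (f x) (g x)) \<longlongrightarrow> Fs \<alpha> \<beta> u N s c) F" "((\<lambda>x. Fs' \<alpha> \<beta> u N (f x) (g x)) \<longlongrightarrow> Fs' \<alpha> \<beta> u N s c) F"
  unfolding Fs_def Fs'_def bp_def bp'_def divide_inverse by (intro tendsto_intros assms)+

lemma Fs'_2 [simp]: "Fs' \<alpha> \<beta> u N 2 2 = 0"
  by (simp add: Fs'_def bp'_def)

lemma bp_0_0: "bp \<alpha> \<beta> n 0 0 = (if n = 0 then 1 else 0)" "bp' \<alpha> \<beta> n 0 0 = 0"
proof -
  have z: "(0::complex) ^ l * 0 ^ (n - l) = 0" if "n \<noteq> 0" for l using that by (cases "l = 0") auto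
  show "bp \<alpha> \<beta> n 0 0 = (if n = 0 then 1 else 0)" by (cases "n = 0") (auto simp: bp_def z bco_def)
  show "bp' \<alpha> \<beta> n 0 0 = 0" by (cases "n = 0") (auto simp: bp'_def z bco_def)
qed

text \<open>\<open>s = c = 0\<close> is the reflection of \<open>s = c = 2\<close>, the value at
  infinity. There the reflected partial sum reduces to its term of index 0.\<close>

lemma Fs_0_0: "N \<ge> 1 \<Longrightarrow> Fs \<alpha> \<beta> u N 0 0 = 1" "Fs' \<alpha> \<beta> u N 0 0 = 0"
proof -
  show "Fs' \<alpha> \<beta> u N 0 0 = 0" by (simp add: Fs'_def bp_0_0)
  assume "N \<ge> 1"
  have "Fs \<alpha> \<beta> u N 0 0 = (\<Sum>n<N. if n = 0 then 1 else 0)" unfolding Fs_def bp_0_0 by (intro sum.cong refl) (simp add: ff_def)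
  thus "Fs \<alpha> \<beta> u N 0 0 = 1" using \<open>N \<ge> 1\<close> by simp
qed

definition Rb :: "real \<Rightarrow> real \<Rightarrow> real" where "Rb \<epsilon> \<kappa> = max 1 (2 / dmin \<epsilon> \<kappa>)"

lemma Rb_ge_1: "Rb \<epsilon> \<kappa> \<ge> 1" by (simp add: Rb_def)

lemma sv_cv_bound:
  assumes "\<epsilon> > 0" "\<kappa> > 0" "\<epsilon> \<le> \<bar>Im \<xi>\<bar>" "\<bar>Im \<xi>\<bar> \<le> pi / 2 - \<epsilon>" "Re \<xi> \<ge> 0" "Re e \<ge> \<kappa>" "\<bar>Im e\<bar> \<le> 1" "t \<ge> 0"
  defines "x \<equiv> \<xi> + of_real t * e"
  shows "norm (sv x) \<le> Rb \<epsilon> \<kappa>" "norm (cv x) \<le> Rb \<epsilon> \<kappa>" "1 - exp (- 2 * x) \<noteq> 0" "1 + exp (- 2 * x) \<noteq> 0"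
    "norm (exp (- 2 * x)) \<le> exp (- (2 * \<kappa>) * t)"
proof -
  note d = ray_distance[OF assms(1-8), folded x_def]
  show n: "1 - exp (- 2 * x) \<noteq> 0" "1 + exp (- 2 * x) \<noteq> 0" using d(1-3) by auto
  have "norm (2 / y) \<le> Rb \<epsilon> \<kappa>" if "norm y \<ge> dmin \<epsilon> \<kappa>" for y :: complex
  proof -
    have "norm (2 / y) \<le> 2 / dmin \<epsilon> \<kappa>" unfolding norm_divide by (rule frac_le) (use that d(1) in auto)
    thus ?thesis by (simp add: Rb_def)
  qed
  thus "norm (sv x) \<le> Rb \<epsilon> \<kappa>" "norm (cv x) \<le> Rb \<epsilon> \<kappa>" unfolding sv_def cv_def using d(2,3) by auto
  show "norm (exp (- 2 * x)) \<le> exp (- (2 * \<kappa>) * t)" by (rule d(4))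
qed

lemma exp_decay: "\<kappa> > 0 \<Longrightarrow> ((\<lambda>t::real. exp (- (2 * \<kappa>) * t)) \<longlongrightarrow> 0) at_top"
proof -
  assume k: "\<kappa> > 0"
  have "filterlim (\<lambda>t::real. (2 * \<kappa>) * t) at_top at_top"
    by (rule filterlim_tendsto_pos_mult_at_top[OF tendsto_const _ filterlim_ident]) (use k in simp)
  hence "filterlim (\<lambda>t::real. - ((2 * \<kappa>) * t)) at_bot at_top" by (simp add: filterlim_uminus_at_bot)
  hence "filterlim (\<lambda>t::real. - (2 * \<kappa>) * t) at_bot at_top" by simp
  thus ?thesis by (rule filterlim_compose[OF exp_at_bot])
qed

text \<open>The residual is of order \<open>1 / norm u ^ (N - 1)\<close>, and
  \<open>ray_estimate\<close> gains one more power of \<open>norm u\<close>.\<close>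

lemma hdiff_bounds:
  fixes \<epsilon> \<kappa> M :: real
  assumes pos: "\<epsilon> > 0" "\<kappa> > 0" "N \<ge> 1"
  obtains C U where "C \<ge> 0" "U > 0" and "\<And>\<alpha> \<beta> u \<xi>. norm \<alpha> \<le> M \<Longrightarrow> norm \<beta> \<le> M \<Longrightarrow> norm u \<ge> U \<Longrightarrow> norm u + Re u \<ge> \<kappa> * norm u \<Longrightarrow>
     Re \<xi> > 0 \<Longrightarrow> \<epsilon> \<le> \<bar>Im \<xi>\<bar> \<Longrightarrow> \<bar>Im \<xi>\<bar> \<le> pi / 2 - \<epsilon> \<Longrightarrow>
     norm (hdiff \<alpha> \<beta> u N \<xi>) \<le> C / norm u ^ N \<and> norm (hdiff' \<alpha> \<beta> u N \<xi>) \<le> C / norm u ^ N"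
proof -
  define R where "R = Rb \<epsilon> \<kappa>"
  have R: "R \<ge> 1" by (simp add: R_def Rb_def)
  define Q where "Q = 2 * (M\<^sup>2 + 1) * R\<^sup>2"
  define B where "B = \<bar>bB M R N\<bar>"
  \<comment> \<open>The first entry keeps the products \<open>ff u n\<close> away from 0, the second
    absorbs the potential in \<open>ray_estimate\<close>.\<close>
  define U where "U = max (2 * real N) (2 * Q / \<kappa>\<^sup>2)"
  define C where "C = 2 * 2 ^ N * B * (1 / \<kappa>\<^sup>2 + 1 / \<kappa>)"
  have Q0: "Q \<ge> 0" by (simp add: Q_def)
  show thesis
  proof (rule that[of C U])
    show "C \<ge> 0" using pos by (simp add: C_def B_def)
    show "U > 0" using pos by (simp add: U_def less_max_iff_disj)
    fix \<alpha> \<beta> u \<xi> :: complex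
    assume ab: "norm \<alpha> \<le> M" "norm \<beta> \<le> M" and u: "norm u \<ge> U" "norm u + Re u \<ge> \<kappa> * norm u"
      and x: "Re \<xi> > 0" "\<epsilon> \<le> \<bar>Im \<xi>\<bar>" "\<bar>Im \<xi>\<bar> \<le> pi / 2 - \<epsilon>"
    have uN: "norm u \<ge> 2 * real N" and uQ: "2 * Q / \<kappa>\<^sup>2 \<le> norm u" using u by (auto simp: U_def)
    have u0: "norm u > 0" using uN pos by linarith
    \<comment> \<open>With this direction \<open>u * e = u + norm u\<close>, so the real part is
      \<open>norm u + Re u\<close>, which the sector bounds below by
      \<open>\<kappa> * norm u\<close>. The same choice gives \<open>Re e \<ge> \<kappa>\<close>, so
      the ray moves to the right, and \<open>\<bar>Im e\<bar> \<le> 1\<close>, so it turns away from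
      the starting height slowly enough for \<open>ray_distance\<close>.\<close>
    define e where "e = 1 + cnj u / of_real (norm u)"
    have e1: "norm e \<le> 2"
      using norm_triangle_ineq[of 1 "cnj u / of_real (norm u)"] u0 by (simp add: e_def norm_divide)
    have "u * e = u + of_real (norm u)"
      using u0 unfolding e_def by (simp add: distrib_left complex_norm_square[symmetric] power2_eq_square flip: of_real_mult of_real_divide)
    hence e2: "Re (u * e) \<ge> \<kappa> * norm u" using u(2) by simp
    have "\<kappa> * norm u / norm u \<le> (norm u + Re u) / norm u" using u(2) u0 by (intro divide_right_mono) auto
    hence e3: "Re e \<ge> \<kappa>" using u0 by (simp add: e_def add_divide_distrib)
    have e4: "\<bar>Im e\<bar> \<le> 1" using abs_Im_le_cmod[of u] u0 by (simp add: e_def)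
    have nr: "nonres u" using u(2) u0 pos by (intro nonres_sector) (metis less_le_trans mult_pos_pos)
    have nz: "\<And>j. j < N \<Longrightarrow> u - 1 - of_nat j \<noteq> 0" using ff_nonzero(2)[OF uN pos(3) order_refl] .
    define \<gamma> where "\<gamma> = (\<lambda>t. \<xi> + of_real t * e)"
    have re: "Re (\<gamma> t) > 0" if "t \<ge> 0" for t
      using x(1) e3 pos that by (simp add: \<gamma>_def add_pos_nonneg)
    have b: "norm (sv (\<gamma> t)) \<le> R" "norm (cv (\<gamma> t)) \<le> R" "1 - exp (- 2 * \<gamma> t) \<noteq> 0" "1 + exp (- 2 * \<gamma> t) \<noteq> 0"
      "norm (exp (- 2 * \<gamma> t)) \<le> exp (- (2 * \<kappa>) * t)" if "t \<ge> 0" for t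
      using sv_cv_bound[OF pos(1,2) x(2,3) less_imp_le[OF x(1)] e3 e4 that] unfolding \<gamma>_def R_def by auto
    have dg: "(\<gamma> has_vector_derivative e) (at t)" for t
      unfolding \<gamma>_def by (auto intro!: derivative_eq_intros)
    define P where "P = 2 * bB M R N / (norm u / 2) ^ (N - 1)"
    let ?q = "\<lambda>t. Qp (\<alpha>\<^sup>2 - 1 / 4) (\<beta>\<^sup>2 - 1 / 4) (sv (\<gamma> t)) (cv (\<gamma> t))"
    let ?r = "\<lambda>t. rem \<alpha> \<beta> u N (sv (\<gamma> t)) (cv (\<gamma> t))"
    have cb: "norm (?q t) \<le> Q * exp (- (2 * \<kappa>) * t) \<and> norm (?r t) \<le> P * exp (- (2 * \<kappa>) * t)" if "t \<ge> 0" for t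
    proof -
      note bb = b[OF that]
      note sc = sv_cv(2,3)[OF bb(3,4)]
      note cc = coef_bounds[OF ab bb(1,2) R sc uN pos(3)]
      have "M \<ge> 0" using ab(1) norm_ge_zero order_trans by blast
      hence "P \<ge> 0" using R bB_nonneg[of M R N] by (simp add: P_def)
      hence "P * norm (exp (- 2 * \<gamma> t)) \<le> P * exp (- (2 * \<kappa>) * t)" "Q * norm (exp (- 2 * \<gamma> t)) \<le> Q * exp (- (2 * \<kappa>) * t)"
        using bb(5) Q0 by (intro mult_left_mono; simp)+
      thus ?thesis using cc(1,2) unfolding Q_def[symmetric] P_def[symmetric] by linarith
    qed
    have tau0: "((\<lambda>t. exp (- 2 * \<gamma> t)) \<longlongrightarrow> 0) at_top"
      by (rule Lim_null_comparison[OF _ exp_decay[OF pos(2)]])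
         (use b(5) in \<open>auto intro: eventually_mono[OF eventually_ge_at_top[of 0]]\<close>)
    have sl: "((\<lambda>t. sv (\<gamma> t)) \<longlongrightarrow> 2 / (1 - 0)) at_top" "((\<lambda>t. cv (\<gamma> t)) \<longlongrightarrow> 2 / (1 + 0)) at_top"
      unfolding sv_def cv_def by (intro tendsto_intros tau0; simp)+
    have gl: "((\<lambda>t. gf u A B (exp (- 2 * \<gamma> t))) \<longlongrightarrow> 1) at_top" "((\<lambda>t. gf' u A B (exp (- 2 * \<gamma> t))) \<longlongrightarrow> gf' u A B 0) at_top" for A B
      using isCont_tendsto_compose[OF DERIV_isCont[OF gf_deriv(1)[of 0]] tau0] isCont_tendsto_compose[OF DERIV_isCont[OF gf_deriv(2)[of 0]] tau0] by auto
    have l1: "((\<lambda>t. hdiff \<alpha> \<beta> u N (\<gamma> t)) \<longlongrightarrow> Fs \<alpha> \<beta> u N 2 2 * 1 - Fs \<alpha> \<beta> u N (2 / (1 - 0)) (2 / (1 + 0))) at_top"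
      unfolding hdiff_def by (intro tendsto_diff tendsto_mult tendsto_const gl Fs_tendsto sl)
    have l2: "((\<lambda>t. hdiff' \<alpha> \<beta> u N (\<gamma> t)) \<longlongrightarrow> Fs \<alpha> \<beta> u N 2 2 * (- 2 * 0 * gf' u (\<alpha>\<^sup>2 - 1 / 4) (\<beta>\<^sup>2 - 1 / 4) 0) - Fs' \<alpha> \<beta> u N (2 / (1 - 0)) (2 / (1 + 0))) at_top"
      unfolding hdiff'_def by (intro tendsto_diff tendsto_mult tendsto_const gl Fs_tendsto sl tau0)
    have dd: "((\<lambda>t. hdiff \<alpha> \<beta> u N (\<gamma> t)) has_vector_derivative e * hdiff' \<alpha> \<beta> u N (\<gamma> t)) (at t)"
      "((\<lambda>t. hdiff' \<alpha> \<beta> u N (\<gamma> t)) has_vector_derivative e * (2 * u * hdiff' \<alpha> \<beta> u N (\<gamma> t) + ?q t * hdiff \<alpha> \<beta> u N (\<gamma> t) - ?r t)) (at t)"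
      if "t \<ge> 0" for t
      using field_vector_diff_chain_at[OF dg hdiff_deriv(1)[OF re[OF that] nr pos(3) nz]]
        field_vector_diff_chain_at[OF dg hdiff_deriv(2)[OF re[OF that] nr pos(3) nz]]
      unfolding o_def by auto
    have Qu: "2 * Q \<le> \<kappa>\<^sup>2 * norm u" using uQ pos by (simp add: divide_le_eq mult.commute)
    have lim: "((\<lambda>t. hdiff \<alpha> \<beta> u N (\<gamma> t)) \<longlongrightarrow> 0) at_top" "((\<lambda>t. hdiff' \<alpha> \<beta> u N (\<gamma> t)) \<longlongrightarrow> 0) at_top"
      using l1 l2 by simp_all
    note est = ray_estimate[OF dd, where Q = Q and P = P and \<kappa> = \<kappa>, OF _ _ conjunct1[OF cb] conjunct2[OF cb] lim e1 e2 pos(2) u0 Qu]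
    have g0: "\<gamma> 0 = \<xi>" by (simp add: \<gamma>_def)
    have PB: "P \<le> 2 ^ N * B / norm u ^ (N - 1)"
    proof -
      have "P = 2 * 2 ^ (N - 1) * bB M R N / norm u ^ (N - 1)" by (simp add: P_def power_divide)
      also have "2 * 2 ^ (N - 1) = (2::real) ^ N" using pos(3) by (metis power_eq_if not_one_le_zero)
      also have "2 ^ N * bB M R N / norm u ^ (N - 1) \<le> 2 ^ N * B / norm u ^ (N - 1)"
        by (intro divide_right_mono mult_left_mono) (auto simp: B_def)
      finally show ?thesis .
    qed
    have uNN: "norm u ^ N = norm u ^ (N - 1) * norm u" using pos(3) by (metis power_eq_if not_one_le_zero mult.commute)
    have fin: "2 * P / (k * norm u) \<le> C / norm u ^ N" if "k > 0" "1 / k \<le> 1 / \<kappa>\<^sup>2 + 1 / \<kappa>" for k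
    proof -
      have "2 * P / (k * norm u) \<le> 2 * (2 ^ N * B / norm u ^ (N - 1)) / (k * norm u)"
        by (intro divide_right_mono mult_left_mono PB) (use that u0 in auto)
      also have "\<dots> = 2 * 2 ^ N * B * (1 / k) / norm u ^ N" unfolding uNN by (simp add: mult_ac)
      also have "\<dots> \<le> 2 * 2 ^ N * B * (1 / \<kappa>\<^sup>2 + 1 / \<kappa>) / norm u ^ N"
        by (intro divide_right_mono mult_left_mono that) (auto simp: B_def)
      finally show ?thesis by (simp add: C_def)
    qed
    show "norm (hdiff \<alpha> \<beta> u N \<xi>) \<le> C / norm u ^ N \<and> norm (hdiff' \<alpha> \<beta> u N \<xi>) \<le> C / norm u ^ N"
      using est[unfolded g0] fin[of "\<kappa>\<^sup>2"] fin[of \<kappa>] pos(2) by auto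
  qed
qed

text \<open>The expression is the Wronskian of \<open>exp (- u * \<xi>)\<close> times the partial
  sum and \<open>exp (u * \<xi>)\<close> times its reflection. The exponentials cancel, the
  derivative involves only the two residuals, and the limit at infinity is
  \<open>2 * u * Fs \<alpha> \<beta> u N 2 2\<close>. Hence a horizontal ray suffices here, whatever
  the argument of \<open>u\<close>.\<close>

lemma Fs_wronskian_estimate:
  fixes \<epsilon> M :: real
  assumes pos: "\<epsilon> > 0" "N \<ge> 1"
  obtains C where "C \<ge> 0" and "\<And>\<alpha> \<beta> u \<zeta>. norm \<alpha> \<le> M \<Longrightarrow> norm \<beta> \<le> M \<Longrightarrow> norm u \<ge> 2 * real N \<Longrightarrow> \<epsilon> \<le> \<zeta> \<Longrightarrow> \<zeta> \<le> pi / 2 - \<epsilon> \<Longrightarrow>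
     norm (2 * u * Fs \<alpha> \<beta> u N (sv (\<i> * of_real \<zeta>)) (cv (\<i> * of_real \<zeta>)) * Fs \<alpha> \<beta> u N (2 - sv (\<i> * of_real \<zeta>)) (2 - cv (\<i> * of_real \<zeta>))
       - Fs \<alpha> \<beta> u N (sv (\<i> * of_real \<zeta>)) (cv (\<i> * of_real \<zeta>)) * Fs' \<alpha> \<beta> u N (2 - sv (\<i> * of_real \<zeta>)) (2 - cv (\<i> * of_real \<zeta>))
       - Fs' \<alpha> \<beta> u N (sv (\<i> * of_real \<zeta>)) (cv (\<i> * of_real \<zeta>)) * Fs \<alpha> \<beta> u N (2 - sv (\<i> * of_real \<zeta>)) (2 - cv (\<i> * of_real \<zeta>))
       - 2 * u * Fs \<alpha> \<beta> u N 2 2) \<le> C / norm u ^ (N - 1)"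
proof -
  define R where "R = Rb \<epsilon> 1"
  have R: "R \<ge> 1" by (simp add: R_def Rb_def)
  define FB where "FB = \<bar>\<Sum>n<N. bB M R n\<bar>"
  define C where "C = 2 ^ N * \<bar>bB M R N\<bar> * FB"
  show thesis
  proof (rule that[of C])
    show "C \<ge> 0" by (simp add: C_def FB_def)
    fix \<alpha> \<beta> u :: complex and \<zeta> :: real
    assume ab: "norm \<alpha> \<le> M" "norm \<beta> \<le> M" and uN: "norm u \<ge> 2 * real N" and z: "\<epsilon> \<le> \<zeta>" "\<zeta> \<le> pi / 2 - \<epsilon>"
    have u2: "norm u \<ge> 2" using uN pos(2) by linarith
    define A where "A = \<alpha>\<^sup>2 - 1 / 4"
    define B where "B = \<beta>\<^sup>2 - 1 / 4"
    define \<xi> where "\<xi> = \<i> * complex_of_real \<zeta>"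
    define \<gamma> where "\<gamma> = (\<lambda>t. \<xi> + of_real t * 1)"
    have x: "\<epsilon> \<le> \<bar>Im \<xi>\<bar>" "\<bar>Im \<xi>\<bar> \<le> pi / 2 - \<epsilon>" "Re \<xi> \<ge> 0" using z pos by (auto simp: \<xi>_def)
    have b: "norm (sv (\<gamma> t)) \<le> R" "norm (cv (\<gamma> t)) \<le> R" "1 - exp (- 2 * \<gamma> t) \<noteq> 0" "1 + exp (- 2 * \<gamma> t) \<noteq> 0"
      "norm (exp (- 2 * \<gamma> t)) \<le> exp (- (2 * 1) * t)" if "t \<ge> 0" for t
      using sv_cv_bound[OF pos(1) zero_less_one x, of 1 t] that unfolding \<gamma>_def R_def by auto
    have dg: "(\<gamma> has_vector_derivative 1) (at t)" for t unfolding \<gamma>_def by (auto intro!: derivative_eq_intros)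
    define F where "F = (\<lambda>x. Fs \<alpha> \<beta> u N (sv x) (cv x))"
    define F1 where "F1 = (\<lambda>x. Fs' \<alpha> \<beta> u N (sv x) (cv x))"
    define F2 where "F2 = (\<lambda>x. Fs'' \<alpha> \<beta> u N (sv x) (cv x))"
    define G where "G = (\<lambda>x. Fs \<alpha> \<beta> u N (2 - sv x) (2 - cv x))"
    define G1 where "G1 = (\<lambda>x. Fs' \<alpha> \<beta> u N (2 - sv x) (2 - cv x))"
    define G2 where "G2 = (\<lambda>x. Fs'' \<alpha> \<beta> u N (2 - sv x) (2 - cv x))"
    define V where "V = (\<lambda>x. 2 * u * F x * G x - F x * G1 x - F1 x * G x)"
    define r s where "r = (\<lambda>x. rem \<alpha> \<beta> u N (sv x) (cv x))" and "s = (\<lambda>x. rem \<alpha> \<beta> u N (2 - sv x) (2 - cv x))"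
    have nz: "\<And>j. j < N \<Longrightarrow> u - 1 - of_nat j \<noteq> 0" using ff_nonzero(2)[OF uN pos(2) order_refl] .
    have dV: "(V has_field_derivative F x * s x - G x * r x) (at x)" if n: "1 - exp (- 2 * x) \<noteq> 0" "1 + exp (- 2 * x) \<noteq> 0" for x
    proof -
      note sc = sv_cv[OF n]
      have dF: "(F has_field_derivative F1 x) (at x)" "(F1 has_field_derivative F2 x) (at x)"
        unfolding F_def F1_def F2_def using Fs_deriv[of sv 1 x cv \<alpha> \<beta> u N] sc(4,5) by simp_all
      have d2: "((\<lambda>x. 2 - f x) has_field_derivative - 1 * (2 * (2 - f x) - (2 - f x)\<^sup>2)) (at x)"
        if "(f has_field_derivative (2 * f x - (f x)\<^sup>2)) (at x)" for f :: "complex \<Rightarrow> complex"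
        by (rule DERIV_cong[OF DERIV_diff[OF DERIV_const that]]) (simp add: power2_eq_square algebra_simps)
      have dG: "(G has_field_derivative - G1 x) (at x)" "(G1 has_field_derivative - G2 x) (at x)"
        unfolding G_def G1_def G2_def using Fs_deriv[OF d2[OF sc(4)] d2[OF sc(5)], of \<alpha> \<beta> u N] by simp_all
      have oF: "F2 x - 2 * u * F1 x - Qp A B (sv x) (cv x) * F x = r x"
        unfolding F_def F1_def F2_def r_def A_def B_def by (rule Fs_ode[OF sc(1) pos(2) nz])
      have "(2 - sv x) + (2 - cv x) = (2 - sv x) * (2 - cv x)"
      proof -
        have "(2 - a) + (2 - b) = (2 - a) * (2 - b)" if "a + b = a * b" for a b :: complex using that by algebra
        from this[OF sc(1)] show ?thesis .
      qed
      hence oG: "G2 x - 2 * u * G1 x - Qp A B (2 - sv x) (2 - cv x) * G x = s x"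
        unfolding G_def G1_def G2_def s_def A_def B_def by (rule Fs_ode[OF _ pos(2) nz])
      have q: "Qp A B (2 - sv x) (2 - cv x) = Qp A B (sv x) (cv x)"
        unfolding Qp_def by (simp add: power2_eq_square algebra_simps)
      have "(V has_field_derivative (2 * u * (F1 x * G x + (- G1 x) * F x) - (F1 x * G1 x + (- G2 x) * F x) - (F2 x * G x + (- G1 x) * F1 x))) (at x)"
        unfolding V_def mult.assoc
        by (intro DERIV_diff DERIV_cmult DERIV_mult dF dG)
      moreover have "2 * u * (F1 x * G x + (- G1 x) * F x) - (F1 x * G1 x + (- G2 x) * F x) - (F2 x * G x + (- G1 x) * F1 x) = F x * s x - G x * r x"
        unfolding oF[symmetric] oG[symmetric] q by (simp add: algebra_simps)
      ultimately show ?thesis by simp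
    qed
    have dVt: "((\<lambda>t. V (\<gamma> t) - 2 * u * Fs \<alpha> \<beta> u N 2 2) has_vector_derivative 0 * (V (\<gamma> t) - 2 * u * Fs \<alpha> \<beta> u N 2 2) + (F (\<gamma> t) * s (\<gamma> t) - G (\<gamma> t) * r (\<gamma> t))) (at t)" if "t \<ge> 0" for t
      using has_vector_derivative_diff[OF field_vector_diff_chain_at[OF dg dV[OF b(3,4)[OF that]]] has_vector_derivative_const] by (simp add: o_def)
    define P where "P = 2 * bB M R N / (norm u / 2) ^ (N - 1)"
    have M0: "M \<ge> 0" using ab(1) norm_ge_zero order_trans by blast
    have P0: "P \<ge> 0" using R bB_nonneg[OF M0, of R N] by (simp add: P_def)
    have rb: "norm (F (\<gamma> t) * s (\<gamma> t) - G (\<gamma> t) * r (\<gamma> t)) \<le> 2 * FB * P * exp (- 2 * t)" if "t \<ge> 0" for t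
    proof -
      note bb = b[OF that]
      note sc = sv_cv(2,3)[OF bb(3,4)]
      note cc = coef_bounds[OF ab bb(1,2) R sc uN pos(2), folded P_def]
      have t1: "norm (exp (- 2 * \<gamma> t)) \<le> 1" using bb(5) that by (auto intro: order_trans)
      have ns: "norm (2 - sv (\<gamma> t)) \<le> R" "norm (2 - cv (\<gamma> t)) \<le> R"
      proof -
        have "norm (exp (- 2 * \<gamma> t)) * x \<le> R" if "x \<le> R" "x \<ge> 0" for x
          using mult_left_le_one_le[OF that(2) norm_ge_zero t1] that(1) by linarith
        thus "norm (2 - sv (\<gamma> t)) \<le> R" "norm (2 - cv (\<gamma> t)) \<le> R"
          unfolding sc norm_mult norm_minus_cancel using bb(1,2) by auto
      qed
      have FB: "norm (F (\<gamma> t)) \<le> FB" "norm (G (\<gamma> t)) \<le> FB"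
        using Fs_bound[OF ab bb(1,2) R uN u2] Fs_bound[OF ab ns R uN u2] unfolding F_def G_def FB_def by linarith+
      have Pe: "P * norm (exp (- 2 * \<gamma> t)) \<le> P * exp (- 2 * t)" using bb(5) P0 by (intro mult_left_mono) auto
      have sr: "norm (s (\<gamma> t)) \<le> P * exp (- 2 * t)" "norm (r (\<gamma> t)) \<le> P * exp (- 2 * t)"
        using cc(2) cc(3)[OF t1] Pe unfolding s_def r_def by linarith+
      have "norm (F (\<gamma> t) * s (\<gamma> t) - G (\<gamma> t) * r (\<gamma> t)) \<le> FB * (P * exp (- 2 * t)) + FB * (P * exp (- 2 * t))"
        by (rule order_trans[OF norm_triangle_ineq4], unfold norm_mult, intro add_mono mult_mono FB sr) (auto simp: FB_def)
      thus ?thesis by (simp add: algebra_simps)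
    qed
    have tau0: "((\<lambda>t. exp (- 2 * \<gamma> t)) \<longlongrightarrow> 0) at_top"
      by (rule Lim_null_comparison[OF _ exp_decay[OF zero_less_one]])
         (use b(5) in \<open>auto intro: eventually_mono[OF eventually_ge_at_top[of 0]]\<close>)
    have sl: "((\<lambda>t. sv (\<gamma> t)) \<longlongrightarrow> 2 / (1 - 0)) at_top" "((\<lambda>t. cv (\<gamma> t)) \<longlongrightarrow> 2 / (1 + 0)) at_top"
      unfolding sv_def cv_def by (intro tendsto_intros tau0; simp)+
    have sl2: "((\<lambda>t. 2 - sv (\<gamma> t)) \<longlongrightarrow> 2 - 2 / (1 - 0)) at_top" "((\<lambda>t. 2 - cv (\<gamma> t)) \<longlongrightarrow> 2 - 2 / (1 + 0)) at_top"
      by (intro tendsto_diff tendsto_const sl)+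
    have fl: "((\<lambda>t. F (\<gamma> t)) \<longlongrightarrow> Fs \<alpha> \<beta> u N 2 2) at_top" "((\<lambda>t. F1 (\<gamma> t)) \<longlongrightarrow> 0) at_top"
      "((\<lambda>t. G (\<gamma> t)) \<longlongrightarrow> 1) at_top" "((\<lambda>t. G1 (\<gamma> t)) \<longlongrightarrow> 0) at_top"
      unfolding F_def F1_def G_def G1_def
      using Fs_tendsto[OF sl, where \<alpha> = \<alpha> and \<beta> = \<beta> and u = u and N = N]
        Fs_tendsto[OF sl2, where \<alpha> = \<alpha> and \<beta> = \<beta> and u = u and N = N]
        Fs_0_0[where \<alpha> = \<alpha> and \<beta> = \<beta> and u = u and N = N] pos(2) by simp_all
    have "((\<lambda>t. V (\<gamma> t) - 2 * u * Fs \<alpha> \<beta> u N 2 2) \<longlongrightarrow> (2 * u * Fs \<alpha> \<beta> u N 2 2 * 1 - Fs \<alpha> \<beta> u N 2 2 * 0 - 0 * 1) - 2 * u * Fs \<alpha> \<beta> u N 2 2) at_top"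
      unfolding V_def by (intro tendsto_diff tendsto_mult tendsto_const fl)
    hence lim: "((\<lambda>t. V (\<gamma> t) - 2 * u * Fs \<alpha> \<beta> u N 2 2) \<longlongrightarrow> 0) at_top" by simp
    have "norm (V (\<gamma> 0) - 2 * u * Fs \<alpha> \<beta> u N 2 2) \<le> 2 * FB * P / (2 + Re 0) * exp (- 2 * 0)"
      by (rule decay[OF dVt rb]) (use lim in auto)
    also have "\<dots> = FB * P" by simp
    also have "\<dots> \<le> C / norm u ^ (N - 1)"
    proof -
      have "P = 2 * 2 ^ (N - 1) * bB M R N / norm u ^ (N - 1)" by (simp add: P_def power_divide)
      also have "2 * 2 ^ (N - 1) = (2::real) ^ N" using pos(2) by (metis power_eq_if not_one_le_zero)
      also have "2 ^ N * bB M R N / norm u ^ (N - 1) \<le> 2 ^ N * \<bar>bB M R N\<bar> / norm u ^ (N - 1)"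
        by (intro divide_right_mono mult_left_mono) auto
      finally have "FB * P \<le> FB * (2 ^ N * \<bar>bB M R N\<bar> / norm u ^ (N - 1))" by (intro mult_left_mono) (auto simp: FB_def)
      thus ?thesis by (simp add: C_def mult_ac)
    qed
    finally show "norm (2 * u * Fs \<alpha> \<beta> u N (sv (\<i> * of_real \<zeta>)) (cv (\<i> * of_real \<zeta>)) * Fs \<alpha> \<beta> u N (2 - sv (\<i> * of_real \<zeta>)) (2 - cv (\<i> * of_real \<zeta>))
       - Fs \<alpha> \<beta> u N (sv (\<i> * of_real \<zeta>)) (cv (\<i> * of_real \<zeta>)) * Fs' \<alpha> \<beta> u N (2 - sv (\<i> * of_real \<zeta>)) (2 - cv (\<i> * of_real \<zeta>))
       - Fs' \<alpha> \<beta> u N (sv (\<i> * of_real \<zeta>)) (cv (\<i> * of_real \<zeta>)) * Fs \<alpha> \<beta> u N (2 - sv (\<i> * of_real \<zeta>)) (2 - cv (\<i> * of_real \<zeta>))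
       - 2 * u * Fs \<alpha> \<beta> u N 2 2) \<le> C / norm u ^ (N - 1)"
      unfolding V_def F_def F1_def G_def G1_def \<gamma>_def \<xi>_def by simp
  qed
qed

subsection \<open>Boundary limits\<close>

abbreviation rhp :: "complex set" where "rhp \<equiv> {\<xi>. Re \<xi> > 0}"

text \<open>On a convex set a bounded derivative gives a Lipschitz bound, and a Lipschitz function
  extends continuously to the closure.\<close>

lemma bounded_deriv_boundary_limit:
  fixes f :: "complex \<Rightarrow> complex"
  assumes "convex S" "\<And>x. x \<in> S \<Longrightarrow> (f has_field_derivative f' x) (at x)" "\<And>x. x \<in> S \<Longrightarrow> norm (f' x) \<le> B" "x \<in> closure S"
  obtains l where "(f \<longlongrightarrow> l) (at x within S)"
proof -
  have "\<bar>B\<bar>-lipschitz_on S f"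
  proof (rule lipschitz_onI)
    fix y z assume yz: "y \<in> S" "z \<in> S"
    have "norm (f' w) \<le> \<bar>B\<bar>" if "w \<in> S" for w using assms(3)[OF that] by linarith
    from field_differentiable_bound[OF assms(1) has_field_derivative_at_within[OF assms(2)] this yz]
    show "dist (f y) (f z) \<le> \<bar>B\<bar> * dist y z" by (simp add: dist_norm)
  qed simp
  hence "uniformly_continuous_on S f" by (rule lipschitz_on_uniformly_continuous)
  from uniformly_continuous_on_extension_at_closure[OF this assms(4)] that show thesis by blast
qed

lemma rhp_boundary_ne_bot: "Re \<xi> = 0 \<Longrightarrow> at \<xi> within rhp \<noteq> bot"
proof -
  assume r: "Re \<xi> = 0"
  have "\<xi> \<in> closure (rhp - {\<xi>})"
    unfolding closure_approachable
  proof (intro allI impI)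
    fix e :: real assume "0 < e"
    thus "\<exists>y\<in>rhp - {\<xi>}. dist y \<xi> < e" by (intro bexI[of _ "\<xi> + of_real (e / 2)"]) (use r in \<open>auto simp: dist_norm\<close>)
  qed
  thus ?thesis by (simp add: at_within_eq_bot_iff)
qed

text \<open>\<open>hdiff\<close> has a limit because \<open>hdiff'\<close> is bounded, and
  \<open>hdiff'\<close> has one because the differential equation bounds the next derivative. The
  bounds are assumed with margin \<open>\<epsilon> / 2\<close> so that they hold at all points of
  the half-plane near \<open>\<xi>0\<close>.\<close>

lemma hdiff_limits:
  fixes \<alpha> \<beta> u \<xi>0 :: complex
  assumes ab: "norm \<alpha> \<le> M" "norm \<beta> \<le> M" and N: "N \<ge> 1" and uN: "norm u \<ge> 2 * real N" and nr: "nonres u" and \<epsilon>: "\<epsilon> > 0"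
    and x0: "Re \<xi>0 = 0" "\<epsilon> \<le> \<bar>Im \<xi>0\<bar>" "\<bar>Im \<xi>0\<bar> \<le> pi / 2 - \<epsilon>"
    and bd: "\<And>\<xi>. Re \<xi> > 0 \<Longrightarrow> \<epsilon> / 2 \<le> \<bar>Im \<xi>\<bar> \<Longrightarrow> \<bar>Im \<xi>\<bar> \<le> pi / 2 - \<epsilon> / 2 \<Longrightarrow> norm (hdiff \<alpha> \<beta> u N \<xi>) \<le> D \<and> norm (hdiff' \<alpha> \<beta> u N \<xi>) \<le> D"
  obtains h0 h1 where "(hdiff \<alpha> \<beta> u N \<longlongrightarrow> h0) (at \<xi>0 within rhp)" "(hdiff' \<alpha> \<beta> u N \<longlongrightarrow> h1) (at \<xi>0 within rhp)"
    "norm h0 \<le> D" "norm h1 \<le> D"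
proof -
  define T where "T = {\<xi>. Im \<xi>0 - \<epsilon> / 2 < Im \<xi>} \<inter> {\<xi>. Im \<xi> < Im \<xi>0 + \<epsilon> / 2}"
  have T: "open T" "\<xi>0 \<in> T" "convex T" unfolding T_def using \<epsilon>
    by (auto intro!: open_Int open_halfspace_Im_gt open_halfspace_Im_lt convex_Int convex_halfspace_Im_gt convex_halfspace_Im_lt)
  have cS: "convex (rhp \<inter> T)" by (intro convex_Int convex_halfspace_Re_gt T)
  have F: "at \<xi>0 within (rhp \<inter> T) = at \<xi>0 within rhp"
    by (rule at_within_nhd[OF T(2,1)]) auto
  have cl: "\<xi>0 \<in> closure (rhp \<inter> T)"
  proof -
    have "at \<xi>0 within (rhp \<inter> T) \<noteq> bot" unfolding F by (rule rhp_boundary_ne_bot[OF x0(1)])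
    hence "\<xi>0 \<in> closure (rhp \<inter> T - {\<xi>0})" by (simp add: at_within_eq_bot_iff)
    thus ?thesis by (meson Diff_subset closure_mono subsetD)
  qed
  have S: "Re \<xi> > 0" "\<epsilon> / 2 \<le> \<bar>Im \<xi>\<bar>" "\<bar>Im \<xi>\<bar> \<le> pi / 2 - \<epsilon> / 2" if "\<xi> \<in> rhp \<inter> T" for \<xi>
    using that x0 \<epsilon> unfolding T_def by (auto simp: abs_if split: if_splits)
  have nz: "\<And>j. j < N \<Longrightarrow> u - 1 - of_nat j \<noteq> 0" using ff_nonzero(2)[OF uN N order_refl] .
  define R where "R = Rb (\<epsilon> / 2) 1"
  define P where "P = 2 * bB M R N / (norm u / 2) ^ (N - 1)"
  have M0: "M \<ge> 0" using ab(1) norm_ge_zero order_trans by blast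
  have P0: "P \<ge> 0" using bB_nonneg[OF M0, of R N] Rb_ge_1[of "\<epsilon> / 2" 1] by (simp add: P_def R_def)
  let ?h2 = "\<lambda>\<xi>. 2 * u * hdiff' \<alpha> \<beta> u N \<xi> + Qp (\<alpha>\<^sup>2 - 1 / 4) (\<beta>\<^sup>2 - 1 / 4) (sv \<xi>) (cv \<xi>) * hdiff \<alpha> \<beta> u N \<xi> - rem \<alpha> \<beta> u N (sv \<xi>) (cv \<xi>)"
  have b2: "norm (?h2 \<xi>) \<le> 2 * norm u * D + 2 * (M\<^sup>2 + 1) * R\<^sup>2 * D + P" if "\<xi> \<in> rhp \<inter> T" for \<xi>
  proof -
    note Sx = S[OF that]
    have e2: "\<epsilon> / 2 > 0" using \<epsilon> by simp
    have b: "norm (sv \<xi>) \<le> R" "norm (cv \<xi>) \<le> R" "1 - exp (- 2 * \<xi>) \<noteq> 0" "1 + exp (- 2 * \<xi>) \<noteq> 0"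
      using sv_cv_bound[OF e2 zero_less_one Sx(2,3) less_imp_le[OF Sx(1)], of 1 0] unfolding R_def by auto
    note sc = sv_cv(2,3)[OF b(3,4)]
    note cc = coef_bounds[OF ab b(1,2) Rb_ge_1[of "\<epsilon> / 2" 1, folded R_def] sc uN N, folded P_def]
    have t1: "norm (exp (- 2 * \<xi>)) \<le> 1" using Sx(1) by simp
    have q: "norm (Qp (\<alpha>\<^sup>2 - 1 / 4) (\<beta>\<^sup>2 - 1 / 4) (sv \<xi>) (cv \<xi>)) \<le> 2 * (M\<^sup>2 + 1) * R\<^sup>2"
      by (rule order_trans[OF cc(1)]) (use t1 in \<open>intro mult_left_le, auto\<close>)
    have r: "norm (rem \<alpha> \<beta> u N (sv \<xi>) (cv \<xi>)) \<le> P"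
      by (rule order_trans[OF cc(2)]) (use t1 P0 in \<open>intro mult_left_le, auto\<close>)
    have "norm (?h2 \<xi>) \<le> norm (2 * u * hdiff' \<alpha> \<beta> u N \<xi>) + norm (Qp (\<alpha>\<^sup>2 - 1 / 4) (\<beta>\<^sup>2 - 1 / 4) (sv \<xi>) (cv \<xi>) * hdiff \<alpha> \<beta> u N \<xi>) + norm (rem \<alpha> \<beta> u N (sv \<xi>) (cv \<xi>))"
      by (rule order_trans[OF norm_triangle_ineq4 add_right_mono[OF norm_triangle_ineq]])
    also have "norm (2 * u * hdiff' \<alpha> \<beta> u N \<xi>) \<le> 2 * norm u * D"
      using bd[OF Sx] by (simp add: norm_mult mult_left_mono)
    also have "norm (Qp (\<alpha>\<^sup>2 - 1 / 4) (\<beta>\<^sup>2 - 1 / 4) (sv \<xi>) (cv \<xi>) * hdiff \<alpha> \<beta> u N \<xi>) \<le> 2 * (M\<^sup>2 + 1) * R\<^sup>2 * D"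
      unfolding norm_mult[of "Qp _ _ _ _"] by (intro mult_mono q) (use bd[OF Sx] in auto)
    also note r
    finally show ?thesis by simp
  qed
  obtain h0 where h0: "(hdiff \<alpha> \<beta> u N \<longlongrightarrow> h0) (at \<xi>0 within (rhp \<inter> T))"
    by (rule bounded_deriv_boundary_limit[OF cS hdiff_deriv(1)[OF S(1) nr N nz] _ cl, where B = D]) (use bd[OF S] in auto)
  obtain h1 where h1: "(hdiff' \<alpha> \<beta> u N \<longlongrightarrow> h1) (at \<xi>0 within (rhp \<inter> T))"
    by (rule bounded_deriv_boundary_limit[OF cS hdiff_deriv(2)[OF S(1) nr N nz] b2 cl]) auto
  have nb: "at \<xi>0 within (rhp \<inter> T) \<noteq> bot" unfolding F by (rule rhp_boundary_ne_bot[OF x0(1)])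
  have ev: "eventually (\<lambda>\<xi>. \<xi> \<in> rhp \<inter> T) (at \<xi>0 within (rhp \<inter> T))" by (simp add: eventually_at_filter)
  have "norm h0 \<le> D" by (rule tendsto_upperbound[OF tendsto_norm[OF h0] _ nb]) (use ev bd[OF S] in \<open>auto elim!: eventually_mono\<close>)
  moreover have "norm h1 \<le> D" by (rule tendsto_upperbound[OF tendsto_norm[OF h1] _ nb]) (use ev bd[OF S] in \<open>auto elim!: eventually_mono\<close>)
  ultimately show thesis using that h0 h1 unfolding F by blast
qed


section \<open>Boundary values of the recessive solution\<close>

text \<open>The term of index 0 is 1, and every further term has at least one denominator of size
  \<open>norm u / 2\<close>. In particular the value does not vanish for large
  \<open>u\<close>.\<close>

lemma Fs_2_2_near_1:
  assumes "norm \<alpha> \<le> M" "norm \<beta> \<le> M" "norm u \<ge> 2 * real N" "N \<ge> 1"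
  shows "norm (Fs \<alpha> \<beta> u N 2 2 - 1) \<le> (2 * (\<Sum>n<N. bB M 2 n)) / norm u"
proof -
  have M: "M \<ge> 0" using assms(1) norm_ge_zero order_trans by blast
  have u2: "norm u \<ge> 2" using assms(3,4) by linarith
  obtain m where m: "N = Suc m" using assms(4) by (cases N) auto
  have b: "norm (bp \<alpha> \<beta> (Suc n) 2 2 / ff u (Suc n)) \<le> 2 / norm u * bB M 2 (Suc n)" if "n < m" for n
  proof -
    have "(norm u / 2) ^ Suc n \<le> norm (ff u (Suc n))" by (rule ff_bound) (use assms that m in simp)
    moreover have "norm u / 2 \<le> (norm u / 2) ^ Suc n" using power_increasing[of 1 "Suc n" "norm u / 2"] u2 by simp
    ultimately have l: "norm u / 2 \<le> norm (ff u (Suc n))" by linarith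
    have "norm (bp \<alpha> \<beta> (Suc n) 2 2 / ff u (Suc n)) \<le> bB M 2 (Suc n) / (norm u / 2)"
      unfolding norm_divide by (rule frac_le[OF _ bp_bound[OF assms(1,2)] _ l]) (use u2 in \<open>auto intro!: bB_nonneg M\<close>)
    thus ?thesis by (simp add: mult.commute)
  qed
  have "Fs \<alpha> \<beta> u N 2 2 - 1 = (\<Sum>n<m. bp \<alpha> \<beta> (Suc n) 2 2 / ff u (Suc n))"
    unfolding Fs_def m sum.lessThan_Suc_shift by (simp add: bp_def bco_def ff_def)
  hence "norm (Fs \<alpha> \<beta> u N 2 2 - 1) \<le> (\<Sum>n<m. 2 / norm u * bB M 2 (Suc n))"
    by (simp only:) (intro sum_norm_le b, simp)
  also have "\<dots> = 2 / norm u * (\<Sum>n<m. bB M 2 (Suc n))" by (simp add: sum_distrib_left)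
  also have "\<dots> \<le> 2 / norm u * (\<Sum>n<N. bB M 2 n)"
    unfolding m sum.lessThan_Suc_shift by (intro mult_left_mono) (auto intro!: bB_nonneg M)
  finally show ?thesis by simp
qed

lemma Fs'_bound:
  assumes "norm \<alpha> \<le> M" "norm \<beta> \<le> M" "norm s \<le> R" "norm c \<le> R" "R \<ge> 1" "2 - s = - t * s" "2 - c = t * c" "norm t \<le> 1"
    "norm u \<ge> 2 * real N" "norm u \<ge> 2"
  shows "norm (Fs' \<alpha> \<beta> u N s c) \<le> (\<Sum>n<N. bB M R n)" "norm (Fs' \<alpha> \<beta> u N (2 - s) (2 - c)) \<le> (\<Sum>n<N. bB M R n)"
proof -
  have M: "M \<ge> 0" using assms(1) norm_ge_zero order_trans by blast
  have d: "norm (x / ff u n) \<le> bB M R n" if "norm x \<le> norm t * bB M R n" "n < N" for x n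
  proof -
    have "(norm u / 2) ^ n \<le> norm (ff u n)" by (rule ff_bound) (use assms that in simp)
    moreover have "(1::real) \<le> (norm u / 2) ^ n" using assms by simp
    ultimately have f: "1 \<le> norm (ff u n)" by linarith
    have b0: "bB M R n \<ge> 0" using assms(5) by (intro bB_nonneg M) simp
    have "norm t * bB M R n \<le> bB M R n" using assms(8) b0 by (simp add: mult_left_le_one_le)
    hence "norm x \<le> bB M R n" using that(1) by linarith
    hence "norm (x / ff u n) \<le> bB M R n / 1" unfolding norm_divide by (rule frac_le[OF b0 _ zero_less_one f])
    thus ?thesis by simp
  qed
  show "norm (Fs' \<alpha> \<beta> u N s c) \<le> (\<Sum>n<N. bB M R n)"
    unfolding Fs'_def by (intro sum_norm_le d bp'_bound(1)[OF assms(1-7)]) auto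
  show "norm (Fs' \<alpha> \<beta> u N (2 - s) (2 - c)) \<le> (\<Sum>n<N. bB M R n)"
    unfolding Fs'_def
  proof (intro sum_norm_le d)
    fix n assume "n \<in> {..<N}"
    thus "n < N" by simp
    show "norm (bp' \<alpha> \<beta> n (2 - s) (2 - c)) \<le> norm t * bB M R n"
    proof (cases "n = 0")
      case True
      have "bB M R 0 \<ge> 0" using assms(5) by (intro bB_nonneg M) simp
      thus ?thesis using True by (simp add: bp'_def)
    qed (use bp'_bound(2)[OF assms(1-8), of n] in auto)
  qed
qed

lemma sv_cv_minus:
  assumes "1 - exp (- 2 * \<xi>) \<noteq> 0" "1 + exp (- 2 * \<xi>) \<noteq> 0"
  shows "sv (- \<xi>) = 2 - sv \<xi>" "cv (- \<xi>) = 2 - cv \<xi>"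
proof -
  define t where "t = exp (- 2 * \<xi>)"
  have t: "t \<noteq> 0" "exp (- 2 * (- \<xi>)) = 1 / t" by (simp_all add: t_def exp_minus divide_inverse)
  note n = assms[folded t_def]
  have n': "t - 1 \<noteq> 0" "t + 1 \<noteq> 0" using n by (auto simp: add.commute)
  have "1 - 1 / t = (t - 1) / t" "1 + 1 / t = (t + 1) / t" using t(1) by (simp_all add: diff_divide_distrib add_divide_distrib)
  hence "sv (- \<xi>) = 2 * t / (t - 1)" "cv (- \<xi>) = 2 * t / (t + 1)" unfolding sv_def cv_def t(2) by simp_all
  moreover have "2 * t / (t - 1) = 2 - 2 / (1 - t)" "2 * t / (t + 1) = 2 - 2 / (1 + t)"
    using n n' by (simp_all add: field_simps)
  ultimately show "sv (- \<xi>) = 2 - sv \<xi>" "cv (- \<xi>) = 2 - cv \<xi>" by (simp_all add: sv_def cv_def t_def)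
qed

text \<open>\<open>wu\<close> is \<open>exp (- u * \<xi>)\<close> times the sum of
  \<open>hdiff\<close> and the partial sum, divided by \<open>k\<close>, and each of these parts has
  a limit on the axis.\<close>

lemma wu_limits:
  fixes \<alpha> \<beta> u \<xi>0 :: complex and N :: nat
  defines "A \<equiv> \<alpha>\<^sup>2 - 1 / 4" and "B \<equiv> \<beta>\<^sup>2 - 1 / 4"
  defines "k \<equiv> Fs \<alpha> \<beta> u N 2 2"
  assumes h: "(hdiff \<alpha> \<beta> u N \<longlongrightarrow> h0) (at \<xi>0 within rhp)" "(hdiff' \<alpha> \<beta> u N \<longlongrightarrow> h1) (at \<xi>0 within rhp)"
    and k: "k \<noteq> 0" and n: "1 - exp (- 2 * \<xi>0) \<noteq> 0" "1 + exp (- 2 * \<xi>0) \<noteq> 0"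
  shows "(wu u A B \<longlongrightarrow> exp (- u * \<xi>0) * (h0 + Fs \<alpha> \<beta> u N (sv \<xi>0) (cv \<xi>0)) / k) (at \<xi>0 within rhp)"
    "(wu' u A B \<longlongrightarrow> exp (- u * \<xi>0) * (- u * (h0 + Fs \<alpha> \<beta> u N (sv \<xi>0) (cv \<xi>0)) + (h1 + Fs' \<alpha> \<beta> u N (sv \<xi>0) (cv \<xi>0))) / k) (at \<xi>0 within rhp)"
proof -
  let ?F = "at \<xi>0 within rhp"
  have e: "((\<lambda>\<xi>. exp (- u * \<xi>)) \<longlongrightarrow> exp (- u * \<xi>0)) ?F" by (intro tendsto_intros)
  have s: "(sv \<longlongrightarrow> sv \<xi>0) ?F" "(cv \<longlongrightarrow> cv \<xi>0) ?F"
    using DERIV_isCont[OF sv_cv(4)[OF n]] DERIV_isCont[OF sv_cv(5)[OF n]]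
    by (auto simp: isCont_def intro: tendsto_within_subset)
  have 1: "wu u A B = (\<lambda>\<xi>. exp (- u * \<xi>) * (hdiff \<alpha> \<beta> u N \<xi> + Fs \<alpha> \<beta> u N (sv \<xi>) (cv \<xi>)) / k)"
    unfolding wu_def[abs_def] hdiff_def A_def B_def k_def[symmetric] using k by simp
  have 2: "wu' u A B = (\<lambda>\<xi>. exp (- u * \<xi>) * (- u * (hdiff \<alpha> \<beta> u N \<xi> + Fs \<alpha> \<beta> u N (sv \<xi>) (cv \<xi>)) + (hdiff' \<alpha> \<beta> u N \<xi> + Fs' \<alpha> \<beta> u N (sv \<xi>) (cv \<xi>))) / k)"
  proof (rule ext)
    fix \<xi>
    have "E * (- u * g - 2 * t * g') = E * (- u * (k * g - F + F) + (k * (- 2 * t * g') - F' + F')) / k" for E g t g' F F'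
      using k by (simp add: field_simps)
    thus "wu' u A B \<xi> = exp (- u * \<xi>) * (- u * (hdiff \<alpha> \<beta> u N \<xi> + Fs \<alpha> \<beta> u N (sv \<xi>) (cv \<xi>)) + (hdiff' \<alpha> \<beta> u N \<xi> + Fs' \<alpha> \<beta> u N (sv \<xi>) (cv \<xi>))) / k"
      unfolding wu'_def hdiff_def hdiff'_def A_def B_def k_def[symmetric] .
  qed
  show "(wu u A B \<longlongrightarrow> exp (- u * \<xi>0) * (h0 + Fs \<alpha> \<beta> u N (sv \<xi>0) (cv \<xi>0)) / k) ?F"
    unfolding 1 by (intro tendsto_divide tendsto_mult tendsto_add tendsto_const e h Fs_tendsto s k)
  show "(wu' u A B \<longlongrightarrow> exp (- u * \<xi>0) * (- u * (h0 + Fs \<alpha> \<beta> u N (sv \<xi>0) (cv \<xi>0)) + (h1 + Fs' \<alpha> \<beta> u N (sv \<xi>0) (cv \<xi>0))) / k) ?F"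
    unfolding 2 by (intro tendsto_divide tendsto_mult tendsto_add tendsto_const e h Fs_tendsto s k)
qed

text \<open>The Wronskian of the boundary values is compared with that of the partial sums. The
  difference consists of products with at least one limit of \<open>hdiff\<close> or
  \<open>hdiff'\<close>, each of order \<open>1 / norm u ^ N\<close>; the factor \<open>u\<close>
  costs one power, hence the exponent \<open>N - 1\<close>.\<close>

lemma core_estimate:
  fixes \<epsilon> \<kappa> M :: real
  assumes pos: "\<epsilon> > 0" "\<kappa> > 0" "N \<ge> 1"
  obtains C U where "C \<ge> 0" "U \<ge> 2 * real N" and
    "\<And>\<alpha> \<beta> u \<zeta>. norm \<alpha> \<le> M \<Longrightarrow> norm \<beta> \<le> M \<Longrightarrow> norm u \<ge> U \<Longrightarrow> norm u + Re u \<ge> \<kappa> * norm u \<Longrightarrow> \<epsilon> \<le> \<zeta> \<Longrightarrow> \<zeta> \<le> pi / 2 - \<epsilon> \<Longrightarrow>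
      \<exists>a a' b b'. (wu u (\<alpha>\<^sup>2 - 1 / 4) (\<beta>\<^sup>2 - 1 / 4) \<longlongrightarrow> a) (at (\<i> * of_real \<zeta>) within rhp) \<and>
        (wu' u (\<alpha>\<^sup>2 - 1 / 4) (\<beta>\<^sup>2 - 1 / 4) \<longlongrightarrow> a') (at (\<i> * of_real \<zeta>) within rhp) \<and>
        (wu u (\<alpha>\<^sup>2 - 1 / 4) (\<beta>\<^sup>2 - 1 / 4) \<longlongrightarrow> b) (at (- (\<i> * of_real \<zeta>)) within rhp) \<and>
        (wu' u (\<alpha>\<^sup>2 - 1 / 4) (\<beta>\<^sup>2 - 1 / 4) \<longlongrightarrow> b') (at (- (\<i> * of_real \<zeta>)) within rhp) \<and>
        norm (Fs \<alpha> \<beta> u N (sv (\<i> * of_real \<zeta>)) (cv (\<i> * of_real \<zeta>))) \<le> C \<and>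
        norm (Fs \<alpha> \<beta> u N (2 - sv (\<i> * of_real \<zeta>)) (2 - cv (\<i> * of_real \<zeta>))) \<le> C \<and>
        norm (Fs \<alpha> \<beta> u N 2 2 * a - exp (- u * (\<i> * of_real \<zeta>)) * Fs \<alpha> \<beta> u N (sv (\<i> * of_real \<zeta>)) (cv (\<i> * of_real \<zeta>)))
          \<le> C / norm u ^ N * norm (exp (- u * (\<i> * of_real \<zeta>))) \<and>
        norm (Fs \<alpha> \<beta> u N 2 2 * b - exp (u * (\<i> * of_real \<zeta>)) * Fs \<alpha> \<beta> u N (2 - sv (\<i> * of_real \<zeta>)) (2 - cv (\<i> * of_real \<zeta>)))
          \<le> C / norm u ^ N * norm (exp (u * (\<i> * of_real \<zeta>))) \<and>
        norm ((Fs \<alpha> \<beta> u N 2 2)\<^sup>2 * (a' * b + b' * a) + 2 * u * Fs \<alpha> \<beta> u N 2 2) \<le> C / norm u ^ (N - 1) \<and>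
        norm (Fs \<alpha> \<beta> u N 2 2 - 1) \<le> 1 / 2"
proof -
  \<comment> \<open>Bounds are needed around the boundary points, not only at their height, hence
    half the margin.\<close>
  have e2: "\<epsilon> / 2 > 0" using pos by simp
  obtain C1 U1 where C1: "C1 \<ge> 0" "U1 > 0" and hb: "\<And>\<alpha> \<beta> u \<xi>. norm \<alpha> \<le> M \<Longrightarrow> norm \<beta> \<le> M \<Longrightarrow> norm u \<ge> U1 \<Longrightarrow> norm u + Re u \<ge> \<kappa> * norm u \<Longrightarrow>
     Re \<xi> > 0 \<Longrightarrow> \<epsilon> / 2 \<le> \<bar>Im \<xi>\<bar> \<Longrightarrow> \<bar>Im \<xi>\<bar> \<le> pi / 2 - \<epsilon> / 2 \<Longrightarrow>
     norm (hdiff \<alpha> \<beta> u N \<xi>) \<le> C1 / norm u ^ N \<and> norm (hdiff' \<alpha> \<beta> u N \<xi>) \<le> C1 / norm u ^ N"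
    using hdiff_bounds[OF e2 pos(2,3), of M] by blast
  obtain C2 where C2: "C2 \<ge> 0" and Vb: "\<And>\<alpha> \<beta> u \<zeta>. norm \<alpha> \<le> M \<Longrightarrow> norm \<beta> \<le> M \<Longrightarrow> norm u \<ge> 2 * real N \<Longrightarrow> \<epsilon> \<le> \<zeta> \<Longrightarrow> \<zeta> \<le> pi / 2 - \<epsilon> \<Longrightarrow>
     norm (2 * u * Fs \<alpha> \<beta> u N (sv (\<i> * of_real \<zeta>)) (cv (\<i> * of_real \<zeta>)) * Fs \<alpha> \<beta> u N (2 - sv (\<i> * of_real \<zeta>)) (2 - cv (\<i> * of_real \<zeta>))
       - Fs \<alpha> \<beta> u N (sv (\<i> * of_real \<zeta>)) (cv (\<i> * of_real \<zeta>)) * Fs' \<alpha> \<beta> u N (2 - sv (\<i> * of_real \<zeta>)) (2 - cv (\<i> * of_real \<zeta>))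
       - Fs' \<alpha> \<beta> u N (sv (\<i> * of_real \<zeta>)) (cv (\<i> * of_real \<zeta>)) * Fs \<alpha> \<beta> u N (2 - sv (\<i> * of_real \<zeta>)) (2 - cv (\<i> * of_real \<zeta>))
       - 2 * u * Fs \<alpha> \<beta> u N 2 2) \<le> C2 / norm u ^ (N - 1)"
    using Fs_wronskian_estimate[OF pos(1,3), of M] by blast
  define R where "R = Rb \<epsilon> 1"
  have R: "R \<ge> 1" by (simp add: R_def Rb_ge_1)
  define FB where "FB = \<bar>\<Sum>n<N. bB M R n\<bar>"
  define S2 where "S2 = \<bar>\<Sum>n<N. bB M 2 n\<bar>"
  define C where "C = FB + C1 + (C2 + 4 * C1 * (2 * FB + C1))"
  \<comment> \<open>The entry \<open>4 * S2\<close> forces \<open>norm (k - 1) \<le> 1 / 2\<close>,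
    so that division by \<open>k\<close> is harmless.\<close>
  define U where "U = max (max (2 * real N) U1) (4 * S2)"
  have FB0: "FB \<ge> 0" by (simp add: FB_def)
  show thesis
  proof (rule that[of C U])
    show "C \<ge> 0" using FB0 C1 C2 by (simp add: C_def)
    show "U \<ge> 2 * real N" by (simp add: U_def)
    fix \<alpha> \<beta> u :: complex and \<zeta> :: real
    assume ab: "norm \<alpha> \<le> M" "norm \<beta> \<le> M" and u: "norm u \<ge> U" "norm u + Re u \<ge> \<kappa> * norm u" and z: "\<epsilon> \<le> \<zeta>" "\<zeta> \<le> pi / 2 - \<epsilon>"
    have uN: "norm u \<ge> 2 * real N" and uU: "norm u \<ge> U1" and uS: "norm u \<ge> 4 * S2" using u by (auto simp: U_def)
    have u2: "norm u \<ge> 2" using uN pos by linarith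
    have "\<kappa> * norm u > 0" using u2 pos by (intro mult_pos_pos) auto
    hence nr: "nonres u" using u(2) by (intro nonres_sector) linarith
    let ?x = "\<i> * complex_of_real \<zeta>"
    define k where "k = Fs \<alpha> \<beta> u N 2 2"
    have k1: "norm (k - 1) \<le> 1 / 2"
    proof -
      have "norm (k - 1) \<le> (2 * (\<Sum>n<N. bB M 2 n)) / norm u" unfolding k_def by (rule Fs_2_2_near_1[OF ab uN pos(3)])
      also have "\<dots> \<le> (2 * S2) / norm u" by (intro divide_right_mono) (auto simp: S2_def)
      also have "\<dots> \<le> 1 / 2" using uS u2 by (simp add: divide_le_eq)
      finally show ?thesis .
    qed
    have k0: "k \<noteq> 0" using k1 by auto
    have x: "\<epsilon> \<le> \<bar>Im ?x\<bar>" "\<bar>Im ?x\<bar> \<le> pi / 2 - \<epsilon>" "Re ?x = 0" "Re ?x \<ge> 0" using z pos by auto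
    have x': "\<epsilon> \<le> \<bar>Im (- ?x)\<bar>" "\<bar>Im (- ?x)\<bar> \<le> pi / 2 - \<epsilon>" "Re (- ?x) = 0" "Re (- ?x) \<ge> 0" using z pos by auto
    have b: "norm (sv ?x) \<le> R" "norm (cv ?x) \<le> R" "1 - exp (- 2 * ?x) \<noteq> 0" "1 + exp (- 2 * ?x) \<noteq> 0"
      using sv_cv_bound[OF pos(1) zero_less_one x(1,2,4), of 1 0] unfolding R_def by auto
    have bm: "1 - exp (- 2 * (- ?x)) \<noteq> 0" "1 + exp (- 2 * (- ?x)) \<noteq> 0"
      using sv_cv_bound(3,4)[OF pos(1) zero_less_one x'(1,2,4), of 1 0] by auto
    note sm = sv_cv_minus[OF b(3,4)]
    define D where "D = C1 / norm u ^ N"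
    obtain h h1 where h: "(hdiff \<alpha> \<beta> u N \<longlongrightarrow> h) (at ?x within rhp)" "(hdiff' \<alpha> \<beta> u N \<longlongrightarrow> h1) (at ?x within rhp)" "norm h \<le> D" "norm h1 \<le> D"
      using hdiff_limits[OF ab pos(3) uN nr pos(1) x(3,1,2), of D] hb[OF ab uU u(2)] unfolding D_def by blast
    obtain j j1 where j: "(hdiff \<alpha> \<beta> u N \<longlongrightarrow> j) (at (- ?x) within rhp)" "(hdiff' \<alpha> \<beta> u N \<longlongrightarrow> j1) (at (- ?x) within rhp)" "norm j \<le> D" "norm j1 \<le> D"
      using hdiff_limits[OF ab pos(3) uN nr pos(1) x'(3,1,2), of D] hb[OF ab uU u(2)] unfolding D_def by blast
    define P Q p q where "P = Fs \<alpha> \<beta> u N (sv ?x) (cv ?x)" and "Q = Fs \<alpha> \<beta> u N (2 - sv ?x) (2 - cv ?x)"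
      and "p = Fs' \<alpha> \<beta> u N (sv ?x) (cv ?x)" and "q = Fs' \<alpha> \<beta> u N (2 - sv ?x) (2 - cv ?x)"
    define E E' where "E = exp (- u * ?x)" and "E' = exp (u * ?x)"
    have EE: "E * E' = 1" unfolding E_def E'_def exp_add[symmetric] by simp
    define a a' b b' where "a = E * (h + P) / k" and "a' = E * (- u * (h + P) + (h1 + p)) / k"
      and "b = E' * (j + Q) / k" and "b' = E' * (- u * (j + Q) + (j1 + q)) / k"
    have t1: "norm (exp (- 2 * ?x)) \<le> 1" by simp
    have ns: "norm (2 - sv ?x) \<le> R" "norm (2 - cv ?x) \<le> R"
      unfolding sv_cv(2,3)[OF b(3,4)] norm_mult norm_minus_cancel using b(1,2) by simp_all
    have bd: "norm P \<le> FB" "norm Q \<le> FB" "norm p \<le> FB" "norm q \<le> FB"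
      using Fs_bound[OF ab b(1,2) R uN u2] Fs_bound[OF ab ns R uN u2] Fs'_bound[OF ab b(1,2) R sv_cv(2,3)[OF b(3,4)] t1 uN u2]
      unfolding P_def Q_def p_def q_def FB_def by linarith+
    have V: "norm (2 * u * P * Q - P * q - p * Q - 2 * u * k) \<le> C2 / norm u ^ (N - 1)"
      unfolding P_def Q_def p_def q_def k_def by (rule Vb[OF ab uN z])
    have D0: "D \<ge> 0" using C1 by (simp add: D_def)
    have DC: "D \<le> C1"
    proof -
      have "norm u ^ N \<ge> 1" using u2 by simp
      thus ?thesis unfolding D_def using C1 by (simp add: divide_le_eq mult_left_le_one_le mult_le_cancel_left1)
    qed
    \<comment> \<open>All terms that contain at least one of the errors \<open>h\<close>,
      \<open>h1\<close>, \<open>j\<close>, \<open>j1\<close>.\<close>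
    define X where "X = - (2 * u) * (P * j + h * Q + h * j) + (p * j + h1 * Q + h1 * j) + (q * h + j1 * P + j1 * h)"
    have eq: "k\<^sup>2 * (a' * b + b' * a) + 2 * u * k = - (2 * u * P * Q - P * q - p * Q - 2 * u * k) + X"
    proof -
      have "k * a = E * (h + P)" "k * a' = E * (- u * (h + P) + (h1 + p))" "k * b = E' * (j + Q)" "k * b' = E' * (- u * (j + Q) + (j1 + q))"
        using k0 by (simp_all add: a_def a'_def b_def b'_def)
      hence "k\<^sup>2 * (a' * b + b' * a) = (E * E') * ((- u * (h + P) + (h1 + p)) * (j + Q) + (- u * (j + Q) + (j1 + q)) * (h + P))"
        by (simp add: power2_eq_square) algebra
      thus ?thesis unfolding EE X_def by (simp add: algebra_simps)
    qed
    have g3: "norm (x1 * y1 + x2 * y2 + x3 * y3) \<le> D * (2 * FB + C1)"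
      if "norm (x1 * y1) \<le> FB * D" "norm (x2 * y2) \<le> D * FB" "norm (x3 * y3) \<le> D * D" for x1 x2 x3 y1 y2 y3 :: complex
    proof -
      have "norm (x1 * y1 + x2 * y2 + x3 * y3) \<le> FB * D + D * FB + D * D" by (intro norm_triangle_mono that)
      also have "D * D \<le> D * C1" using DC D0 by (rule mult_left_mono)
      finally show ?thesis by (simp add: algebra_simps)
    qed
    have m: "norm x \<le> r \<Longrightarrow> norm y \<le> s \<Longrightarrow> norm (x * y) \<le> r * s" for x y :: complex and r s
      unfolding norm_mult by (intro mult_mono) (auto intro: order_trans[OF norm_ge_zero])
    have g: "norm (P * j + h * Q + h * j) \<le> D * (2 * FB + C1)" "norm (p * j + h1 * Q + h1 * j) \<le> D * (2 * FB + C1)"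
      "norm (q * h + j1 * P + j1 * h) \<le> D * (2 * FB + C1)"
      by (intro g3 m bd h j)+
    have "norm X \<le> 2 * norm u * (D * (2 * FB + C1)) + D * (2 * FB + C1) + D * (2 * FB + C1)"
      unfolding X_def by (intro norm_triangle_mono g m) (simp add: norm_mult)
    also have "\<dots> = (2 * norm u + 2) * (D * (2 * FB + C1))" by (simp add: algebra_simps)
    also have "\<dots> \<le> (4 * norm u) * (D * (2 * FB + C1))"
      using u2 D0 FB0 C1 by (intro mult_right_mono mult_nonneg_nonneg) auto
    also have "\<dots> = 4 * C1 * (2 * FB + C1) / norm u ^ (N - 1)"
    proof -
      have "norm u ^ N = norm u ^ (N - 1) * norm u" using pos(3) by (metis power_eq_if not_one_le_zero mult.commute)
      moreover have "4 * n * (x / (p * n) * y) = 4 * x * y / p" if "n \<noteq> 0" for n x y p :: real using that by (cases "p = 0") (simp_all add: field_simps)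
      ultimately show ?thesis using u2 unfolding D_def by auto
    qed
    finally have Xb: "norm X \<le> 4 * C1 * (2 * FB + C1) / norm u ^ (N - 1)" .
    have "norm (k\<^sup>2 * (a' * b + b' * a) + 2 * u * k) \<le> C2 / norm u ^ (N - 1) + 4 * C1 * (2 * FB + C1) / norm u ^ (N - 1)"
      unfolding eq by (intro norm_triangle_mono Xb) (use V in \<open>simp only: norm_minus_cancel\<close>)
    also have "\<dots> = (C2 + 4 * C1 * (2 * FB + C1)) / norm u ^ (N - 1)" by (simp add: add_divide_distrib)
    also have "\<dots> \<le> C / norm u ^ (N - 1)" unfolding C_def using FB0 C1 by (intro divide_right_mono) auto
    finally have main: "norm (k\<^sup>2 * (a' * b + b' * a) + 2 * u * k) \<le> C / norm u ^ (N - 1)" .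
    have DCu: "D \<le> C / norm u ^ N" unfolding D_def C_def using FB0 C1 C2 by (intro divide_right_mono) auto
    have ka: "norm (k * a - E * P) \<le> C / norm u ^ N * norm E" "norm (k * b - E' * Q) \<le> C / norm u ^ N * norm E'"
    proof -
      have "k * a = E * (h + P)" "k * b = E' * (j + Q)" using k0 by (simp_all add: a_def b_def)
      hence "k * a - E * P = h * E" "k * b - E' * Q = j * E'" by (simp_all add: algebra_simps)
      thus "norm (k * a - E * P) \<le> C / norm u ^ N * norm E" "norm (k * b - E' * Q) \<le> C / norm u ^ N * norm E'"
        using mult_right_mono[OF order_trans[OF h(3) DCu], of "norm E"] mult_right_mono[OF order_trans[OF j(3) DCu], of "norm E'"]
        by (simp_all only: norm_mult norm_ge_zero)
    qed
    have FC: "FB \<le> C" unfolding C_def using FB0 C1 C2 by simp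
    note L = wu_limits[OF h(1,2) k0[unfolded k_def] b(3,4)] wu_limits[OF j(1,2) k0[unfolded k_def] bm, unfolded sm]
    have mx: "- u * - ?x = u * ?x" by simp
    note L' = L[unfolded mx, folded k_def P_def Q_def p_def q_def E_def E'_def, folded a_def a'_def b_def b'_def]
    show "\<exists>a a' b b'. (wu u (\<alpha>\<^sup>2 - 1 / 4) (\<beta>\<^sup>2 - 1 / 4) \<longlongrightarrow> a) (at (\<i> * of_real \<zeta>) within rhp) \<and>
        (wu' u (\<alpha>\<^sup>2 - 1 / 4) (\<beta>\<^sup>2 - 1 / 4) \<longlongrightarrow> a') (at (\<i> * of_real \<zeta>) within rhp) \<and>
        (wu u (\<alpha>\<^sup>2 - 1 / 4) (\<beta>\<^sup>2 - 1 / 4) \<longlongrightarrow> b) (at (- (\<i> * of_real \<zeta>)) within rhp) \<and>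
        (wu' u (\<alpha>\<^sup>2 - 1 / 4) (\<beta>\<^sup>2 - 1 / 4) \<longlongrightarrow> b') (at (- (\<i> * of_real \<zeta>)) within rhp) \<and>
        norm (Fs \<alpha> \<beta> u N (sv (\<i> * of_real \<zeta>)) (cv (\<i> * of_real \<zeta>))) \<le> C \<and>
        norm (Fs \<alpha> \<beta> u N (2 - sv (\<i> * of_real \<zeta>)) (2 - cv (\<i> * of_real \<zeta>))) \<le> C \<and>
        norm (Fs \<alpha> \<beta> u N 2 2 * a - exp (- u * (\<i> * of_real \<zeta>)) * Fs \<alpha> \<beta> u N (sv (\<i> * of_real \<zeta>)) (cv (\<i> * of_real \<zeta>)))
          \<le> C / norm u ^ N * norm (exp (- u * (\<i> * of_real \<zeta>))) \<and>
        norm (Fs \<alpha> \<beta> u N 2 2 * b - exp (u * (\<i> * of_real \<zeta>)) * Fs \<alpha> \<beta> u N (2 - sv (\<i> * of_real \<zeta>)) (2 - cv (\<i> * of_real \<zeta>)))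
          \<le> C / norm u ^ N * norm (exp (u * (\<i> * of_real \<zeta>))) \<and>
        norm ((Fs \<alpha> \<beta> u N 2 2)\<^sup>2 * (a' * b + b' * a) + 2 * u * Fs \<alpha> \<beta> u N 2 2) \<le> C / norm u ^ (N - 1) \<and>
        norm (Fs \<alpha> \<beta> u N 2 2 - 1) \<le> 1 / 2"
      unfolding k_def[symmetric] P_def[symmetric] Q_def[symmetric] E_def[symmetric] E'_def[symmetric]
      by (intro exI[of _ a] exI[of _ a'] exI[of _ b] exI[of _ b'] conjI L' order_trans[OF bd(1) FC] order_trans[OF bd(2) FC] ka main k1)
  qed
qed


section \<open>Boundary values of the functions of the second kind\<close>

lemma xmap_exp:
  assumes "exp (- 2 * \<xi>) \<noteq> 1"
  shows "xmap (exp (- 2 * \<xi>)) = 2 / (1 - cosh (2 * \<xi>))"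
proof -
  define t where "t = exp (- 2 * \<xi>)"
  have t: "t \<noteq> 0" "t \<noteq> 1" "exp (2 * \<xi>) = 1 / t" using assms by (simp_all add: t_def exp_minus divide_inverse)
  have c: "cosh (2 * \<xi>) = (1 / t + t) / 2" using t(3) unfolding cosh_field_def t_def by simp
  have "1 - (1 / t + t) / 2 = - (1 - t)\<^sup>2 / (2 * t)" using t by (simp add: field_simps power2_eq_square)
  moreover have "(1 - t)\<^sup>2 \<noteq> 0" using t by simp
  ultimately show ?thesis unfolding c t_def[symmetric] xmap_def by simp
qed

text \<open>\<open>\<sigma> = 1\<close> is the upper and \<open>\<sigma> = -1\<close> the lower side
  of the cut. All powers are collected into the exponential of one sum of principal logarithms, each
  continuous at its limit point, so the phase in the result needs no separate choice of
  branch.\<close>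

lemma jacobi_Q_boundary:
  fixes \<sigma> \<zeta> :: real
  assumes s: "\<sigma> = 1 \<or> \<sigma> = -1" and z: "0 < \<zeta>" "\<zeta> < pi / 2" and nr: "nonres (2 * \<nu> + \<alpha> + \<beta> + 1)"
    and lim: "(wu (2 * \<nu> + \<alpha> + \<beta> + 1) (\<alpha>\<^sup>2 - 1 / 4) (\<beta>\<^sup>2 - 1 / 4) \<longlongrightarrow> a) (at (\<i> * of_real (\<sigma> * \<zeta>)) within rhp)"
  shows "((\<lambda>\<eta>. jacobi_Q \<nu> \<alpha> \<beta> (of_real (cos (2 * \<zeta>)) + \<i> * of_real (\<sigma> * \<eta>))) \<longlongrightarrow>
     exp ((2 * \<nu> + \<alpha> + \<beta>) * of_real (ln 2)) * Gamma (\<nu> + \<alpha> + 1) * Gamma (\<nu> + \<beta> + 1) * rGamma (2 * \<nu> + \<alpha> + \<beta> + 2) *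
     inverse (pfac \<alpha> \<beta> \<zeta>) * exp (- \<i> * of_real (\<sigma> * (pi / 2)) * (\<alpha> + 1 / 2)) * a) (at_right 0)"
proof -
  define u where "u = 2 * \<nu> + \<alpha> + \<beta> + 1"
  define x where "x = cos (2 * \<zeta>)"
  define zz where "zz = (\<lambda>\<eta>::real. complex_of_real x + \<i> * of_real (\<sigma> * \<eta>))"
  \<comment> \<open>Solves \<open>cosh (2 * \<xi> \<eta>) = zz \<eta>\<close> with limit
    \<open>\<i> * \<sigma> * \<zeta>\<close>. The factor \<sigma> selects the solution with positive
    real part.\<close>
  define \<xi> where "\<xi> = (\<lambda>\<eta>. \<i> * of_real \<sigma> * Arccos (zz \<eta>) / 2)"
  define L where "L = (\<lambda>\<eta>. (\<nu> + \<alpha> + \<beta>) * Ln 2 - (\<nu> + \<alpha> + 1) * (Ln (1 - zz \<eta>) + \<i> * of_real (\<sigma> * pi)) - \<beta> * Ln (zz \<eta> + 1)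
     + (2 * \<nu> + \<alpha> + 3 / 2) * Ln (1 - exp (- 2 * \<xi> \<eta>)) + (\<beta> - 1 / 2) * Ln (1 + exp (- 2 * \<xi> \<eta>)) + u * \<xi> \<eta>)"
  define G where "G = Gamma (\<nu> + \<alpha> + 1) * Gamma (\<nu> + \<beta> + 1) * rGamma (2 * \<nu> + \<alpha> + \<beta> + 2)"
  have x: "\<bar>x\<bar> < 1" 
  proof -
    have "\<bar>x\<bar> \<noteq> 1"
    proof
      assume "\<bar>x\<bar> = 1"
      hence "x\<^sup>2 = 1" by (metis power2_abs one_power2)
      hence "sin (2 * \<zeta>) = 0" using sin_cos_squared_add[of "2 * \<zeta>"] unfolding x_def by simp
      moreover have "sin (2 * \<zeta>) > 0" using z by (intro sin_gt_zero) auto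
      ultimately show False by simp
    qed
    thus ?thesis using abs_cos_le_one[of "2 * \<zeta>"] unfolding x_def by linarith
  qed
  have sz: "sin \<zeta> > 0" "cos \<zeta> > 0" using z by (auto intro: sin_gt_zero cos_gt_zero)
  have zt: "(zz \<longlongrightarrow> of_real x) (at_right 0)"
  proof -
    have "(zz \<longlongrightarrow> of_real x + \<i> * of_real (\<sigma> * 0)) (at_right 0)" unfolding zz_def by (intro tendsto_intros)
    thus ?thesis by simp
  qed
  have ac: "isCont Arccos (complex_of_real x)" by (rule isCont_Arccos) (use x in auto)
  have acx: "Arccos (complex_of_real x) = of_real (2 * \<zeta>)"
  proof -
    have "complex_of_real x = cos (of_real (2 * \<zeta>))" unfolding x_def cos_of_real by simp
    thus ?thesis by (simp only:) (rule Arccos_cos, use z in simp)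
  qed
  have act: "((\<lambda>\<eta>. Arccos (zz \<eta>)) \<longlongrightarrow> of_real (2 * \<zeta>)) (at_right 0)"
    using isCont_tendsto_compose[OF ac zt] unfolding acx .
  have \<xi>t: "(\<xi> \<longlongrightarrow> \<i> * of_real (\<sigma> * \<zeta>)) (at_right 0)"
  proof -
    have "(\<xi> \<longlongrightarrow> \<i> * of_real \<sigma> * of_real (2 * \<zeta>) / 2) (at_right 0)" unfolding \<xi>_def by (intro tendsto_intros act) simp
    thus ?thesis by (simp add: mult_ac)
  qed
  have ss: "\<sigma> * \<sigma> = 1" "complex_of_real \<sigma> * of_real \<sigma> = 1" using s by auto
  have ch: "cosh (2 * \<xi> \<eta>) = zz \<eta>" for \<eta>
  proof -
    have "cosh (\<i> * of_real \<sigma> * w) = cos w" for w :: complex using s unfolding cosh_field_def cos_exp_eq by (auto simp: add.commute)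
    from this[of "Arccos (zz \<eta>)"] show ?thesis unfolding \<xi>_def by (simp add: cos_Arccos)
  qed
  have re: "\<forall>\<^sub>F \<eta> in at_right 0. \<xi> \<eta> \<in> rhp"
  proof -
    have "((\<lambda>\<eta>. Re (Arccos (zz \<eta>))) \<longlongrightarrow> Re (of_real (2 * \<zeta>))) (at_right 0)" by (intro tendsto_Re act)
    hence "\<forall>\<^sub>F \<eta> in at_right 0. Re (Arccos (zz \<eta>)) > 0" "\<forall>\<^sub>F \<eta> in at_right 0. Re (Arccos (zz \<eta>)) < pi"
      using z by (auto intro: order_tendstoD(1)[where y = "2 * \<zeta>"] order_tendstoD(2)[where y = "2 * \<zeta>"])
    thus ?thesis using eventually_at_right_less[of 0]
    proof eventually_elim
      case (elim \<eta>)
      define p where "p = Arccos (zz \<eta>)"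
      \<comment> \<open>The imaginary part of \<open>Arccos\<close> has the sign opposite to
        \<sigma>, and this puts \<open>\<xi> \<eta>\<close> in the right half-plane.\<close>
      have "Im (cos p) = \<sigma> * \<eta>" unfolding p_def cos_Arccos zz_def by simp
      hence i: "- sin (Re p) * sinh (Im p) = \<sigma> * \<eta>" by (simp add: Im_cos sinh_def exp_minus field_simps)
      have sp: "sin (Re p) > 0" using elim by (intro sin_gt_zero) (auto simp: p_def)
      have "sin (Re p) * (- \<sigma> * sinh (Im p)) = (\<sigma> * \<sigma>) * \<eta>" using arg_cong[OF i, of "\<lambda>y. \<sigma> * y"] by (simp add: mult_ac)
      hence "sin (Re p) * (- \<sigma> * sinh (Im p)) > 0" using elim(3) ss by simp
      hence "- \<sigma> * sinh (Im p) > 0" using sp zero_less_mult_pos by blast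
      hence "- \<sigma> * Im p > 0" using s by auto
      thus ?case by (simp add: \<xi>_def p_def[symmetric])
    qed
  qed
  have fl: "filterlim \<xi> (at (\<i> * of_real (\<sigma> * \<zeta>)) within rhp) (at_right 0)"
    unfolding filterlim_at
  proof (intro conjI \<xi>t)
    show "\<forall>\<^sub>F \<eta> in at_right 0. \<xi> \<eta> \<in> rhp \<and> \<xi> \<eta> \<noteq> \<i> * of_real (\<sigma> * \<zeta>)"
      by (rule eventually_mono[OF re]) auto
  qed
  have wt: "((\<lambda>\<eta>. wu u (\<alpha>\<^sup>2 - 1 / 4) (\<beta>\<^sup>2 - 1 / 4) (\<xi> \<eta>)) \<longlongrightarrow> a) (at_right 0)"
    by (rule filterlim_compose[OF lim[folded u_def] fl])
  have eq: "\<forall>\<^sub>F \<eta> in at_right 0. jacobi_Q \<nu> \<alpha> \<beta> (zz \<eta>) = exp (L \<eta>) * G * wu u (\<alpha>\<^sup>2 - 1 / 4) (\<beta>\<^sup>2 - 1 / 4) (\<xi> \<eta>)"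
    using re eventually_at_right_less[of 0]
  proof eventually_elim
    case (elim \<eta>)
    define t where "t = exp (- 2 * \<xi> \<eta>)"
    have t: "norm t < 1" using elim by (simp add: t_def)
    have t1: "exp (- 2 * \<xi> \<eta>) \<noteq> 1" using t unfolding t_def by (metis norm_one less_irrefl)
    have im: "Im (1 - zz \<eta>) = - (\<sigma> * \<eta>)" "Im (zz \<eta> + 1) = \<sigma> * \<eta>" by (simp_all add: zz_def)
    have nz: "zz \<eta> - 1 \<noteq> 0" "zz \<eta> + 1 \<noteq> 0" "1 - zz \<eta> \<noteq> 0" using im elim s by (auto simp: complex_eq_iff)
    \<comment> \<open>\<open>zz \<eta> - 1\<close> tends to a point on the branch cut of
      \<open>Ln\<close>, while \<open>1 - zz \<eta>\<close> does not. The difference of the two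
      logarithms depends on the side \<sigma>.\<close>
    have ln: "Ln (zz \<eta> - 1) = Ln (1 - zz \<eta>) + \<i> * of_real (\<sigma> * pi)"
      using Ln_minus[OF nz(3)] im(1) s elim by auto
    have h: "hyp_reg (\<nu> + 1) (\<nu> + \<alpha> + 1) (2 * \<nu> + \<alpha> + \<beta> + 2) (2 / (1 - zz \<eta>)) =
      rGamma (2 * \<nu> + \<alpha> + \<beta> + 2) * lfac (2 * \<nu> + \<alpha> + 3 / 2) (\<beta> - 1 / 2) t * gf u (\<alpha>\<^sup>2 - 1 / 4) (\<beta>\<^sup>2 - 1 / 4) t"
    proof -
      have e: "(\<nu> + 1) + (\<nu> + \<alpha> + 1) - 1 / 2 = 2 * \<nu> + \<alpha> + 3 / 2" "2 * \<nu> + \<alpha> + \<beta> + 2 - (\<nu> + 1) - (\<nu> + \<alpha> + 1) = \<beta>"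
        "2 * \<nu> + \<alpha> + \<beta> + 2 - 1 = u" "\<nu> + \<alpha> + 1 - (\<nu> + 1) = \<alpha>" by (simp_all add: u_def)
      have "nonres (2 * \<nu> + \<alpha> + \<beta> + 2 - 1)" using nr unfolding e(3) u_def .
      from hyp_reg_pullback[OF this t, of "\<nu> + 1" "\<nu> + \<alpha> + 1"] show ?thesis
        unfolding e xmap_exp[OF t1, folded t_def, unfolded ch] .
    qed
    have w: "gf u A B t = exp (u * \<xi> \<eta>) * wu u A B (\<xi> \<eta>)" for A B
      unfolding wu_def t_def by (simp add: mult.assoc[symmetric] exp_add[symmetric])
    have g: "exp x0 * g1 * g2 / (exp x1 * exp x2) * (r * exp (x3 + x4) * (exp x5 * W)) = exp (x0 - x1 - x2 + x3 + x4 + x5) * (g1 * g2 * r) * W"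
      for x0 x1 x2 x3 x4 x5 g1 g2 r W :: complex
      by (simp add: exp_add exp_diff divide_inverse mult_ac)
    have p: "2 powr (\<nu> + \<alpha> + \<beta>) = exp ((\<nu> + \<alpha> + \<beta>) * Ln 2)" "(zz \<eta> + 1) powr \<beta> = exp (\<beta> * Ln (zz \<eta> + 1))"
      "(zz \<eta> - 1) powr (\<nu> + \<alpha> + 1) = exp ((\<nu> + \<alpha> + 1) * (Ln (1 - zz \<eta>) + \<i> * of_real (\<sigma> * pi)))"
      using nz by (simp_all add: powr_def ln)
    show ?case unfolding jacobi_Q_def h w lfac_def p g G_def L_def t_def[symmetric] ..
  qed
  define L0 where "L0 = (\<nu> + \<alpha> + \<beta>) * Ln 2 - (\<nu> + \<alpha> + 1) * (of_real (ln (2 * (sin \<zeta>)\<^sup>2)) + \<i> * of_real (\<sigma> * pi)) - \<beta> * of_real (ln (2 * (cos \<zeta>)\<^sup>2))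
     + (2 * \<nu> + \<alpha> + 3 / 2) * (of_real (ln (2 * sin \<zeta>)) + \<i> * of_real (\<sigma> * (pi / 2 - \<zeta>))) + (\<beta> - 1 / 2) * (of_real (ln (2 * cos \<zeta>)) - \<i> * of_real (\<sigma> * \<zeta>)) + u * (\<i> * of_real (\<sigma> * \<zeta>))"
  have lnr: "((\<lambda>\<eta>. Ln (f \<eta>)) \<longlongrightarrow> of_real (ln r) + \<i> * of_real q) (at_right 0)"
    if "(f \<longlongrightarrow> exp (of_real (ln r) + \<i> * of_real q)) (at_right 0)" "\<bar>q\<bar> < pi" for f :: "real \<Rightarrow> complex" and r q :: real
  proof -
    have e: "Ln (exp (of_real (ln r) + \<i> * of_real q)) = of_real (ln r) + \<i> * of_real q" by (rule Ln_exp) (use that(2) in auto)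
    have "exp (of_real (ln r) + \<i> * of_real q) \<notin> \<real>\<^sub>\<le>\<^sub>0"
    proof
      assume "exp (of_real (ln r) + \<i> * of_real q) \<in> \<real>\<^sub>\<le>\<^sub>0"
      then obtain y where y: "y \<le> 0" "exp (of_real (ln r) + \<i> * of_real q) = complex_of_real y" by (auto elim: nonpos_Reals_cases)
      have "y \<noteq> 0" using y(2) by (metis exp_not_eq_zero of_real_0)
      hence "Im (Ln (complex_of_real y)) = pi" using y(1) by (simp add: Im_Ln_eq_pi)
      thus False using e that(2) unfolding y(2)[symmetric] by simp
    qed
    from tendsto_Ln[OF that(1) this] show ?thesis unfolding e .
  qed
  have ex: "exp (of_real (ln r) + \<i> * of_real q) = of_real r * exp (\<i> * of_real q)" if "r > 0" for r q :: real
    using that by (simp add: exp_add exp_of_real)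
  have et: "((\<lambda>\<eta>. exp (- 2 * \<xi> \<eta>)) \<longlongrightarrow> exp (- 2 * (\<i> * of_real (\<sigma> * \<zeta>)))) (at_right 0)" by (intro tendsto_intros \<xi>t)
  have tv: "1 - exp (- 2 * (\<i> * of_real (\<sigma> * \<zeta>))) = of_real (2 * sin \<zeta>) * exp (\<i> * of_real (\<sigma> * (pi / 2 - \<zeta>)))"
    "1 + exp (- 2 * (\<i> * of_real (\<sigma> * \<zeta>))) = of_real (2 * cos \<zeta>) * exp (\<i> * of_real (- \<sigma> * \<zeta>))"
  proof -
    have "cos (2 * \<zeta>) = 1 - 2 * (sin \<zeta> * sin \<zeta>)" "cos (2 * \<zeta>) = 2 * (cos \<zeta> * cos \<zeta>) - 1" "sin (2 * \<zeta>) = 2 * (sin \<zeta> * cos \<zeta>)"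
      using cos_double_sin[of \<zeta>] cos_double_cos[of \<zeta>] sin_double[of \<zeta>] by (simp_all add: power2_eq_square)
    moreover have "cos (pi / 2 - \<zeta>) = sin \<zeta>" "sin (pi / 2 - \<zeta>) = cos \<zeta>" "cos (\<zeta> - pi / 2) = sin \<zeta>" "sin (\<zeta> - pi / 2) = - cos \<zeta>"
      by (simp_all add: cos_diff sin_diff)
    ultimately show "1 - exp (- 2 * (\<i> * of_real (\<sigma> * \<zeta>))) = of_real (2 * sin \<zeta>) * exp (\<i> * of_real (\<sigma> * (pi / 2 - \<zeta>)))"
      "1 + exp (- 2 * (\<i> * of_real (\<sigma> * \<zeta>))) = of_real (2 * cos \<zeta>) * exp (\<i> * of_real (- \<sigma> * \<zeta>))"
      using s by (auto simp: complex_eq_iff Re_exp Im_exp sin_diff)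
  qed
  have "(L \<longlongrightarrow> L0) (at_right 0)"
  proof -
    have 1: "((\<lambda>\<eta>. Ln (1 - zz \<eta>)) \<longlongrightarrow> of_real (ln (2 * (sin \<zeta>)\<^sup>2))) (at_right 0)"
    proof -
      have "((\<lambda>\<eta>. 1 - zz \<eta>) \<longlongrightarrow> 1 - of_real x) (at_right 0)" by (intro tendsto_intros zt)
      moreover have "1 - complex_of_real x = of_real (2 * (sin \<zeta>)\<^sup>2)" unfolding x_def cos_double_sin by simp
      ultimately show ?thesis using lnr[of "\<lambda>\<eta>. 1 - zz \<eta>" "2 * (sin \<zeta>)\<^sup>2" 0] ex[of "2 * (sin \<zeta>)\<^sup>2" 0] sz by simp
    qed
    have 2: "((\<lambda>\<eta>. Ln (zz \<eta> + 1)) \<longlongrightarrow> of_real (ln (2 * (cos \<zeta>)\<^sup>2))) (at_right 0)"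
    proof -
      have "((\<lambda>\<eta>. zz \<eta> + 1) \<longlongrightarrow> of_real x + 1) (at_right 0)" by (intro tendsto_intros zt)
      moreover have "complex_of_real x + 1 = of_real (2 * (cos \<zeta>)\<^sup>2)" unfolding x_def cos_double_cos by simp
      ultimately show ?thesis using lnr[of "\<lambda>\<eta>. zz \<eta> + 1" "2 * (cos \<zeta>)\<^sup>2" 0] ex[of "2 * (cos \<zeta>)\<^sup>2" 0] sz by simp
    qed
    have 3: "((\<lambda>\<eta>. Ln (1 - exp (- 2 * \<xi> \<eta>))) \<longlongrightarrow> of_real (ln (2 * sin \<zeta>)) + \<i> * of_real (\<sigma> * (pi / 2 - \<zeta>))) (at_right 0)"
    proof (rule lnr)
      show "((\<lambda>\<eta>. 1 - exp (- 2 * \<xi> \<eta>)) \<longlongrightarrow> exp (of_real (ln (2 * sin \<zeta>)) + \<i> * of_real (\<sigma> * (pi / 2 - \<zeta>)))) (at_right 0)"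
        using tendsto_diff[OF tendsto_const et, of 1] unfolding tv ex[OF mult_pos_pos[OF zero_less_numeral sz(1)]] .
      show "\<bar>\<sigma> * (pi / 2 - \<zeta>)\<bar> < pi" using s z by auto
    qed
    have 4: "((\<lambda>\<eta>. Ln (1 + exp (- 2 * \<xi> \<eta>))) \<longlongrightarrow> of_real (ln (2 * cos \<zeta>)) + \<i> * of_real (- \<sigma> * \<zeta>)) (at_right 0)"
    proof (rule lnr)
      show "((\<lambda>\<eta>. 1 + exp (- 2 * \<xi> \<eta>)) \<longlongrightarrow> exp (of_real (ln (2 * cos \<zeta>)) + \<i> * of_real (- \<sigma> * \<zeta>))) (at_right 0)"
        using tendsto_add[OF tendsto_const et, of 1] unfolding tv ex[OF mult_pos_pos[OF zero_less_numeral sz(2)]] .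
      show "\<bar>- \<sigma> * \<zeta>\<bar> < pi" using s z by auto
    qed
    have 4: "((\<lambda>\<eta>. Ln (1 + exp (- 2 * \<xi> \<eta>))) \<longlongrightarrow> of_real (ln (2 * cos \<zeta>)) - \<i> * of_real (\<sigma> * \<zeta>)) (at_right 0)"
      using 4 by simp
    show ?thesis unfolding L_def L0_def by (intro tendsto_intros 1 2 3 4 \<xi>t)
  qed
  hence "((\<lambda>\<eta>. exp (L \<eta>) * G * wu u (\<alpha>\<^sup>2 - 1 / 4) (\<beta>\<^sup>2 - 1 / 4) (\<xi> \<eta>)) \<longlongrightarrow> exp L0 * G * a) (at_right 0)"
    by (intro tendsto_intros wt)
  hence "((\<lambda>\<eta>. jacobi_Q \<nu> \<alpha> \<beta> (zz \<eta>)) \<longlongrightarrow> exp L0 * G * a) (at_right 0)"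
    by (rule Lim_transform_eventually) (use eq in \<open>auto elim: eventually_mono\<close>)
  moreover have "exp L0 = exp ((2 * \<nu> + \<alpha> + \<beta>) * of_real (ln 2)) * inverse (pfac \<alpha> \<beta> \<zeta>) * exp (- \<i> * of_real (\<sigma> * (pi / 2)) * (\<alpha> + 1 / 2))"
  proof -
    define l S C P Z where "l = complex_of_real (ln 2)" and "S = complex_of_real (ln (sin \<zeta>))" and "C = complex_of_real (ln (cos \<zeta>))"
      and "P = \<i> * complex_of_real (\<sigma> * (pi / 2))" and "Z = \<i> * complex_of_real (\<sigma> * \<zeta>)"
    have r: "complex_of_real (ln (2 * (sin \<zeta>)\<^sup>2)) = l + 2 * S" "complex_of_real (ln (2 * (cos \<zeta>)\<^sup>2)) = l + 2 * C"
      "complex_of_real (ln (2 * sin \<zeta>)) = l + S" "complex_of_real (ln (2 * cos \<zeta>)) = l + C"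
      using sz by (simp_all add: ln_mult ln_realpow l_def S_def C_def)
    have r2: "\<i> * complex_of_real (\<sigma> * pi) = 2 * P" "\<i> * complex_of_real (\<sigma> * (pi / 2 - \<zeta>)) = P - Z" "Ln 2 = l"
      using Ln_of_real[of 2] by (simp_all add: P_def Z_def l_def algebra_simps)
    have "L0 = (2 * \<nu> + \<alpha> + \<beta>) * l - ((\<alpha> + 1 / 2) * S + (\<beta> + 1 / 2) * C) + - P * (\<alpha> + 1 / 2)"
    proof -
      \<comment> \<open>Here \<open>h\<close> stands for 1/2. With \<open>h\<close> free the desired
        identity fails by \<open>(2 * h - 1) * (Z - l)\<close>, which vanishes at 1/2.\<close>
      have "(\<nu> + \<alpha> + \<beta>) * l - (\<nu> + \<alpha> + 1) * (l + 2 * S + 2 * P) - \<beta> * (l + 2 * C) + (2 * \<nu> + \<alpha> + (2 - h)) * (l + S + (P - Z))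
        + (\<beta> - h) * (l + C - Z) + (2 * \<nu> + \<alpha> + \<beta> + 1) * Z =
        (2 * \<nu> + \<alpha> + \<beta>) * l - ((\<alpha> + h) * S + (\<beta> + h) * C) + - P * (\<alpha> + h) + (2 * h - 1) * (Z - l)" for h
        by (simp add: algebra_simps)
      moreover have "(2::complex) - 1 / 2 = 3 / 2" "2 * (1 / 2) - 1 = (0::complex)" by simp_all
      ultimately show ?thesis unfolding L0_def r r2 Z_def[symmetric] u_def by (metis add.right_neutral mult_zero_left)
    qed
    moreover have "exp (x - y + w) = exp x * inverse (exp y) * exp w" for x y w :: complex
      by (simp add: exp_add exp_diff divide_inverse)
    moreover have "- \<i> * of_real (\<sigma> * (pi / 2)) = - P" by (simp add: P_def)
    ultimately show ?thesis unfolding pfac_def l_def[symmetric] S_def[symmetric] C_def[symmetric] by (simp only:)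
  qed
  moreover have "e * i * s * (g1 * g2 * r) * a = e * g1 * g2 * r * i * s * a" for e i s g1 g2 r :: complex
    by (simp add: mult_ac)
  ultimately show ?thesis unfolding zz_def x_def G_def by (simp only:)
qed


section \<open>The expansion in terms of boundary values\<close>

lemma sv_cv_ii:
  assumes z: "0 < \<zeta>" "\<zeta> < pi / 2"
  defines "E \<equiv> exp (\<i> * complex_of_real \<zeta>)" and "E' \<equiv> exp (- (\<i> * complex_of_real \<zeta>))"
  shows "sv (\<i> * of_real \<zeta>) = - \<i> * E / of_real (sin \<zeta>)" "cv (\<i> * of_real \<zeta>) = E / of_real (cos \<zeta>)"
    "2 - sv (\<i> * of_real \<zeta>) = \<i> * E' / of_real (sin \<zeta>)" "2 - cv (\<i> * of_real \<zeta>) = E' / of_real (cos \<zeta>)"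
proof -
  have EE: "E * E' = 1" unfolding E_def E'_def exp_add[symmetric] by simp
  have sz: "sin \<zeta> > 0" "cos \<zeta> > 0" using z by (auto intro: sin_gt_zero cos_gt_zero)
  define s c where "s = complex_of_real (sin \<zeta>)" and "c = complex_of_real (cos \<zeta>)"
  have nz: "s \<noteq> 0" "c \<noteq> 0" using sz unfolding s_def c_def by simp_all
  have sc: "2 * \<i> * s = E - E'" "2 * c = E + E'"
    unfolding s_def c_def E_def E'_def sin_of_real[symmetric] cos_of_real[symmetric] sin_exp_eq cos_exp_eq by simp_all
  have t: "exp (- 2 * (\<i> * of_real \<zeta>)) = E' * E'" unfolding E'_def exp_add[symmetric] by simp
  have n: "E' \<noteq> 0" by (simp add: E'_def)
  have d: "1 - E' * E' = E' * (2 * \<i> * s)" "1 + E' * E' = E' * (2 * c)"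
    unfolding sc using EE by (simp_all add: algebra_simps)
  have E: "E = 1 / E'" using EE n by (simp add: field_simps)
  have i: "2 / (x * (2 * \<i> * y)) = - \<i> * (1 / x) / y" "2 / (x * (2 * y)) = (1 / x) / y" if "x \<noteq> 0" "y \<noteq> 0" for x y :: complex
    using that by (simp_all add: field_simps)
  have svc: "sv (\<i> * of_real \<zeta>) = - \<i> * E / s" "cv (\<i> * of_real \<zeta>) = E / c"
    unfolding sv_def cv_def t d E using i[OF n nz(1)] i[OF n nz(2)] by simp_all
  moreover have "2 - (- \<i> * E / s) = \<i> * E' / s"
  proof -
    have "2 * s + \<i> * E = \<i> * E'" using arg_cong[OF sc(1), of "\<lambda>y. - \<i> * y"] by (simp add: algebra_simps)
    moreover have "2 - (- \<i> * E / s) = (2 * s + \<i> * E) / s" using nz by (simp add: field_simps)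
    ultimately show ?thesis by simp
  qed
  moreover have "2 - E / c = E' / c"
  proof -
    have "2 * c - E = E'" using sc(2) by simp
    moreover have "2 - E / c = (2 * c - E) / c" using nz by (simp add: field_simps)
    ultimately show ?thesis by simp
  qed
  ultimately show "sv (\<i> * of_real \<zeta>) = - \<i> * E / of_real (sin \<zeta>)" "cv (\<i> * of_real \<zeta>) = E / of_real (cos \<zeta>)"
    "2 - sv (\<i> * of_real \<zeta>) = \<i> * E' / of_real (sin \<zeta>)" "2 - cv (\<i> * of_real \<zeta>) = E' / of_real (cos \<zeta>)"
    unfolding s_def c_def by simp_all
qed

text \<open>No pole is met: a real \<open>u\<close> must be positive by the second part of the
  hypothesis and is then at least \<open>2 * N\<close>, so \<open>u - of_nat m\<close> with
  \<open>m < N\<close> cannot be a nonpositive integer.\<close>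

lemma Gamma_ratio:
  assumes u: "norm u \<ge> 2 * real N" "norm u + Re u > 0" and n: "n < N"
  shows "Gamma (u - of_nat n) / Gamma (u + 1) = 1 / (u * ff u n)"
proof -
  have np: "u - of_nat m \<notin> \<int>\<^sub>\<le>\<^sub>0" if "m < N" for m
  proof
    assume "u - of_nat m \<in> \<int>\<^sub>\<le>\<^sub>0"
    then obtain k where "u - of_nat m = - of_nat k" by (elim nonpos_Ints_cases')
    hence e: "u = of_real (real m - real k)" by (simp add: algebra_simps)
    show False using u that unfolding e by (auto simp del: of_real_diff simp: norm_of_real)
  qed
  have G: "Gamma u = ff u m * Gamma (u - of_nat m)" if "m < N" for m
    using that
  proof (induction m)
    case (Suc m)
    have "Gamma (u - of_nat (Suc m) + 1) = (u - of_nat (Suc m)) * Gamma (u - of_nat (Suc m))"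
      by (rule Gamma_plus1[OF np[OF Suc.prems]])
    moreover have "u - of_nat (Suc m) + 1 = u - of_nat m" "u - of_nat (Suc m) = u - 1 - of_nat m" by simp_all
    ultimately show ?case using Suc by (simp add: ff_def)
  qed (simp add: ff_def)
  have np0: "u \<notin> \<int>\<^sub>\<le>\<^sub>0" using np[of 0] n by simp
  have "Gamma (u - of_nat n) \<noteq> 0" using np[OF n] by (simp add: Gamma_eq_zero_iff)
  thus ?thesis unfolding Gamma_plus1[OF np0] G[OF n] by simp
qed

text \<open>Combination of the partial sums at the two boundary points with phases \<open>p\<close>
  and \<open>q\<close>. Divided by \<open>2 * u\<close> it is the truncated expansion in exponential
  form.\<close>

definition Tb :: "complex \<Rightarrow> complex \<Rightarrow> complex \<Rightarrow> nat \<Rightarrow> real \<Rightarrow> complex \<Rightarrow> complex \<Rightarrow> complex" where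
  "Tb \<alpha> \<beta> u N \<zeta> p q =
     p * (exp (- u * (\<i> * of_real \<zeta>)) * Fs \<alpha> \<beta> u N (sv (\<i> * of_real \<zeta>)) (cv (\<i> * of_real \<zeta>))) +
     q * (exp (u * (\<i> * of_real \<zeta>)) * Fs \<alpha> \<beta> u N (2 - sv (\<i> * of_real \<zeta>)) (2 - cv (\<i> * of_real \<zeta>)))"

text \<open>On the axis \<open>s ^ l * c ^ (n - l)\<close> is
  \<open>(- \<i>) ^ l * exp (\<i> * \<zeta>) ^ n\<close> over powers of sine and cosine, so its
  exponential does not depend on \<open>l\<close>. The hypothesis \<open>trig\<close> merges the
  contributions of the two boundary points into one sine or cosine.\<close>

lemma Tb_eq_expansion:
  fixes \<zeta> :: real
  assumes z: "0 < \<zeta>" "\<zeta> < pi / 2" and u: "u = 2 * \<nu> + \<alpha> + \<beta> + 1" "norm u \<ge> 2 * real N" "norm u + Re u > 0"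
    and trig: "\<And>n l. p * (exp (- u * (\<i> * of_real \<zeta>)) * ((- \<i>) ^ l * exp (\<i> * of_real \<zeta>) ^ n)) +
       q * (exp (u * (\<i> * of_real \<zeta>)) * (\<i> ^ l * exp (- (\<i> * of_real \<zeta>)) ^ n)) = 2 * c * trig (ph \<nu> \<alpha> \<beta> \<zeta> n l)"
  shows "Tb \<alpha> \<beta> u N \<zeta> p q / (2 * u) = c * (\<Sum>n<N. expansion_term trig ph n \<nu> \<alpha> \<beta> \<zeta>)"
proof -
  define S C where "S = complex_of_real (sin \<zeta>)" and "C = complex_of_real (cos \<zeta>)"
  define E E' where "E = exp (\<i> * complex_of_real \<zeta>)" and "E' = exp (- (\<i> * complex_of_real \<zeta>))"
  define e e' where "e = exp (- u * (\<i> * complex_of_real \<zeta>))" and "e' = exp (u * (\<i> * complex_of_real \<zeta>))"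
  note sc = sv_cv_ii[OF z, folded S_def C_def E_def E'_def]
  have b: "bp \<alpha> \<beta> n (k * x / S) (x / C) = (\<Sum>l\<le>n. bco \<alpha> \<beta> n l / (S ^ l * C ^ (n - l)) * (k ^ l * x ^ n))" for k x n
    unfolding bp_def
  proof (rule sum.cong[OF refl])
    fix l assume "l \<in> {..n}"
    hence "x ^ n = x ^ l * x ^ (n - l)" by (simp flip: power_add)
    thus "bco \<alpha> \<beta> n l * ((k * x / S) ^ l * (x / C) ^ (n - l)) = bco \<alpha> \<beta> n l / (S ^ l * C ^ (n - l)) * (k ^ l * x ^ n)"
      by (simp add: power_divide power_mult_distrib)
  qed
  have t: "p * (e * bp \<alpha> \<beta> n (- \<i> * E / S) (E / C)) + q * (e' * bp \<alpha> \<beta> n (\<i> * E' / S) (E' / C)) =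
     2 * c * (\<Sum>l\<le>n. a_coeff l \<alpha> * a_coeff (n - l) \<beta> / (S ^ l * C ^ (n - l)) * trig (ph \<nu> \<alpha> \<beta> \<zeta> n l))" for n
  proof -
    have "p * (e * bp \<alpha> \<beta> n (- \<i> * E / S) (E / C)) + q * (e' * bp \<alpha> \<beta> n (\<i> * E' / S) (E' / C)) =
      (\<Sum>l\<le>n. bco \<alpha> \<beta> n l / (S ^ l * C ^ (n - l)) * (p * (e * ((- \<i>) ^ l * E ^ n)) + q * (e' * (\<i> ^ l * E' ^ n))))"
      unfolding b sum_distrib_left sum.distrib[symmetric] by (rule sum.cong[OF refl]) (simp add: algebra_simps)
    also have "\<dots> = (\<Sum>l\<le>n. bco \<alpha> \<beta> n l / (S ^ l * C ^ (n - l)) * (2 * c * trig (ph \<nu> \<alpha> \<beta> \<zeta> n l)))"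
      by (rule sum.cong[OF refl], rule arg_cong[where f = "\<lambda>y. _ * y"]) (use trig[folded E_def E'_def e_def e'_def] in blast)
    also have "\<dots> = 2 * c * (\<Sum>l\<le>n. a_coeff l \<alpha> * a_coeff (n - l) \<beta> / (S ^ l * C ^ (n - l)) * trig (ph \<nu> \<alpha> \<beta> \<zeta> n l))"
      unfolding sum_distrib_left bco_def by (rule sum.cong[OF refl]) (simp add: mult_ac)
    finally show ?thesis .
  qed
  have "Tb \<alpha> \<beta> u N \<zeta> p q = (\<Sum>n<N. (p * (e * bp \<alpha> \<beta> n (- \<i> * E / S) (E / C)) + q * (e' * bp \<alpha> \<beta> n (\<i> * E' / S) (E' / C))) / ff u n)"
    unfolding Tb_def sc(3,4)
    unfolding sc(1,2) Fs_def e_def[symmetric] e'_def[symmetric] sum_distrib_left sum.distrib[symmetric]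
    by (rule sum.cong[OF refl]) (simp add: add_divide_distrib)
  hence "Tb \<alpha> \<beta> u N \<zeta> p q / (2 * u) = (\<Sum>n<N. 2 * c * (\<Sum>l\<le>n. a_coeff l \<alpha> * a_coeff (n - l) \<beta> / (S ^ l * C ^ (n - l)) * trig (ph \<nu> \<alpha> \<beta> \<zeta> n l)) / ff u n / (2 * u))"
    unfolding t by (simp only: sum_divide_distrib)
  also have "\<dots> = c * (\<Sum>n<N. expansion_term trig ph n \<nu> \<alpha> \<beta> \<zeta>)"
    unfolding sum_distrib_left[of c]
  proof (rule sum.cong[OF refl])
    fix n assume "n \<in> {..<N}"
    hence n: "n < N" by simp
    have a: "2 * \<nu> + \<alpha> + \<beta> - of_nat n + 1 = u - of_nat n" "2 * \<nu> + \<alpha> + \<beta> + 2 = u + 1" by (simp_all add: u(1))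
    have "2 * c * T / f / (2 * u) = c * (T * (1 / (u * f)))" for T f by simp
    thus "2 * c * (\<Sum>l\<le>n. a_coeff l \<alpha> * a_coeff (n - l) \<beta> / (S ^ l * C ^ (n - l)) * trig (ph \<nu> \<alpha> \<beta> \<zeta> n l)) / ff u n / (2 * u)
      = c * expansion_term trig ph n \<nu> \<alpha> \<beta> \<zeta>"
      unfolding expansion_term_def a Gamma_ratio[OF u(2,3) n] S_def C_def .
  qed
  finally show ?thesis .
qed

lemma ii_power: "(- \<i>) ^ l = exp (- (\<i> * of_real (pi / 2) * of_nat l))" "\<i> ^ l = exp (\<i> * of_real (pi / 2) * of_nat l)"
proof -
  have e: "exp (\<i> * of_real (pi / 2)) = \<i>" "exp (- (\<i> * of_real (pi / 2))) = - \<i>"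
    by (simp_all add: exp_eq_polar complex_eq_iff Re_exp Im_exp)
  have "exp (of_nat l * (- (\<i> * of_real (pi / 2)))) = (- \<i>) ^ l" "exp (of_nat l * (\<i> * of_real (pi / 2))) = \<i> ^ l"
    unfolding exp_of_nat_mult e by simp_all
  thus "(- \<i>) ^ l = exp (- (\<i> * of_real (pi / 2) * of_nat l))" "\<i> ^ l = exp (\<i> * of_real (pi / 2) * of_nat l)"
    by (simp_all add: mult_ac)
qed

text \<open>The three pairs of phases are those of the first kind, of the plain average and of the
  average with phase factors.\<close>

lemma trig_boundary:
  fixes \<nu> \<alpha> \<beta> :: complex and \<zeta> :: real
  defines "u \<equiv> 2 * \<nu> + \<alpha> + \<beta> + 1" and "s \<equiv> sphase \<alpha>"
  shows "s * (exp (- u * (\<i> * of_real \<zeta>)) * ((- \<i>) ^ l * exp (\<i> * of_real \<zeta>) ^ n)) +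
       inverse s * (exp (u * (\<i> * of_real \<zeta>)) * (\<i> ^ l * exp (- (\<i> * of_real \<zeta>)) ^ n)) = 2 * 1 * cos (zeta1 \<nu> \<alpha> \<beta> \<zeta> n l)"
    "inverse s * (exp (- u * (\<i> * of_real \<zeta>)) * ((- \<i>) ^ l * exp (\<i> * of_real \<zeta>) ^ n)) +
       s * (exp (u * (\<i> * of_real \<zeta>)) * (\<i> ^ l * exp (- (\<i> * of_real \<zeta>)) ^ n)) = 2 * 1 * cos (zeta2 \<nu> \<alpha> \<beta> \<zeta> n l)"
    "(- \<i> * s) * (exp (- u * (\<i> * of_real \<zeta>)) * ((- \<i>) ^ l * exp (\<i> * of_real \<zeta>) ^ n)) +
       (\<i> * inverse s) * (exp (u * (\<i> * of_real \<zeta>)) * (\<i> ^ l * exp (- (\<i> * of_real \<zeta>)) ^ n)) = 2 * (- 1) * sin (zeta1 \<nu> \<alpha> \<beta> \<zeta> n l)"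
proof -
  define Z h where "Z = complex_of_real \<zeta>" and "h = complex_of_real (pi / 2)"
  have p: "exp (\<i> * Z) ^ n = exp (\<i> * Z * of_nat n)" "exp (- (\<i> * Z)) ^ n = exp (- (\<i> * Z * of_nat n))"
    by (simp_all add: exp_of_nat_mult[symmetric] mult_ac)
  have 1: "s * (exp (- u * (\<i> * Z)) * ((- \<i>) ^ l * exp (\<i> * Z) ^ n)) = exp (- (\<i> * zeta1 \<nu> \<alpha> \<beta> \<zeta> n l))"
    "inverse s * (exp (u * (\<i> * Z)) * (\<i> ^ l * exp (- (\<i> * Z)) ^ n)) = exp (\<i> * zeta1 \<nu> \<alpha> \<beta> \<zeta> n l)"
    "inverse s * (exp (- u * (\<i> * Z)) * ((- \<i>) ^ l * exp (\<i> * Z) ^ n)) = exp (- (\<i> * zeta2 \<nu> \<alpha> \<beta> \<zeta> n l))"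
    "s * (exp (u * (\<i> * Z)) * (\<i> ^ l * exp (- (\<i> * Z)) ^ n)) = exp (\<i> * zeta2 \<nu> \<alpha> \<beta> \<zeta> n l)"
    unfolding s_def sphase_def ii_power p exp_minus[symmetric] exp_add[symmetric] zeta1_def zeta2_def u_def Z_def[symmetric] h_def[symmetric]
    by (rule arg_cong[where f = exp], simp add: algebra_simps)+
  show "s * (exp (- u * (\<i> * of_real \<zeta>)) * ((- \<i>) ^ l * exp (\<i> * of_real \<zeta>) ^ n)) +
       inverse s * (exp (u * (\<i> * of_real \<zeta>)) * (\<i> ^ l * exp (- (\<i> * of_real \<zeta>)) ^ n)) = 2 * 1 * cos (zeta1 \<nu> \<alpha> \<beta> \<zeta> n l)"
    "inverse s * (exp (- u * (\<i> * of_real \<zeta>)) * ((- \<i>) ^ l * exp (\<i> * of_real \<zeta>) ^ n)) +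
       s * (exp (u * (\<i> * of_real \<zeta>)) * (\<i> ^ l * exp (- (\<i> * of_real \<zeta>)) ^ n)) = 2 * 1 * cos (zeta2 \<nu> \<alpha> \<beta> \<zeta> n l)"
    unfolding Z_def[symmetric] 1 cos_exp_eq by simp_all
  have A: "(- \<i> * s) * x + (\<i> * inverse s) * y = \<i> * (inverse s * y - s * x)" for x y by (simp add: algebra_simps)
  show "(- \<i> * s) * (exp (- u * (\<i> * of_real \<zeta>)) * ((- \<i>) ^ l * exp (\<i> * of_real \<zeta>) ^ n)) +
       (\<i> * inverse s) * (exp (u * (\<i> * of_real \<zeta>)) * (\<i> ^ l * exp (- (\<i> * of_real \<zeta>)) ^ n)) = 2 * (- 1) * sin (zeta1 \<nu> \<alpha> \<beta> \<zeta> n l)"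
    unfolding Z_def[symmetric] A unfolding 1 sin_exp_eq by (simp add: field_simps)
qed

lemma Gamma_nonres: "nonres u \<Longrightarrow> Gamma (u + 1) \<noteq> 0"
  using rGamma_nonres[of u] by (simp add: rGamma_inverse_Gamma)

text \<open>The power of 2, the Beta function and the gamma factors of \<open>jacobi_P\<close>
  multiply exactly to \<open>- 1 / omv \<nu> \<alpha> \<beta>\<close>.\<close>

lemma jacobi_P_eq_pcut:
  assumes nr: "nonres (2 * \<nu> + \<alpha> + \<beta> + 1)" "nonres (\<nu> + \<alpha>)" "nonres (\<nu> + \<alpha> + \<beta>)" "nonres \<nu>"
  shows "2 powr (2 * \<nu> + \<alpha> + \<beta>) * Beta (\<nu> + 1) (\<nu> + \<alpha> + \<beta> + 1) * jacobi_P \<nu> \<alpha> \<beta> (of_real (cos (2 * \<zeta>))) =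
    inverse (pfac \<alpha> \<beta> \<zeta>) * (- (pcut \<nu> \<alpha> \<beta> \<zeta> / omv \<nu> \<alpha> \<beta>))"
proof -
  have nr1: "nonres (2 * \<nu> + \<alpha> + \<beta> + 1)" by (rule nr)
  have a: "2 * \<nu> + \<alpha> + \<beta> + 1 + 1 = 2 * \<nu> + \<alpha> + \<beta> + 2" "\<nu> + 1 + (\<nu> + \<alpha> + \<beta> + 1) = 2 * \<nu> + \<alpha> + \<beta> + 2" by simp_all
  note G = Gamma_nonres[OF nr(1), unfolded a] Gamma_nonres[OF nr(2)] Gamma_nonres[OF nr(3)] Gamma_nonres[OF nr(4)]
  define l where "l = complex_of_real (ln 2)"
  have p: "2 powr (2 * \<nu> + \<alpha> + \<beta>) = exp ((2 * \<nu> + \<alpha> + \<beta>) * l)" using Ln_of_real[of 2] by (simp add: powr_def l_def)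
  have x: "(1 - complex_of_real (cos (2 * \<zeta>))) / 2 = of_real ((sin \<zeta>)\<^sup>2)" unfolding cos_double_sin by simp
  have e: "exp (- (2 * \<nu> + \<alpha> + \<beta> + 1) * l) = 1 / (2 * exp ((2 * \<nu> + \<alpha> + \<beta>) * l))"
  proof -
    have "exp l = 2" unfolding l_def exp_of_real by simp
    hence "exp ((2 * \<nu> + \<alpha> + \<beta> + 1) * l) = 2 * exp ((2 * \<nu> + \<alpha> + \<beta>) * l)" by (simp add: exp_add distrib_right)
    moreover have "exp (- x * l) = 1 / exp (x * l)" for x by (simp add: exp_minus divide_inverse)
    ultimately show ?thesis by (simp only:)
  qed
  have "E * (g1 * g2 / g) * (g3 * inverse g1 * F) = inverse f * (- (f * F / (- 2 * (1 / (2 * E)) * g * inverse g3 * inverse g2)))"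
    if "E \<noteq> 0" "g \<noteq> 0" "g1 \<noteq> 0" "g2 \<noteq> 0" "g3 \<noteq> 0" "f \<noteq> 0" for E g g1 g2 g3 F f :: complex
    using that by (simp add: field_simps)
  from this[OF _ G(1) G(4) G(3) G(2), of "exp ((2 * \<nu> + \<alpha> + \<beta>) * l)" "pfac \<alpha> \<beta> \<zeta>"] show ?thesis
    unfolding jacobi_P_def x pcut_def omv_def Pf_def p Beta_def a(2) rGamma_inverse_Gamma l_def[symmetric] e by (simp add: pfac_def)
qed

text \<open>The value of the Wronskian of \<open>w \<xi>\<close> and \<open>w (- \<xi>)\<close> on the imaginary axis.\<close>

definition Wv :: "complex \<Rightarrow> complex \<Rightarrow> complex \<Rightarrow> complex" where
  "Wv \<nu> \<alpha> \<beta> = - of_real pi * omv \<nu> \<alpha> \<beta> * omv (\<nu> + \<alpha>) (- \<alpha>) \<beta>"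

text \<open>The gamma factors of \<open>jacobi_Q\<close>, the power of 2 and the Beta function
  multiply to the reciprocal of \<open>Wv\<close> up to sign. No sine enters, so integer \<alpha>
  are included.\<close>

lemma jacobi_Q_eq_boundary:
  fixes \<nu> \<alpha> \<beta> a b :: complex and \<zeta> :: real
  assumes z: "0 < \<zeta>" "\<zeta> < pi / 2"
    and nr: "nonres (2 * \<nu> + \<alpha> + \<beta> + 1)"
    and lim: "(wu (2 * \<nu> + \<alpha> + \<beta> + 1) (\<alpha>\<^sup>2 - 1 / 4) (\<beta>\<^sup>2 - 1 / 4) \<longlongrightarrow> a) (at (\<i> * of_real \<zeta>) within rhp)"
      "(wu (2 * \<nu> + \<alpha> + \<beta> + 1) (\<alpha>\<^sup>2 - 1 / 4) (\<beta>\<^sup>2 - 1 / 4) \<longlongrightarrow> b) (at (- (\<i> * of_real \<zeta>)) within rhp)"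
  defines "s \<equiv> sphase \<alpha>"
  shows "2 powr (2 * \<nu> + \<alpha> + \<beta> + 1) / of_real pi * Beta (\<nu> + 1) (\<nu> + \<alpha> + \<beta> + 1) * jacobi_Qcut \<nu> \<alpha> \<beta> (cos (2 * \<zeta>)) =
     inverse (pfac \<alpha> \<beta> \<zeta>) * (- ((inverse s * a + s * b) / Wv \<nu> \<alpha> \<beta>))"
   "2 powr (2 * \<nu> + \<alpha> + \<beta> + 1) / of_real pi * Beta (\<nu> + 1) (\<nu> + \<alpha> + \<beta> + 1) * jacobi_Qsf \<nu> \<alpha> \<beta> (cos (2 * \<zeta>)) =
     inverse (pfac \<alpha> \<beta> \<zeta>) * (- ((- \<i> * s * a + \<i> * inverse s * b) / Wv \<nu> \<alpha> \<beta>))"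
proof -
  define l where "l = complex_of_real (ln 2)"
  define K where "K = exp ((2 * \<nu> + \<alpha> + \<beta>) * l) * Gamma (\<nu> + \<alpha> + 1) * Gamma (\<nu> + \<beta> + 1) * rGamma (2 * \<nu> + \<alpha> + \<beta> + 2) * inverse (pfac \<alpha> \<beta> \<zeta>)"
  have sp: "exp (- \<i> * of_real (1 * (pi / 2)) * (\<alpha> + 1 / 2)) = inverse s" "exp (- \<i> * of_real (- 1 * (pi / 2)) * (\<alpha> + 1 / 2)) = s"
    unfolding s_def sphase_def exp_minus[symmetric] by (rule arg_cong[where f = exp], simp)+
  have Q: "((\<lambda>\<eta>. jacobi_Q \<nu> \<alpha> \<beta> (of_real (cos (2 * \<zeta>)) + \<i> * of_real \<eta>)) \<longlongrightarrow> K * inverse s * a) (at_right 0)"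
    "((\<lambda>\<eta>. jacobi_Q \<nu> \<alpha> \<beta> (of_real (cos (2 * \<zeta>)) - \<i> * of_real \<eta>)) \<longlongrightarrow> K * s * b) (at_right 0)"
    using jacobi_Q_boundary[of 1, OF _ z nr, of a, unfolded sp, folded l_def, folded K_def] lim(1)
      jacobi_Q_boundary[of "- 1", OF _ z nr, of b, unfolded sp, folded l_def, folded K_def] lim(2) by simp_all
  have tb: "at_right (0::real) \<noteq> bot" by simp
  have "((\<lambda>\<eta>. 1 / 2 * (jacobi_Q \<nu> \<alpha> \<beta> (of_real (cos (2 * \<zeta>)) + \<i> * of_real \<eta>) + jacobi_Q \<nu> \<alpha> \<beta> (of_real (cos (2 * \<zeta>)) - \<i> * of_real \<eta>)))
     \<longlongrightarrow> 1 / 2 * (K * inverse s * a + K * s * b)) (at_right 0)"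
    by (intro tendsto_intros Q)
  from tendsto_Lim[OF tb this] have c: "jacobi_Qcut \<nu> \<alpha> \<beta> (cos (2 * \<zeta>)) = 1 / 2 * (K * inverse s * a + K * s * b)" unfolding jacobi_Qcut_def .
  have "((\<lambda>\<eta>. 1 / 2 * (exp (of_real pi * \<alpha> * \<i>) * jacobi_Q \<nu> \<alpha> \<beta> (of_real (cos (2 * \<zeta>)) + \<i> * of_real \<eta>) + exp (- (of_real pi * \<alpha> * \<i>)) * jacobi_Q \<nu> \<alpha> \<beta> (of_real (cos (2 * \<zeta>)) - \<i> * of_real \<eta>)))
     \<longlongrightarrow> 1 / 2 * (exp (of_real pi * \<alpha> * \<i>) * (K * inverse s * a) + exp (- (of_real pi * \<alpha> * \<i>)) * (K * s * b))) (at_right 0)"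
    by (intro tendsto_intros Q)
  from tendsto_Lim[OF tb this] have f: "jacobi_Qsf \<nu> \<alpha> \<beta> (cos (2 * \<zeta>)) = 1 / 2 * (exp (of_real pi * \<alpha> * \<i>) * (K * inverse s * a) + exp (- (of_real pi * \<alpha> * \<i>)) * (K * s * b))"
    unfolding jacobi_Qsf_def .
  \<comment> \<open>Since \<open>s * s\<close> is \<open>\<i>\<close> times the phase factor
    \<open>exp (of_real pi * \<alpha> * \<i>)\<close>, weighting with the phases exchanges
    \<open>s\<close> and \<open>inverse s\<close> up to \<open>\<i>\<close> or
    \<open>- \<i>\<close>.\<close>
  have ph: "exp (of_real pi * \<alpha> * \<i>) * inverse s = - \<i> * s" "exp (- (of_real pi * \<alpha> * \<i>)) * s = \<i> * inverse s"
  proof -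
    have "s * s = exp (of_real pi * \<alpha> * \<i> + \<i> * of_real (pi / 2))"
      unfolding s_def sphase_def exp_add[symmetric] by (rule arg_cong[where f = exp]) (simp add: field_simps)
    also have "\<dots> = \<i> * exp (of_real pi * \<alpha> * \<i>)" unfolding exp_add using ii_power(2)[of 1] by simp
    finally have "exp (of_real pi * \<alpha> * \<i>) = - \<i> * (s * s)" by simp
    moreover have "s \<noteq> 0" by (simp add: s_def)
    ultimately show "exp (of_real pi * \<alpha> * \<i>) * inverse s = - \<i> * s" "exp (- (of_real pi * \<alpha> * \<i>)) * s = \<i> * inverse s"
      unfolding exp_minus by (simp_all add: field_simps)
  qed
  have a: "2 * \<nu> + \<alpha> + \<beta> + 1 + 1 = 2 * \<nu> + \<alpha> + \<beta> + 2" "\<nu> + 1 + (\<nu> + \<alpha> + \<beta> + 1) = 2 * \<nu> + \<alpha> + \<beta> + 2"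
    "2 * (\<nu> + \<alpha>) + - \<alpha> + \<beta> = 2 * \<nu> + \<alpha> + \<beta>" "\<nu> + \<alpha> + - \<alpha> = \<nu>" by simp_all
  have e1: "exp ((2 * \<nu> + \<alpha> + \<beta> + 1) * l) = 2 * exp ((2 * \<nu> + \<alpha> + \<beta>) * l)"
  proof -
    have "exp l = 2" unfolding l_def exp_of_real by simp
    thus ?thesis by (simp add: exp_add distrib_right)
  qed
  have e2: "exp (- (2 * \<nu> + \<alpha> + \<beta> + 1) * l) = 1 / (2 * exp ((2 * \<nu> + \<alpha> + \<beta>) * l))"
  proof -
    have "exp (- x * l) = 1 / exp (x * l)" for x by (simp add: exp_minus divide_inverse)
    thus ?thesis unfolding e1[symmetric] .
  qed
  have p: "2 powr (2 * \<nu> + \<alpha> + \<beta> + 1) = 2 * exp ((2 * \<nu> + \<alpha> + \<beta>) * l)" using Ln_of_real[of 2] unfolding e1[symmetric] unfolding l_def by (simp add: powr_def)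
  have key: "2 * E / P * (g1 * g2 / g) * (1 / 2 * ((E * g3 * g4 * inverse g * i) * X)) =
     i * (- (X / (- P * (- 2 * (1 / (2 * E)) * g * inverse g3 * inverse g2) * (- 2 * (1 / (2 * E)) * g * inverse g1 * inverse g4))))"
    for E P g g1 g2 g3 g4 i X :: complex
  proof -
    have a: "- 2 * (1 / (2 * E)) = - (1 / E)" by simp
    have b: "- P * (- x * y * z * w) * (- x * y * p * q) = - (P * (x * y * z * w) * (x * y * p * q))" for x y z w p q :: complex by simp
    have c: "- (X / (- Y)) = X / Y" for Y by simp
    have d: "2 * E / P * A * (1 / 2 * B) = E / P * A * B" for A B by simp
    show ?thesis unfolding a b c d unfolding divide_inverse inverse_mult_distrib inverse_inverse_eq mult_1_left inverse_1 by (simp only: mult_ac)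
  qed
  have main: "2 powr (2 * \<nu> + \<alpha> + \<beta> + 1) / of_real pi * Beta (\<nu> + 1) (\<nu> + \<alpha> + \<beta> + 1) * (1 / 2 * (K * X)) =
     inverse (pfac \<alpha> \<beta> \<zeta>) * (- (X / Wv \<nu> \<alpha> \<beta>))" for X
    unfolding p K_def Beta_def a Wv_def omv_def rGamma_inverse_Gamma l_def[symmetric] e2
    by (rule key)
  have X: "K * inverse s * a + K * s * b = K * (inverse s * a + s * b)" by (simp add: algebra_simps)
  show "2 powr (2 * \<nu> + \<alpha> + \<beta> + 1) / of_real pi * Beta (\<nu> + 1) (\<nu> + \<alpha> + \<beta> + 1) * jacobi_Qcut \<nu> \<alpha> \<beta> (cos (2 * \<zeta>)) =
     inverse (pfac \<alpha> \<beta> \<zeta>) * (- ((inverse s * a + s * b) / Wv \<nu> \<alpha> \<beta>))" unfolding c X by (rule main)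
  have "e * (K * i * a) + e' * (K * t * b) = K * ((e * i) * a + (e' * t) * b)" for e i e' t by (simp add: algebra_simps)
  hence X: "exp (of_real pi * \<alpha> * \<i>) * (K * inverse s * a) + exp (- (of_real pi * \<alpha> * \<i>)) * (K * s * b) = K * (- \<i> * s * a + \<i> * inverse s * b)"
    unfolding ph[symmetric] .
  show "2 powr (2 * \<nu> + \<alpha> + \<beta> + 1) / of_real pi * Beta (\<nu> + 1) (\<nu> + \<alpha> + \<beta> + 1) * jacobi_Qsf \<nu> \<alpha> \<beta> (cos (2 * \<zeta>)) =
     inverse (pfac \<alpha> \<beta> \<zeta>) * (- ((- \<i> * s * a + \<i> * inverse s * b) / Wv \<nu> \<alpha> \<beta>))" unfolding f X by (rule main)
qed


section \<open>Uniform estimates\<close>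

text \<open>The lower bound is that of the cosine of the argument. For \<open>\<delta> > pi\<close>
  the sector is empty, and \<open>min \<delta> pi\<close> keeps the constant positive for every
  positive \<delta>, although \<open>cos \<delta>\<close> may return to 1.\<close>

lemma sector_re:
  assumes "\<delta> > 0" "\<bar>Arg \<nu>\<bar> \<le> pi - \<delta>" "\<nu> \<noteq> 0"
  shows "norm \<nu> + Re \<nu> \<ge> (1 - cos (min \<delta> pi)) * norm \<nu>"
proof -
  have d: "\<delta> \<le> pi" using assms(2) abs_ge_zero[of "Arg \<nu>"] by linarith
  have "cos (pi - \<delta>) \<le> cos \<bar>Arg \<nu>\<bar>" using assms d by (intro cos_monotone_0_pi_le) auto
  hence "- cos \<delta> \<le> Re \<nu> / norm \<nu>" using cos_Arg[OF assms(3)] by simp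
  hence "- cos \<delta> * norm \<nu> \<le> Re \<nu>" using assms(3) by (simp add: le_divide_eq)
  thus ?thesis using d by (simp add: algebra_simps min_def)
qed

text \<open>The condition \<open>\<bar>arg \<nu>\<bar> \<le> \<pi> - \<delta>\<close> is used in the form \<open>\<bar>\<nu>\<bar> + Re \<nu> \<ge> \<kappa> \<bar>\<nu>\<bar>\<close>, which survives bounded shifts.\<close>

lemma sector_shift:
  fixes \<nu> w :: complex
  assumes "\<kappa> > 0" "\<kappa> \<le> 2" "norm \<nu> + Re \<nu> \<ge> \<kappa> * norm \<nu>" "norm w \<le> B" "\<kappa> * norm \<nu> \<ge> 4 * B" "norm \<nu> > 0"
  shows "norm (\<nu> + w) + Re (\<nu> + w) > 0" "norm (2 * \<nu> + w) + Re (2 * \<nu> + w) \<ge> \<kappa> / 2 * norm (2 * \<nu> + w)"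
    "norm (2 * \<nu> + w) \<ge> norm \<nu>" "norm (2 * \<nu> + w) + Re (2 * \<nu> + w) > 0"
proof -
  have k: "\<kappa> * norm \<nu> > 0" using assms by simp
  have B0: "B \<ge> 0" using norm_ge_zero[of w] assms(4) by linarith
  have "\<kappa> * norm \<nu> \<le> 2 * norm \<nu>" using assms(2) by (intro mult_right_mono) auto
  hence B: "2 * B \<le> norm \<nu>" using assms(5) by linarith
  have r: "\<bar>Re w\<bar> \<le> B" using abs_Re_le_cmod[of w] assms(4) by linarith
  have t1: "norm (\<nu> + w) \<ge> norm \<nu> - B" using norm_diff_ineq[of \<nu> w] assms(4) by linarith
  show "norm (\<nu> + w) + Re (\<nu> + w) > 0"
    using t1 r assms(3,5) k B0 unfolding plus_complex.sel by linarith
  have n2: "norm (2 * \<nu>) = 2 * norm \<nu>" by (simp add: norm_mult)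
  have t2: "norm (2 * \<nu> + w) \<ge> 2 * norm \<nu> - B" using norm_diff_ineq[of "2 * \<nu>" w] assms(4) n2 by linarith
  have t3: "norm (2 * \<nu> + w) \<le> 2 * norm \<nu> + B" using norm_triangle_ineq[of "2 * \<nu>" w] assms(4) n2 by linarith
  show "norm (2 * \<nu> + w) \<ge> norm \<nu>" using t2 B B0 by linarith
  have re: "Re (2 * \<nu> + w) = 2 * Re \<nu> + Re w" by simp
  have l: "norm (2 * \<nu> + w) + Re (2 * \<nu> + w) \<ge> 2 * (\<kappa> * norm \<nu>) - 2 * B" unfolding re using t2 r assms(3) by linarith
  have "\<kappa> / 2 * norm (2 * \<nu> + w) \<le> \<kappa> / 2 * (3 * norm \<nu>)"
    using t3 B B0 assms(1) by (intro mult_left_mono) auto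
  moreover have "\<kappa> / 2 * (3 * norm \<nu>) = 3 / 2 * (\<kappa> * norm \<nu>)" by simp
  ultimately show "norm (2 * \<nu> + w) + Re (2 * \<nu> + w) \<ge> \<kappa> / 2 * norm (2 * \<nu> + w)" using l assms(5) by linarith
  show "norm (2 * \<nu> + w) + Re (2 * \<nu> + w) > 0" using l assms(5) k by linarith
qed

text \<open>Writing \<open>k\<^sup>2 * V = - (2 * u * k) * (1 + d)\<close> with
  \<open>norm d \<le> 1 / 2\<close> turns \<open>- X * V = p * a + q * b\<close> into
  \<open>2 * u * X * (1 + d) = p * (k * a) + q * (k * b)\<close>, where only the controlled products
  \<open>k * a\<close> and \<open>k * b\<close> occur. The second bound serves the case of an empty
  partial sum.\<close>

lemma perturbed_quotient:
  fixes u k V a b E E' P Q X p q :: complex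
  assumes N: "N \<ge> 1" and C: "C \<ge> 0" and u: "norm u \<ge> 1" "norm u \<ge> 2 * C" and k: "norm (k - 1) \<le> 1 / 2"
    and V: "norm (k\<^sup>2 * V + 2 * u * k) \<le> C / norm u ^ (N - 1)"
    and a: "norm (k * a - E * P) \<le> C / norm u ^ N * norm E" and b: "norm (k * b - E' * Q) \<le> C / norm u ^ N * norm E'"
    and PQ: "norm P \<le> C" "norm Q \<le> C" and pq: "norm p \<le> r" "norm q \<le> r" and e: "norm E \<le> e" "norm E' \<le> e"
    and X: "- X * V = p * a + q * b"
  shows "norm (X - (p * (E * P) + q * (E' * Q)) / (2 * u)) \<le> 2 * r * C * (1 + C) * e / norm u ^ (N + 1)"
    "norm X \<le> (2 * r * C * (1 + C) + r * C) * e / norm u"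
proof -
  have k0: "k \<noteq> 0" using k by auto
  have kn: "norm k \<ge> 1 / 2" using k norm_triangle_ineq2[of 1 k] by (simp add: norm_minus_commute)
  have u0: "u \<noteq> 0" using u by auto
  have r0: "r \<ge> 0" and e0: "e \<ge> 0" using pq(1) e(1) norm_ge_zero order_trans by blast+
  define D where "D = C / norm u ^ N"
  have uN: "norm u ^ N = norm u * norm u ^ (N - 1)" using N by (metis power_eq_if not_one_le_zero)
  have D0: "D \<ge> 0" using C by (simp add: D_def)
  have D1: "D \<le> 1 / 2"
  proof -
    have "2 * C * 1 \<le> norm u * norm u ^ (N - 1)" using u C by (intro mult_mono) auto
    moreover have "norm u * norm u ^ (N - 1) > 0" using u0 by simp
    ultimately show ?thesis unfolding D_def uN by (simp add: pos_divide_le_eq)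
  qed
  define d where "d = - (k\<^sup>2 * V + 2 * u * k) / (2 * u * k)"
  have dn: "norm d \<le> D"
  proof -
    have "norm d \<le> (C / norm u ^ (N - 1)) / (2 * norm u * (1 / 2))"
      unfolding d_def norm_divide norm_minus_cancel
    proof (rule frac_le)
      show "2 * norm u * (1 / 2) \<le> norm (2 * u * k)" unfolding norm_mult using kn by (intro mult_mono) auto
    qed (use V C u in auto)
    thus ?thesis unfolding D_def uN by (simp add: mult.commute)
  qed
  define S T where "S = p * (k * a) + q * (k * b)" and "T = p * (E * P) + q * (E' * Q)"
  have eq: "2 * u * X * (1 + d) = S"
  proof -
    have "k\<^sup>2 * V = - (2 * u * k) * (1 + d)" using u0 k0 by (simp add: d_def field_simps)
    hence "- X * (k\<^sup>2 * V) = - X * (- (2 * u * k) * (1 + d))" by (simp only:)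
    moreover have "- X * (k\<^sup>2 * V) = k\<^sup>2 * (- X * V)" "- X * (- (2 * u * k) * (1 + d)) = k * (2 * u * X * (1 + d))"
      by (simp_all add: mult_ac)
    ultimately have "k * (2 * u * X * (1 + d)) = k\<^sup>2 * (- X * V)" by (simp only:)
    also have "\<dots> = k * S" unfolding X S_def by (simp add: power2_eq_square algebra_simps)
    finally show ?thesis using k0 by simp
  qed
  have m: "norm x \<le> s \<Longrightarrow> norm y \<le> t \<Longrightarrow> norm (x * y) \<le> s * t" for x y :: complex and s t
    unfolding norm_mult by (intro mult_mono) (auto intro: order_trans[OF norm_ge_zero])
  have ST: "norm (S - T) \<le> r * (D * e) + r * (D * e)"
  proof -
    have "S - T = p * (k * a - E * P) + q * (k * b - E' * Q)" unfolding S_def T_def by (simp add: algebra_simps)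
    moreover have "norm (k * a - E * P) \<le> D * e" "norm (k * b - E' * Q) \<le> D * e"
      using a b mult_left_mono[OF e(1) D0] mult_left_mono[OF e(2) D0] unfolding D_def by linarith+
    ultimately show ?thesis by (simp only:) (intro norm_triangle_mono m pq)
  qed
  have T: "norm T \<le> 2 * r * C * e"
  proof -
    have "norm T \<le> r * (e * C) + r * (e * C)" unfolding T_def by (intro norm_triangle_mono m pq e PQ)
    thus ?thesis by (simp add: mult_ac)
  qed
  have d1: "norm (1 + d) \<ge> 1 / 2" using norm_diff_ineq[of 1 d] dn D1 by simp
  have "(2 * u * X - T) * (1 + d) = (S - T) - d * T" using eq by (simp add: algebra_simps)
  hence "norm (2 * u * X - T) * norm (1 + d) = norm ((S - T) - d * T)" by (metis norm_mult)
  also have "\<dots> \<le> (r * (D * e) + r * (D * e)) + D * (2 * r * C * e)"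
    by (intro order_trans[OF norm_triangle_ineq4] add_mono ST m dn T)
  also have "\<dots> = 2 * r * D * e * (1 + C)" by (simp add: algebra_simps)
  finally have "norm (2 * u * X - T) * norm (1 + d) \<le> 2 * r * D * e * (1 + C)" .
  moreover have "norm (2 * u * X - T) * (1 / 2) \<le> norm (2 * u * X - T) * norm (1 + d)" using d1 by (intro mult_left_mono) auto
  ultimately have h: "norm (2 * u * X - T) \<le> 4 * r * D * e * (1 + C)" by linarith
  have "X - T / (2 * u) = (2 * u * X - T) / (2 * u)" using u0 by (simp add: field_simps)
  hence "norm (X - T / (2 * u)) = norm (2 * u * X - T) / (2 * norm u)" by (simp add: norm_divide norm_mult)
  also have "\<dots> \<le> (4 * r * D * e * (1 + C)) / (2 * norm u)" by (rule divide_right_mono[OF h]) simp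
  also have "\<dots> = 2 * r * C * (1 + C) * e / norm u ^ (N + 1)"
  proof -
    have "(4 * r * (C / p) * e * c) / (2 * n) = 2 * r * C * c * e / (n * p)" for c p n by (simp add: mult_ac)
    thus ?thesis unfolding D_def by simp
  qed
  finally have fin: "norm (X - T / (2 * u)) \<le> 2 * r * C * (1 + C) * e / norm u ^ (N + 1)" .
  thus "norm (X - (p * (E * P) + q * (E' * Q)) / (2 * u)) \<le> 2 * r * C * (1 + C) * e / norm u ^ (N + 1)" unfolding T_def .
  have c0: "2 * r * C * (1 + C) * e \<ge> 0" using r0 e0 C by simp
  have "norm u ^ 1 \<le> norm u ^ (N + 1)" using u by (intro power_increasing) auto
  hence "2 * r * C * (1 + C) * e / norm u ^ (N + 1) \<le> 2 * r * C * (1 + C) * e / norm u"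
    using c0 u0 by (intro divide_left_mono) auto
  moreover have "norm (T / (2 * u)) \<le> r * C * e / norm u"
  proof -
    have "norm (T / (2 * u)) = norm T / (2 * norm u)" by (simp add: norm_divide norm_mult)
    also have "\<dots> \<le> (2 * r * C * e) / (2 * norm u)" by (rule divide_right_mono[OF T]) simp
    finally show ?thesis by simp
  qed
  moreover have "norm X \<le> norm (X - T / (2 * u)) + norm (T / (2 * u))" by (metis diff_add_cancel norm_triangle_ineq)
  ultimately have "norm X \<le> 2 * r * C * (1 + C) * e / norm u + r * C * e / norm u" using fin by linarith
  thus "norm X \<le> (2 * r * C * (1 + C) + r * C) * e / norm u" by (simp add: add_divide_distrib distrib_right)
qed

lemma tendsto_pochhammer:
  fixes f :: "_ \<Rightarrow> complex"
  shows "(f \<longlongrightarrow> l) F \<Longrightarrow> ((\<lambda>x. pochhammer (f x) n) \<longlongrightarrow> pochhammer l n) F"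
  unfolding pochhammer_prod by (intro tendsto_intros)

lemma tendsto_rGamma: "(f \<longlongrightarrow> l) F \<Longrightarrow> ((\<lambda>x. rGamma (f x)) \<longlongrightarrow> rGamma l) F" for f :: "_ \<Rightarrow> complex"
  by (rule isCont_tendsto_compose[OF isCont_rGamma]) auto

text \<open>Both sides are continuous in \<alpha>, so the bound passes to the limit along noninteger
  parameters.\<close>

lemma wronskian_estimate_closed:
  fixes \<nu> \<alpha> \<beta> :: complex
  defines "u \<equiv> (\<lambda>x. 2 * \<nu> + x + \<beta> + 1)"
  assumes nr: "nonres (u \<alpha>)" and un: "norm (u \<alpha>) \<ge> 2 * real N" "N \<ge> 1"
    and est: "\<And>x. dist x \<alpha> \<le> 1 \<Longrightarrow> sin (of_real pi * x) \<noteq> 0 \<Longrightarrow>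
      norm ((Fs x \<beta> (u x) N 2 2)\<^sup>2 * Wv \<nu> x \<beta> + 2 * u x * Fs x \<beta> (u x) N 2 2) \<le> C / norm (u x) ^ (N - 1)"
  shows "norm ((Fs \<alpha> \<beta> (u \<alpha>) N 2 2)\<^sup>2 * Wv \<nu> \<alpha> \<beta> + 2 * u \<alpha> * Fs \<alpha> \<beta> (u \<alpha>) N 2 2) \<le> C / norm (u \<alpha>) ^ (N - 1)"
proof (cases "sin (of_real pi * \<alpha>) = 0")
  case False
  thus ?thesis by (intro est) auto
next
  case True
  \<comment> \<open>The denominator is \<open>n + 2\<close> because
    \<open>sin (pi / (n + 1))\<close> would vanish at \<open>n = 0\<close>. The distance to \<alpha>
    stays at most 1.\<close>
  define x where "x = (\<lambda>n::nat. \<alpha> + of_real (1 / real (n + 2)))"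
  have xl: "x \<longlonglongrightarrow> \<alpha>"
  proof -
    have "(\<lambda>n. 1 / real (n + 2)) \<longlonglongrightarrow> 0" by real_asymp
    hence "x \<longlonglongrightarrow> \<alpha> + of_real 0" unfolding x_def by (intro tendsto_intros)
    thus ?thesis by simp
  qed
  have xd: "dist (x n) \<alpha> \<le> 1" for n by (simp add: x_def dist_norm norm_divide norm_inverse divide_simps del: of_real_divide of_real_add)
  have xs: "sin (of_real pi * x n) \<noteq> 0" for n
  proof -
    have c: "cos (of_real pi * \<alpha>) \<noteq> 0" using True sin_cos_squared_add[of "of_real pi * \<alpha>"] by auto
    have "sin (pi / real (n + 2)) > 0" by (intro sin_gt_zero) (auto simp: divide_less_eq)
    hence s: "sin (complex_of_real (pi / real (n + 2))) \<noteq> 0" unfolding sin_of_real by simp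
    have "of_real pi * x n = of_real pi * \<alpha> + of_real (pi / real (n + 2))" by (simp add: x_def algebra_simps)
    thus ?thesis using True c s by (simp add: sin_add)
  qed
  have ul: "(\<lambda>n. u (x n)) \<longlonglongrightarrow> u \<alpha>" unfolding u_def by (intro tendsto_intros xl)
  have ffn: "ff (u \<alpha>) n \<noteq> 0" if "n < N" for n using ff_nonzero(1)[OF un] that by simp
  have Fl: "(\<lambda>n. Fs (x n) \<beta> (u (x n)) N 2 2) \<longlonglongrightarrow> Fs \<alpha> \<beta> (u \<alpha>) N 2 2"
    unfolding Fs_def
  proof (rule tendsto_sum)
    fix n assume "n \<in> {..<N}"
    hence n: "ff (u \<alpha>) n \<noteq> 0" by (simp add: ffn)
    have f: "(\<lambda>k. ff (u (x k)) n) \<longlonglongrightarrow> ff (u \<alpha>) n" unfolding ff_def by (intro tendsto_intros ul)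
    show "(\<lambda>k. bp (x k) \<beta> n 2 2 / ff (u (x k)) n) \<longlonglongrightarrow> bp \<alpha> \<beta> n 2 2 / ff (u \<alpha>) n"
      by (intro tendsto_divide f n) (unfold bp_def bco_def a_coeff_def, intro tendsto_intros tendsto_pochhammer xl, simp_all)
  qed
  have Wl: "(\<lambda>n. Wv \<nu> (x n) \<beta>) \<longlonglongrightarrow> Wv \<nu> \<alpha> \<beta>"
  proof -
    have "2 * \<nu> + \<alpha> + \<beta> + 2 \<notin> \<int>\<^sub>\<le>\<^sub>0"
    proof
      assume "2 * \<nu> + \<alpha> + \<beta> + 2 \<in> \<int>\<^sub>\<le>\<^sub>0"
      then obtain k where "2 * \<nu> + \<alpha> + \<beta> + 2 = - of_nat k" by (elim nonpos_Ints_cases')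
      hence "of_nat (Suc k) + u \<alpha> = 0" by (simp add: u_def algebra_simps eq_neg_iff_add_eq_0)
      thus False using nr unfolding nonres_def by blast
    qed
    moreover have a: "2 * (\<nu> + y) + - y + \<beta> = 2 * \<nu> + y + \<beta>" for y :: complex by simp
    ultimately show ?thesis unfolding Wv_def omv_def a
      by (intro tendsto_intros tendsto_rGamma xl)
  qed
  have "(\<lambda>n. norm ((Fs (x n) \<beta> (u (x n)) N 2 2)\<^sup>2 * Wv \<nu> (x n) \<beta> + 2 * u (x n) * Fs (x n) \<beta> (u (x n)) N 2 2)) \<longlonglongrightarrow>
    norm ((Fs \<alpha> \<beta> (u \<alpha>) N 2 2)\<^sup>2 * Wv \<nu> \<alpha> \<beta> + 2 * u \<alpha> * Fs \<alpha> \<beta> (u \<alpha>) N 2 2)"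
    by (intro tendsto_intros Fl Wl ul)
  moreover have "(\<lambda>n. C / norm (u (x n)) ^ (N - 1)) \<longlonglongrightarrow> C / norm (u \<alpha>) ^ (N - 1)"
    using un by (intro tendsto_intros ul) auto
  ultimately show ?thesis by (rule LIMSEQ_le) (use est[OF xd xs] in blast)
qed


lemma cut_limits_at_boundary:
  fixes \<nu> \<alpha> \<beta> a a' b b' :: complex and \<zeta> :: real
  defines "u \<equiv> 2 * \<nu> + \<alpha> + \<beta> + 1" and "A \<equiv> \<alpha>\<^sup>2 - 1 / 4" and "B \<equiv> \<beta>\<^sup>2 - 1 / 4"
  assumes z: "0 < \<zeta>" "\<zeta> < pi / 2"
    and nr: "nonres u" "nonres (\<nu> + \<alpha>)" "nonres (\<nu> + \<alpha> + \<beta>)" "nonres \<nu>" "nonres (\<nu> + \<beta>)"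
    and lim: "(wu u A B \<longlongrightarrow> a) (at (\<i> * of_real \<zeta>) within rhp)" "(wu' u A B \<longlongrightarrow> a') (at (\<i> * of_real \<zeta>) within rhp)"
      "(wu u A B \<longlongrightarrow> b) (at (- (\<i> * of_real \<zeta>)) within rhp)" "(wu' u A B \<longlongrightarrow> b') (at (- (\<i> * of_real \<zeta>)) within rhp)"
  shows "cut_limits \<nu> \<alpha> \<beta> u A B \<zeta> (at (\<i> * of_real \<zeta>) within rhp) (at (- (\<i> * of_real \<zeta>)) within rhp) a a' b b'"
proof -
  have le: "at x within rhp \<le> nhds x" for x by (simp add: at_within_def)
  have st: "\<forall>\<^sub>F \<xi> in at x within rhp. \<xi> \<in> strip" if "\<bar>Im x\<bar> < pi / 2" for x
    unfolding eventually_at_topological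
  proof (intro exI conjI ballI impI)
    show "open ({\<xi>. - (pi / 2) < Im \<xi>} \<inter> {\<xi>. Im \<xi> < pi / 2})"
      by (intro open_Int open_halfspace_Im_gt open_halfspace_Im_lt)
  qed (use that in \<open>auto simp: strip_def\<close>)
  show ?thesis
  proof
    show "\<forall>\<^sub>F \<xi> in at (\<i> * of_real \<zeta>) within rhp. \<xi> \<in> strip" "\<forall>\<^sub>F \<xi> in at (- (\<i> * of_real \<zeta>)) within rhp. \<xi> \<in> strip"
      by (rule st, use z in simp)+
  qed (use z nr lim rhp_boundary_ne_bot le in \<open>auto simp: u_def A_def B_def\<close>)
qed

lemma sphase_bound:
  assumes "norm \<alpha> \<le> M"
  shows "norm (sphase \<alpha>) \<le> exp (pi / 2 * (M + 1 / 2))" "norm (inverse (sphase \<alpha>)) \<le> exp (pi / 2 * (M + 1 / 2))"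
proof -
  have "norm (\<alpha> + 1 / 2) \<le> M + 1 / 2" using norm_triangle_ineq[of \<alpha> "1 / 2"] assms by simp
  hence "pi / 2 * norm (\<alpha> + 1 / 2) \<le> pi / 2 * (M + 1 / 2)" by (intro mult_left_mono) auto
  hence n: "norm (\<i> * of_real (pi / 2) * (\<alpha> + 1 / 2)) \<le> pi / 2 * (M + 1 / 2)"
    unfolding norm_mult by simp
  show "norm (sphase \<alpha>) \<le> exp (pi / 2 * (M + 1 / 2))"
    unfolding sphase_def using norm_exp n by (meson exp_le_cancel_iff order_trans)
  show "norm (inverse (sphase \<alpha>)) \<le> exp (pi / 2 * (M + 1 / 2))"
    unfolding sphase_def exp_minus[symmetric] using norm_exp[of "- (\<i> * of_real (pi / 2) * (\<alpha> + 1 / 2))"] n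
    by (smt (verit) exp_le_cancel_iff norm_minus_cancel)
qed

text \<open>\<open>X\<close> is the common form of the three left-hand sides without the prefactor.
  For the first kind the estimate of \<open>a' * b + b' * a\<close> is used directly. For the second
  kind it is the estimate of the closed form \<open>Wv\<close>, obtained at noninteger parameters
  and then by continuity.\<close>

lemma boundary_estimate:
  fixes \<epsilon> \<delta> M :: real
  assumes pos: "\<epsilon> > 0" "\<delta> > 0" "N \<ge> 1"
  obtains C R where "C \<ge> 0" "R > 0" and
    "\<And>\<nu> \<alpha> \<beta> \<zeta>. norm \<nu> \<ge> R \<Longrightarrow> \<bar>Arg \<nu>\<bar> \<le> pi - \<delta> \<Longrightarrow> norm \<alpha> \<le> M \<Longrightarrow> norm \<beta> \<le> M \<Longrightarrow> \<epsilon> \<le> \<zeta> \<Longrightarrow> \<zeta> \<le> pi / 2 - \<epsilon> \<Longrightarrow>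
      \<exists>a b. nonres (2 * \<nu> + \<alpha> + \<beta> + 1) \<and> nonres (\<nu> + \<alpha>) \<and> nonres (\<nu> + \<alpha> + \<beta>) \<and> nonres \<nu> \<and>
        norm (2 * \<nu> + \<alpha> + \<beta> + 1) \<ge> 2 * real N \<and> norm (2 * \<nu> + \<alpha> + \<beta> + 1) + Re (2 * \<nu> + \<alpha> + \<beta> + 1) > 0 \<and>
        (wu (2 * \<nu> + \<alpha> + \<beta> + 1) (\<alpha>\<^sup>2 - 1 / 4) (\<beta>\<^sup>2 - 1 / 4) \<longlongrightarrow> a) (at (\<i> * of_real \<zeta>) within rhp) \<and>
        (wu (2 * \<nu> + \<alpha> + \<beta> + 1) (\<alpha>\<^sup>2 - 1 / 4) (\<beta>\<^sup>2 - 1 / 4) \<longlongrightarrow> b) (at (- (\<i> * of_real \<zeta>)) within rhp) \<and>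
        (\<forall>p q X. norm p \<le> exp (pi / 2 * (M + 1 / 2)) \<longrightarrow> norm q \<le> exp (pi / 2 * (M + 1 / 2)) \<longrightarrow>
           p = sphase \<alpha> \<and> q = inverse (sphase \<alpha>) \<and> X = - (pcut \<nu> \<alpha> \<beta> \<zeta> / omv \<nu> \<alpha> \<beta>) \<or> X = - ((p * a + q * b) / Wv \<nu> \<alpha> \<beta>) \<longrightarrow>
           norm (X - Tb \<alpha> \<beta> (2 * \<nu> + \<alpha> + \<beta> + 1) N \<zeta> p q / (2 * (2 * \<nu> + \<alpha> + \<beta> + 1))) \<le> C * exp (2 * \<zeta> * \<bar>Im \<nu>\<bar>) / norm \<nu> ^ (N + 1) \<and>
           norm X \<le> C * exp (2 * \<zeta> * \<bar>Im \<nu>\<bar>) / norm \<nu>)"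
proof -
  define \<kappa> where "\<kappa> = 1 - cos (min \<delta> pi)"
  have k: "\<kappa> > 0" "\<kappa> \<le> 2" "\<kappa> / 2 > 0"
    using cos_monotone_0_pi[of 0 "min \<delta> pi"] pos cos_ge_minus_one[of "min \<delta> pi"] by (simp_all add: \<kappa>_def)
  \<comment> \<open>\<open>M + 1\<close> leaves room for moving \<alpha> by up to 1 in the
    continuity argument, and \<open>\<kappa> / 2\<close> for passing from \<nu> to
    \<open>u\<close>.\<close>
  obtain C0 U where C0: "C0 \<ge> 0" and U: "U \<ge> 2 * real N" and
    core: "\<And>\<alpha> \<beta> u \<zeta>. norm \<alpha> \<le> M + 1 \<Longrightarrow> norm \<beta> \<le> M + 1 \<Longrightarrow> norm u \<ge> U \<Longrightarrow> norm u + Re u \<ge> \<kappa> / 2 * norm u \<Longrightarrow> \<epsilon> \<le> \<zeta> \<Longrightarrow> \<zeta> \<le> pi / 2 - \<epsilon> \<Longrightarrow>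
      \<exists>a a' b b'. (wu u (\<alpha>\<^sup>2 - 1 / 4) (\<beta>\<^sup>2 - 1 / 4) \<longlongrightarrow> a) (at (\<i> * of_real \<zeta>) within rhp) \<and>
        (wu' u (\<alpha>\<^sup>2 - 1 / 4) (\<beta>\<^sup>2 - 1 / 4) \<longlongrightarrow> a') (at (\<i> * of_real \<zeta>) within rhp) \<and>
        (wu u (\<alpha>\<^sup>2 - 1 / 4) (\<beta>\<^sup>2 - 1 / 4) \<longlongrightarrow> b) (at (- (\<i> * of_real \<zeta>)) within rhp) \<and>
        (wu' u (\<alpha>\<^sup>2 - 1 / 4) (\<beta>\<^sup>2 - 1 / 4) \<longlongrightarrow> b') (at (- (\<i> * of_real \<zeta>)) within rhp) \<and>
        norm (Fs \<alpha> \<beta> u N (sv (\<i> * of_real \<zeta>)) (cv (\<i> * of_real \<zeta>))) \<le> C0 \<and>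
        norm (Fs \<alpha> \<beta> u N (2 - sv (\<i> * of_real \<zeta>)) (2 - cv (\<i> * of_real \<zeta>))) \<le> C0 \<and>
        norm (Fs \<alpha> \<beta> u N 2 2 * a - exp (- u * (\<i> * of_real \<zeta>)) * Fs \<alpha> \<beta> u N (sv (\<i> * of_real \<zeta>)) (cv (\<i> * of_real \<zeta>)))
          \<le> C0 / norm u ^ N * norm (exp (- u * (\<i> * of_real \<zeta>))) \<and>
        norm (Fs \<alpha> \<beta> u N 2 2 * b - exp (u * (\<i> * of_real \<zeta>)) * Fs \<alpha> \<beta> u N (2 - sv (\<i> * of_real \<zeta>)) (2 - cv (\<i> * of_real \<zeta>)))
          \<le> C0 / norm u ^ N * norm (exp (u * (\<i> * of_real \<zeta>))) \<and>
        norm ((Fs \<alpha> \<beta> u N 2 2)\<^sup>2 * (a' * b + b' * a) + 2 * u * Fs \<alpha> \<beta> u N 2 2) \<le> C0 / norm u ^ (N - 1) \<and>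
        norm (Fs \<alpha> \<beta> u N 2 2 - 1) \<le> 1 / 2"
    using core_estimate[OF pos(1) k(3) pos(3), of "M + 1"] by blast
  \<comment> \<open>Bounds the shift \<open>x + \<beta> + 1\<close> between \<open>2 * \<nu>\<close>
    and \<open>u x\<close>, as well as the shifts of \<nu> in the other parameters.\<close>
  define B where "B = 2 * (M + 1) + 1"
  define R where "R = max (max 1 U) (max (2 * C0) (4 * B / \<kappa>))"
  define r where "r = exp (pi / 2 * (M + 1 / 2))"
  define c1 where "c1 = 2 * r * C0 * (1 + C0) + r * C0"
  have r0: "r \<ge> 0" by (simp add: r_def)
  have c1: "c1 \<ge> 0" "2 * r * C0 * (1 + C0) \<le> c1" using r0 C0 by (simp_all add: c1_def)
  show thesis
  proof (rule that[of "c1 * exp (pi * M)" R])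
    show "c1 * exp (pi * M) \<ge> 0" using c1 by simp
    show "R > 0" by (simp add: R_def)
    fix \<nu> \<alpha> \<beta> :: complex and \<zeta> :: real
    assume nu: "norm \<nu> \<ge> R" "\<bar>Arg \<nu>\<bar> \<le> pi - \<delta>" and ab: "norm \<alpha> \<le> M" "norm \<beta> \<le> M" and ze: "\<epsilon> \<le> \<zeta>" "\<zeta> \<le> pi / 2 - \<epsilon>"
    define u where "u = (\<lambda>x. 2 * \<nu> + x + \<beta> + 1)"
    have z: "0 < \<zeta>" "\<zeta> < pi / 2" using ze pos by auto
    have n1: "norm \<nu> \<ge> 1" "norm \<nu> \<ge> U" "norm \<nu> \<ge> 2 * C0" "norm \<nu> > 0" using nu(1) by (auto simp: R_def)
    have n2: "\<kappa> * norm \<nu> \<ge> 4 * B" using nu(1) k by (simp add: R_def pos_divide_le_eq mult.commute)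
    have n3: "norm \<nu> + Re \<nu> \<ge> \<kappa> * norm \<nu>" unfolding \<kappa>_def by (rule sector_re[OF pos(2) nu(2)]) (use n1 in auto)
    have M0: "M \<ge> 0" using ab(1) norm_ge_zero order_trans by blast
    note ss = sector_shift[OF k(1,2) n3 _ n2 n1(4)]
    have nrs: "nonres (\<nu> + w)" if "norm w \<le> B" for w using ss(1)[OF that] by (rule nonres_sector)
    have ux: "norm (u x) \<ge> norm \<nu>" "norm (u x) + Re (u x) \<ge> \<kappa> / 2 * norm (u x)" "norm (u x) + Re (u x) > 0"
      "nonres (u x)" "nonres (\<nu> + x)" "nonres (\<nu> + x + \<beta>)" "nonres \<nu>" "nonres (\<nu> + \<beta>)" if x: "norm x \<le> M + 1" for x
    proof -
      have e: "u x = 2 * \<nu> + (x + \<beta> + 1)" by (simp add: u_def)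
      have "norm (x + \<beta> + 1) \<le> norm x + norm \<beta> + norm (1::complex)" by (intro norm_triangle_mono) auto
      hence w: "norm (x + \<beta> + 1) \<le> B" using x ab by (simp add: B_def)
      show "norm (u x) \<ge> norm \<nu>" "norm (u x) + Re (u x) \<ge> \<kappa> / 2 * norm (u x)" "norm (u x) + Re (u x) > 0"
        unfolding e by (rule ss(3)[OF w], rule ss(2)[OF w], rule ss(4)[OF w])
      thus "nonres (u x)" by (intro nonres_sector)
      show "nonres (\<nu> + x)" "nonres (\<nu> + \<beta>)" by (rule nrs, use x ab M0 in \<open>simp add: B_def\<close>)+
      show "nonres \<nu>" using nrs[of 0] M0 by (simp add: B_def)
      have "norm (x + \<beta>) \<le> B" using norm_triangle_ineq[of x \<beta>] x ab by (simp add: B_def)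
      from nrs[OF this] show "nonres (\<nu> + x + \<beta>)" by (simp add: add.assoc)
    qed
    have b1: "norm \<beta> \<le> M + 1" and a1: "norm \<alpha> \<le> M + 1" using ab by auto
    have uN: "norm (u x) \<ge> U" if "norm x \<le> M + 1" for x using ux(1)[OF that] n1 by linarith
    \<comment> \<open>At a noninteger \<open>x\<close> near \<alpha> the closed form is the
      Wronskian of the boundary values for the parameter \<open>x\<close>, to which the core
      estimate applies.\<close>
    have Wc: "norm ((Fs x \<beta> (u x) N 2 2)\<^sup>2 * Wv \<nu> x \<beta> + 2 * u x * Fs x \<beta> (u x) N 2 2) \<le> C0 / norm (u x) ^ (N - 1)"
      if x: "dist x \<alpha> \<le> 1" "sin (of_real pi * x) \<noteq> 0" for x
    proof -
      have xM: "norm x \<le> M + 1" using norm_triangle_ineq2[of x \<alpha>] x(1) ab unfolding dist_norm by linarith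
      note uu = ux[OF xM]
      obtain a a' b b' where l: "(wu (u x) (x\<^sup>2 - 1 / 4) (\<beta>\<^sup>2 - 1 / 4) \<longlongrightarrow> a) (at (\<i> * of_real \<zeta>) within rhp)"
        "(wu' (u x) (x\<^sup>2 - 1 / 4) (\<beta>\<^sup>2 - 1 / 4) \<longlongrightarrow> a') (at (\<i> * of_real \<zeta>) within rhp)"
        "(wu (u x) (x\<^sup>2 - 1 / 4) (\<beta>\<^sup>2 - 1 / 4) \<longlongrightarrow> b) (at (- (\<i> * of_real \<zeta>)) within rhp)"
        "(wu' (u x) (x\<^sup>2 - 1 / 4) (\<beta>\<^sup>2 - 1 / 4) \<longlongrightarrow> b') (at (- (\<i> * of_real \<zeta>)) within rhp)"
        and e: "norm ((Fs x \<beta> (u x) N 2 2)\<^sup>2 * (a' * b + b' * a) + 2 * u x * Fs x \<beta> (u x) N 2 2) \<le> C0 / norm (u x) ^ (N - 1)"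
        using core[OF xM b1 uN[OF xM] uu(2) ze] by blast
      interpret cut_limits \<nu> x \<beta> "u x" "x\<^sup>2 - 1 / 4" "\<beta>\<^sup>2 - 1 / 4" \<zeta> "at (\<i> * of_real \<zeta>) within rhp" "at (- (\<i> * of_real \<zeta>)) within rhp" a a' b b'
        unfolding u_def by (rule cut_limits_at_boundary[OF z uu(4-8)[unfolded u_def] l[unfolded u_def]])
      show ?thesis using e unfolding wronskian_ab[OF x(2)] Wv_def .
    qed
    note uu = ux[OF a1]
    have W: "norm ((Fs \<alpha> \<beta> (u \<alpha>) N 2 2)\<^sup>2 * Wv \<nu> \<alpha> \<beta> + 2 * u \<alpha> * Fs \<alpha> \<beta> (u \<alpha>) N 2 2) \<le> C0 / norm (u \<alpha>) ^ (N - 1)"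
      unfolding u_def
    proof (rule wronskian_estimate_closed[OF uu(4)[unfolded u_def] _ pos(3)])
      show "2 * real N \<le> norm (2 * \<nu> + \<alpha> + \<beta> + 1)" using uN[OF a1] U unfolding u_def by linarith
    qed (rule Wc[unfolded u_def]; assumption)
    obtain a a' b b' where l: "(wu (u \<alpha>) (\<alpha>\<^sup>2 - 1 / 4) (\<beta>\<^sup>2 - 1 / 4) \<longlongrightarrow> a) (at (\<i> * of_real \<zeta>) within rhp)"
        "(wu' (u \<alpha>) (\<alpha>\<^sup>2 - 1 / 4) (\<beta>\<^sup>2 - 1 / 4) \<longlongrightarrow> a') (at (\<i> * of_real \<zeta>) within rhp)"
        "(wu (u \<alpha>) (\<alpha>\<^sup>2 - 1 / 4) (\<beta>\<^sup>2 - 1 / 4) \<longlongrightarrow> b) (at (- (\<i> * of_real \<zeta>)) within rhp)"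
        "(wu' (u \<alpha>) (\<alpha>\<^sup>2 - 1 / 4) (\<beta>\<^sup>2 - 1 / 4) \<longlongrightarrow> b') (at (- (\<i> * of_real \<zeta>)) within rhp)"
      and F: "norm (Fs \<alpha> \<beta> (u \<alpha>) N (sv (\<i> * of_real \<zeta>)) (cv (\<i> * of_real \<zeta>))) \<le> C0"
        "norm (Fs \<alpha> \<beta> (u \<alpha>) N (2 - sv (\<i> * of_real \<zeta>)) (2 - cv (\<i> * of_real \<zeta>))) \<le> C0"
      and e: "norm (Fs \<alpha> \<beta> (u \<alpha>) N 2 2 * a - exp (- u \<alpha> * (\<i> * of_real \<zeta>)) * Fs \<alpha> \<beta> (u \<alpha>) N (sv (\<i> * of_real \<zeta>)) (cv (\<i> * of_real \<zeta>)))
          \<le> C0 / norm (u \<alpha>) ^ N * norm (exp (- u \<alpha> * (\<i> * of_real \<zeta>)))"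
        "norm (Fs \<alpha> \<beta> (u \<alpha>) N 2 2 * b - exp (u \<alpha> * (\<i> * of_real \<zeta>)) * Fs \<alpha> \<beta> (u \<alpha>) N (2 - sv (\<i> * of_real \<zeta>)) (2 - cv (\<i> * of_real \<zeta>)))
          \<le> C0 / norm (u \<alpha>) ^ N * norm (exp (u \<alpha> * (\<i> * of_real \<zeta>)))"
      and V: "norm ((Fs \<alpha> \<beta> (u \<alpha>) N 2 2)\<^sup>2 * (a' * b + b' * a) + 2 * u \<alpha> * Fs \<alpha> \<beta> (u \<alpha>) N 2 2) \<le> C0 / norm (u \<alpha>) ^ (N - 1)"
      and k1: "norm (Fs \<alpha> \<beta> (u \<alpha>) N 2 2 - 1) \<le> 1 / 2"
      using core[OF a1 b1 uN[OF a1] uu(2) ze] by blast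
    interpret cut_limits \<nu> \<alpha> \<beta> "u \<alpha>" "\<alpha>\<^sup>2 - 1 / 4" "\<beta>\<^sup>2 - 1 / 4" \<zeta> "at (\<i> * of_real \<zeta>) within rhp" "at (- (\<i> * of_real \<zeta>)) within rhp" a a' b b'
      unfolding u_def by (rule cut_limits_at_boundary[OF z uu(4-8)[unfolded u_def] l[unfolded u_def]])
    have a: "2 * \<nu> + \<alpha> + \<beta> + 1 + 1 = 2 * \<nu> + \<alpha> + \<beta> + 2" "2 * (\<nu> + \<alpha>) + - \<alpha> + \<beta> = 2 * \<nu> + \<alpha> + \<beta>" "\<nu> + \<alpha> + - \<alpha> = \<nu>" by simp_all
    note G = Gamma_nonres[OF uu(4)[unfolded u_def], unfolded a] uu(5-8)[THEN rGamma_nonres]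
    have om: "omv \<nu> \<alpha> \<beta> \<noteq> 0" "Wv \<nu> \<alpha> \<beta> \<noteq> 0" unfolding Wv_def omv_def a using G by simp_all
    \<comment> \<open>The imaginary part of \<open>u \<alpha>\<close> differs from
      \<open>2 * Im \<nu>\<close> by at most \<open>2 * M\<close>, and
      \<open>2 * \<zeta> < pi\<close>; hence the constant \<open>exp (pi * M)\<close>.\<close>
    define m where "m = exp (2 * \<zeta> * \<bar>Im \<nu>\<bar>) * exp (pi * M)"
    have m: "norm (exp (- u \<alpha> * (\<i> * of_real \<zeta>))) \<le> m" "norm (exp (u \<alpha> * (\<i> * of_real \<zeta>))) \<le> m"
    proof -
      have "\<bar>Im (u \<alpha>)\<bar> \<le> 2 * \<bar>Im \<nu>\<bar> + 2 * M" using abs_Im_le_cmod[of \<alpha>] abs_Im_le_cmod[of \<beta>] ab by (simp add: u_def)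
      hence "\<zeta> * \<bar>Im (u \<alpha>)\<bar> \<le> \<zeta> * (2 * \<bar>Im \<nu>\<bar> + 2 * M)" using z by (intro mult_left_mono) auto
      also have "\<dots> = 2 * \<zeta> * \<bar>Im \<nu>\<bar> + (2 * \<zeta>) * M" by (simp add: algebra_simps)
      also have "(2 * \<zeta>) * M \<le> pi * M" using z M0 by (intro mult_right_mono) auto
      finally have "\<zeta> * \<bar>Im (u \<alpha>)\<bar> \<le> 2 * \<zeta> * \<bar>Im \<nu>\<bar> + pi * M" by simp
      moreover have "\<bar>\<zeta> * Im (u \<alpha>)\<bar> = \<zeta> * \<bar>Im (u \<alpha>)\<bar>" using z by (simp add: abs_mult)
      ultimately have "\<bar>\<zeta> * Im (u \<alpha>)\<bar> \<le> 2 * \<zeta> * \<bar>Im \<nu>\<bar> + pi * M" by linarith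
      thus "norm (exp (- u \<alpha> * (\<i> * of_real \<zeta>))) \<le> m" "norm (exp (u \<alpha> * (\<i> * of_real \<zeta>))) \<le> m"
        unfolding m_def exp_add[symmetric] by (auto simp: mult.commute abs_le_iff)
    qed
    have fin: "norm (X - Tb \<alpha> \<beta> (u \<alpha>) N \<zeta> p q / (2 * u \<alpha>)) \<le> c1 * exp (pi * M) * exp (2 * \<zeta> * \<bar>Im \<nu>\<bar>) / norm \<nu> ^ (N + 1) \<and>
         norm X \<le> c1 * exp (pi * M) * exp (2 * \<zeta> * \<bar>Im \<nu>\<bar>) / norm \<nu>"
      if pq: "norm p \<le> r" "norm q \<le> r" and X: "- X * T = p * a + q * b"
        and T: "norm ((Fs \<alpha> \<beta> (u \<alpha>) N 2 2)\<^sup>2 * T + 2 * u \<alpha> * Fs \<alpha> \<beta> (u \<alpha>) N 2 2) \<le> C0 / norm (u \<alpha>) ^ (N - 1)" for p q X T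
    proof -
      have u1: "norm (u \<alpha>) \<ge> 1" "norm (u \<alpha>) \<ge> 2 * C0" using uu(1) n1 by linarith+
      note pe = perturbed_quotient[OF pos(3) C0 u1 k1 T e F pq m X]
      have m0: "m \<ge> 0" by (simp add: m_def)
      have me: "c1 * exp (pi * M) * exp (2 * \<zeta> * \<bar>Im \<nu>\<bar>) = c1 * m" by (simp add: m_def)
      have "norm (X - Tb \<alpha> \<beta> (u \<alpha>) N \<zeta> p q / (2 * u \<alpha>)) \<le> 2 * r * C0 * (1 + C0) * m / norm (u \<alpha>) ^ (N + 1)"
        unfolding Tb_def by (rule pe(1))
      also have "\<dots> \<le> c1 * m / norm \<nu> ^ (N + 1)"
        using c1 m0 n1 uu(1) by (intro frac_le mult_right_mono power_mono mult_nonneg_nonneg) auto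
      finally have 1: "norm (X - Tb \<alpha> \<beta> (u \<alpha>) N \<zeta> p q / (2 * u \<alpha>)) \<le> c1 * m / norm \<nu> ^ (N + 1)" .
      have "norm X \<le> c1 * m / norm (u \<alpha>)" unfolding c1_def by (rule pe(2))
      also have "\<dots> \<le> c1 * m / norm \<nu>" using c1 m0 n1 uu(1) by (intro frac_le mult_nonneg_nonneg) auto
      finally show ?thesis using 1 unfolding me by blast
    qed
    have PX: "- (- (pcut \<nu> \<alpha> \<beta> \<zeta> / omv \<nu> \<alpha> \<beta>)) * (a' * b + b' * a) = sphase \<alpha> * a + inverse (sphase \<alpha>) * b"
      using pcut_formula om(1) by (simp add: field_simps)
    have QX: "- (- ((p * a + q * b) / Wv \<nu> \<alpha> \<beta>)) * Wv \<nu> \<alpha> \<beta> = p * a + q * b" for p q using om(2) by simp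
    have all: "\<forall>p q X. norm p \<le> r \<longrightarrow> norm q \<le> r \<longrightarrow>
           p = sphase \<alpha> \<and> q = inverse (sphase \<alpha>) \<and> X = - (pcut \<nu> \<alpha> \<beta> \<zeta> / omv \<nu> \<alpha> \<beta>) \<or> X = - ((p * a + q * b) / Wv \<nu> \<alpha> \<beta>) \<longrightarrow>
           norm (X - Tb \<alpha> \<beta> (u \<alpha>) N \<zeta> p q / (2 * u \<alpha>)) \<le> c1 * exp (pi * M) * exp (2 * \<zeta> * \<bar>Im \<nu>\<bar>) / norm \<nu> ^ (N + 1) \<and>
           norm X \<le> c1 * exp (pi * M) * exp (2 * \<zeta> * \<bar>Im \<nu>\<bar>) / norm \<nu>"
    proof (intro allI impI)
      fix p q X assume pq: "norm p \<le> r" "norm q \<le> r"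
        and "p = sphase \<alpha> \<and> q = inverse (sphase \<alpha>) \<and> X = - (pcut \<nu> \<alpha> \<beta> \<zeta> / omv \<nu> \<alpha> \<beta>) \<or> X = - ((p * a + q * b) / Wv \<nu> \<alpha> \<beta>)"
      then consider "p = sphase \<alpha>" "q = inverse (sphase \<alpha>)" "X = - (pcut \<nu> \<alpha> \<beta> \<zeta> / omv \<nu> \<alpha> \<beta>)" | "X = - ((p * a + q * b) / Wv \<nu> \<alpha> \<beta>)" by blast
      thus "norm (X - Tb \<alpha> \<beta> (u \<alpha>) N \<zeta> p q / (2 * u \<alpha>)) \<le> c1 * exp (pi * M) * exp (2 * \<zeta> * \<bar>Im \<nu>\<bar>) / norm \<nu> ^ (N + 1) \<and>
           norm X \<le> c1 * exp (pi * M) * exp (2 * \<zeta> * \<bar>Im \<nu>\<bar>) / norm \<nu>"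
      proof cases
        case 1
        show ?thesis by (rule fin[OF pq _ V]) (use PX in \<open>simp only: 1\<close>)
      next
        case 2
        show ?thesis by (rule fin[OF pq _ W]) (use QX in \<open>simp only: 2\<close>)
      qed
    qed
    have uU: "norm (u \<alpha>) \<ge> 2 * real N" using uN[OF a1] U by linarith
    show "\<exists>a b. nonres (2 * \<nu> + \<alpha> + \<beta> + 1) \<and> nonres (\<nu> + \<alpha>) \<and> nonres (\<nu> + \<alpha> + \<beta>) \<and> nonres \<nu> \<and>
        norm (2 * \<nu> + \<alpha> + \<beta> + 1) \<ge> 2 * real N \<and> norm (2 * \<nu> + \<alpha> + \<beta> + 1) + Re (2 * \<nu> + \<alpha> + \<beta> + 1) > 0 \<and>
        (wu (2 * \<nu> + \<alpha> + \<beta> + 1) (\<alpha>\<^sup>2 - 1 / 4) (\<beta>\<^sup>2 - 1 / 4) \<longlongrightarrow> a) (at (\<i> * of_real \<zeta>) within rhp) \<and>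
        (wu (2 * \<nu> + \<alpha> + \<beta> + 1) (\<alpha>\<^sup>2 - 1 / 4) (\<beta>\<^sup>2 - 1 / 4) \<longlongrightarrow> b) (at (- (\<i> * of_real \<zeta>)) within rhp) \<and>
        (\<forall>p q X. norm p \<le> exp (pi / 2 * (M + 1 / 2)) \<longrightarrow> norm q \<le> exp (pi / 2 * (M + 1 / 2)) \<longrightarrow>
           p = sphase \<alpha> \<and> q = inverse (sphase \<alpha>) \<and> X = - (pcut \<nu> \<alpha> \<beta> \<zeta> / omv \<nu> \<alpha> \<beta>) \<or> X = - ((p * a + q * b) / Wv \<nu> \<alpha> \<beta>) \<longrightarrow>
           norm (X - Tb \<alpha> \<beta> (2 * \<nu> + \<alpha> + \<beta> + 1) N \<zeta> p q / (2 * (2 * \<nu> + \<alpha> + \<beta> + 1))) \<le> c1 * exp (pi * M) * exp (2 * \<zeta> * \<bar>Im \<nu>\<bar>) / norm \<nu> ^ (N + 1) \<and>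
           norm X \<le> c1 * exp (pi * M) * exp (2 * \<zeta> * \<bar>Im \<nu>\<bar>) / norm \<nu>)"
      by (rule exI[of _ a], rule exI[of _ b])
        (intro conjI uu(4-7)[unfolded u_def] uU[unfolded u_def] uu(3)[unfolded u_def] l(1,3)[unfolded u_def] all[unfolded u_def r_def])
  qed
qed

section \<open>From boundary values to the uniform expansions\<close>

lemma prefactor_eq_pfac:
  assumes "0 < \<zeta>" "\<zeta> < pi / 2"
  shows "prefactor \<alpha> \<beta> \<zeta> = inverse (pfac \<alpha> \<beta> \<zeta>)"
proof -
  have sz: "sin \<zeta> > 0" "cos \<zeta> > 0" using assms by (auto intro: sin_gt_zero cos_gt_zero)
  have "complex_of_real x powr w = exp (w * of_real (ln x))" if "x > 0" for x w
    using that Ln_of_real[OF that] by (simp add: powr_def)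
  moreover have "1 / (exp x * exp y) = inverse (exp (x + y))" for x y :: complex
    by (simp add: exp_add divide_inverse)
  ultimately show ?thesis using sz unfolding prefactor_def pfac_def by simp
qed

text \<open>\<zeta> keeps the distance \<epsilon> from 0 and from \<open>pi / 2\<close>, so both
  logarithms are bounded in modulus by that of \<open>sin \<epsilon>\<close>.\<close>

lemma pfac_inverse_bound:
  assumes "\<epsilon> > 0" "\<epsilon> \<le> \<zeta>" "\<zeta> \<le> pi / 2 - \<epsilon>" "norm \<alpha> \<le> M" "norm \<beta> \<le> M"
  shows "norm (inverse (pfac \<alpha> \<beta> \<zeta>)) \<le> exp (2 * ((M + 1) * \<bar>ln (sin \<epsilon>)\<bar>))"
proof -
  have sz: "sin \<zeta> > 0" "cos \<zeta> > 0" "sin \<epsilon> > 0" using assms by (auto intro: sin_gt_zero cos_gt_zero)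
  have l: "sin \<epsilon> \<le> sin \<zeta>" "sin \<epsilon> \<le> cos \<zeta>"
  proof -
    show "sin \<epsilon> \<le> sin \<zeta>" using assms by (intro sin_monotone_2pi_le) auto
    have "sin \<epsilon> \<le> sin (pi / 2 - \<zeta>)" using assms by (intro sin_monotone_2pi_le) auto
    thus "sin \<epsilon> \<le> cos \<zeta>" by (simp add: sin_diff)
  qed
  have ln: "\<bar>ln y\<bar> \<le> \<bar>ln (sin \<epsilon>)\<bar>" if "sin \<epsilon> \<le> y" "y \<le> 1" for y
  proof -
    have "ln (sin \<epsilon>) \<le> ln y" using that sz by (subst ln_le_cancel_iff) auto
    moreover have "ln y \<le> 0" using that sz by (subst ln_le_zero_iff) auto
    ultimately show ?thesis by linarith
  qed
  have t: "norm ((x + 1 / 2) * of_real (ln y)) \<le> (M + 1) * \<bar>ln (sin \<epsilon>)\<bar>" if "norm x \<le> M" "sin \<epsilon> \<le> y" "y \<le> 1" for x :: complex and y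
  proof -
    have "norm (x + 1 / 2) \<le> M + 1" using norm_triangle_ineq[of x "1 / 2"] that by simp
    moreover have "0 \<le> M + 1" using norm_ge_zero[of x] that(1) by linarith
    ultimately show ?thesis unfolding norm_mult norm_of_real using ln[OF that(2,3)] by (intro mult_mono) auto
  qed
  have "norm (inverse (pfac \<alpha> \<beta> \<zeta>)) \<le> exp (norm (- ((\<alpha> + 1 / 2) * of_real (ln (sin \<zeta>)) + (\<beta> + 1 / 2) * of_real (ln (cos \<zeta>)))))"
    unfolding pfac_def exp_minus[symmetric] by (rule norm_exp)
  also have "\<dots> \<le> exp ((M + 1) * \<bar>ln (sin \<epsilon>)\<bar> + (M + 1) * \<bar>ln (sin \<epsilon>)\<bar>)"
    unfolding exp_le_cancel_iff norm_minus_cancel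
    by (rule norm_triangle_mono[OF t[OF assms(4) l(1) sin_le_one] t[OF assms(5) l(2) cos_le_one]])
  finally show ?thesis by simp
qed

text \<open>The estimates are available for \<open>N \<ge> 1\<close>. For \<open>N = 0\<close> the
  partial sum is empty and the claim is the bound for \<open>X\<close> alone, taken from the
  estimate with one term.\<close>

lemma uniform_expansionI:
  fixes \<epsilon> \<delta> M :: real
  assumes "\<epsilon> > 0"
    and pre: "\<And>\<alpha> \<beta> \<zeta>. 0 < \<zeta> \<Longrightarrow> \<zeta> < pi / 2 \<Longrightarrow> pre \<alpha> \<beta> \<zeta> = c * inverse (pfac \<alpha> \<beta> \<zeta>)"
    and ex: "\<And>N. N \<ge> 1 \<Longrightarrow> \<exists>C R. C \<ge> 0 \<and> R > 0 \<and> (\<forall>\<nu> \<alpha> \<beta> \<zeta>. norm \<nu> \<ge> R \<longrightarrow> \<bar>Arg \<nu>\<bar> \<le> pi - \<delta> \<longrightarrow> norm \<alpha> \<le> M \<longrightarrow> norm \<beta> \<le> M \<longrightarrow> \<epsilon> \<le> \<zeta> \<longrightarrow> \<zeta> \<le> pi / 2 - \<epsilon> \<longrightarrow>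
      (\<exists>X. f \<nu> \<alpha> \<beta> \<zeta> = inverse (pfac \<alpha> \<beta> \<zeta>) * X \<and> norm (X - c * (\<Sum>n<N. t n \<nu> \<alpha> \<beta> \<zeta>)) \<le> C * exp (2 * \<zeta> * \<bar>Im \<nu>\<bar>) / norm \<nu> ^ (N + 1) \<and>
        norm X \<le> C * exp (2 * \<zeta> * \<bar>Im \<nu>\<bar>) / norm \<nu>))"
  shows "uniform_expansion \<epsilon> \<delta> M f pre t"
  unfolding uniform_expansion_def
proof
  fix N :: nat
  define K where "K = exp (2 * ((M + 1) * \<bar>ln (sin \<epsilon>)\<bar>))"
  have K0: "K \<ge> 0" by (simp add: K_def)
  obtain C R where C: "C \<ge> 0" "R > 0" and e: "\<And>\<nu> \<alpha> \<beta> \<zeta>. norm \<nu> \<ge> R \<Longrightarrow> \<bar>Arg \<nu>\<bar> \<le> pi - \<delta> \<Longrightarrow> norm \<alpha> \<le> M \<Longrightarrow> norm \<beta> \<le> M \<Longrightarrow> \<epsilon> \<le> \<zeta> \<Longrightarrow> \<zeta> \<le> pi / 2 - \<epsilon> \<Longrightarrow>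
      \<exists>X. f \<nu> \<alpha> \<beta> \<zeta> = inverse (pfac \<alpha> \<beta> \<zeta>) * X \<and> norm (X - c * (\<Sum>n<N. t n \<nu> \<alpha> \<beta> \<zeta>)) \<le> C * exp (2 * \<zeta> * \<bar>Im \<nu>\<bar>) / norm \<nu> ^ (N + 1)"
  proof (cases "N \<ge> 1")
    case True
    from ex[OF this] show ?thesis
    proof (elim exE conjE)
      fix C R
      assume C: "C \<ge> 0" "R > 0" and e: "\<forall>\<nu> \<alpha> \<beta> \<zeta>. norm \<nu> \<ge> R \<longrightarrow> \<bar>Arg \<nu>\<bar> \<le> pi - \<delta> \<longrightarrow> norm \<alpha> \<le> M \<longrightarrow> norm \<beta> \<le> M \<longrightarrow> \<epsilon> \<le> \<zeta> \<longrightarrow> \<zeta> \<le> pi / 2 - \<epsilon> \<longrightarrow>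
      (\<exists>X. f \<nu> \<alpha> \<beta> \<zeta> = inverse (pfac \<alpha> \<beta> \<zeta>) * X \<and> norm (X - c * (\<Sum>n<N. t n \<nu> \<alpha> \<beta> \<zeta>)) \<le> C * exp (2 * \<zeta> * \<bar>Im \<nu>\<bar>) / norm \<nu> ^ (N + 1) \<and>
        norm X \<le> C * exp (2 * \<zeta> * \<bar>Im \<nu>\<bar>) / norm \<nu>)"
      show ?thesis
      proof (rule that[OF C])
        fix \<nu> \<alpha> \<beta> :: complex and \<zeta> :: real
        assume a: "norm \<nu> \<ge> R" "\<bar>Arg \<nu>\<bar> \<le> pi - \<delta>" "norm \<alpha> \<le> M" "norm \<beta> \<le> M" "\<epsilon> \<le> \<zeta>" "\<zeta> \<le> pi / 2 - \<epsilon>"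
        obtain X where X: "f \<nu> \<alpha> \<beta> \<zeta> = inverse (pfac \<alpha> \<beta> \<zeta>) * X" "norm (X - c * (\<Sum>n<N. t n \<nu> \<alpha> \<beta> \<zeta>)) \<le> C * exp (2 * \<zeta> * \<bar>Im \<nu>\<bar>) / norm \<nu> ^ (N + 1)"
          using e[rule_format, OF a] by auto
        show "\<exists>X. f \<nu> \<alpha> \<beta> \<zeta> = inverse (pfac \<alpha> \<beta> \<zeta>) * X \<and> norm (X - c * (\<Sum>n<N. t n \<nu> \<alpha> \<beta> \<zeta>)) \<le> C * exp (2 * \<zeta> * \<bar>Im \<nu>\<bar>) / norm \<nu> ^ (N + 1)"
          by (rule exI[of _ X], rule conjI[OF X(1) X(2)])
      qed
    qed
  next
    case False
    hence N: "N = 0" by simp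
    from ex[OF order_refl] show ?thesis
    proof (elim exE conjE)
      fix C R
      assume C: "C \<ge> 0" "R > 0" and e: "\<forall>\<nu> \<alpha> \<beta> \<zeta>. norm \<nu> \<ge> R \<longrightarrow> \<bar>Arg \<nu>\<bar> \<le> pi - \<delta> \<longrightarrow> norm \<alpha> \<le> M \<longrightarrow> norm \<beta> \<le> M \<longrightarrow> \<epsilon> \<le> \<zeta> \<longrightarrow> \<zeta> \<le> pi / 2 - \<epsilon> \<longrightarrow>
      (\<exists>X. f \<nu> \<alpha> \<beta> \<zeta> = inverse (pfac \<alpha> \<beta> \<zeta>) * X \<and> norm (X - c * (\<Sum>n<1. t n \<nu> \<alpha> \<beta> \<zeta>)) \<le> C * exp (2 * \<zeta> * \<bar>Im \<nu>\<bar>) / norm \<nu> ^ (1 + 1) \<and>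
        norm X \<le> C * exp (2 * \<zeta> * \<bar>Im \<nu>\<bar>) / norm \<nu>)"
      have z: "norm (X - c * (\<Sum>n<N. t n \<nu> \<alpha> \<beta> \<zeta>)) \<le> y / norm \<nu> ^ (N + 1)" if "norm X \<le> y / norm \<nu>" for X y \<nu> \<alpha> \<beta> \<zeta>
        using that by (simp add: N)
      show ?thesis
      proof (rule that[OF C])
        fix \<nu> \<alpha> \<beta> :: complex and \<zeta> :: real
        assume a: "norm \<nu> \<ge> R" "\<bar>Arg \<nu>\<bar> \<le> pi - \<delta>" "norm \<alpha> \<le> M" "norm \<beta> \<le> M" "\<epsilon> \<le> \<zeta>" "\<zeta> \<le> pi / 2 - \<epsilon>"
        obtain X where X: "f \<nu> \<alpha> \<beta> \<zeta> = inverse (pfac \<alpha> \<beta> \<zeta>) * X" "norm X \<le> C * exp (2 * \<zeta> * \<bar>Im \<nu>\<bar>) / norm \<nu>"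
          using e[rule_format, OF a] by auto
        show "\<exists>X. f \<nu> \<alpha> \<beta> \<zeta> = inverse (pfac \<alpha> \<beta> \<zeta>) * X \<and> norm (X - c * (\<Sum>n<N. t n \<nu> \<alpha> \<beta> \<zeta>)) \<le> C * exp (2 * \<zeta> * \<bar>Im \<nu>\<bar>) / norm \<nu> ^ (N + 1)"
          by (rule exI[of _ X], rule conjI[OF X(1) z[OF X(2)]])
      qed
    qed
  qed
  show "\<exists>C R. R > 0 \<and> (\<forall>\<nu> \<alpha> \<beta> \<zeta>. norm \<nu> \<ge> R \<longrightarrow> \<bar>Arg \<nu>\<bar> \<le> pi - \<delta> \<longrightarrow> norm \<alpha> \<le> M \<longrightarrow> norm \<beta> \<le> M \<longrightarrow>
      \<epsilon> \<le> \<zeta> \<longrightarrow> \<zeta> \<le> pi / 2 - \<epsilon> \<longrightarrow>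
      norm (f \<nu> \<alpha> \<beta> \<zeta> - pre \<alpha> \<beta> \<zeta> * (\<Sum>n<N. t n \<nu> \<alpha> \<beta> \<zeta>)) \<le> C * (exp (2 * \<zeta> * \<bar>Im \<nu>\<bar>) / norm \<nu> ^ (N + 1)))"
  proof (rule exI[of _ "K * C"], rule exI[of _ R], intro conjI C allI impI)
    fix \<nu> \<alpha> \<beta> :: complex and \<zeta> :: real
    assume a: "norm \<nu> \<ge> R" "\<bar>Arg \<nu>\<bar> \<le> pi - \<delta>" "norm \<alpha> \<le> M" "norm \<beta> \<le> M" "\<epsilon> \<le> \<zeta>" "\<zeta> \<le> pi / 2 - \<epsilon>"
    define S where "S = (\<Sum>n<N. t n \<nu> \<alpha> \<beta> \<zeta>)"
    obtain X where X: "f \<nu> \<alpha> \<beta> \<zeta> = inverse (pfac \<alpha> \<beta> \<zeta>) * X" "norm (X - c * S) \<le> C * exp (2 * \<zeta> * \<bar>Im \<nu>\<bar>) / norm \<nu> ^ (N + 1)"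
      using e[OF a] unfolding S_def by blast
    have "pre \<alpha> \<beta> \<zeta> = c * inverse (pfac \<alpha> \<beta> \<zeta>)" using a assms(1) by (intro pre) auto
    hence "f \<nu> \<alpha> \<beta> \<zeta> - pre \<alpha> \<beta> \<zeta> * S = inverse (pfac \<alpha> \<beta> \<zeta>) * (X - c * S)" unfolding X(1) by (simp add: algebra_simps)
    hence "norm (f \<nu> \<alpha> \<beta> \<zeta> - pre \<alpha> \<beta> \<zeta> * S) \<le> K * (C * exp (2 * \<zeta> * \<bar>Im \<nu>\<bar>) / norm \<nu> ^ (N + 1))"
      using mult_mono[OF pfac_inverse_bound[OF assms(1) a(5,6,3,4), folded K_def] X(2) K0 norm_ge_zero] by (simp add: norm_mult)
    thus "norm (f \<nu> \<alpha> \<beta> \<zeta> - pre \<alpha> \<beta> \<zeta> * (\<Sum>n<N. t n \<nu> \<alpha> \<beta> \<zeta>)) \<le> K * C * (exp (2 * \<zeta> * \<bar>Im \<nu>\<bar>) / norm \<nu> ^ (N + 1))"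
      unfolding S_def by simp
  qed
qed

theorem theorem1p2:
  fixes \<epsilon> \<delta> M :: real
  assumes "\<epsilon> > 0" and "\<delta> > 0"
  shows "uniform_expansion \<epsilon> \<delta> M
           (\<lambda>\<nu> \<alpha> \<beta> \<zeta>. 2 powr (2 * \<nu> + \<alpha> + \<beta>) * Beta (\<nu> + 1) (\<nu> + \<alpha> + \<beta> + 1) *
              jacobi_P \<nu> \<alpha> \<beta> (of_real (cos (2 * \<zeta>))))
           prefactor
           (expansion_term cos zeta1) \<and>
         uniform_expansion \<epsilon> \<delta> M
           (\<lambda>\<nu> \<alpha> \<beta> \<zeta>. 2 powr (2 * \<nu> + \<alpha> + \<beta> + 1) / of_real pi *
              Beta (\<nu> + 1) (\<nu> + \<alpha> + \<beta> + 1) * jacobi_Qcut \<nu> \<alpha> \<beta> (cos (2 * \<zeta>)))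
           prefactor
           (expansion_term cos zeta2) \<and>
         uniform_expansion \<epsilon> \<delta> M
           (\<lambda>\<nu> \<alpha> \<beta> \<zeta>. 2 powr (2 * \<nu> + \<alpha> + \<beta> + 1) / of_real pi *
              Beta (\<nu> + 1) (\<nu> + \<alpha> + \<beta> + 1) * jacobi_Qsf \<nu> \<alpha> \<beta> (cos (2 * \<zeta>)))
           (\<lambda>\<alpha> \<beta> \<zeta>. - prefactor \<alpha> \<beta> \<zeta>)
           (expansion_term sin zeta1)"
proof -
  let ?fP = "\<lambda>\<nu> \<alpha> \<beta> \<zeta>. 2 powr (2 * \<nu> + \<alpha> + \<beta>) * Beta (\<nu> + 1) (\<nu> + \<alpha> + \<beta> + 1) * jacobi_P \<nu> \<alpha> \<beta> (of_real (cos (2 * \<zeta>)))"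
  let ?fQ = "\<lambda>\<nu> \<alpha> \<beta> \<zeta>. 2 powr (2 * \<nu> + \<alpha> + \<beta> + 1) / of_real pi * Beta (\<nu> + 1) (\<nu> + \<alpha> + \<beta> + 1) * jacobi_Qcut \<nu> \<alpha> \<beta> (cos (2 * \<zeta>))"
  let ?fS = "\<lambda>\<nu> \<alpha> \<beta> \<zeta>. 2 powr (2 * \<nu> + \<alpha> + \<beta> + 1) / of_real pi * Beta (\<nu> + 1) (\<nu> + \<alpha> + \<beta> + 1) * jacobi_Qsf \<nu> \<alpha> \<beta> (cos (2 * \<zeta>))"
  have ex: "\<exists>C R. C \<ge> 0 \<and> R > 0 \<and> (\<forall>\<nu> \<alpha> \<beta> \<zeta>. norm \<nu> \<ge> R \<longrightarrow> \<bar>Arg \<nu>\<bar> \<le> pi - \<delta> \<longrightarrow> norm \<alpha> \<le> M \<longrightarrow> norm \<beta> \<le> M \<longrightarrow> \<epsilon> \<le> \<zeta> \<longrightarrow> \<zeta> \<le> pi / 2 - \<epsilon> \<longrightarrow>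
      (\<exists>X. f \<nu> \<alpha> \<beta> \<zeta> = inverse (pfac \<alpha> \<beta> \<zeta>) * X \<and> norm (X - c * (\<Sum>n<N. expansion_term tr ph n \<nu> \<alpha> \<beta> \<zeta>)) \<le> C * exp (2 * \<zeta> * \<bar>Im \<nu>\<bar>) / norm \<nu> ^ (N + 1) \<and>
        norm X \<le> C * exp (2 * \<zeta> * \<bar>Im \<nu>\<bar>) / norm \<nu>))"
    if N: "N \<ge> 1" and kind: "f = ?fP \<and> c = 1 \<and> tr = cos \<and> ph = zeta1 \<or> f = ?fQ \<and> c = 1 \<and> tr = cos \<and> ph = zeta2 \<or> f = ?fS \<and> c = - 1 \<and> tr = sin \<and> ph = zeta1"
    for N f c tr ph
  proof (rule boundary_estimate[OF assms N, of M], rule exI, rule exI, intro conjI allI impI)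
    fix C R \<zeta> :: real and \<nu> \<alpha> \<beta> :: complex
    assume "C \<ge> 0" "R > 0" and est: "\<And>\<nu> \<alpha> \<beta> \<zeta>. norm \<nu> \<ge> R \<Longrightarrow> \<bar>Arg \<nu>\<bar> \<le> pi - \<delta> \<Longrightarrow> norm \<alpha> \<le> M \<Longrightarrow> norm \<beta> \<le> M \<Longrightarrow> \<epsilon> \<le> \<zeta> \<Longrightarrow> \<zeta> \<le> pi / 2 - \<epsilon> \<Longrightarrow>
      \<exists>a b. nonres (2 * \<nu> + \<alpha> + \<beta> + 1) \<and> nonres (\<nu> + \<alpha>) \<and> nonres (\<nu> + \<alpha> + \<beta>) \<and> nonres \<nu> \<and>
        norm (2 * \<nu> + \<alpha> + \<beta> + 1) \<ge> 2 * real N \<and> norm (2 * \<nu> + \<alpha> + \<beta> + 1) + Re (2 * \<nu> + \<alpha> + \<beta> + 1) > 0 \<and>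
        (wu (2 * \<nu> + \<alpha> + \<beta> + 1) (\<alpha>\<^sup>2 - 1 / 4) (\<beta>\<^sup>2 - 1 / 4) \<longlongrightarrow> a) (at (\<i> * of_real \<zeta>) within rhp) \<and>
        (wu (2 * \<nu> + \<alpha> + \<beta> + 1) (\<alpha>\<^sup>2 - 1 / 4) (\<beta>\<^sup>2 - 1 / 4) \<longlongrightarrow> b) (at (- (\<i> * of_real \<zeta>)) within rhp) \<and>
        (\<forall>p q X. norm p \<le> exp (pi / 2 * (M + 1 / 2)) \<longrightarrow> norm q \<le> exp (pi / 2 * (M + 1 / 2)) \<longrightarrow>
           p = sphase \<alpha> \<and> q = inverse (sphase \<alpha>) \<and> X = - (pcut \<nu> \<alpha> \<beta> \<zeta> / omv \<nu> \<alpha> \<beta>) \<or> X = - ((p * a + q * b) / Wv \<nu> \<alpha> \<beta>) \<longrightarrow>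
           norm (X - Tb \<alpha> \<beta> (2 * \<nu> + \<alpha> + \<beta> + 1) N \<zeta> p q / (2 * (2 * \<nu> + \<alpha> + \<beta> + 1))) \<le> C * exp (2 * \<zeta> * \<bar>Im \<nu>\<bar>) / norm \<nu> ^ (N + 1) \<and>
           norm X \<le> C * exp (2 * \<zeta> * \<bar>Im \<nu>\<bar>) / norm \<nu>)"
      and rng: "norm \<nu> \<ge> R" "\<bar>Arg \<nu>\<bar> \<le> pi - \<delta>" "norm \<alpha> \<le> M" "norm \<beta> \<le> M" "\<epsilon> \<le> \<zeta>" "\<zeta> \<le> pi / 2 - \<epsilon>"
    have z: "0 < \<zeta>" "\<zeta> < pi / 2" using rng assms by auto
    define u s where "u = 2 * \<nu> + \<alpha> + \<beta> + 1" and "s = sphase \<alpha>"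
    from est[OF rng, folded u_def s_def] obtain a b where nr: "nonres u" "nonres (\<nu> + \<alpha>)" "nonres (\<nu> + \<alpha> + \<beta>)" "nonres \<nu>"
      and un: "norm u \<ge> 2 * real N" "norm u + Re u > 0"
      and l: "(wu u (\<alpha>\<^sup>2 - 1 / 4) (\<beta>\<^sup>2 - 1 / 4) \<longlongrightarrow> a) (at (\<i> * of_real \<zeta>) within rhp)"
        "(wu u (\<alpha>\<^sup>2 - 1 / 4) (\<beta>\<^sup>2 - 1 / 4) \<longlongrightarrow> b) (at (- (\<i> * of_real \<zeta>)) within rhp)"
      and h: "\<And>p q X. norm p \<le> exp (pi / 2 * (M + 1 / 2)) \<Longrightarrow> norm q \<le> exp (pi / 2 * (M + 1 / 2)) \<Longrightarrow>
           p = s \<and> q = inverse s \<and> X = - (pcut \<nu> \<alpha> \<beta> \<zeta> / omv \<nu> \<alpha> \<beta>) \<or> X = - ((p * a + q * b) / Wv \<nu> \<alpha> \<beta>) \<Longrightarrow>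
           norm (X - Tb \<alpha> \<beta> u N \<zeta> p q / (2 * u)) \<le> C * exp (2 * \<zeta> * \<bar>Im \<nu>\<bar>) / norm \<nu> ^ (N + 1) \<and>
           norm X \<le> C * exp (2 * \<zeta> * \<bar>Im \<nu>\<bar>) / norm \<nu>" by blast
    note sb = sphase_bound[OF rng(3), folded s_def]
    have sb': "norm (- \<i> * s) \<le> exp (pi / 2 * (M + 1 / 2))" "norm (\<i> * inverse s) \<le> exp (pi / 2 * (M + 1 / 2))"
      using sb by (simp_all add: norm_mult)
    note tr = trig_boundary[of \<alpha> \<nu> \<beta> \<zeta>, folded u_def s_def]
    note Tb = Tb_eq_expansion[OF z u_def un]
    note QQ = jacobi_Q_eq_boundary[OF z nr(1)[unfolded u_def] l[unfolded u_def], folded s_def]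
    from kind show "\<exists>X. f \<nu> \<alpha> \<beta> \<zeta> = inverse (pfac \<alpha> \<beta> \<zeta>) * X \<and> norm (X - c * (\<Sum>n<N. expansion_term tr ph n \<nu> \<alpha> \<beta> \<zeta>)) \<le> C * exp (2 * \<zeta> * \<bar>Im \<nu>\<bar>) / norm \<nu> ^ (N + 1) \<and>
        norm X \<le> C * exp (2 * \<zeta> * \<bar>Im \<nu>\<bar>) / norm \<nu>"
    proof (elim disjE conjE)
      assume e: "f = ?fP" "c = 1" "tr = cos" "ph = zeta1"
      show ?thesis unfolding e Tb[where trig = cos and ph = zeta1 and c = "1", OF tr(1), symmetric]
        by (rule exI, rule conjI[OF jacobi_P_eq_pcut[OF nr[unfolded u_def]]], rule h[OF sb]) blast
    next
      assume e: "f = ?fQ" "c = 1" "tr = cos" "ph = zeta2"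
      show ?thesis unfolding e Tb[where trig = cos and ph = zeta2 and c = "1", OF tr(2), symmetric]
        by (rule exI, rule conjI[OF QQ(1)], rule h[OF sb(2,1)]) blast
    next
      assume e: "f = ?fS" "c = - 1" "tr = sin" "ph = zeta1"
      show ?thesis unfolding e Tb[where trig = sin and ph = zeta1 and c = "- 1", OF tr(3), symmetric]
        by (rule exI, rule conjI[OF QQ(2)], rule h[OF sb']) blast
    qed
  qed
  have "uniform_expansion \<epsilon> \<delta> M ?fP prefactor (expansion_term cos zeta1)"
    by (rule uniform_expansionI[OF assms(1), where c = "1"], simp add: prefactor_eq_pfac, rule ex[where tr = cos and ph = zeta1 and c = "1"], assumption, blast)
  moreover have "uniform_expansion \<epsilon> \<delta> M ?fQ prefactor (expansion_term cos zeta2)"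
    by (rule uniform_expansionI[OF assms(1), where c = "1"], simp add: prefactor_eq_pfac, rule ex[where tr = cos and ph = zeta2 and c = "1"], assumption, blast)
  moreover have "uniform_expansion \<epsilon> \<delta> M ?fS (\<lambda>\<alpha> \<beta> \<zeta>. - prefactor \<alpha> \<beta> \<zeta>) (expansion_term sin zeta1)"
    by (rule uniform_expansionI[OF assms(1), where c = "- 1"], simp add: prefactor_eq_pfac, rule ex[where tr = sin and ph = zeta1 and c = "- 1"], assumption, blast)
  ultimately show ?thesis by blast
qed


end
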